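(* Let $\mathfrak X$ be an infinite countable set, let $\alpha$ be a probability measure on $\mathfrak X$ and let $M>0$. Let $\mathbf P_0$ be a probability measure on $\mathfrak X$ and let $(X_n)_{n\ge1}$ be an i.i.d. sequence with law $\mathbf P_0$. Let $\mathcal F=\{1_C: C\subset\mathfrak X\}$. Assume that $$\sum_{y\in\mathfrak X}\sqrt{\mathbf P_0(\{y\})}<\infty\quad\text{and}\quad\sum_{y\in\mathfrak X}\sqrt{\alpha(\{y\})}<\infty.$$ Then for almost every realization $(x_n)_{n\ge1}$ (that is, for $\mathbf P_0^{\otimes\mathbb N^*}$-almost every sequence) we have $$\sqrt n\,\big(Post_n(x_1,\dots,x_n)-\mathbf P_{(x_1,\dots,x_n)}\big)\longrightarrow\mathbb G_{\mathbf P_0}\quad\text{weakly in }\ell^\infty(\mathcal F)\text{ as }n\to\infty.$$ As a consequence, for almost every sequence $(x_n)_{n\ge1}$ we have $$\sqrt n\,\big\|Post_n(x_1,\dots,x_n)-\mathbf P_{(x_1,\dots,x_n)}\big\|_{Tot.Var.}\longrightarrow\|\mathbb G_{\mathbf P_0}\|_{\mathcal F}\quad\text{in law}.$$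
   Context: $\mathfrak X$ carries the $\sigma$-algebra of all its subsets. For two probability measures, $\|Q-Q'\|_{Tot.Var.}=\sup_{C\subset\mathfrak X}|Q(C)-Q'(C)|$. $\ell^\infty(\mathcal F)$ is the space of bounded real functions on $\mathcal F$ with the norm $\|\psi\|_{\mathcal F}=\sup_{f\in\mathcal F}|\psi(f)|$; a (random) signed measure $P$ is identified with the map $f\mapsto P(f)=\int f\,dP$. Weak convergence in $\ell^\infty(\mathcal F)$ is in the sense of Hoffmann-Jørgensen (outer expectations of bounded continuous functions). For a probability measure $\alpha$ on $\mathfrak X$ and $M>0$, $DP(\alpha,M)$ denotes the Dirichlet process with mean measure $\alpha$ and concentration parameter $M$, i.e. the random probability measure with the law of $\sum_{i\in\mathbb N}\beta_i\delta_{Y_i}$, where $(Y_i)_{i\in\mathbb N}$ is i.i.d. with law $\alpha$, $\beta_i=V_i\prod_{j\le i-1}(1-V_j)$, and $(V_i)_{i\in\mathbb N}$ is i.i.d. with law $Beta(1,M)$, independent of $(Y_i)_{i\in\mathbb N}$. For $x_1,\dots,x_n\in\mathfrak X$ let $\mathbf P_{(x_1,\dots,x_n)}=\frac1n\sum_{i=1}^n\delta_{x_i}$, $\theta_n=\frac{M}{M+n}$ and $\alpha_{(x_1,\dots,x_n)}=\theta_n\alpha+(1-\theta_n)\mathbf P_{(x_1,\dots,x_n)}$. The (version of the) posterior of the Dirichlet process prior $DP(\alpha,M)$ given the observed sample is $Post_n(x_1,\dots,x_n):=DP(\alpha_{(x_1,\dots,x_n)},M+n)$, viewed as a random probability measure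 for fixed $(x_1,\dots,x_n)$. $\mathbb G_{\mathbf P_0}$ is the $\mathbf P_0$-Brownian bridge indexed by $\mathcal F$: the tight centered Gaussian random element of $\ell^\infty(\mathcal F)$ with covariance $\operatorname{Cov}(\mathbb G_{\mathbf P_0}(f),\mathbb G_{\mathbf P_0}(g))=\mathbf P_0(fg)-\mathbf P_0(f)\mathbf P_0(g)$. *)

theory Defs
  imports "HOL-Probability.Probability"
begin

section \<open>Probability measures on a countable set\<close>

text \<open>The countable set is the universe of the type \<open>'a\<close>; every measure on it has the
  \<open>\<sigma>\<close>-algebra of all subsets.\<close>

definition mixture_measure :: "real \<Rightarrow> 'a measure \<Rightarrow> 'a measure \<Rightarrow> 'a measure" where
  "mixture_measure \<theta> P Q =
     measure_of UNIV UNIV (\<lambda>C. ennreal \<theta> * emeasure P C + ennreal (1 - \<theta>) * emeasure Q C)"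

text \<open>A sample \<open>x\<^sub>1, \<dots>, x\<^sub>n\<close> is given by the first \<open>n\<close> terms \<open>x 0, \<dots>, x (n - 1)\<close> of a sequence.\<close>

definition empirical_measure :: "(nat \<Rightarrow> 'a) \<Rightarrow> nat \<Rightarrow> 'a measure" where
  "empirical_measure x n =
     measure_of UNIV UNIV
       (\<lambda>C. ennreal (1 / real n) * (\<Sum>i<n. emeasure (return (count_space UNIV) (x i)) C))"

definition tv_dist :: "'a measure \<Rightarrow> 'a measure \<Rightarrow> real" where
  "tv_dist Q Q' = (SUP C. \<bar>measure Q C - measure Q' C\<bar>)"

section \<open>The Dirichlet process\<close>

text \<open>The underlying space is the open unit interval, so that the stick-breaking weights below
  are nonnegative with sum at most one at every (not just almost every) point.\<close>

definition beta_measure :: "real \<Rightarrow> real \<Rightarrow> real measure" where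
  "beta_measure a b =
     density (restrict_space lborel {0<..<1})
       (\<lambda>v. ennreal (v powr (a - 1) * (1 - v) powr (b - 1) / Beta a b))"

definition stick_weight :: "(nat \<Rightarrow> real) \<Rightarrow> nat \<Rightarrow> real" where
  "stick_weight V i = V i * (\<Prod>j<i. 1 - V j)"

definition stick_breaking :: "(nat \<Rightarrow> real) \<Rightarrow> (nat \<Rightarrow> 'a) \<Rightarrow> 'a measure" where
  "stick_breaking V Y =
     measure_of UNIV UNIV
       (\<lambda>C. \<Sum>i. ennreal (stick_weight V i) * emeasure (return (count_space UNIV) (Y i)) C)"

text \<open>The law of the Dirichlet process. Since the weights sum to one only almost surely, it is a
  law on subprobability measures that is carried by the probability measures.\<close>

definition DP_law :: "'a measure \<Rightarrow> real \<Rightarrow> 'a measure measure" where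
  "DP_law \<alpha> M =
     distr ((\<Pi>\<^sub>M i\<in>(UNIV::nat set). beta_measure 1 M) \<Otimes>\<^sub>M (\<Pi>\<^sub>M i\<in>(UNIV::nat set). \<alpha>))
       (subprob_algebra (count_space UNIV)) (\<lambda>(V, Y). stick_breaking V Y)"

definition dirichlet_process ::
    "'a measure \<Rightarrow> real \<Rightarrow> 'w measure \<Rightarrow> ('w \<Rightarrow> 'a measure) \<Rightarrow> bool" where
  "dirichlet_process \<alpha> M \<Omega> R \<longleftrightarrow>
     prob_space \<Omega> \<and> R \<in> \<Omega> \<rightarrow>\<^sub>M prob_algebra (count_space UNIV) \<and>
     distr \<Omega> (subprob_algebra (count_space UNIV)) R = DP_law \<alpha> M"

definition posterior_mean :: "'a measure \<Rightarrow> real \<Rightarrow> (nat \<Rightarrow> 'a) \<Rightarrow> nat \<Rightarrow> 'a measure" where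
  "posterior_mean \<alpha> M x n = mixture_measure (M / (M + real n)) \<alpha> (empirical_measure x n)"

definition DP_posterior ::
    "'a measure \<Rightarrow> real \<Rightarrow> (nat \<Rightarrow> 'a) \<Rightarrow> nat \<Rightarrow> 'w measure \<Rightarrow> ('w \<Rightarrow> 'a measure) \<Rightarrow> bool" where
  "DP_posterior \<alpha> M x n \<Omega> R \<longleftrightarrow> dirichlet_process (posterior_mean \<alpha> M x n) (M + real n) \<Omega> R"

section \<open>Weak convergence in the space of bounded functions\<close>

text \<open>Bounded real functions on \<open>F\<close> (extended by \<^term>\<open>undefined\<close> outside of \<open>F\<close>) with the
  supremum metric.\<close>

abbreviation linf :: "'f set \<Rightarrow> ('f \<Rightarrow> real) metric" where
  "linf F \<equiv> funspace F euclidean_metric"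

definition linf_norm :: "'f set \<Rightarrow> ('f \<Rightarrow> real) \<Rightarrow> real" where
  "linf_norm F \<psi> = (SUP f\<in>F. \<bar>\<psi> f\<bar>)"

definition linf_borel :: "'f set \<Rightarrow> ('f \<Rightarrow> real) measure" where
  "linf_borel F = sigma (mspace (linf F)) {U. openin (mtopology_of (linf F)) U}"

text \<open>Outer expectation, for bounded (possibly nonmeasurable) \<open>g\<close>; for these it suffices to
  consider real-valued integrable majorants.\<close>

definition outer_expectation :: "'w measure \<Rightarrow> ('w \<Rightarrow> real) \<Rightarrow> real" where
  "outer_expectation \<Omega> g =
     Inf {integral\<^sup>L \<Omega> U | U. integrable \<Omega> U \<and> (\<forall>\<omega>\<in>space \<Omega>. g \<omega> \<le> U \<omega>)}"

text \<open>Weak convergence in the sense of Hoffmann-Joergensen of the maps \<open>Z n\<close>, each defined on its own probability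
  space, to a Borel random element \<open>G\<close>.\<close>

definition weakly_converges_linf ::
    "'f set \<Rightarrow> (nat \<Rightarrow> 'w measure) \<Rightarrow> (nat \<Rightarrow> 'w \<Rightarrow> 'f \<Rightarrow> real) \<Rightarrow>
     'g measure \<Rightarrow> ('g \<Rightarrow> 'f \<Rightarrow> real) \<Rightarrow> bool" where
  "weakly_converges_linf F \<Omega> Z N G \<longleftrightarrow>
     (\<forall>h. continuous_map (mtopology_of (linf F)) euclideanreal h \<and> bounded (h ` mspace (linf F)) \<longrightarrow>
        (\<lambda>n. outer_expectation (\<Omega> n) (\<lambda>\<omega>. h (Z n \<omega>))) \<longlonglongrightarrow> (\<integral>\<omega>. h (G \<omega>) \<partial>N))"

text \<open>The signed measure \<open>c (P - Q)\<close> as an element of \<open>linf F\<close>.\<close>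

definition scaled_diff :: "('a \<Rightarrow> real) set \<Rightarrow> real \<Rightarrow> 'a measure \<Rightarrow> 'a measure \<Rightarrow> ('a \<Rightarrow> real) \<Rightarrow> real" where
  "scaled_diff F c P Q = (\<lambda>f\<in>F. c * (integral\<^sup>L P f - integral\<^sup>L Q f))"

section \<open>The Brownian bridge\<close>

text \<open>Degenerate normal distributions are included.\<close>

definition gaussian_law :: "real measure \<Rightarrow> bool" where
  "gaussian_law \<nu> \<longleftrightarrow>
     (\<exists>m. \<nu> = return borel m) \<or>
     (\<exists>m s. 0 < s \<and> \<nu> = density lborel (\<lambda>t. ennreal (normal_density m s t)))"

definition gaussian_process :: "'f set \<Rightarrow> 'g measure \<Rightarrow> ('g \<Rightarrow> 'f \<Rightarrow> real) \<Rightarrow> bool" where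
  "gaussian_process F N G \<longleftrightarrow>
     (\<forall>S c. finite S \<and> S \<subseteq> F \<longrightarrow> gaussian_law (distr N borel (\<lambda>\<omega>. \<Sum>f\<in>S. c f * G \<omega> f)))"

definition tight_linf :: "'f set \<Rightarrow> 'g measure \<Rightarrow> ('g \<Rightarrow> 'f \<Rightarrow> real) \<Rightarrow> bool" where
  "tight_linf F N G \<longleftrightarrow>
     (\<forall>\<epsilon>>0. \<exists>K. compactin (mtopology_of (linf F)) K \<and> 1 - \<epsilon> \<le> measure N {\<omega>\<in>space N. G \<omega> \<in> K})"

definition brownian_bridge ::
    "'a measure \<Rightarrow> ('a \<Rightarrow> real) set \<Rightarrow> 'g measure \<Rightarrow> ('g \<Rightarrow> ('a \<Rightarrow> real) \<Rightarrow> real) \<Rightarrow> bool" where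
  "brownian_bridge P F N G \<longleftrightarrow>
     prob_space N \<and> G \<in> N \<rightarrow>\<^sub>M linf_borel F \<and> tight_linf F N G \<and> gaussian_process F N G \<and>
     (\<forall>f\<in>F. (\<integral>\<omega>. G \<omega> f \<partial>N) = 0) \<and>
     (\<forall>f\<in>F. \<forall>g\<in>F. (\<integral>\<omega>. G \<omega> f * G \<omega> g \<partial>N) =
        (\<integral>y. f y * g y \<partial>P) - (\<integral>y. f y \<partial>P) * (\<integral>y. g y \<partial>P))"

text \<open>The indicator functions of all subsets.\<close>

abbreviation indicators :: "('a \<Rightarrow> real) set" where
  "indicators \<equiv> range indicator"

end

theory Submission
  imports Defs
begin

text \<open>
  Enumerate the countable set by a bijection \<open>e\<close> and let \<open>a i\<close>, \<open>p i\<close> and \<open>q n i\<close> be the masses that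
  \<open>\<alpha>\<close>, \<open>P0\<close> and the empirical measure of the first \<open>n\<close> observations give to \<open>e i\<close>. A signed measure is
  then a summable sequence \<open>u\<close>, acting on indicators by \<open>f \<mapsto> \<Sum>i. u i * f (e i)\<close>; the map from \<open>l\<^sup>1\<close> to
  bounded functions (\<open>atomic\<close>) is Lipschitz. Hence weak convergence follows once, for almost every
  sample, random sequences with the laws of the scaled posteriors are found that converge in
  \<open>l\<^sup>1\<close> in probability.

  Such sequences come from the gamma representation of the Dirichlet process: if \<open>R\<close> is the posterior
  and \<open>S\<close> an independent gamma variable with parameter \<open>M + n\<close>, then the products \<open>S * R{e i}\<close> are independent
  gamma variables with parameters \<open>M * a i + n * q n i\<close>, and dividing by their sum recovers \<open>R\<close>.
  This is read off from Laplace transforms: \<open>stick_process.dirichlet_laplace\<close> computes the transform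
  of \<open>S * R\<close> from the stick-breaking construction, through the recursion that removes
  the first stick, and \<open>laplace_unique\<close> identifies the laws. Since
  \<open>n * q n i\<close> is an integer \<open>k\<close>, the gamma variable is a gamma variable with parameter \<open>M * a i\<close> plus \<open>k\<close>
  independent standard exponential ones. By the central limit theorem and Skorohod's theorem these sums can be
  realised for all \<open>k\<close> on one space as \<open>k + sqrt k * V k\<close> with \<open>V k\<close> converging in \<open>L\<^sup>1\<close> to a standard
  normal \<open>Z\<close> (\<open>coupled_exponential_sums\<close>); one independent copy is used for each \<open>i\<close>.

  In this coupling the centred gamma variables divided by \<open>sqrt n\<close> converge to \<open>sqrt (p i) * Z\<close> in \<open>L\<^sup>1\<close> for
  each fixed \<open>i\<close>, because \<open>q n i\<close> tends to \<open>p i\<close>. The sum over \<open>i\<close> converges by domination: the expected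
  distance is at most a constant times \<open>a i + sqrt (p i) + (SUP n. sqrt (q n i))\<close>. The last
  term is almost surely summable, since by a dyadic maximal inequality (\<open>sqrt_freq_maximal\<close>) its expectation is
  at most a constant times \<open>sqrt (p i)\<close>; this is where the summability of \<open>sqrt (p i)\<close> enters. Passing to almost
  surely convergent subsequences, the normalisation is a deterministic computation
  (\<open>l1_limit_of_normalised_weights\<close>): with \<open>U i\<close> the normal limits, the scaled differences tend to
  \<open>U i - p i * (\<Sum>j. U j)\<close>.

  This limit acts on indicators as a Brownian bridge (\<open>gaussian_sequence.brownian_bridge_atomic\<close>), and two tight
  Brownian bridges give the same expectation to each bounded continuous function
  (\<open>bridge_expectation_unique\<close>), so the limit may be stated with any of them. The statement about the
  total variation distance is the same convergence for functions of the norm.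
\<close>

section \<open>Measures determined by a multiplicative family of functions\<close>

text \<open>The family \<open>T\<close> spans an algebra up to linear combinations, which covers both Laplace transforms
  (products of exponentials are exponentials) and cosines (products of cosines are half sums
  of cosines). Call a bounded \<open>g\<close> good if \<open>g * t\<close> has equal integrals for all \<open>t\<close> in \<open>T\<close>. Good functions stay good
  under multiplication by \<open>t\<close>, hence by polynomials in \<open>t\<close>, by continuous functions of \<open>t\<close>
  (Weierstrass) and by indicators of \<open>t \<le> c\<close>. Sets whose indicators preserve goodness form a
  generating system closed under intersections.\<close>

lemma prob_measure_eqI_mult_class:
  fixes T :: "('b \<Rightarrow> real) set"
  assumes "prob_space \<mu>" "prob_space \<nu>" and sets [measurable_cong]: "sets \<mu> = sets B" "sets \<nu> = sets B"
    and meas: "\<And>t. t \<in> T \<Longrightarrow> t \<in> borel_measurable B"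
    and bdd: "\<And>t. t \<in> T \<Longrightarrow> \<exists>b. \<forall>x\<in>space B. \<bar>t x\<bar> \<le> b"
    and one: "(\<lambda>_. 1) \<in> T"
    and mult: "\<And>s t. s \<in> T \<Longrightarrow> t \<in> T \<Longrightarrow> \<exists>c1 t1 c2 t2. t1 \<in> T \<and> t2 \<in> T \<and>
      (\<forall>x\<in>space B. s x * t x = c1 * t1 x + c2 * t2 x)"
    and eq: "\<And>t. t \<in> T \<Longrightarrow> integral\<^sup>L \<mu> t = integral\<^sup>L \<nu> t"
    and gen: "sets B \<subseteq> sigma_sets (space B) {t -` {..c} \<inter> space B | t c. t \<in> T}"
  shows "\<mu> = \<nu>"
proof -
  interpret \<mu>: prob_space \<mu> by fact
  interpret \<nu>: prob_space \<nu> by fact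
  have sp: "space \<mu> = space B" "space \<nu> = space B"
    using sets by (auto dest: sets_eq_imp_space_eq)
  define L where "L g \<longleftrightarrow> g \<in> borel_measurable B \<and> (\<exists>b. \<forall>x\<in>space B. \<bar>g x\<bar> \<le> b) \<and>
    (\<forall>t\<in>T. (\<integral>x. g x * t x \<partial>\<mu>) = (\<integral>x. g x * t x \<partial>\<nu>))" for g :: "'b \<Rightarrow> real"
  have bint: "integrable \<mu> g" "integrable \<nu> g"
    if "g \<in> borel_measurable B" "\<And>x. x \<in> space B \<Longrightarrow> \<bar>g x\<bar> \<le> b" for g :: "'b \<Rightarrow> real" and b
    using that by (auto intro!: \<mu>.integrable_const_bound[where B=b] \<nu>.integrable_const_bound[where B=b]
        simp: sp measurable_cong_sets[OF sets(1) refl] measurable_cong_sets[OF sets(2) refl])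
  have bmult: "\<exists>b. \<forall>x\<in>space B. \<bar>f x * g x\<bar> \<le> b"
    if f: "\<exists>b. \<forall>x\<in>space B. \<bar>f x\<bar> \<le> b" and g: "\<exists>b. \<forall>x\<in>space B. \<bar>g x\<bar> \<le> b" for f g :: "'b \<Rightarrow> real"
  proof -
    from f obtain b where b: "\<forall>x\<in>space B. \<bar>f x\<bar> \<le> b" by auto
    from g obtain c where c: "\<forall>x\<in>space B. \<bar>g x\<bar> \<le> c" by auto
    have "\<bar>f x * g x\<bar> \<le> \<bar>b\<bar> * \<bar>c\<bar>" if "x \<in> space B" for x
      unfolding abs_mult using b[rule_format, OF that] c[rule_format, OF that] by (intro mult_mono) auto
    then show ?thesis by blast
  qed
  have Lint: "integrable \<mu> (\<lambda>x. g x * t x)" "integrable \<nu> (\<lambda>x. g x * t x)" if "L g" "t \<in> T" for g t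
  proof -
    have "\<exists>b. \<forall>x\<in>space B. \<bar>g x * t x\<bar> \<le> b" using that bdd by (intro bmult) (auto simp: L_def)
    then obtain b where b: "\<And>x. x \<in> space B \<Longrightarrow> \<bar>g x * t x\<bar> \<le> b" by blast
    have m: "(\<lambda>x. g x * t x) \<in> borel_measurable B"
      using that meas by (auto simp: L_def)
    show "integrable \<mu> (\<lambda>x. g x * t x)" "integrable \<nu> (\<lambda>x. g x * t x)"
      by (rule bint(1)[OF m b] bint(2)[OF m b], assumption)+
  qed
  have L_one: "L (\<lambda>_. 1)" using eq by (auto simp: L_def intro: exI[of _ 1])
  have L_mult: "L (\<lambda>x. s x * g x)" if g: "L g" and s: "s \<in> T" for g s
  proof -
    have "(\<integral>x. (s x * g x) * t x \<partial>\<mu>) = (\<integral>x. (s x * g x) * t x \<partial>\<nu>)" if t: "t \<in> T" for t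
    proof -
      obtain c1 t1 c2 t2 where T: "t1 \<in> T" "t2 \<in> T"
        and st: "\<And>x. x \<in> space B \<Longrightarrow> s x * t x = c1 * t1 x + c2 * t2 x"
        using mult[OF s t] by blast
      have e: "(s x * g x) * t x = c1 * (g x * t1 x) + c2 * (g x * t2 x)" if "x \<in> space B" for x
      proof -
        have "(s x * g x) * t x = g x * (s x * t x)" by (simp only: mult_ac)
        also have "\<dots> = c1 * (g x * t1 x) + c2 * (g x * t2 x)"
          unfolding st[OF that] by (simp add: algebra_simps)
        finally show ?thesis .
      qed
      have "(\<integral>x. (s x * g x) * t x \<partial>\<mu>) = (\<integral>x. c1 * (g x * t1 x) + c2 * (g x * t2 x) \<partial>\<mu>)"
        by (rule Bochner_Integration.integral_cong) (auto simp: sp e)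
      also have "\<dots> = c1 * (\<integral>x. g x * t1 x \<partial>\<mu>) + c2 * (\<integral>x. g x * t2 x \<partial>\<mu>)"
        using Lint[OF g] T by simp
      also have "\<dots> = c1 * (\<integral>x. g x * t1 x \<partial>\<nu>) + c2 * (\<integral>x. g x * t2 x \<partial>\<nu>)"
        using g T by (simp add: L_def)
      also have "\<dots> = (\<integral>x. c1 * (g x * t1 x) + c2 * (g x * t2 x) \<partial>\<nu>)"
        using Lint[OF g] T by simp
      also have "\<dots> = (\<integral>x. (s x * g x) * t x \<partial>\<nu>)"
        by (rule Bochner_Integration.integral_cong) (auto simp: sp e)
      finally show ?thesis .
    qed
    then show ?thesis using g s meas bdd by (auto simp: L_def intro!: bmult)
  qed
  have L_add: "L (\<lambda>x. f x + g x)" if f: "L f" and g: "L g" for f g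
  proof -
    from f obtain b where b: "\<forall>x\<in>space B. \<bar>f x\<bar> \<le> b" by (auto simp: L_def)
    from g obtain c where c: "\<forall>x\<in>space B. \<bar>g x\<bar> \<le> c" by (auto simp: L_def)
    have "\<forall>x\<in>space B. \<bar>f x + g x\<bar> \<le> b + c"
      using b c by (smt (verit, best))
    moreover have "(\<integral>x. (f x + g x) * t x \<partial>\<mu>) = (\<integral>x. (f x + g x) * t x \<partial>\<nu>)" if "t \<in> T" for t
      using f g Lint[OF f that] Lint[OF g that] that by (simp add: L_def distrib_right)
    ultimately show ?thesis using f g by (auto simp: L_def)
  qed
  have L_scale: "L (\<lambda>x. c * g x)" if g: "L g" for g c
  proof -
    have "\<exists>b. \<forall>x\<in>space B. \<bar>c * g x\<bar> \<le> b" using g by (intro bmult) (auto simp: L_def)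
    then show ?thesis using g by (auto simp: L_def mult.assoc)
  qed
  have L_lim: "L g" if f: "\<And>n::nat. L (f n)" and b: "\<And>n x. x \<in> space B \<Longrightarrow> \<bar>f n x\<bar> \<le> b"
    and lim: "\<And>x. x \<in> space B \<Longrightarrow> (\<lambda>n. f n x) \<longlonglongrightarrow> g x" for f g b
  proof -
    have [measurable]: "f n \<in> borel_measurable B" for n using f by (auto simp: L_def)
    have gm [measurable]: "g \<in> borel_measurable B"
      by (rule borel_measurable_LIMSEQ_real[OF lim]) auto
    have gb: "\<bar>g x\<bar> \<le> b" if "x \<in> space B" for x
      using LIMSEQ_le_const2[OF tendsto_rabs[OF lim[OF that]], of b] b[OF that] by auto
    have "(\<integral>x. g x * t x \<partial>\<mu>) = (\<integral>x. g x * t x \<partial>\<nu>)" if t: "t \<in> T" for t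
    proof -
      obtain d where d: "\<And>x. x \<in> space B \<Longrightarrow> \<bar>t x\<bar> \<le> d" using bdd[OF t] by auto
      have [measurable]: "t \<in> borel_measurable B" using meas t by auto
      have bb: "\<bar>f n x * t x\<bar> \<le> \<bar>b\<bar> * \<bar>d\<bar>" if "x \<in> space B" for n x
        unfolding abs_mult using b[OF that, of n] d[OF that] by (intro mult_mono) auto
      have "(\<lambda>n. \<integral>x. f n x * t x \<partial>\<mu>) \<longlonglongrightarrow> (\<integral>x. g x * t x \<partial>\<mu>)"
        by (rule integral_dominated_convergence[where w="\<lambda>_. \<bar>b\<bar> * \<bar>d\<bar>"])
           (auto simp: sp bb[unfolded abs_mult] abs_mult intro!: tendsto_mult lim AE_I2)
      moreover have "(\<lambda>n. \<integral>x. f n x * t x \<partial>\<nu>) \<longlonglongrightarrow> (\<integral>x. g x * t x \<partial>\<nu>)"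
        by (rule integral_dominated_convergence[where w="\<lambda>_. \<bar>b\<bar> * \<bar>d\<bar>"])
           (auto simp: sp bb[unfolded abs_mult] abs_mult intro!: tendsto_mult lim AE_I2)
      moreover have "(\<integral>x. f n x * t x \<partial>\<mu>) = (\<integral>x. f n x * t x \<partial>\<nu>)" for n
        using f[of n] t by (auto simp: L_def)
      ultimately show ?thesis using LIMSEQ_unique by auto
    qed
    then show ?thesis using gb by (auto simp: L_def)
  qed
  have L_poly: "L (\<lambda>x. p (s x) * g x)" if p: "real_polynomial_function p" and s: "s \<in> T" and g: "L g"
    for p :: "real \<Rightarrow> real" and s g
    using p g
  proof (induction p arbitrary: g)
    case (linear f)
    then interpret f: bounded_linear f by simp
    have "f (s x) = f 1 * s x" for x using f.scaleR[of "s x" 1] by simp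
    then show ?case using L_scale[OF L_mult[OF linear(2) s], of "f 1"] by (simp add: mult.assoc)
  next
    case (const c)
    then show ?case using L_scale by simp
  next
    case (add p q)
    then show ?case using L_add[of "\<lambda>x. p (s x) * g x" "\<lambda>x. q (s x) * g x"] by (simp add: distrib_right)
  next
    case (mult p q)
    show ?case using mult.IH(1)[OF mult.IH(2)[OF mult.prems]] by (simp add: mult.assoc)
  qed
  have L_cont: "L (\<lambda>x. \<phi> (s x) * g x)" if \<phi>: "continuous_on UNIV \<phi>" and s: "s \<in> T" and g: "L g"
    for \<phi> :: "real \<Rightarrow> real" and s g
  proof -
    obtain b where b: "\<And>x. x \<in> space B \<Longrightarrow> \<bar>s x\<bar> \<le> b" using bdd[OF s] by auto
    obtain c where c: "\<And>x. x \<in> space B \<Longrightarrow> \<bar>g x\<bar> \<le> c" using g by (auto simp: L_def)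
    have "\<exists>p. real_polynomial_function p \<and> (\<forall>y\<in>{-b..b}. \<bar>\<phi> y - p y\<bar> < 1 / (real n + 1))" for n
    proof -
      have "compact {-b..b}" "continuous_on {-b..b} \<phi>" "1 / (real n + 1) > 0"
        using continuous_on_subset[OF \<phi>] by auto
      then obtain p where "real_polynomial_function p" "\<And>y. y \<in> {-b..b} \<Longrightarrow> \<bar>\<phi> y - p y\<bar> < 1 / (real n + 1)"
        by (rule Stone_Weierstrass_real_polynomial_function) (rule that)
      then show ?thesis by (intro exI[of _ p]) simp
    qed
    then obtain p where p: "\<And>n. real_polynomial_function (p n)"
      and pb: "\<And>n y. y \<in> {-b..b} \<Longrightarrow> \<bar>\<phi> y - p n y\<bar> < 1 / (real n + 1)" by metis
    have "bounded (\<phi> ` {-b..b})"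
      using continuous_on_subset[OF \<phi>] by (intro compact_imp_bounded compact_continuous_image) auto
    then obtain d where d: "\<And>y. y \<in> {-b..b} \<Longrightarrow> \<bar>\<phi> y\<bar> \<le> d"
      unfolding bounded_iff by (metis image_eqI real_norm_def)
    have sb: "s x \<in> {-b..b}" if "x \<in> space B" for x using b[OF that] by auto
    show ?thesis
    proof (rule L_lim[of "\<lambda>n x. p n (s x) * g x" "(\<bar>d\<bar> + 1) * \<bar>c\<bar>"])
      show "L (\<lambda>x. p n (s x) * g x)" for n by (rule L_poly[OF p s g])
      show "\<bar>p n (s x) * g x\<bar> \<le> (\<bar>d\<bar> + 1) * \<bar>c\<bar>" if x: "x \<in> space B" for n x
      proof -
        have "1 / (real n + 1) \<le> 1" by simp
        then have "\<bar>p n (s x)\<bar> \<le> \<bar>d\<bar> + 1"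
          using pb[OF sb[OF x], of n] d[OF sb[OF x]] by linarith
        then show ?thesis unfolding abs_mult using c[OF x] by (intro mult_mono) auto
      qed
      show "(\<lambda>n. p n (s x) * g x) \<longlonglongrightarrow> \<phi> (s x) * g x" if x: "x \<in> space B" for x
      proof (intro tendsto_mult tendsto_const)
        have "(\<lambda>n. p n (s x) - \<phi> (s x)) \<longlonglongrightarrow> 0"
        proof (rule Lim_null_comparison)
          show "\<forall>\<^sub>F n in sequentially. norm (p n (s x) - \<phi> (s x)) \<le> 1 / (real n + 1)"
            using pb[OF sb[OF x]] by (intro always_eventually allI) (metis abs_minus_commute less_imp_le real_norm_def)
          show "(\<lambda>n. 1 / (real n + 1)) \<longlonglongrightarrow> 0"
            using LIMSEQ_Suc[OF lim_1_over_n[where 'a=real]] by (simp add: add.commute)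
        qed
        then show "(\<lambda>n. p n (s x)) \<longlonglongrightarrow> \<phi> (s x)" by (simp add: LIM_zero_iff)
      qed
    qed
  qed
  have L_ind: "L (\<lambda>x. indicator {..c} (s x) * g x)" if s: "s \<in> T" and g: "L g" for c s g
  proof -
    \<comment> \<open>Continuous functions decreasing to the indicator of the half-line up to \<open>c\<close>.\<close>
    define \<phi> where "\<phi> n y = max 0 (min 1 (1 - real n * (y - c)))" for n y
    obtain d where d: "\<And>x. x \<in> space B \<Longrightarrow> \<bar>g x\<bar> \<le> d" using g by (auto simp: L_def)
    have \<phi>b: "\<bar>\<phi> n y\<bar> \<le> 1" for n y by (auto simp: \<phi>_def)
    have lim: "(\<lambda>n. \<phi> n y) \<longlonglongrightarrow> indicator {..c} y" for y
    proof (cases "y \<le> c")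
      case True
      then have "\<phi> n y = 1" for n by (simp add: \<phi>_def min_def mult_nonneg_nonpos)
      then show ?thesis using True by simp
    next
      case False
      obtain N :: nat where N: "1 / (y - c) < real N" using reals_Archimedean2 by blast
      have "\<phi> n y = 0" if "n \<ge> N" for n
      proof -
        have "1 \<le> real n * (y - c)" using N that False
          by (smt (verit, best) divide_less_eq mult_mono of_nat_0_le_iff of_nat_mono)
        then show ?thesis by (simp add: \<phi>_def)
      qed
      then show ?thesis using False by (auto intro!: tendsto_eventually eventually_sequentiallyI[of N])
    qed
    show ?thesis
    proof (rule L_lim[of "\<lambda>n x. \<phi> n (s x) * g x" "1 * \<bar>d\<bar>"])
      show "L (\<lambda>x. \<phi> n (s x) * g x)" for n
        using s g by (intro L_cont) (auto simp: \<phi>_def intro!: continuous_intros)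
      show "\<bar>\<phi> n (s x) * g x\<bar> \<le> 1 * \<bar>d\<bar>" if "x \<in> space B" for n x
        unfolding abs_mult using \<phi>b[of n "s x"] d[OF that] by (intro mult_mono) auto
      show "(\<lambda>n. \<phi> n (s x) * g x) \<longlonglongrightarrow> indicator {..c} (s x) * g x" for x
        by (intro tendsto_mult lim tendsto_const)
    qed
  qed
  \<comment> \<open>Quantifying over all good functions, and not only the constant one, makes this family closed under intersections.\<close>
  define E where "E = {A \<in> sets B. \<forall>g. L g \<longrightarrow> L (\<lambda>x. indicator A x * g x)}"
  have "space B \<in> E"
  proof -
    have "L (\<lambda>x. indicator (space B) x * g x)" if "L g" for g
    proof -
      have "(\<lambda>x. indicator (space B) x * g x) \<in> borel_measurable B" using that by (auto simp: L_def)
      moreover have "\<forall>x\<in>space B. indicator (space B) x * g x = g x" by simp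
      moreover have "(\<integral>x. (indicator (space B) x * g x) * t x \<partial>\<mu>) = (\<integral>x. g x * t x \<partial>\<mu>)"
        "(\<integral>x. (indicator (space B) x * g x) * t x \<partial>\<nu>) = (\<integral>x. g x * t x \<partial>\<nu>)" for t
        by (auto intro!: Bochner_Integration.integral_cong simp: sp)
      ultimately show ?thesis using that by (auto simp: L_def)
    qed
    then show ?thesis by (auto simp: E_def)
  qed
  have EP: "E \<subseteq> Pow (space B)" by (auto simp: E_def dest: sets.sets_into_space)
  have TE: "t -` {..c} \<inter> space B \<in> E" if t: "t \<in> T" for t c
  proof -
    have [measurable]: "t \<in> borel_measurable B" using meas t by auto
    have "L (\<lambda>x. indicator (t -` {..c} \<inter> space B) x * g x)" if "L g" for g
    proof -
      have e: "indicator (t -` {..c} \<inter> space B) x = (indicator (space B) x * indicator {..c} (t x) :: real)" for x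
        by (auto simp: indicator_def)
      have "L (\<lambda>x. indicator (space B) x * (indicator {..c} (t x) * g x))"
        using L_ind[OF t that] \<open>space B \<in> E\<close> by (auto simp: E_def)
      then show ?thesis unfolding e by (simp add: mult.assoc)
    qed
    then show ?thesis by (auto simp: E_def)
  qed
  have sE: "sets B = sigma_sets (space B) E"
  proof
    show "sigma_sets (space B) E \<subseteq> sets B"
      by (rule sets.sigma_sets_subset) (auto simp: E_def)
    have "sigma_sets (space B) {t -` {..c} \<inter> space B | t c. t \<in> T} \<subseteq> sigma_sets (space B) E"
      by (rule sigma_sets_subseteq) (use TE in auto)
    with gen show "sets B \<subseteq> sigma_sets (space B) E" by auto
  qed
  show ?thesis
  proof (rule measure_eqI_generator_eq[where E=E and \<Omega>="space B" and A="\<lambda>_. space B"])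
    show "Int_stable E"
    proof (rule Int_stableI)
      fix A C assume "A \<in> E" "C \<in> E"
      moreover have "(\<lambda>x. indicator (A \<inter> C) x * g x) = (\<lambda>x. indicator A x * (indicator C x * g x :: real))" for g
        by (auto simp: indicator_def)
      ultimately show "A \<inter> C \<in> E" unfolding E_def by auto
    qed
    show "emeasure \<mu> X = emeasure \<nu> X" if "X \<in> E" for X
    proof -
      have "L (\<lambda>x. indicator X x * 1)" "X \<in> sets B" using that L_one by (auto simp: E_def)
      then have "(\<integral>x. indicator X x * 1 * 1 \<partial>\<mu>) = (\<integral>x. indicator X x * 1 * (1::real) \<partial>\<nu>)"
        using one by (force simp: L_def)
      then show ?thesis using \<open>X \<in> sets B\<close> sets.sets_into_space[OF \<open>X \<in> sets B\<close>]
        by (simp add: \<mu>.emeasure_eq_measure \<nu>.emeasure_eq_measure sp Int_absorb2)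
    qed
  qed (use EP sE sets \<open>space B \<in> E\<close> in auto)
qed

section \<open>Random elements of the space of bounded functions\<close>

\<comment> \<open>The simplifier would replace the metric by a conditional expression; the lemmas below are used instead.\<close>
declare mspace_funspace [simp del] mdist_funspace [simp del]

lemma mem_linf: "\<psi> \<in> mspace (linf F) \<longleftrightarrow> \<psi> \<in> extensional F \<and> bounded (\<psi> ` F)"
  by (auto simp: mspace_funspace Met_TC.fspace_def)

lemma mdist_linf_le:
  assumes "\<psi> \<in> mspace (linf F)" "\<phi> \<in> mspace (linf F)" "F \<noteq> {}"
  shows "mdist (linf F) \<psi> \<phi> \<le> a \<longleftrightarrow> (\<forall>f\<in>F. \<bar>\<psi> f - \<phi> f\<bar> \<le> a)"
  using funspace_mdist_le[OF assms, of a] by (simp add: dist_real_def)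

lemma abs_diff_le_mdist_linf:
  assumes "\<psi> \<in> mspace (linf F)" "\<phi> \<in> mspace (linf F)" "f \<in> F"
  shows "\<bar>\<psi> f - \<phi> f\<bar> \<le> mdist (linf F) \<psi> \<phi>"
  using mdist_linf_le[OF assms(1,2), of "mdist (linf F) \<psi> \<phi>"] assms(3) by auto

lemma openin_linf_subset: "openin (mtopology_of (linf F)) U \<Longrightarrow> U \<subseteq> mspace (linf F)"
  using openin_subset by fastforce

text \<open>Evaluations and the norm change by no more than the distance, which gives their continuity.\<close>

lemma Lipschitz_imp_continuous_linf:
  fixes h :: "('f \<Rightarrow> real) \<Rightarrow> real"
  assumes "\<And>\<psi> \<phi>. \<psi> \<in> mspace (linf F) \<Longrightarrow> \<phi> \<in> mspace (linf F) \<Longrightarrow> \<bar>h \<psi> - h \<phi>\<bar> \<le> mdist (linf F) \<psi> \<phi>"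
  shows "continuous_map (mtopology_of (linf F)) euclideanreal h"
proof -
  have "Lipschitz_continuous_map (linf F) euclidean_metric h"
    unfolding Lipschitz_continuous_map_def using assms
    by (auto simp: dist_real_def intro!: exI[of _ 1])
  from Lipschitz_continuous_imp_continuous_map[OF this] show ?thesis by simp
qed

lemma continuous_map_linf_eval:
  assumes "f \<in> F" shows "continuous_map (mtopology_of (linf F)) euclideanreal (\<lambda>\<psi>. \<psi> f)"
  using abs_diff_le_mdist_linf[OF _ _ assms] by (intro Lipschitz_imp_continuous_linf) auto

lemma bdd_above_linf:
  assumes "\<psi> \<in> mspace (linf F)" shows "bdd_above ((\<lambda>f. \<bar>\<psi> f\<bar>) ` F)"
proof -
  have "bounded (\<psi> ` F)" using assms by (simp add: mem_linf)
  then obtain b where "\<And>x. x \<in> \<psi> ` F \<Longrightarrow> norm x \<le> b" unfolding bounded_iff by blast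
  then show ?thesis by (intro bdd_aboveI[of _ b]) auto
qed

lemma continuous_map_linf_norm:
  assumes "F \<noteq> {}"
  shows "continuous_map (mtopology_of (linf F)) euclideanreal (linf_norm F)"
proof (rule Lipschitz_imp_continuous_linf)
  have *: "linf_norm F \<psi> - linf_norm F \<phi> \<le> mdist (linf F) \<psi> \<phi>"
    if \<psi>: "\<psi> \<in> mspace (linf F)" and \<phi>: "\<phi> \<in> mspace (linf F)" for \<psi> \<phi>
  proof -
    have "linf_norm F \<psi> \<le> linf_norm F \<phi> + mdist (linf F) \<psi> \<phi>"
      unfolding linf_norm_def
    proof (rule cSUP_least[OF assms])
      fix f assume f: "f \<in> F"
      have "\<bar>\<phi> f\<bar> \<le> (SUP f\<in>F. \<bar>\<phi> f\<bar>)" by (rule cSUP_upper[OF f bdd_above_linf[OF \<phi>]])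
      with abs_diff_le_mdist_linf[OF \<psi> \<phi> f]
      show "\<bar>\<psi> f\<bar> \<le> (SUP f\<in>F. \<bar>\<phi> f\<bar>) + mdist (linf F) \<psi> \<phi>" by linarith
    qed
    then show ?thesis by simp
  qed
  fix \<psi> \<phi> assume "\<psi> \<in> mspace (linf F)" "\<phi> \<in> mspace (linf F)"
  with *[of \<psi> \<phi>] *[of \<phi> \<psi>] show "\<bar>linf_norm F \<psi> - linf_norm F \<phi>\<bar> \<le> mdist (linf F) \<psi> \<phi>"
    by (simp add: mdist_commute abs_le_iff)
qed

lemma space_linf_borel [simp]: "space (linf_borel F) = mspace (linf F)"
  unfolding linf_borel_def by (rule space_measure_of) (auto dest: openin_linf_subset)

lemma sets_linf_borel: "sets (linf_borel F) = sigma_sets (mspace (linf F)) {U. openin (mtopology_of (linf F)) U}"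
  unfolding linf_borel_def by (rule sets_measure_of) (auto dest: openin_linf_subset)

lemma open_in_linf_borel: "openin (mtopology_of (linf F)) U \<Longrightarrow> U \<in> sets (linf_borel F)"
  by (auto simp: sets_linf_borel)

lemma closed_in_linf_borel:
  assumes "closedin (mtopology_of (linf F)) C" shows "C \<in> sets (linf_borel F)"
proof -
  have "C = mspace (linf F) - (mspace (linf F) - C)" using closedin_subset[OF assms] by auto
  moreover have "mspace (linf F) - C \<in> sets (linf_borel F)"
    using assms by (intro open_in_linf_borel) (auto simp: closedin_def)
  ultimately show ?thesis using sets.compl_sets[of "mspace (linf F) - C" "linf_borel F"] by simp
qed

lemma measurable_linf_borelI:
  assumes "\<And>\<omega>. \<omega> \<in> space M \<Longrightarrow> Z \<omega> \<in> mspace (linf F)"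
    and "\<And>U. openin (mtopology_of (linf F)) U \<Longrightarrow> Z -` U \<inter> space M \<in> sets M"
  shows "Z \<in> M \<rightarrow>\<^sub>M linf_borel F"
  unfolding linf_borel_def using assms
  by (intro measurable_measure_of) (auto dest: openin_linf_subset)

lemma continuous_map_linf_measurable:
  assumes "continuous_map (mtopology_of (linf F)) euclideanreal h"
  shows "h \<in> borel_measurable (linf_borel F)"
proof (rule borel_measurableI)
  fix S :: "real set" assume "open S"
  with assms have "openin (mtopology_of (linf F)) {\<psi> \<in> mspace (linf F). h \<psi> \<in> S}"
    using openin_continuous_map_preimage[OF assms, of S] by simp
  then have "{\<psi> \<in> mspace (linf F). h \<psi> \<in> S} \<in> sets (linf_borel F)" by (rule open_in_linf_borel)
  moreover have "h -` S \<inter> space (linf_borel F) = {\<psi> \<in> mspace (linf F). h \<psi> \<in> S}" by auto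
  ultimately show "h -` S \<inter> space (linf_borel F) \<in> sets (linf_borel F)" by simp
qed

text \<open>The space of bounded functions is not separable, so measurability of limits has to be checked on open
  sets: the limit lies in \<open>U\<close> iff for some \<open>k\<close> the sequence eventually avoids the open
  \<open>1 / (k + 1)\<close>-neighbourhood of the complement of \<open>U\<close>.\<close>

lemma measurable_linf_limit:
  assumes Zn: "\<And>n::nat. Zn n \<in> M \<rightarrow>\<^sub>M linf_borel F"
    and Z: "\<And>\<omega>. \<omega> \<in> space M \<Longrightarrow> Z \<omega> \<in> mspace (linf F)"
    and lim: "\<And>\<omega>. \<omega> \<in> space M \<Longrightarrow> (\<lambda>n. mdist (linf F) (Zn n \<omega>) (Z \<omega>)) \<longlonglongrightarrow> 0"
  shows "Z \<in> M \<rightarrow>\<^sub>M linf_borel F"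
proof (rule measurable_linf_borelI[OF Z])
  fix U assume U: "openin (mtopology_of (linf F)) U"
  interpret l: Metric_space "mspace (linf F)" "mdist (linf F)" by simp
  have top: "mtopology_of (linf F) = l.mtopology" by (simp add: mtopology_of_def)
  define W where "W k = (\<Union>\<phi>\<in>mspace (linf F) - U. l.mball \<phi> (1 / (real k + 1)))" for k :: nat
  have WO: "openin (mtopology_of (linf F)) (W k)" for k
    unfolding W_def top by (intro openin_Union) auto
  have Znm: "Zn n \<omega> \<in> mspace (linf F)" if "\<omega> \<in> space M" for n \<omega>
    using measurable_space[OF Zn that] by simp
  have eq: "Z \<omega> \<in> U \<longleftrightarrow> (\<exists>k N. \<forall>n\<ge>N. Zn n \<omega> \<notin> W k)" if \<omega>: "\<omega> \<in> space M" for \<omega>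
  proof
    assume "Z \<omega> \<in> U"
    then obtain r where r: "r > 0" "l.mball (Z \<omega>) r \<subseteq> U" using U unfolding top l.openin_mtopology by blast
    obtain k :: nat where k: "1 / (real k + 1) < r / 2"
      using r reals_Archimedean[of "r/2"] by (auto simp: inverse_eq_divide add.commute)
    have "\<forall>\<^sub>F n in sequentially. mdist (linf F) (Zn n \<omega>) (Z \<omega>) < r / 2"
      using order_tendstoD(2)[OF lim[OF \<omega>], of "r / 2"] r(1) by simp
    then obtain N where N: "\<And>n. n \<ge> N \<Longrightarrow> mdist (linf F) (Zn n \<omega>) (Z \<omega>) < r / 2"
      by (auto simp: eventually_sequentially)
    have "Zn n \<omega> \<notin> W k" if "n \<ge> N" for n
    proof
      assume "Zn n \<omega> \<in> W k"
      then obtain \<phi> where \<phi>: "\<phi> \<in> mspace (linf F)" "\<phi> \<notin> U" "mdist (linf F) \<phi> (Zn n \<omega>) < 1 / (real k + 1)"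
        by (auto simp: W_def)
      have "mdist (linf F) (Z \<omega>) \<phi> \<le> mdist (linf F) (Z \<omega>) (Zn n \<omega>) + mdist (linf F) (Zn n \<omega>) \<phi>"
        by (rule l.triangle) (use Z Znm \<phi> \<omega> in auto)
      also have "\<dots> < r / 2 + r / 2"
        using N[OF that] \<phi>(3) k by (simp add: l.commute)
      finally have "\<phi> \<in> l.mball (Z \<omega>) r" using \<phi> Z \<omega> by auto
      with r \<phi> show False by auto
    qed
    then show "\<exists>k N. \<forall>n\<ge>N. Zn n \<omega> \<notin> W k" by blast
  next
    assume "\<exists>k N. \<forall>n\<ge>N. Zn n \<omega> \<notin> W k"
    then obtain k N where kN: "\<And>n. n \<ge> N \<Longrightarrow> Zn n \<omega> \<notin> W k" by blast
    have "\<forall>\<^sub>F n in sequentially. mdist (linf F) (Zn n \<omega>) (Z \<omega>) < 1 / (real k + 1)"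
      using order_tendstoD(2)[OF lim[OF \<omega>], of "1 / (real k + 1)"] by simp
    then obtain N' where N': "\<And>n. n \<ge> N' \<Longrightarrow> mdist (linf F) (Zn n \<omega>) (Z \<omega>) < 1 / (real k + 1)"
      by (auto simp: eventually_sequentially)
    show "Z \<omega> \<in> U"
    proof (rule ccontr)
      assume "Z \<omega> \<notin> U"
      then have "Zn (max N N') \<omega> \<in> W k"
        using N'[of "max N N'"] Z[OF \<omega>] Znm[OF \<omega>] by (auto simp: W_def l.commute intro!: bexI[of _ "Z \<omega>"])
      with kN[of "max N N'"] show False by auto
    qed
  qed
  have [measurable]: "{\<omega> \<in> space M. Zn n \<omega> \<notin> W k} \<in> sets M" for n k
  proof -
    have "Zn n -` W k \<inter> space M \<in> sets M"
      using Zn open_in_linf_borel[OF WO] by (rule measurable_sets)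
    then have "space M - (Zn n -` W k \<inter> space M) \<in> sets M" by auto
    moreover have "space M - (Zn n -` W k \<inter> space M) = {\<omega> \<in> space M. Zn n \<omega> \<notin> W k}" by auto
    ultimately show ?thesis by simp
  qed
  have "Z -` U \<inter> space M = {\<omega> \<in> space M. \<exists>k N. \<forall>n\<ge>N. Zn n \<omega> \<notin> W k}" using eq by auto
  also have "\<dots> \<in> sets M" by measurable
  finally show "Z -` U \<inter> space M \<in> sets M" .
qed

lemma indicators_nonempty: "(indicators :: ('a \<Rightarrow> real) set) \<noteq> {}" by auto

lemma abs_indicators_le_1: "f \<in> indicators \<Longrightarrow> \<bar>f x\<bar> \<le> 1"
  by (auto simp: indicator_def)

text \<open>Sequences that are not absolutely summable are replaced by \<open>0\<close>. This makes \<open>atomic\<close> total with values in the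
  space of bounded functions, as is needed for random sequences that are summable only almost surely.\<close>

definition l1_part :: "(nat \<Rightarrow> real) \<Rightarrow> nat \<Rightarrow> real" where
  "l1_part u = (if summable (\<lambda>i. \<bar>u i\<bar>) then u else (\<lambda>_. 0))"

definition atomic :: "(nat \<Rightarrow> 'a) \<Rightarrow> (nat \<Rightarrow> real) \<Rightarrow> ('a \<Rightarrow> real) \<Rightarrow> real" where
  "atomic e u = (\<lambda>f\<in>indicators. \<Sum>i. l1_part u i * f (e i))"

lemma summable_l1_part: "summable (\<lambda>i. \<bar>l1_part u i\<bar>)"
  by (auto simp: l1_part_def)

lemma summable_mult_bounded:
  fixes u b :: "nat \<Rightarrow> real"
  assumes "summable (\<lambda>i. \<bar>u i\<bar>)" "\<And>i. \<bar>b i\<bar> \<le> B"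
  shows "summable (\<lambda>i. \<bar>u i * b i\<bar>)" "summable (\<lambda>i. u i * b i)"
    "\<bar>\<Sum>i. u i * b i\<bar> \<le> B * (\<Sum>i. \<bar>u i\<bar>)"
proof -
  have le: "\<bar>u i * b i\<bar> \<le> B * \<bar>u i\<bar>" for i
    unfolding abs_mult using mult_right_mono[OF assms(2)[of i], of "\<bar>u i\<bar>"] by (simp add: mult.commute)
  have s: "summable (\<lambda>i. B * \<bar>u i\<bar>)" using assms(1) by (rule summable_mult)
  show a: "summable (\<lambda>i. \<bar>u i * b i\<bar>)"
    by (rule summable_comparison_test'[OF s, of 0]) (use le in auto)
  then show "summable (\<lambda>i. u i * b i)" by (rule summable_rabs_cancel)
  have "\<bar>\<Sum>i. u i * b i\<bar> \<le> (\<Sum>i. \<bar>u i * b i\<bar>)" by (rule summable_rabs[OF a])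
  also have "\<dots> \<le> (\<Sum>i. B * \<bar>u i\<bar>)" by (rule suminf_le[OF le a s])
  also have "\<dots> = B * (\<Sum>i. \<bar>u i\<bar>)" by (rule suminf_mult[OF assms(1)])
  finally show "\<bar>\<Sum>i. u i * b i\<bar> \<le> B * (\<Sum>i. \<bar>u i\<bar>)" .
qed

lemma atomic_in_linf: "atomic e u \<in> mspace (linf indicators)"
  unfolding mem_linf
proof
  have "\<bar>\<Sum>i. l1_part u i * f (e i)\<bar> \<le> 1 * (\<Sum>i. \<bar>l1_part u i\<bar>)" if "f \<in> indicators" for f
    using summable_mult_bounded(3)[OF summable_l1_part, of "\<lambda>i. f (e i)" 1 u] abs_indicators_le_1[OF that] by auto
  then show "bounded (atomic e u ` indicators)"
    unfolding bounded_iff by (intro exI[of _ "1 * (\<Sum>i. \<bar>l1_part u i\<bar>)"]) (auto simp: atomic_def)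
qed (auto simp: atomic_def)

lemma atomic_apply:
  assumes "summable (\<lambda>i. \<bar>u i\<bar>)" "f \<in> indicators"
  shows "atomic e u f = (\<Sum>i. u i * f (e i))"
  using assms by (simp add: atomic_def l1_part_def)

lemma mdist_atomic_le:
  assumes u: "summable (\<lambda>i. \<bar>u i\<bar>)" and v: "summable (\<lambda>i. \<bar>v i\<bar>)"
  shows "mdist (linf indicators) (atomic e u) (atomic e v) \<le> (\<Sum>i. \<bar>u i - v i\<bar>)"
  unfolding mdist_linf_le[OF atomic_in_linf atomic_in_linf indicators_nonempty]
proof
  fix f :: "'a \<Rightarrow> real" assume f: "f \<in> indicators"
  have s: "summable (\<lambda>i. \<bar>u i - v i\<bar>)"
    by (rule summable_comparison_test'[OF summable_add[OF u v], of 0]) auto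
  have "(\<Sum>i. u i * f (e i)) - (\<Sum>i. v i * f (e i)) = (\<Sum>i. u i * f (e i) - v i * f (e i))"
    using summable_mult_bounded(2)[of _ "\<lambda>i. f (e i)" 1] u v abs_indicators_le_1[OF f] by (intro suminf_diff) auto
  then have "atomic e u f - atomic e v f = (\<Sum>i. (u i - v i) * f (e i))"
    using u v f by (simp add: atomic_apply left_diff_distrib)
  then show "\<bar>atomic e u f - atomic e v f\<bar> \<le> (\<Sum>i. \<bar>u i - v i\<bar>)"
    using summable_mult_bounded(3)[OF s, of "\<lambda>i. f (e i)" 1] abs_indicators_le_1[OF f] by auto
qed

text \<open>The reduction of convergence in the space of bounded functions to convergence in \<open>l\<^sup>1\<close>.\<close>

lemma continuous_atomic_tendsto:
  assumes h: "continuous_map (mtopology_of (linf indicators)) euclideanreal h"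
    and un: "\<And>n. summable (\<lambda>i. \<bar>un n i\<bar>)" and u: "summable (\<lambda>i. \<bar>u i\<bar>)"
    and lim: "(\<lambda>n::nat. \<Sum>i. \<bar>un n i - u i\<bar>) \<longlonglongrightarrow> 0"
  shows "(\<lambda>n. h (atomic e (un n))) \<longlonglongrightarrow> h (atomic e u)"
proof -
  interpret l: Metric_space "mspace (linf (indicators :: ('a \<Rightarrow> real) set))" "mdist (linf (indicators :: ('a \<Rightarrow> real) set))" by simp
  have top: "mtopology_of (linf indicators) = l.mtopology" by (simp add: mtopology_of_def)
  have "limitin l.mtopology (\<lambda>n. atomic e (un n)) (atomic e u) sequentially"
    unfolding l.limitin_metric
  proof (intro conjI allI impI)
    fix \<epsilon> :: real assume "\<epsilon> > 0"
    with order_tendstoD(2)[OF lim] have "\<forall>\<^sub>F n in sequentially. (\<Sum>i. \<bar>un n i - u i\<bar>) < \<epsilon>" by auto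
    then show "\<forall>\<^sub>F n in sequentially. atomic e (un n) \<in> mspace (linf indicators) \<and>
        mdist (linf indicators) (atomic e (un n)) (atomic e u) < \<epsilon>"
      by eventually_elim (use mdist_atomic_le[OF un u] atomic_in_linf in \<open>fastforce intro: le_less_trans\<close>)
  qed (rule atomic_in_linf)
  from continuous_map_limit[OF h[unfolded top] this] show ?thesis by (simp add: o_def)
qed

lemma continuous_map_atomic_truncated:
  "continuous_map euclidean (mtopology_of (linf indicators)) (\<lambda>u. atomic e (\<lambda>i. if i < m then u i else 0))"
proof -
  interpret l: Metric_space "mspace (linf (indicators :: ('a \<Rightarrow> real) set))" "mdist (linf (indicators :: ('a \<Rightarrow> real) set))" by simp
  have top: "mtopology_of (linf indicators) = l.mtopology" by (simp add: mtopology_of_def)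
  have fin: "summable (\<lambda>i. \<bar>if i < m then u i else 0\<bar>)" for u :: "nat \<Rightarrow> real"
    by (rule summable_finite[of "{..<m}"]) auto
  have "\<exists>U. openin euclidean U \<and> u \<in> U \<and>
      (\<forall>v\<in>U. atomic e (\<lambda>i. if i < m then v i else 0) \<in> l.mball (atomic e (\<lambda>i. if i < m then u i else 0)) \<epsilon>)"
    if "\<epsilon> > 0" for u \<epsilon>
  proof (intro exI conjI ballI)
    let ?U = "{v. (\<Sum>i<m. \<bar>u i - v i\<bar>) < \<epsilon>}"
    show "openin euclidean ?U"
      unfolding open_openin[symmetric]
      by (intro open_Collect_less continuous_intros continuous_on_product_coordinates)
    show "u \<in> ?U" using that by simp
    fix v assume v: "v \<in> ?U"
    have "mdist (linf indicators) (atomic e (\<lambda>i. if i < m then u i else 0)) (atomic e (\<lambda>i. if i < m then v i else 0))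
      \<le> (\<Sum>i. \<bar>(if i < m then u i else 0) - (if i < m then v i else 0)\<bar>)"
      by (rule mdist_atomic_le[OF fin fin])
    also have "\<dots> = (\<Sum>i<m. \<bar>(if i < m then u i else 0) - (if i < m then v i else 0)\<bar>)"
      by (rule suminf_finite) auto
    also have "\<dots> = (\<Sum>i<m. \<bar>u i - v i\<bar>)" by (intro sum.cong) auto
    also have "\<dots> < \<epsilon>" using v by simp
    finally show "atomic e (\<lambda>i. if i < m then v i else 0) \<in> l.mball (atomic e (\<lambda>i. if i < m then u i else 0)) \<epsilon>"
      by (simp add: atomic_in_linf)
  qed
  then show ?thesis unfolding top l.continuous_map_to_metric by simp
qed

lemma suminf_tail_tendsto_0:
  fixes u :: "nat \<Rightarrow> real"
  assumes "summable (\<lambda>i. \<bar>u i\<bar>)"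
  shows "summable (\<lambda>i. \<bar>(if i < m then u i else 0) - u i\<bar>)"
    and "(\<Sum>i. \<bar>(if i < m then u i else 0) - u i\<bar>) = (\<Sum>i. \<bar>u (i + m)\<bar>)"
    and "(\<lambda>m. \<Sum>i. \<bar>(if i < m then u i else 0) - u i\<bar>) \<longlonglongrightarrow> 0"
proof -
  show s: "summable (\<lambda>i. \<bar>(if i < m then u i else 0) - u i\<bar>)" for m
    by (rule summable_comparison_test'[OF assms, of 0]) auto
  show eq: "(\<Sum>i. \<bar>(if i < m then u i else 0) - u i\<bar>) = (\<Sum>i. \<bar>u (i + m)\<bar>)" for m
    by (subst suminf_split_initial_segment[OF s, of _ m]) simp
  show "(\<lambda>m. \<Sum>i. \<bar>(if i < m then u i else 0) - u i\<bar>) \<longlonglongrightarrow> 0"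
    unfolding eq by (rule suminf_exist_split2[OF assms])
qed

lemma measurable_summable_abs:
  fixes u :: "'w \<Rightarrow> nat \<Rightarrow> real"
  assumes [measurable]: "\<And>i. (\<lambda>\<omega>. u \<omega> i) \<in> borel_measurable M"
  shows "{\<omega> \<in> space M. summable (\<lambda>i. \<bar>u \<omega> i\<bar>)} \<in> sets M"
proof -
  have "summable (\<lambda>i. \<bar>u \<omega> i\<bar>) \<longleftrightarrow> (\<exists>K::nat. \<forall>m. (\<Sum>i<m. \<bar>u \<omega> i\<bar>) \<le> real K)" for \<omega>
  proof
    assume s: "summable (\<lambda>i. \<bar>u \<omega> i\<bar>)"
    obtain K :: nat where "(\<Sum>i. \<bar>u \<omega> i\<bar>) \<le> real K" using real_arch_simple by blast
    with sum_le_suminf[OF s] show "\<exists>K::nat. \<forall>m. (\<Sum>i<m. \<bar>u \<omega> i\<bar>) \<le> real K"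
      by (meson abs_ge_zero finite_lessThan order_trans)
  qed (auto intro: summableI_nonneg_bounded)
  then show ?thesis by simp
qed

lemma measurable_l1_part:
  fixes u :: "'w \<Rightarrow> nat \<Rightarrow> real"
  assumes m [measurable]: "\<And>i. (\<lambda>\<omega>. u \<omega> i) \<in> borel_measurable M"
  shows "(\<lambda>\<omega>. l1_part (u \<omega>) i) \<in> borel_measurable M"
proof -
  have [measurable]: "{\<omega> \<in> space M. summable (\<lambda>i. \<bar>u \<omega> i\<bar>)} \<in> sets M"
    by (rule measurable_summable_abs) measurable
  have "(\<lambda>\<omega>. l1_part (u \<omega>) i) = (\<lambda>\<omega>. if summable (\<lambda>i. \<bar>u \<omega> i\<bar>) then u \<omega> i else 0)"
    by (auto simp: l1_part_def)
  then show ?thesis by simp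
qed

text \<open>Truncations depend continuously on finitely many coordinates, and \<open>atomic\<close> is their limit. The detour avoids
  the Borel sets of a nonseparable space, where coordinatewise arguments fail.\<close>

lemma measurable_atomic:
  fixes u :: "'w \<Rightarrow> nat \<Rightarrow> real"
  assumes m: "\<And>i. (\<lambda>\<omega>. u \<omega> i) \<in> borel_measurable M"
  shows "(\<lambda>\<omega>. atomic e (u \<omega>)) \<in> M \<rightarrow>\<^sub>M linf_borel indicators"
proof -
  let ?v = "\<lambda>m \<omega>. (\<lambda>i. if i < m then l1_part (u \<omega>) i else 0)"
  have l1: "(\<lambda>\<omega>. l1_part (u \<omega>)) \<in> M \<rightarrow>\<^sub>M (borel :: (nat \<Rightarrow> real) measure)"
    by (rule measurable_coordinatewise_then_product[OF measurable_l1_part[OF m]])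
  have meas: "(\<lambda>\<omega>. atomic e (?v m \<omega>)) \<in> M \<rightarrow>\<^sub>M linf_borel indicators" for m
  proof (rule measurable_linf_borelI)
    show "atomic e (?v m \<omega>) \<in> mspace (linf indicators)" for \<omega> by (rule atomic_in_linf)
    fix U :: "(('a \<Rightarrow> real) \<Rightarrow> real) set" assume U: "openin (mtopology_of (linf indicators)) U"
    have "open {u. atomic e (\<lambda>i. if i < m then u i else 0) \<in> U}"
    proof -
      have "openin euclidean {u \<in> topspace euclidean. atomic e (\<lambda>i. if i < m then u i else 0) \<in> U}"
        by (rule openin_continuous_map_preimage[OF continuous_map_atomic_truncated[of e m] U])
      then show ?thesis by simp
    qed
    then have "(\<lambda>\<omega>. l1_part (u \<omega>)) -` {u. atomic e (\<lambda>i. if i < m then u i else 0) \<in> U} \<inter> space M \<in> sets M"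
      by (intro measurable_sets[OF l1]) auto
    then show "(\<lambda>\<omega>. atomic e (?v m \<omega>)) -` U \<inter> space M \<in> sets M" by (simp add: vimage_def)
  qed
  have lim: "(\<lambda>m. mdist (linf indicators) (atomic e (?v m \<omega>)) (atomic e (u \<omega>))) \<longlonglongrightarrow> 0" for \<omega>
  proof -
    have eq: "atomic e (u \<omega>) = atomic e (l1_part (u \<omega>))" by (simp add: atomic_def l1_part_def)
    have s: "summable (\<lambda>i. \<bar>?v m \<omega> i\<bar>)" for m by (rule summable_finite[of "{..<m}"]) auto
    have "mdist (linf indicators) (atomic e (?v m \<omega>)) (atomic e (u \<omega>)) \<le> (\<Sum>i. \<bar>?v m \<omega> i - l1_part (u \<omega>) i\<bar>)" for m
      unfolding eq by (rule mdist_atomic_le[OF s summable_l1_part])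
    with tendsto_sandwich[OF _ _ tendsto_const suminf_tail_tendsto_0(3)[OF summable_l1_part[of "u \<omega>"]]]
    show ?thesis by simp
  qed
  show ?thesis
    by (rule measurable_linf_limit[where Zn="\<lambda>m \<omega>. atomic e (?v m \<omega>)", OF meas atomic_in_linf lim])
qed

text \<open>The sequences with weighted norm at most \<open>R\<close> are compact for pointwise convergence by Tychonoff's theorem, and
  since the weights diverge their tails are uniformly small; hence \<open>atomic e\<close> is a uniform limit of continuous
  maps on this set and has a compact image. These are the compact sets that witness tightness of the bridge.\<close>

lemma compactin_atomic_weighted:
  fixes w :: "nat \<Rightarrow> real"
  assumes w: "\<And>i. w i > 0" "filterlim w at_top sequentially"
  shows "compactin (mtopology_of (linf indicators)) (atomic e ` {u. \<forall>m. (\<Sum>i<m. w i * \<bar>u i\<bar>) \<le> R})"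
proof -
  let ?K = "{u. \<forall>m. (\<Sum>i<m. w i * \<bar>u i\<bar>) \<le> R}"
  interpret l: Metric_space "mspace (linf (indicators :: ('a \<Rightarrow> real) set))" "mdist (linf (indicators :: ('a \<Rightarrow> real) set))" by simp
  have top: "mtopology_of (linf indicators) = l.mtopology" by (simp add: mtopology_of_def)
  have "compactin (product_topology (\<lambda>i::nat. euclideanreal) UNIV) (Pi\<^sub>E UNIV (\<lambda>i. {-(R / w i)..R / w i}))"
    by (simp add: compactin_PiE)
  then have c: "compact (Pi\<^sub>E UNIV (\<lambda>i. {-(R / w i)..R / w i}))"
    by (simp add: euclidean_product_topology)
  have sub: "?K \<subseteq> Pi\<^sub>E UNIV (\<lambda>i. {-(R / w i)..R / w i})"
  proof
    fix u assume u: "u \<in> ?K"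
    have "\<bar>u i\<bar> \<le> R / w i" for i
    proof -
      have "w i * \<bar>u i\<bar> \<le> (\<Sum>i<Suc i. w i * \<bar>u i\<bar>)"
        by (rule member_le_sum) (auto intro!: mult_nonneg_nonneg less_imp_le[OF w(1)])
      also have "\<dots> \<le> R" using u by blast
      finally show ?thesis using w(1)[of i] by (simp add: field_simps)
    qed
    then show "u \<in> Pi\<^sub>E UNIV (\<lambda>i. {-(R / w i)..R / w i})" by (auto simp: abs_le_iff minus_le_iff)
  qed
  have "closed ?K"
    by (intro closed_Collect_all closed_Collect_le continuous_intros continuous_on_product_coordinates)
  from compact_Int_closed[OF c this] have "compact ?K" using sub by (simp add: Int_absorb1)
  then have K: "compactin (subtopology euclidean ?K) ?K" by simp
  have summ: "summable (\<lambda>i. w i * \<bar>u i\<bar>)" "(\<Sum>i. w i * \<bar>u i\<bar>) \<le> R" if "u \<in> ?K" for u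
  proof -
    show s: "summable (\<lambda>i. w i * \<bar>u i\<bar>)"
      using that less_imp_le[OF w(1)] by (intro summableI_nonneg_bounded[of _ R]) auto
    show "(\<Sum>i. w i * \<bar>u i\<bar>) \<le> R" by (rule suminf_le_const[OF s]) (use that in auto)
  qed
  have tail: "\<exists>N. \<forall>u\<in>?K. summable (\<lambda>i. \<bar>u i\<bar>) \<and> (\<forall>m\<ge>N. (\<Sum>i. \<bar>u (i + m)\<bar>) < \<epsilon>)" if "\<epsilon> > 0" for \<epsilon>
  proof -
    define B where "B = (\<bar>R\<bar> + 1) / \<epsilon>"
    have B: "B > 0" using that by (simp add: B_def)
    obtain N where N: "\<And>i. i \<ge> N \<Longrightarrow> w i \<ge> B"
      using w(2) unfolding filterlim_at_top eventually_sequentially by blast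
    have "summable (\<lambda>i. \<bar>u i\<bar>) \<and> (\<forall>m\<ge>N. (\<Sum>i. \<bar>u (i + m)\<bar>) < \<epsilon>)" if u: "u \<in> ?K" for u
    proof (intro conjI allI impI)
      have le: "\<bar>u i\<bar> \<le> w i * \<bar>u i\<bar> / B" if "i \<ge> N" for i
        using mult_right_mono[OF N[OF that], of "\<bar>u i\<bar>"] B by (simp add: field_simps)
      have sB: "summable (\<lambda>i. w i * \<bar>u i\<bar> / B)" by (intro summable_divide summ u)
      show s: "summable (\<lambda>i. \<bar>u i\<bar>)"
        by (rule summable_comparison_test'[OF sB, of N]) (use le in auto)
      fix m assume m: "m \<ge> N"
      have "(\<Sum>i. \<bar>u (i + m)\<bar>) \<le> (\<Sum>i. w (i + m) * \<bar>u (i + m)\<bar> / B)"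
        by (rule suminf_le[OF _ summable_ignore_initial_segment[OF s, of m] summable_ignore_initial_segment[OF sB, of m]])
           (use le m in auto)
      also have "\<dots> \<le> (\<Sum>i. w i * \<bar>u i\<bar> / B)"
        using suminf_split_initial_segment[OF sB, of m] less_imp_le[OF w(1)] B
          sum_nonneg[of "{..<m}" "\<lambda>i. w i * \<bar>u i\<bar> / B"] by simp
      also have "\<dots> = (\<Sum>i. w i * \<bar>u i\<bar>) / B" by (intro suminf_divide summ u)
      also have "\<dots> \<le> R / B" using summ(2)[OF u] B by (simp add: divide_right_mono)
      also have "\<dots> < \<epsilon>"
      proof -
        have "R < \<epsilon> * B" using \<open>\<epsilon> > 0\<close> by (simp add: B_def)
        then show ?thesis using B by (simp add: pos_divide_less_eq)
      qed
      finally show "(\<Sum>i. \<bar>u (i + m)\<bar>) < \<epsilon>" .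
    qed
    then show ?thesis by (intro exI[of _ N] ballI)
  qed
  have "continuous_map (subtopology euclidean ?K) l.mtopology (atomic e)"
  proof (rule l.continuous_map_uniform_limit_alt[where F=sequentially and f="\<lambda>m u. atomic e (\<lambda>i. if i < m then u i else 0)"])
    show "\<forall>\<^sub>F m in sequentially. continuous_map (subtopology euclidean ?K) l.mtopology (\<lambda>u. atomic e (\<lambda>i. if i < m then u i else 0))"
      using continuous_map_from_subtopology[OF continuous_map_atomic_truncated[of e]] unfolding top by simp
    show "atomic e \<in> topspace (subtopology euclidean ?K) \<rightarrow> mspace (linf indicators)"
      using atomic_in_linf by auto
    fix \<epsilon> :: real assume "\<epsilon> > 0"
    from tail[OF this] obtain N where N0: "\<forall>u\<in>?K. summable (\<lambda>i. \<bar>u i\<bar>) \<and> (\<forall>m\<ge>N. (\<Sum>i. \<bar>u (i + m)\<bar>) < \<epsilon>)" ..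
    have N: "summable (\<lambda>i. \<bar>u i\<bar>)" "m \<ge> N \<Longrightarrow> (\<Sum>i. \<bar>u (i + m)\<bar>) < \<epsilon>" if "u \<in> ?K" for u m
      using bspec[OF N0 that] by simp_all
    show "\<forall>\<^sub>F m in sequentially. \<forall>u\<in>topspace (subtopology euclidean ?K).
        mdist (linf indicators) (atomic e (\<lambda>i. if i < m then u i else 0)) (atomic e u) < \<epsilon>"
    proof (rule eventually_sequentiallyI[of N], rule ballI)
      fix m u assume m: "m \<ge> N" and "u \<in> topspace (subtopology euclidean ?K)"
      then have u: "u \<in> ?K" by simp
      have "mdist (linf indicators) (atomic e (\<lambda>i. if i < m then u i else 0)) (atomic e u)
        \<le> (\<Sum>i. \<bar>(if i < m then u i else 0) - u i\<bar>)"
        by (rule mdist_atomic_le[OF _ N(1)[OF u]]) (rule summable_finite[of "{..<m}"], auto)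
      also have "\<dots> < \<epsilon>" unfolding suminf_tail_tendsto_0(2)[OF N(1)[OF u]] by (rule N(2)[OF u m])
      finally show "mdist (linf indicators) (atomic e (\<lambda>i. if i < m then u i else 0)) (atomic e u) < \<epsilon>" .
    qed
  qed simp
  from image_compactin[OF K this] show ?thesis by (simp add: top)
qed

section \<open>Uniqueness of the Brownian bridge\<close>

text \<open>Functions with the topology of pointwise convergence are a Hausdorff space; the Stone-Weierstrass theorem is applied to compact sets of such functions.\<close>

instance "fun" :: (type, t0_space) t0_space
proof
  fix x y :: "'a \<Rightarrow> 'b" assume "x \<noteq> y"
  then obtain i where i: "x i \<noteq> y i" by auto
  obtain U where U: "open U" "\<not> (x i \<in> U \<longleftrightarrow> y i \<in> U)" using t0_space_class.t0_space[OF i] by blast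
  have "open ((\<lambda>x. x i) -` U)" by (rule open_vimage[OF U(1) continuous_on_product_coordinates])
  with U(2) show "\<exists>U. open U \<and> \<not> (x \<in> U \<longleftrightarrow> y \<in> U)"
    by (intro exI[of _ "(\<lambda>x. x i) -` U"]) auto
qed

instance "fun" :: (type, t1_space) t1_space
proof
  fix x y :: "'a \<Rightarrow> 'b" assume "x \<noteq> y"
  then obtain i where i: "x i \<noteq> y i" by auto
  obtain U where U: "open U" "x i \<in> U" "y i \<notin> U" using t1_space[OF i] by blast
  have "open ((\<lambda>x. x i) -` U)" by (rule open_vimage[OF U(1) continuous_on_product_coordinates])
  with U show "\<exists>U. open U \<and> x \<in> U \<and> y \<notin> U"
    by (intro exI[of _ "(\<lambda>x. x i) -` U"]) auto
qed

instance "fun" :: (type, t2_space) t2_space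
proof
  fix x y :: "'a \<Rightarrow> 'b" assume "x \<noteq> y"
  then obtain i where i: "x i \<noteq> y i" by auto
  obtain U V where UV: "open U" "open V" "x i \<in> U" "y i \<in> V" "U \<inter> V = {}"
    using hausdorff[OF i] by blast
  have "open ((\<lambda>x. x i) -` U)" "open ((\<lambda>x. x i) -` V)"
    by (rule open_vimage[OF _ continuous_on_product_coordinates], fact UV)+
  with UV show "\<exists>U V. open U \<and> open V \<and> x \<in> U \<and> y \<in> V \<and> U \<inter> V = {}"
    by (intro exI[of _ "(\<lambda>x. x i) -` U"] exI[of _ "(\<lambda>x. x i) -` V"]) auto
qed

lemma gaussian_law_moments:
  assumes "gaussian_law \<nu>"
  obtains m v where "v \<ge> 0" "integrable \<nu> (\<lambda>x. x)" "integrable \<nu> (\<lambda>x. x\<^sup>2)"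
    "(\<integral>x. x \<partial>\<nu>) = m" "(\<integral>x. x\<^sup>2 \<partial>\<nu>) = v + m\<^sup>2"
    "\<nu> = (if v = 0 then return borel m else density lborel (\<lambda>t. ennreal (normal_density m (sqrt v) t)))"
  using assms unfolding gaussian_law_def
proof (elim disjE exE conjE)
  fix m assume \<nu>: "\<nu> = return borel m"
  show thesis
    by (rule that[of 0 m]) (auto simp: \<nu> integral_return intro!: integrableI_bounded simp: nn_integral_return)
next
  fix m s :: real assume s: "0 < s" and \<nu>: "\<nu> = density lborel (\<lambda>t. ennreal (normal_density m s t))"
  have sq: "integrable lborel (\<lambda>x. normal_density m s x * x\<^sup>2)"
    and sq': "(\<integral>x. normal_density m s x * x\<^sup>2 \<partial>lborel) = s\<^sup>2 + m\<^sup>2"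
  proof -
    have i0: "integrable lborel (\<lambda>x. normal_density m s x * (x - m)\<^sup>2)"
      using integrable_normal_moment[OF s, of m 2] by simp
    have i1: "integrable lborel (\<lambda>x. normal_density m s x * x)"
      using integrable_normal_moment_nz_1[OF s, of m] by simp
    have i2: "integrable lborel (normal_density m s)" using s by (rule integrable_normal_density)
    have eq: "normal_density m s x * x\<^sup>2 = normal_density m s x * (x - m)\<^sup>2 + 2 * m * (normal_density m s x * x) - m\<^sup>2 * normal_density m s x" for x
      by (simp add: power2_eq_square algebra_simps)
    show "integrable lborel (\<lambda>x. normal_density m s x * x\<^sup>2)"
      unfolding eq using i0 i1 i2 by simp
    show "(\<integral>x. normal_density m s x * x\<^sup>2 \<partial>lborel) = s\<^sup>2 + m\<^sup>2"
      unfolding eq using i0 i1 i2 integral_normal_moment_even[OF s, of m 1] integral_normal_moment_nz_1[OF s, of m]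
        integral_normal_density[OF s, of m]
      by (simp add: power2_eq_square)
  qed
  show thesis
  proof (rule that[of "s\<^sup>2" m])
    show "integrable \<nu> (\<lambda>x. x)" "(\<integral>x. x \<partial>\<nu>) = m"
      using integrable_normal_moment_nz_1[OF s, of m] integral_normal_moment_nz_1[OF s, of m]
      unfolding \<nu> by (simp_all add: integrable_density integral_density)
    show "integrable \<nu> (\<lambda>x. x\<^sup>2)" "(\<integral>x. x\<^sup>2 \<partial>\<nu>) = s\<^sup>2 + m\<^sup>2"
      using sq sq' unfolding \<nu> by (simp_all add: integrable_density integral_density)
    show "\<nu> = (if s\<^sup>2 = 0 then return borel m else density lborel (\<lambda>t. ennreal (normal_density m (sqrt (s\<^sup>2)) t)))"
      using s by (simp add: \<nu>)
  qed simp
qed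

text \<open>Degenerate laws are included: variance \<open>0\<close> singles out the point masses.\<close>

lemma gaussian_law_eqI:
  assumes "gaussian_law \<nu>" "gaussian_law \<nu>'"
    and "(\<integral>x. x \<partial>\<nu>) = (\<integral>x. x \<partial>\<nu>')" "(\<integral>x. x\<^sup>2 \<partial>\<nu>) = (\<integral>x. x\<^sup>2 \<partial>\<nu>')"
  shows "\<nu> = \<nu>'"
proof -
  obtain m v where 1: "(\<integral>x. x \<partial>\<nu>) = m" "(\<integral>x. x\<^sup>2 \<partial>\<nu>) = v + m\<^sup>2"
    "\<nu> = (if v = 0 then return borel m else density lborel (\<lambda>t. ennreal (normal_density m (sqrt v) t)))"
    using gaussian_law_moments[OF assms(1)] by metis
  obtain m' v' where 2: "(\<integral>x. x \<partial>\<nu>') = m'" "(\<integral>x. x\<^sup>2 \<partial>\<nu>') = v' + m'\<^sup>2"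
    "\<nu>' = (if v' = 0 then return borel m' else density lborel (\<lambda>t. ennreal (normal_density m' (sqrt v') t)))"
    using gaussian_law_moments[OF assms(2)] by metis
  have "m = m'" "v = v'" using 1 2 assms(3,4) by auto
  then show ?thesis using 1(3) 2(3) by simp
qed

lemma bridge_eval_measurable:
  assumes "brownian_bridge P F N G" "f \<in> F"
  shows "(\<lambda>\<omega>. G \<omega> f) \<in> borel_measurable N"
proof -
  have "G \<in> N \<rightarrow>\<^sub>M linf_borel F" using assms by (simp add: brownian_bridge_def)
  from measurable_compose[OF this continuous_map_linf_measurable[OF continuous_map_linf_eval[OF assms(2)]]]
  show ?thesis .
qed

lemma bridge_linear_combination:
  fixes c :: "('a \<Rightarrow> real) \<Rightarrow> real"
  assumes G: "brownian_bridge P F N G" and S: "finite S" "S \<subseteq> F"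
  defines "L \<equiv> (\<lambda>\<omega>. \<Sum>f\<in>S. c f * G \<omega> f)"
  shows "L \<in> borel_measurable N" "gaussian_law (distr N borel L)"
    "(\<integral>x. x \<partial>distr N borel L) = 0"
    "(\<integral>x. x\<^sup>2 \<partial>distr N borel L) = (\<Sum>f\<in>S. \<Sum>g\<in>S. c f * c g *
        ((\<integral>y. f y * g y \<partial>P) - (\<integral>y. f y \<partial>P) * (\<integral>y. g y \<partial>P)))"
proof -
  have meas: "(\<lambda>\<omega>. G \<omega> f) \<in> borel_measurable N" if "f \<in> F" for f
    using bridge_eval_measurable[OF G that] .
  have m [measurable]: "L \<in> borel_measurable N"
    unfolding L_def using S meas by (intro borel_measurable_sum) auto
  then show "L \<in> borel_measurable N" .
  have gp: "gaussian_process F N G" using G by (simp add: brownian_bridge_def)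
  then show "gaussian_law (distr N borel L)" using S by (simp add: gaussian_process_def L_def)
  have int: "integrable N (\<lambda>\<omega>. G \<omega> f)" "integrable N (\<lambda>\<omega>. (G \<omega> f)\<^sup>2)" if f: "f \<in> F" for f
  proof -
    note [measurable] = meas[OF f]
    have "gaussian_law (distr N borel (\<lambda>\<omega>. \<Sum>f\<in>{f}. 1 * G \<omega> f))"
      using gp[unfolded gaussian_process_def, rule_format, of "{f}" "\<lambda>_. 1"] f by simp
    then have "gaussian_law (distr N borel (\<lambda>\<omega>. G \<omega> f))" by simp
    then obtain m v where "integrable (distr N borel (\<lambda>\<omega>. G \<omega> f)) (\<lambda>x. x)"
      "integrable (distr N borel (\<lambda>\<omega>. G \<omega> f)) (\<lambda>x. x\<^sup>2)" by (rule gaussian_law_moments)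
    then show "integrable N (\<lambda>\<omega>. G \<omega> f)" "integrable N (\<lambda>\<omega>. (G \<omega> f)\<^sup>2)"
      by (simp_all add: integrable_distr_eq)
  qed
  have prod: "integrable N (\<lambda>\<omega>. G \<omega> f * G \<omega> g)" if "f \<in> F" "g \<in> F" for f g
  proof (rule Bochner_Integration.integrable_bound)
    show "integrable N (\<lambda>\<omega>. (G \<omega> f)\<^sup>2 + (G \<omega> g)\<^sup>2)" using int that by simp
    show "(\<lambda>\<omega>. G \<omega> f * G \<omega> g) \<in> borel_measurable N" using meas that by simp
    have "\<bar>x * y\<bar> \<le> x\<^sup>2 + y\<^sup>2" for x y :: real
    proof -
      have "0 \<le> (\<bar>x\<bar> - \<bar>y\<bar>)\<^sup>2" by simp
      then have "2 * \<bar>x * y\<bar> \<le> x\<^sup>2 + y\<^sup>2" by (simp add: power2_diff abs_mult)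
      then show ?thesis by (smt (verit) abs_ge_zero)
    qed
    then show "AE \<omega> in N. norm (G \<omega> f * G \<omega> g) \<le> norm ((G \<omega> f)\<^sup>2 + (G \<omega> g)\<^sup>2)"
      by (intro AE_I2) (metis abs_of_nonneg real_norm_def sum_power2_ge_zero)
  qed
  have mean: "(\<integral>\<omega>. G \<omega> f \<partial>N) = 0" if "f \<in> F" for f using G that by (simp add: brownian_bridge_def)
  have cov: "(\<integral>\<omega>. G \<omega> f * G \<omega> g \<partial>N) = (\<integral>y. f y * g y \<partial>P) - (\<integral>y. f y \<partial>P) * (\<integral>y. g y \<partial>P)"
    if "f \<in> F" "g \<in> F" for f g using G that by (simp add: brownian_bridge_def)
  have "(\<integral>x. x \<partial>distr N borel L) = (\<integral>\<omega>. L \<omega> \<partial>N)" by (rule integral_distr) measurable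
  also have "\<dots> = (\<Sum>f\<in>S. c f * (\<integral>\<omega>. G \<omega> f \<partial>N))"
    unfolding L_def using int S by (subst Bochner_Integration.integral_sum) auto
  also have "\<dots> = 0" using mean S by (intro sum.neutral) auto
  finally show "(\<integral>x. x \<partial>distr N borel L) = 0" .
  have "(\<integral>x. x\<^sup>2 \<partial>distr N borel L) = (\<integral>\<omega>. (L \<omega>)\<^sup>2 \<partial>N)" by (rule integral_distr) measurable
  also have "\<dots> = (\<integral>\<omega>. (\<Sum>f\<in>S. \<Sum>g\<in>S. c f * c g * (G \<omega> f * G \<omega> g)) \<partial>N)"
    unfolding L_def power2_eq_square sum_product
    by (intro Bochner_Integration.integral_cong refl sum.cong) (simp add: mult_ac)
  also have "\<dots> = (\<Sum>f\<in>S. \<Sum>g\<in>S. c f * c g * (\<integral>\<omega>. G \<omega> f * G \<omega> g \<partial>N))"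
    using prod S by (subst Bochner_Integration.integral_sum) (auto intro!: sum.cong Bochner_Integration.integrable_sum simp: Bochner_Integration.integral_sum subset_eq)
  also have "\<dots> = (\<Sum>f\<in>S. \<Sum>g\<in>S. c f * c g * ((\<integral>y. f y * g y \<partial>P) - (\<integral>y. f y \<partial>P) * (\<integral>y. g y \<partial>P)))"
    using S by (intro sum.cong refl) (simp add: cov subset_eq)
  finally show "(\<integral>x. x\<^sup>2 \<partial>distr N borel L) = (\<Sum>f\<in>S. \<Sum>g\<in>S. c f * c g *
        ((\<integral>y. f y * g y \<partial>P) - (\<integral>y. f y \<partial>P) * (\<integral>y. g y \<partial>P)))" .
qed

lemma measurable_bridge_PiM:
  assumes "brownian_bridge P F N G"
  shows "G \<in> N \<rightarrow>\<^sub>M (\<Pi>\<^sub>M f\<in>F. borel)"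
proof (rule measurable_PiM_single')
  show "(\<lambda>\<omega>. G \<omega> f) \<in> borel_measurable N" if "f \<in> F" for f by (rule bridge_eval_measurable[OF assms that])
  have "G \<in> N \<rightarrow>\<^sub>M linf_borel F" using assms by (simp add: brownian_bridge_def)
  from measurable_space[OF this] show "G \<in> space N \<rightarrow> (\<Pi>\<^sub>E f\<in>F. space borel)"
    by (auto simp: mem_linf PiE_def)
qed

text \<open>The Cramer-Wold device for arbitrarily many coordinates: laws of finite linear combinations determine the
  integrals of the functions \<open>cos (\<theta> + L)\<close> with \<open>L\<close> linear, and these are closed under products up to linear
  combinations. They generate the product \<open>\<sigma>\<close>-algebra because \<open>k * sin (x f / k)\<close> tends to \<open>x f\<close>.\<close>

lemma fidi_law_eqI:
  fixes \<mu> \<nu> :: "('f \<Rightarrow> real) measure"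
  assumes \<mu>: "prob_space \<mu>" and \<nu>: "prob_space \<nu>"
    and sets: "sets \<mu> = sets (\<Pi>\<^sub>M f\<in>F. borel)" "sets \<nu> = sets (\<Pi>\<^sub>M f\<in>F. borel)"
    and eq: "\<And>S c. finite S \<Longrightarrow> S \<subseteq> F \<Longrightarrow>
      distr \<mu> borel (\<lambda>x. \<Sum>f\<in>S. c f * x f) = distr \<nu> borel (\<lambda>x. \<Sum>f\<in>S. c f * x f)"
  shows "\<mu> = \<nu>"
proof -
  let ?B = "(\<Pi>\<^sub>M f\<in>F. borel) :: ('f \<Rightarrow> real) measure"
  define T where "T = {\<lambda>x::'f \<Rightarrow> real. cos (\<theta> + (\<Sum>f\<in>S. c f * x f)) | \<theta> S c. finite S \<and> S \<subseteq> F}"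
  have lin: "(\<lambda>x. \<Sum>f\<in>S. c f * x f) \<in> borel_measurable ?B" if "finite S" "S \<subseteq> F" for S and c :: "'f \<Rightarrow> real"
    using that by (intro borel_measurable_sum borel_measurable_times measurable_component_singleton borel_measurable_const) auto
  have meas: "t \<in> borel_measurable ?B" if t: "t \<in> T" for t
  proof -
    obtain \<theta> S c where t: "t = (\<lambda>x. cos (\<theta> + (\<Sum>f\<in>S. c f * x f)))" and S: "finite S" "S \<subseteq> F"
      using t by (auto simp: T_def)
    note [measurable] = lin[OF S, of c]
    show ?thesis unfolding t by measurable
  qed
  show ?thesis
  proof (rule prob_measure_eqI_mult_class[of \<mu> \<nu> ?B T, OF \<mu> \<nu> sets meas])
    show "\<exists>b. \<forall>x\<in>space ?B. \<bar>t x\<bar> \<le> b" if "t \<in> T" for t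
      using that by (intro exI[of _ 1]) (auto simp: T_def)
    show "(\<lambda>_. 1) \<in> T" unfolding T_def by (intro CollectI exI[of _ 0] exI[of _ "{}"]) simp
    show "integral\<^sup>L \<mu> t = integral\<^sup>L \<nu> t" if t: "t \<in> T" for t
    proof -
      obtain \<theta> S c where t: "t = (\<lambda>x. cos (\<theta> + (\<Sum>f\<in>S. c f * x f)))" and S: "finite S" "S \<subseteq> F"
        using t by (auto simp: T_def)
      have [measurable]: "(\<lambda>x. \<Sum>f\<in>S. c f * x f) \<in> borel_measurable \<mu>" "(\<lambda>x. \<Sum>f\<in>S. c f * x f) \<in> borel_measurable \<nu>"
        by (subst measurable_cong_sets[OF sets(1) refl] measurable_cong_sets[OF sets(2) refl], rule lin[OF S])+
      have "integral\<^sup>L \<mu> t = (\<integral>y. cos (\<theta> + y) \<partial>distr \<mu> borel (\<lambda>x. \<Sum>f\<in>S. c f * x f))"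
        unfolding t by (subst integral_distr) measurable
      also have "\<dots> = integral\<^sup>L \<nu> t"
        unfolding t eq[OF S] by (subst integral_distr) measurable
      finally show ?thesis .
    qed
    show "\<exists>c1 t1 c2 t2. t1 \<in> T \<and> t2 \<in> T \<and> (\<forall>x\<in>space ?B. s x * t x = c1 * t1 x + c2 * t2 x)"
      if s: "s \<in> T" and t: "t \<in> T" for s t
    proof -
      obtain \<theta> S c where s: "s = (\<lambda>x. cos (\<theta> + (\<Sum>f\<in>S. c f * x f)))" and S: "finite S" "S \<subseteq> F"
        using s by (auto simp: T_def)
      obtain \<theta>' S' c' where t: "t = (\<lambda>x. cos (\<theta>' + (\<Sum>f\<in>S'. c' f * x f)))" and S': "finite S'" "S' \<subseteq> F"
        using t by (auto simp: T_def)
      let ?c = "\<lambda>f. if f \<in> S then c f else 0" and ?c' = "\<lambda>f. if f \<in> S' then c' f else 0"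
      have e1: "(\<Sum>f\<in>S. c f * x f) = (\<Sum>f\<in>S \<union> S'. ?c f * x f)" for x
        using S S' by (intro sum.mono_neutral_cong_left) auto
      have e2: "(\<Sum>f\<in>S'. c' f * x f) = (\<Sum>f\<in>S \<union> S'. ?c' f * x f)" for x
        using S S' by (intro sum.mono_neutral_cong_left) auto
      have pl: "(\<Sum>f\<in>S \<union> S'. (?c f + ?c' f) * x f) = (\<Sum>f\<in>S. c f * x f) + (\<Sum>f\<in>S'. c' f * x f)" for x
        unfolding e1 e2 by (simp only: distrib_right sum.distrib)
      have mi: "(\<Sum>f\<in>S \<union> S'. (?c f - ?c' f) * x f) = (\<Sum>f\<in>S. c f * x f) - (\<Sum>f\<in>S'. c' f * x f)" for x
        unfolding e1 e2 by (simp only: left_diff_distrib sum_subtractf)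
      let ?t1 = "\<lambda>x. cos ((\<theta> + \<theta>') + (\<Sum>f\<in>S \<union> S'. (?c f + ?c' f) * x f))"
      let ?t2 = "\<lambda>x. cos ((\<theta> - \<theta>') + (\<Sum>f\<in>S \<union> S'. (?c f - ?c' f) * x f))"
      have "s x * t x = (1/2) * ?t1 x + (1/2) * ?t2 x" for x
      proof -
        have a: "\<theta> + \<theta>' + ((\<Sum>f\<in>S. c f * x f) + (\<Sum>f\<in>S'. c' f * x f)) = (\<theta> + (\<Sum>f\<in>S. c f * x f)) + (\<theta>' + (\<Sum>f\<in>S'. c' f * x f))"
          and b: "\<theta> - \<theta>' + ((\<Sum>f\<in>S. c f * x f) - (\<Sum>f\<in>S'. c' f * x f)) = (\<theta> + (\<Sum>f\<in>S. c f * x f)) - (\<theta>' + (\<Sum>f\<in>S'. c' f * x f))"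
          by simp_all
        have "cos A * cos B = (1/2) * cos (A + B) + (1/2) * cos (A - B)" for A B :: real
          by (simp add: cos_add cos_diff field_simps)
        then show ?thesis unfolding s t pl mi a b .
      qed
      moreover have "?t1 \<in> T" unfolding T_def
        by (intro CollectI exI[of _ "\<theta> + \<theta>'"] exI[of _ "S \<union> S'"] exI[of _ "\<lambda>f. ?c f + ?c' f"]) (use S S' in auto)
      moreover have "?t2 \<in> T" unfolding T_def
        by (intro CollectI exI[of _ "\<theta> - \<theta>'"] exI[of _ "S \<union> S'"] exI[of _ "\<lambda>f. ?c f - ?c' f"]) (use S S' in auto)
      ultimately show ?thesis by blast
    qed
    define \<Sigma> where "\<Sigma> = sigma (space ?B) {t -` {..c} \<inter> space ?B | t c. t \<in> T}"
    have sp: "space \<Sigma> = space ?B" unfolding \<Sigma>_def by (rule space_measure_of) auto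
    have se: "sets \<Sigma> = sigma_sets (space ?B) {t -` {..c} \<inter> space ?B | t c. t \<in> T}"
      unfolding \<Sigma>_def by (rule sets_measure_of) auto
    have tm: "t \<in> borel_measurable \<Sigma>" if t: "t \<in> T" for t
    proof -
      have "t -` {..c} \<inter> space ?B \<in> sets \<Sigma>" for c unfolding se using t by auto
      moreover have "{x \<in> space \<Sigma>. t x \<le> c} = t -` {..c} \<inter> space ?B" for c by (auto simp: sp)
      ultimately show ?thesis unfolding borel_measurable_iff_le by simp
    qed
    have coord: "(\<lambda>x. x f) \<in> borel_measurable \<Sigma>" if f: "f \<in> F" for f
    proof (rule borel_measurable_LIMSEQ_real)
      show "(\<lambda>k. real (Suc k) * sin (x f / real (Suc k))) \<longlonglongrightarrow> x f" for x
      proof -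
        have "((\<lambda>t. sin (x f * t)) has_real_derivative x f) (at 0)"
          by (auto intro!: derivative_eq_intros)
        then have "((\<lambda>h. sin (x f * h) / h) \<longlongrightarrow> x f) (at 0)"
          by (simp add: has_field_derivative_iff)
        moreover have "filterlim (\<lambda>k. 1 / real (Suc k)) (at 0) sequentially"
          by (rule filterlim_atI) (use LIMSEQ_Suc[OF lim_1_over_n[where 'a=real]] in \<open>auto simp del: of_nat_Suc\<close>)
        ultimately have "(\<lambda>k. sin (x f * (1 / real (Suc k))) / (1 / real (Suc k))) \<longlonglongrightarrow> x f"
          by (rule filterlim_compose)
        then show ?thesis by (simp add: mult.commute)
      qed
      show "(\<lambda>x. real (Suc k) * sin (x f / real (Suc k))) \<in> borel_measurable \<Sigma>" for k
      proof -
        have "(\<lambda>x. cos (- (pi/2) + (\<Sum>g\<in>{f}. (1 / real (Suc k)) * x g))) \<in> T"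
          unfolding T_def
          by (intro CollectI exI[of _ "-(pi/2)"] exI[of _ "{f}"] exI[of _ "\<lambda>_. 1 / real (Suc k)"]) (use f in auto)
        from tm[OF this] have "(\<lambda>x. cos (- (pi/2) + (\<Sum>g\<in>{f}. (1 / real (Suc k)) * x g))) \<in> borel_measurable \<Sigma>" .
        moreover have "cos (- (pi/2) + (\<Sum>g\<in>{f}. (1 / real (Suc k)) * x g)) = sin (x f / real (Suc k))" for x :: "'f \<Rightarrow> real"
        proof -
          have y: "cos (- (pi/2) + y) = sin y" for y :: real unfolding cos_add by simp
          show ?thesis unfolding y by simp
        qed
        ultimately show ?thesis by simp
      qed
    qed
    have id: "(\<lambda>x. x) \<in> \<Sigma> \<rightarrow>\<^sub>M ?B"
      by (rule measurable_PiM_single') (use coord in \<open>auto simp: sp space_PiM\<close>)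
    show "sets ?B \<subseteq> sigma_sets (space ?B) {t -` {..c} \<inter> space ?B | t c. t \<in> T}"
    proof
      fix A assume A: "A \<in> sets ?B"
      have "(\<lambda>x. x) -` A \<inter> space \<Sigma> \<in> sets \<Sigma>" by (rule measurable_sets[OF id A])
      moreover have "(\<lambda>x. x) -` A \<inter> space \<Sigma> = A" using sets.sets_into_space[OF A] by (auto simp: sp)
      ultimately show "A \<in> sigma_sets (space ?B) {t -` {..c} \<inter> space ?B | t c. t \<in> T}" using se by simp
    qed
  qed
qed

lemma bridge_fidi_law_unique:
  assumes G: "brownian_bridge P F N G" and G': "brownian_bridge P F N' G'"
  shows "distr N (\<Pi>\<^sub>M f\<in>F. borel) G = distr N' (\<Pi>\<^sub>M f\<in>F. borel) G'"
proof -
  interpret N: prob_space N using G by (simp add: brownian_bridge_def)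
  interpret N': prob_space N' using G' by (simp add: brownian_bridge_def)
  note mG = measurable_bridge_PiM[OF G] note mG' = measurable_bridge_PiM[OF G']
  show ?thesis
  proof (rule fidi_law_eqI[where F=F])
    show "prob_space (distr N (\<Pi>\<^sub>M f\<in>F. borel) G)" by (rule N.prob_space_distr[OF mG])
    show "prob_space (distr N' (\<Pi>\<^sub>M f\<in>F. borel) G')" by (rule N'.prob_space_distr[OF mG'])
    fix S and c :: "('a \<Rightarrow> real) \<Rightarrow> real" assume S: "finite S" "S \<subseteq> F"
    have lin: "(\<lambda>x. \<Sum>f\<in>S. c f * x f) \<in> borel_measurable (\<Pi>\<^sub>M f\<in>F. borel)"
      using S by (intro borel_measurable_sum borel_measurable_times measurable_component_singleton borel_measurable_const) auto
    have "distr N borel (\<lambda>\<omega>. \<Sum>f\<in>S. c f * G \<omega> f) = distr N' borel (\<lambda>\<omega>. \<Sum>f\<in>S. c f * G' \<omega> f)"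
      by (rule gaussian_law_eqI)
         (simp_all only: bridge_linear_combination[OF G S] bridge_linear_combination[OF G' S])
    then show "distr (distr N (\<Pi>\<^sub>M f\<in>F. borel) G) borel (\<lambda>x. \<Sum>f\<in>S. c f * x f) =
        distr (distr N' (\<Pi>\<^sub>M f\<in>F. borel) G') borel (\<lambda>x. \<Sum>f\<in>S. c f * x f)"
      using distr_distr[OF lin mG] distr_distr[OF lin mG'] by (simp add: o_def)
  qed simp_all
qed

text \<open>On a set that is compact for the supremum metric, that topology agrees with pointwise convergence, as a continuous bijection from
  a compact space to a Hausdorff space is a homeomorphism. Outside of
  \<open>F\<close> all these functions have the value \<open>undefined\<close>, so these coordinates do no harm.\<close>

lemma compact_linf_pointwise:
  assumes K: "compactin (mtopology_of (linf F)) K"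
    and h: "continuous_map (mtopology_of (linf F)) euclideanreal h"
  shows "compact K" "continuous_on K h"
proof -
  let ?X = "subtopology (mtopology_of (linf F)) K"
  let ?Y = "subtopology (euclidean :: ('a \<Rightarrow> real) topology) K"
  have KF: "K \<subseteq> mspace (linf F)" using compactin_subset_topspace[OF K] by simp
  have tX: "topspace ?X = K" using KF by auto
  have ev: "continuous_map ?X euclideanreal (\<lambda>\<psi>. \<psi> k)" for k
  proof (cases "k \<in> F")
    case True then show ?thesis by (intro continuous_map_from_subtopology continuous_map_linf_eval)
  next
    case False
    have "continuous_map ?X euclideanreal (\<lambda>\<psi>. undefined)" by simp
    then show ?thesis
    proof (rule continuous_map_eq)
      fix \<psi> assume "\<psi> \<in> topspace ?X"
      then have "\<psi> \<in> extensional F" using KF tX by (auto simp: mem_linf)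
      then show "undefined = \<psi> k" by (rule extensional_arb[OF _ False, symmetric])
    qed
  qed
  have "continuous_map ?X (product_topology (\<lambda>_. euclideanreal) UNIV) (\<lambda>\<psi>. \<psi>)"
    using ev by (simp add: continuous_map_componentwise_UNIV)
  then have c1: "continuous_map ?X euclidean (\<lambda>\<psi>. \<psi>)" by (simp add: euclidean_product_topology)
  then have c: "continuous_map ?X ?Y (\<lambda>\<psi>. \<psi>)"
    by (intro continuous_map_into_subtopology) (auto simp: tX)
  have cX: "compact_space ?X" using K by (simp add: compact_space_subtopology)
  have "compactin ?X K" using K by simp
  from image_compactin[OF this c1] show "compact K" by simp
  have hd: "Hausdorff_space (euclidean :: ('a \<Rightarrow> real) topology)"
    unfolding Hausdorff_space_def disjnt_def using hausdorff by (simp add: open_openin[symmetric]) blast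
  have "homeomorphic_map ?X ?Y (\<lambda>\<psi>. \<psi>)"
    by (rule continuous_imp_homeomorphic_map[OF c cX Hausdorff_space_subtopology[OF hd]])
       (simp_all add: tX del: topspace_subtopology)
  then obtain g where g: "homeomorphic_maps ?X ?Y (\<lambda>\<psi>. \<psi>) g" using homeomorphic_map_maps by blast
  then have cg: "continuous_map ?Y ?X g" and gi: "\<And>\<psi>. \<psi> \<in> K \<Longrightarrow> g \<psi> = \<psi>"
    unfolding homeomorphic_maps_def using tX by auto
  have "continuous_map ?Y euclideanreal (h \<circ> g)"
    by (rule continuous_map_compose[OF cg continuous_map_from_subtopology[OF h]])
  then have "continuous_map ?Y euclideanreal h" by (rule continuous_map_eq) (simp add: gi)
  then show "continuous_on K h" by simp
qed

lemma bridge_expectation_approx: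
  assumes G: "brownian_bridge P F N G" and hm: "h \<in> borel_measurable (linf_borel F)"
    and b: "\<And>\<psi>. \<psi> \<in> mspace (linf F) \<Longrightarrow> \<bar>h \<psi>\<bar> \<le> b"
    and q: "q \<in> borel_measurable (\<Pi>\<^sub>M f\<in>F. borel)"
    and qK: "\<And>\<psi>. \<psi> \<in> K \<Longrightarrow> \<bar>h \<psi> - q \<psi>\<bar> \<le> \<epsilon>" and qb: "\<And>\<psi>. \<bar>q \<psi>\<bar> \<le> b" and \<epsilon>: "\<epsilon> > 0"
    and K: "compactin (mtopology_of (linf F)) K" and KN: "1 - \<delta> \<le> measure N {\<omega>\<in>space N. G \<omega> \<in> K}"
  shows "\<bar>(\<integral>\<omega>. h (G \<omega>) \<partial>N) - (\<integral>\<omega>. q (G \<omega>) \<partial>N)\<bar> \<le> \<epsilon> + 2 * b * \<delta>"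
proof -
  have b_nonneg: "b \<ge> 0" using qb[of undefined] by linarith
  interpret N: prob_space N using G by (simp add: brownian_bridge_def)
  have Gm [measurable]: "G \<in> N \<rightarrow>\<^sub>M linf_borel F" using G by (simp add: brownian_bridge_def)
  have Gs: "G \<omega> \<in> mspace (linf F)" if "\<omega> \<in> space N" for \<omega> using measurable_space[OF Gm that] by simp
  note [measurable] = measurable_compose[OF Gm hm] measurable_compose[OF measurable_bridge_PiM[OF G] q]
  have "closedin (mtopology_of (linf F)) K"
    by (rule compactin_imp_closedin[OF _ K]) (simp add: mtopology_of_def Metric_space.Hausdorff_space_mtopology)
  then have Ks: "K \<in> sets (linf_borel F)" by (rule closed_in_linf_borel)
  have [measurable]: "{\<omega>\<in>space N. G \<omega> \<in> K} \<in> sets N"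
    using measurable_sets[OF Gm Ks] by (simp add: vimage_def Int_def conj_commute)
  have ih: "integrable N (\<lambda>\<omega>. h (G \<omega>))"
    by (rule N.integrable_const_bound[of _ b]) (auto intro!: AE_I2 b Gs)
  have iq: "integrable N (\<lambda>\<omega>. q (G \<omega>))"
    by (rule N.integrable_const_bound[of _ b]) (auto intro!: AE_I2 qb)
  let ?A = "{\<omega>\<in>space N. \<not> G \<omega> \<in> K}"
  have A: "?A = space N - {\<omega>\<in>space N. G \<omega> \<in> K}" by auto
  have As [measurable]: "?A \<in> sets N" unfolding A by measurable
  have ii: "integrable N (indicat_real ?A)"
    by (rule integrable_real_indicator[OF As]) (simp add: N.emeasure_eq_measure)
  have mA: "measure N ?A \<le> \<delta>" unfolding A using N.prob_compl[of "{\<omega>\<in>space N. G \<omega> \<in> K}"] KN by simp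
  have "\<bar>(\<integral>\<omega>. h (G \<omega>) \<partial>N) - (\<integral>\<omega>. q (G \<omega>) \<partial>N)\<bar> = \<bar>\<integral>\<omega>. h (G \<omega>) - q (G \<omega>) \<partial>N\<bar>"
    using ih iq by simp
  also have "\<dots> \<le> (\<integral>\<omega>. \<bar>h (G \<omega>) - q (G \<omega>)\<bar> \<partial>N)" by (rule integral_abs_bound)
  also have "\<dots> \<le> (\<integral>\<omega>. \<epsilon> + 2 * b * indicator ?A \<omega> \<partial>N)"
  proof (rule integral_mono)
    show "integrable N (\<lambda>\<omega>. \<bar>h (G \<omega>) - q (G \<omega>)\<bar>)" using ih iq by simp
    show "integrable N (\<lambda>\<omega>. \<epsilon> + 2 * b * indicator ?A \<omega>)" by (intro Bochner_Integration.integrable_add integrable_mult_right ii) simp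
    fix \<omega> assume \<omega>: "\<omega> \<in> space N"
    show "\<bar>h (G \<omega>) - q (G \<omega>)\<bar> \<le> \<epsilon> + 2 * b * indicator ?A \<omega>"
    proof (cases "G \<omega> \<in> K")
      case True with qK[OF True] show ?thesis by simp
    next
      case False
      with b[OF Gs[OF \<omega>]] qb[of "G \<omega>"] \<epsilon> \<omega> show ?thesis by simp
    qed
  qed
  also have "\<dots> = (\<integral>\<omega>. \<epsilon> \<partial>N) + (\<integral>\<omega>. 2 * b * indicator ?A \<omega> \<partial>N)"
    by (rule Bochner_Integration.integral_add[OF _ integrable_mult_right[OF ii]]) simp
  also have "\<dots> = \<epsilon> + 2 * b * measure N ?A"
    using sets.sets_into_space[OF As] by (simp only: integral_mult_right_zero integral_indicator Int_absorb2) (simp add: N.prob_space)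
  also have "\<dots> \<le> \<epsilon> + 2 * b * \<delta>" using mA b_nonneg by (intro add_left_mono mult_left_mono) auto
  finally show ?thesis .
qed

text \<open>The Borel \<open>\<sigma>\<close>-algebra of the supremum metric may be larger than the one generated by the coordinates, on which the
  two laws agree. Tightness bridges the gap: up to a small probability both processes stay in a compact set, where by Stone and
  Weierstrass a continuous function is a uniform limit of continuous functions that are measurable for the coordinates.\<close>

lemma bridge_expectation_unique:
  fixes P :: "'a measure"
  assumes G: "brownian_bridge P F N G" and G': "brownian_bridge P F N' G'"
    and h: "continuous_map (mtopology_of (linf F)) euclideanreal h" "bounded (h ` mspace (linf F))"
  shows "(\<integral>\<omega>. h (G \<omega>) \<partial>N) = (\<integral>\<omega>. h (G' \<omega>) \<partial>N')"
proof -
  let ?B = "(\<Pi>\<^sub>M f\<in>F. borel) :: (('a \<Rightarrow> real) \<Rightarrow> real) measure"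
  obtain b0 where b0: "\<forall>\<psi>\<in>mspace (linf F). \<bar>h \<psi>\<bar> \<le> b0" using h(2) unfolding bounded_iff by (metis image_eqI real_norm_def)
  define b where "b = max b0 0"
  have b: "\<bar>h \<psi>\<bar> \<le> b" if "\<psi> \<in> mspace (linf F)" for \<psi> using b0 that by (auto simp: b_def le_max_iff_disj)
  have b_nonneg: "b \<ge> 0" by (simp add: b_def)
  have hm: "h \<in> borel_measurable (linf_borel F)" by (rule continuous_map_linf_measurable[OF h(1)])
  have "\<bar>(\<integral>\<omega>. h (G \<omega>) \<partial>N) - (\<integral>\<omega>. h (G' \<omega>) \<partial>N')\<bar> \<le> \<epsilon>" if "\<epsilon> > 0" for \<epsilon>
  proof -
    define \<eta> where "\<eta> = \<epsilon> / 4"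
    define \<delta> where "\<delta> = \<eta> / (2 * b + 1)"
    have \<eta>: "\<eta> > 0" using that by (simp add: \<eta>_def)
    have \<delta>: "\<delta> > 0" "2 * b * \<delta> \<le> \<eta>" using \<eta> b_nonneg by (auto simp: \<delta>_def field_simps)
    obtain K1 where K1: "compactin (mtopology_of (linf F)) K1" "1 - \<delta> \<le> measure N {\<omega>\<in>space N. G \<omega> \<in> K1}"
      using G \<delta>(1) unfolding brownian_bridge_def tight_linf_def by blast
    obtain K2 where K2: "compactin (mtopology_of (linf F)) K2" "1 - \<delta> \<le> measure N' {\<omega>\<in>space N'. G' \<omega> \<in> K2}"
      using G' \<delta>(1) unfolding brownian_bridge_def tight_linf_def by blast
    define K where "K = K1 \<union> K2"
    have K: "compactin (mtopology_of (linf F)) K" unfolding K_def by (rule compactin_Un[OF K1(1) K2(1)])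
    note cK = compact_linf_pointwise[OF K h(1)]
    have KF: "K \<subseteq> mspace (linf F)" using compactin_subset_topspace[OF K] by simp
    let ?R = "{q :: (('a \<Rightarrow> real) \<Rightarrow> real) \<Rightarrow> real. q \<in> borel_measurable ?B \<and> continuous_on K q}"
    interpret R: function_ring_on ?R K
    proof
      fix \<psi> \<phi> assume K: "\<psi> \<in> K" "\<phi> \<in> K" "\<psi> \<noteq> \<phi>"
      then have "\<psi> \<in> extensional F" "\<phi> \<in> extensional F" using KF by (auto simp: mem_linf)
      then obtain f where f: "f \<in> F" "\<psi> f \<noteq> \<phi> f" using K(3) extensionalityI by blast
      have "(\<lambda>\<psi>. \<psi> f) \<in> borel_measurable ?B" using f by simp
      moreover have "continuous_on K (\<lambda>\<psi>. \<psi> f)"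
        by (rule continuous_on_subset[OF continuous_on_product_coordinates]) simp
      ultimately have "(\<lambda>\<psi>. \<psi> f) \<in> ?R" by simp
      then show "\<exists>q\<in>?R. q \<psi> \<noteq> q \<phi>"
        by (rule bexI[rotated]) (rule f(2))
    qed (auto intro!: cK continuous_intros)
    from R.Stone_Weierstrass_basic[OF cK(2) \<eta>] obtain q0
      where q0': "q0 \<in> ?R" "\<forall>\<psi>\<in>K. \<bar>h \<psi> - q0 \<psi>\<bar> < \<eta>" ..
    then have q0: "q0 \<in> borel_measurable ?B" "\<And>\<psi>. \<psi> \<in> K \<Longrightarrow> \<bar>h \<psi> - q0 \<psi>\<bar> < \<eta>" by simp_all
    \<comment> \<open>The approximation is good only on \<open>K\<close>; clipping bounds it elsewhere and does not spoil it on \<open>K\<close>.\<close>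
    define q where "q \<psi> = max (-b) (min b (q0 \<psi>))" for \<psi>
    have q: "q \<in> borel_measurable ?B" unfolding q_def using q0(1) by simp
    have qb: "\<bar>q \<psi>\<bar> \<le> b" for \<psi> using b_nonneg by (auto simp: q_def)
    have qK: "\<bar>h \<psi> - q \<psi>\<bar> \<le> \<eta>" if "\<psi> \<in> K" for \<psi>
      using q0(2)[OF that] b[of \<psi>] KF that by (auto simp: q_def max_def min_def abs_le_iff)
    have 1: "\<bar>(\<integral>\<omega>. h (G \<omega>) \<partial>N) - (\<integral>\<omega>. q (G \<omega>) \<partial>N)\<bar> \<le> \<eta> + 2 * b * \<delta>"
      using bridge_expectation_approx[OF G hm b q qK qb \<eta> K1] by (auto simp: K_def)
    have 2: "\<bar>(\<integral>\<omega>. h (G' \<omega>) \<partial>N') - (\<integral>\<omega>. q (G' \<omega>) \<partial>N')\<bar> \<le> \<eta> + 2 * b * \<delta>"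
      using bridge_expectation_approx[OF G' hm b q qK qb \<eta> K2] by (auto simp: K_def)
    have "(\<integral>\<omega>. q (G \<omega>) \<partial>N) = (\<integral>\<psi>. q \<psi> \<partial>distr N ?B G)"
      by (rule integral_distr[symmetric, OF measurable_bridge_PiM[OF G] q])
    also have "\<dots> = (\<integral>\<omega>. q (G' \<omega>) \<partial>N')"
      unfolding bridge_fidi_law_unique[OF G G'] by (rule integral_distr[OF measurable_bridge_PiM[OF G'] q])
    finally show ?thesis using 1 2 \<delta>(2) by (simp add: \<eta>_def)
  qed
  then have "\<bar>(\<integral>\<omega>. h (G \<omega>) \<partial>N) - (\<integral>\<omega>. h (G' \<omega>) \<partial>N')\<bar> \<le> 0" by (rule field_le_epsilon[of _ 0, simplified])
  then show ?thesis by simp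
qed

section \<open>Construction of the Brownian bridge\<close>

text \<open>The centred normal law with variance \<open>v\<close>, written as an image so that \<open>v = 0\<close> is no special case.\<close>

definition gauss_law :: "real \<Rightarrow> real measure" where
  "gauss_law v = distr std_normal_distribution borel (\<lambda>x. sqrt v * x)"

interpretation std_normal: real_distribution std_normal_distribution
  by (rule real_dist_normal_dist)

lemma std_normal_moments:
  "integrable std_normal_distribution (\<lambda>x. x)" "(\<integral>x. x \<partial>std_normal_distribution) = 0"
  "integrable std_normal_distribution (\<lambda>x. x\<^sup>2)" "(\<integral>x. x\<^sup>2 \<partial>std_normal_distribution) = 1"
  using integrable_std_normal_moment[of 1] integral_std_normal_moment_odd[of 0]
    integrable_std_normal_moment[of 2] integral_std_normal_moment_even[of 1]
  by (simp_all add: integrable_density integral_density)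

lemma real_distribution_gauss_law: "real_distribution (gauss_law v)"
  unfolding gauss_law_def by (rule std_normal.real_distribution_distr) measurable

lemma char_gauss_law:
  assumes "v \<ge> 0" shows "char (gauss_law v) t = complex_of_real (exp (- (v * t\<^sup>2) / 2))"
proof -
  have "char (gauss_law v) t = (CLINT x|std_normal_distribution. iexp (t * (sqrt v * x)))"
    unfolding char_def gauss_law_def by (rule integral_distr) measurable
  also have "\<dots> = char std_normal_distribution (t * sqrt v)"
    unfolding char_def by (simp add: mult.assoc)
  also have "\<dots> = complex_of_real (exp (- ((t * sqrt v)\<^sup>2) / 2))"
    by (simp add: char_std_normal_distribution)
  also have "(t * sqrt v)\<^sup>2 = v * t\<^sup>2" using assms by (simp add: power_mult_distrib)
  finally show ?thesis .
qed

lemma gauss_law_moments: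
  assumes "v \<ge> 0"
  shows "integrable (gauss_law v) (\<lambda>x. x)" "(\<integral>x. x \<partial>gauss_law v) = 0"
    "integrable (gauss_law v) (\<lambda>x. x\<^sup>2)" "(\<integral>x. x\<^sup>2 \<partial>gauss_law v) = v"
proof -
  have m [measurable]: "(\<lambda>x. sqrt v * x) \<in> borel_measurable std_normal_distribution" by measurable
  have sq: "(sqrt v * x)\<^sup>2 = v * x\<^sup>2" for x using assms by (simp add: power_mult_distrib)
  have i2: "integrable std_normal_distribution (\<lambda>x. (sqrt v * x)\<^sup>2)"
    unfolding sq by (rule integrable_mult_right[OF std_normal_moments(3)])
  show "integrable (gauss_law v) (\<lambda>x. x)"
    unfolding gauss_law_def
    by (rule integrable_distr_eq[OF m, THEN iffD2, OF _ integrable_mult_right[OF std_normal_moments(1)]]) simp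
  show "integrable (gauss_law v) (\<lambda>x. x\<^sup>2)"
    unfolding gauss_law_def
    by (rule integrable_distr_eq[OF m, THEN iffD2, OF _ i2]) simp
  have "(\<integral>x. x \<partial>gauss_law v) = (\<integral>x. sqrt v * x \<partial>std_normal_distribution)"
    unfolding gauss_law_def by (rule integral_distr[OF m]) simp
  then show "(\<integral>x. x \<partial>gauss_law v) = 0" by (simp only: integral_mult_right_zero std_normal_moments(2) mult_zero_right)
  have "(\<integral>x. x\<^sup>2 \<partial>gauss_law v) = (\<integral>x. (sqrt v * x)\<^sup>2 \<partial>std_normal_distribution)"
    unfolding gauss_law_def by (rule integral_distr[OF m]) simp
  then show "(\<integral>x. x\<^sup>2 \<partial>gauss_law v) = v" by (simp only: sq integral_mult_right_zero std_normal_moments(4) mult_1_right)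
qed

lemma gaussian_law_gauss_law:
  assumes "v \<ge> 0" shows "gaussian_law (gauss_law v)"
proof (cases "v = 0")
  case True
  have "gauss_law v = return borel 0"
  proof -
    have "(\<lambda>x::real. sqrt 0 * x) = (\<lambda>_. 0)" by auto
    then show ?thesis unfolding gauss_law_def True by (simp only: std_normal.distr_const space_borel UNIV_I)
  qed
  then show ?thesis unfolding gaussian_law_def by blast
next
  case False
  have d: "distributed std_normal_distribution lborel (\<lambda>x. x) std_normal_density"
    unfolding distributed_def by (auto intro!: distr_id2)
  have "distributed std_normal_distribution lborel (\<lambda>x. 0 + sqrt v * x) (normal_density (0 + sqrt v * 0) (\<bar>sqrt v\<bar> * 1))"
    by (rule std_normal.normal_density_affine[OF d]) (use False in auto)
  then have "distr std_normal_distribution lborel (\<lambda>x. sqrt v * x) = density lborel (normal_density 0 (sqrt v))"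
    using assms by (simp add: distributed_def)
  moreover have "distr std_normal_distribution lborel (\<lambda>x. sqrt v * x) = gauss_law v"
    unfolding gauss_law_def by (rule distr_cong) auto
  ultimately have "gauss_law v = density lborel (\<lambda>t. ennreal (normal_density 0 (sqrt v) t))" by simp
  moreover have "0 < sqrt v" using assms False by simp
  ultimately show ?thesis unfolding gaussian_law_def by blast
qed

lemma distr_moments:
  fixes X :: "'w \<Rightarrow> real"
  assumes m: "X \<in> borel_measurable N"
  shows "(\<integral>x. x \<partial>distr N borel X) = (\<integral>\<omega>. X \<omega> \<partial>N)"
    "integrable (distr N borel X) (\<lambda>x. x\<^sup>2) \<longleftrightarrow> integrable N (\<lambda>\<omega>. (X \<omega>)\<^sup>2)"
    "(\<integral>x. x\<^sup>2 \<partial>distr N borel X) = (\<integral>\<omega>. (X \<omega>)\<^sup>2 \<partial>N)"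
  by (rule integral_distr[OF m] integrable_distr_eq[OF m], simp)+

lemma expectation_abs_le_sqrt_second_moment:
  assumes "prob_space N" and X: "integrable N (\<lambda>x. (X x)\<^sup>2)" "X \<in> borel_measurable N"
  shows "integrable N X" "(\<integral>x. \<bar>X x\<bar> \<partial>N) \<le> sqrt (\<integral>x. (X x)\<^sup>2 \<partial>N)"
proof -
  interpret prob_space N by fact
  show i: "integrable N X" by (rule square_integrable_imp_integrable[OF X(2,1)])
  have "(\<integral>x. \<bar>X x\<bar> \<partial>N)\<^sup>2 \<le> (\<integral>x. \<bar>X x\<bar>\<^sup>2 \<partial>N)"
  proof -
    have "0 \<le> variance (\<lambda>x. \<bar>X x\<bar>)" by (rule variance_positive)
    also have "variance (\<lambda>x. \<bar>X x\<bar>) = (\<integral>x. \<bar>X x\<bar>\<^sup>2 \<partial>N) - (\<integral>x. \<bar>X x\<bar> \<partial>N)\<^sup>2"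
      by (rule variance_eq) (use i X in auto)
    finally show ?thesis by simp
  qed
  then have "(\<integral>x. \<bar>X x\<bar> \<partial>N)\<^sup>2 \<le> (\<integral>x. (X x)\<^sup>2 \<partial>N)" by simp
  then show "(\<integral>x. \<bar>X x\<bar> \<partial>N) \<le> sqrt (\<integral>x. (X x)\<^sup>2 \<partial>N)" by (rule real_le_rsqrt)
qed

text \<open>Fubini's theorem for series, with the null set on which the series diverges made explicit.\<close>

lemma L1_series:
  fixes X :: "nat \<Rightarrow> 'w \<Rightarrow> real"
  assumes X: "\<And>i. integrable N (X i)" and s: "summable (\<lambda>i. \<integral>\<omega>. \<bar>X i \<omega>\<bar> \<partial>N)"
  shows "AE \<omega> in N. summable (\<lambda>i. \<bar>X i \<omega>\<bar>)"
    and "integrable N (\<lambda>\<omega>. \<Sum>i. \<bar>X i \<omega>\<bar>)" "(\<integral>\<omega>. (\<Sum>i. \<bar>X i \<omega>\<bar>) \<partial>N) = (\<Sum>i. \<integral>\<omega>. \<bar>X i \<omega>\<bar> \<partial>N)"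
proof -
  have [measurable]: "X i \<in> borel_measurable N" for i using X by (rule borel_measurable_integrable)
  have "(\<integral>\<^sup>+\<omega>. (\<Sum>i. ennreal \<bar>X i \<omega>\<bar>) \<partial>N) = (\<Sum>i. \<integral>\<^sup>+\<omega>. ennreal \<bar>X i \<omega>\<bar> \<partial>N)"
    by (rule nn_integral_suminf) measurable
  also have "\<dots> = (\<Sum>i. ennreal (\<integral>\<omega>. \<bar>X i \<omega>\<bar> \<partial>N))"
    by (intro suminf_cong nn_integral_eq_integral) (use X in auto)
  also have "\<dots> = ennreal (\<Sum>i. \<integral>\<omega>. \<bar>X i \<omega>\<bar> \<partial>N)" by (rule suminf_ennreal2[OF _ s]) simp
  finally have "(\<integral>\<^sup>+\<omega>. (\<Sum>i. ennreal \<bar>X i \<omega>\<bar>) \<partial>N) \<noteq> \<infinity>" by simp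
  then have "AE \<omega> in N. (\<Sum>i. ennreal \<bar>X i \<omega>\<bar>) \<noteq> \<infinity>" by (rule nn_integral_PInf_AE[rotated]) measurable
  then show ae: "AE \<omega> in N. summable (\<lambda>i. \<bar>X i \<omega>\<bar>)"
    by eventually_elim (auto intro: summable_suminf_not_top)
  have abs: "\<And>i. integrable N (\<lambda>\<omega>. \<bar>X i \<omega>\<bar>)" using X by simp
  show "integrable N (\<lambda>\<omega>. \<Sum>i. \<bar>X i \<omega>\<bar>)"
    by (rule integrable_suminf[OF abs]) (use ae s in auto)
  show "(\<integral>\<omega>. (\<Sum>i. \<bar>X i \<omega>\<bar>) \<partial>N) = (\<Sum>i. \<integral>\<omega>. \<bar>X i \<omega>\<bar> \<partial>N)"
    by (rule integral_suminf[OF abs]) (use ae s in auto)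
qed

lemma integral_countable:
  fixes f :: "'a \<Rightarrow> real"
  assumes "prob_space P" and sets: "sets P = UNIV" and e: "bij_betw e (UNIV :: nat set) UNIV"
    and f: "\<And>x. \<bar>f x\<bar> \<le> B"
  shows "(\<integral>x. f x \<partial>P) = (\<Sum>i. measure P {e i} * f (e i))"
    and "(\<lambda>i. measure P {e i}) sums 1"
proof -
  interpret P: prob_space P by fact
  have sp: "space P = UNIV" using sets sets.top[of P] sets.space_closed[of P] by (metis UNIV_I sets.sets_into_space subset_antisym top_greatest)
  have un: "(\<Union>i. {e i}) = UNIV" using e by (auto simp: bij_betw_def)
  have inj: "inj e" and surj: "surj e" using e by (auto simp: bij_betw_def)
  have "(\<lambda>i. measure P {e i}) sums measure P (\<Union>i. {e i})"
    by (rule P.finite_measure_UNION) (auto simp: sets disjoint_family_on_def dest: injD[OF inj])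
  then show s: "(\<lambda>i. measure P {e i}) sums 1" using P.prob_space by (simp add: un sp)
  have fin: "(\<lambda>i. f (e i) * indicator {e i} x) sums f x" for x
  proof -
    obtain j where j: "x = e j" using surjD[OF surj] by blast
    have "(\<lambda>i. f (e i) * indicator {e i} x) sums (\<Sum>i\<in>{j}. f (e i) * indicator {e i} x)"
      by (rule sums_finite) (auto simp: j inj_eq[OF inj])
    then show ?thesis by (simp add: j)
  qed
  have fin': "summable (\<lambda>i. norm (f (e i) * indicator {e i} x))" for x
  proof -
    obtain j where j: "x = e j" using surjD[OF surj] by blast
    show ?thesis by (rule summable_finite[of "{j}"]) (auto simp: j inj_eq[OF inj])
  qed
  have int: "integrable P (\<lambda>x. f (e i) * indicator {e i} x)" for i
    by (intro integrable_mult_right integrable_real_indicator) (auto simp: sets P.emeasure_eq_measure)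
  have i1: "(\<integral>x. f (e i) * indicator {e i} x \<partial>P) = measure P {e i} * f (e i)" for i
    by (simp add: sp)
  have i2: "(\<integral>x. norm (f (e i) * indicator {e i} x) \<partial>P) = measure P {e i} * \<bar>f (e i)\<bar>" for i
    by (simp add: sp abs_mult)
  have s2: "summable (\<lambda>i. \<integral>x. norm (f (e i) * indicator {e i} x) \<partial>P)"
    unfolding i2
    by (rule summable_comparison_test'[OF summable_mult[OF sums_summable[OF s], of B], of 0])
       (use mult_right_mono[OF f, OF measure_nonneg] in \<open>simp add: abs_mult mult.commute\<close>)
  have "(\<integral>x. f x \<partial>P) = (\<integral>x. (\<Sum>i. f (e i) * indicator {e i} x) \<partial>P)"
    by (intro Bochner_Integration.integral_cong refl sums_unique fin)
  also have "\<dots> = (\<Sum>i. \<integral>x. f (e i) * indicator {e i} x \<partial>P)"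
    by (rule integral_suminf[OF int _ s2]) (use fin' in simp)
  finally show "(\<integral>x. f x \<partial>P) = (\<Sum>i. measure P {e i} * f (e i))" by (simp only: i1)
qed

text \<open>No convergent series converges most slowly: dividing the terms by the square roots of the remainders \<open>t i\<close> still gives a convergent
  series, since \<open>(t i - t (i + 1)) / sqrt (t i)\<close> is at most twice \<open>sqrt (t i) - sqrt (t (i + 1))\<close>, which telescopes.\<close>

lemma diverging_weights:
  fixes s :: "nat \<Rightarrow> real"
  assumes s: "summable s" "\<And>i. s i \<ge> 0"
  obtains w where "\<And>i. w i > 0" "filterlim w at_top sequentially" "summable (\<lambda>i. w i * s i)"
proof -
  \<comment> \<open>The added geometric series keeps all remainders positive.\<close>
  define r where "r i = s i + (1/2)^i" for i
  have r: "summable r" unfolding r_def by (intro summable_add s summable_geometric) simp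
  have rpos: "r i > 0" for i unfolding r_def using s(2)[of i] by (simp add: add_nonneg_pos)
  define t where "t i = (\<Sum>j. r (j + i))" for i
  have sr: "summable (\<lambda>j. r (j + i))" for i by (rule summable_ignore_initial_segment[OF r])
  have tpos: "t i > 0" for i unfolding t_def by (rule suminf_pos[OF sr]) (rule rpos)
  have step: "t i = r i + t (Suc i)" for i
    unfolding t_def using suminf_split_head[OF sr[of i]] by simp
  have t0: "t \<longlonglongrightarrow> 0" unfolding t_def by (rule suminf_exist_split2[OF r])
  have q0: "(\<lambda>i. sqrt (t i)) \<longlonglongrightarrow> 0" using tendsto_real_sqrt[OF t0] by simp
  define w where "w i = 1 / sqrt (t i)" for i
  have wpos: "w i > 0" for i unfolding w_def using tpos by simp
  have "filterlim (\<lambda>i. inverse (sqrt (t i))) at_top sequentially"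
    by (rule filterlim_inverse_at_top[OF q0]) (use tpos in simp)
  then have wlim: "filterlim w at_top sequentially" unfolding w_def by (simp add: inverse_eq_divide)
  have bound: "w i * s i \<le> 2 * (sqrt (t i) - sqrt (t (Suc i)))" for i
  proof -
    define a where "a = sqrt (t i)"
    define b where "b = sqrt (t (Suc i))"
    have a: "a > 0" "b > 0" "b \<le> a" using tpos[of i] tpos[of "Suc i"] step[of i] rpos[of i] by (simp_all add: a_def b_def)
    have "s i \<le> r i" by (simp add: r_def)
    also have "r i = a\<^sup>2 - b\<^sup>2" using tpos[of i] tpos[of "Suc i"] step[of i] by (simp add: a_def b_def less_imp_le)
    finally have "s i \<le> (a - b) * (a + b)" by (simp add: power2_eq_square algebra_simps)
    also have "\<dots> \<le> (a - b) * (2 * a)" using a by (intro mult_left_mono) auto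
    finally have "s i \<le> (2 * (a - b)) * a" by (simp add: algebra_simps)
    then have "s i / a \<le> 2 * (a - b)" using a by (simp add: pos_divide_le_eq)
    then show ?thesis by (simp add: w_def a_def b_def)
  qed
  have tel: "summable (\<lambda>i. 2 * (sqrt (t i) - sqrt (t (Suc i))))"
    by (rule summable_mult[OF telescope_summable'[OF q0]])
  have "summable (\<lambda>i. w i * s i)"
    by (rule summable_comparison_test'[OF tel, of 0]) (use bound s(2) wpos in \<open>simp add: less_imp_le\<close>)
  with wpos wlim show thesis by (rule that)
qed

text \<open>Independent centred normal variables with variances \<open>p i\<close>. The random measure with masses \<open>U i\<close> is the white noise from which the bridge is made. Summability of the standard deviations puts the sequence in \<open>l\<^sup>1\<close> almost surely.\<close>

locale gaussian_sequence = prob_space N for N :: "'w measure" +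
  fixes U :: "nat \<Rightarrow> 'w \<Rightarrow> real" and p :: "nat \<Rightarrow> real"
  assumes indep: "indep_vars (\<lambda>_. borel) U UNIV"
    and law: "\<And>i. distr N borel (U i) = gauss_law (p i)"
    and p_nonneg: "\<And>i. p i \<ge> 0" and p_sums: "p sums 1" and p_sqrt: "summable (\<lambda>i. sqrt (p i))"
begin

lemma U_measurable [measurable]: "U i \<in> borel_measurable N"
  using indep by (simp add: indep_vars_def)

lemma U_moments: "integrable N (U i)" "(\<integral>\<omega>. \<bar>U i \<omega>\<bar> \<partial>N) \<le> sqrt (p i)"
proof -
  have "integrable (distr N borel (U i)) (\<lambda>x. x\<^sup>2)" "(\<integral>x. x\<^sup>2 \<partial>distr N borel (U i)) = p i"
    using gauss_law_moments[OF p_nonneg] unfolding law by auto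
  then have "integrable N (\<lambda>\<omega>. (U i \<omega>)\<^sup>2)" "(\<integral>\<omega>. (U i \<omega>)\<^sup>2 \<partial>N) = p i"
    by (simp_all only: distr_moments[OF U_measurable])
  with expectation_abs_le_sqrt_second_moment[OF prob_space_axioms, of "U i"]
  show "integrable N (U i)" "(\<integral>\<omega>. \<bar>U i \<omega>\<bar> \<partial>N) \<le> sqrt (p i)" by auto
qed

lemma U_summable: "summable (\<lambda>i. \<integral>\<omega>. \<bar>U i \<omega>\<bar> \<partial>N)"
  by (rule summable_comparison_test'[OF p_sqrt, of 0]) (use U_moments in auto)

lemmas U_series = L1_series[of N U, OF U_moments(1) U_summable]

text \<open>Characteristic functions of the partial sums converge to that of the series.\<close>

lemma law_series:
  assumes d: "\<And>i. \<bar>d i\<bar> \<le> D"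
  shows "distr N borel (\<lambda>\<omega>. \<Sum>i. d i * U i \<omega>) = gauss_law (\<Sum>i. (d i)\<^sup>2 * p i)"
    and "summable (\<lambda>i. (d i)\<^sup>2 * p i)"
proof -
  have d2: "(d i)\<^sup>2 \<le> D\<^sup>2" for i using d[of i] by (metis abs_ge_zero power2_abs power_mono)
  show s: "summable (\<lambda>i. (d i)\<^sup>2 * p i)"
    by (rule summable_comparison_test'[OF summable_mult[OF sums_summable[OF p_sums], of "D\<^sup>2"], of 0])
       (use mult_right_mono[OF d2 p_nonneg] p_nonneg in simp)
  let ?v = "\<Sum>i. (d i)\<^sup>2 * p i"
  have v: "?v \<ge> 0" by (rule suminf_nonneg[OF s]) (simp add: p_nonneg)
  let ?S = "\<lambda>m \<omega>. \<Sum>i<m. d i * U i \<omega>" and ?X = "\<lambda>\<omega>. \<Sum>i. d i * U i \<omega>"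
  have lim: "AE \<omega> in N. (\<lambda>m. ?S m \<omega>) \<longlonglongrightarrow> ?X \<omega>"
    using U_series(1)
  proof eventually_elim
    case (elim \<omega>)
    have "summable (\<lambda>i. U i \<omega> * d i)" by (rule summable_mult_bounded(2)[OF elim d])
    then have "summable (\<lambda>i. d i * U i \<omega>)" by (simp add: mult.commute)
    then show ?case by (rule summable_LIMSEQ)
  qed
  have "char (distr N borel ?X) t = char (gauss_law ?v) t" for t
  proof -
    have c: "char (distr N borel Y) t = (CLINT \<omega>|N. iexp (t * Y \<omega>))" if "Y \<in> borel_measurable N" for Y
      unfolding char_def by (rule integral_distr) (use that in measurable)
    have "(\<lambda>m. CLINT \<omega>|N. iexp (t * ?S m \<omega>)) \<longlonglongrightarrow> (CLINT \<omega>|N. iexp (t * ?X \<omega>))"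
    proof (rule integral_dominated_convergence[where w="\<lambda>_. 1"])
      show "AE \<omega> in N. (\<lambda>m. iexp (t * ?S m \<omega>)) \<longlonglongrightarrow> iexp (t * ?X \<omega>)"
        using lim by eventually_elim (intro tendsto_intros)
    qed (auto simp del: of_real_mult of_real_sum intro!: AE_I2)
    then have 1: "(\<lambda>m. char (distr N borel (?S m)) t) \<longlonglongrightarrow> char (distr N borel ?X) t"
      by (subst (1 2) c) auto
    have "char (distr N borel (?S m)) t = complex_of_real (exp (- ((\<Sum>i<m. (d i)\<^sup>2 * p i) * t\<^sup>2) / 2))" for m
    proof -
      have "indep_vars (\<lambda>_. borel) (\<lambda>i \<omega>. d i * U i \<omega>) UNIV"
        by (rule indep_vars_compose2[OF indep]) auto
      then have iv: "indep_vars (\<lambda>_. borel) (\<lambda>i \<omega>. d i * U i \<omega>) {..<m}" by (rule indep_vars_subset) auto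
      have ci: "char (distr N borel (\<lambda>\<omega>. d i * U i \<omega>)) t = complex_of_real (exp (- ((d i)\<^sup>2 * p i * t\<^sup>2) / 2))" for i
      proof -
        have "char (distr N borel (\<lambda>\<omega>. d i * U i \<omega>)) t = (CLINT \<omega>|N. iexp ((t * d i) * U i \<omega>))"
          by (subst c) (auto simp: mult.assoc)
        also have "\<dots> = char (distr N borel (U i)) (t * d i)"
          unfolding char_def by (rule integral_distr[symmetric]) measurable
        also have "\<dots> = complex_of_real (exp (- (p i * (t * d i)\<^sup>2) / 2))"
          unfolding law by (rule char_gauss_law[OF p_nonneg])
        finally show ?thesis by (simp add: power_mult_distrib mult_ac)
      qed
      have "char (distr N borel (?S m)) t = (\<Prod>i<m. complex_of_real (exp (- ((d i)\<^sup>2 * p i * t\<^sup>2) / 2)))"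
        unfolding char_distr_sum[OF iv] ci ..
      also have "\<dots> = complex_of_real (\<Prod>i<m. exp (- ((d i)\<^sup>2 * p i * t\<^sup>2) / 2))" by simp
      also have "(\<Prod>i<m. exp (- ((d i)\<^sup>2 * p i * t\<^sup>2) / 2)) = exp (\<Sum>i<m. - ((d i)\<^sup>2 * p i * t\<^sup>2) / 2)"
        by (rule exp_sum[symmetric]) simp
      also have "(\<Sum>i<m. - ((d i)\<^sup>2 * p i * t\<^sup>2) / 2) = - ((\<Sum>i<m. (d i)\<^sup>2 * p i) * t\<^sup>2) / 2"
        by (simp add: sum_distrib_right sum_divide_distrib sum_negf)
      finally show ?thesis .
    qed
    then have "(\<lambda>m. char (distr N borel (?S m)) t) \<longlonglongrightarrow> complex_of_real (exp (- (?v * t\<^sup>2) / 2))"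
      using summable_LIMSEQ[OF s] by (auto intro!: tendsto_intros)
    with 1 have "char (distr N borel ?X) t = complex_of_real (exp (- (?v * t\<^sup>2) / 2))"
      by (rule LIMSEQ_unique)
    then show ?thesis by (simp add: char_gauss_law[OF v])
  qed
  then show "distr N borel ?X = gauss_law ?v"
    by (intro Levy_uniqueness real_distribution_gauss_law real_distribution_distr) auto
qed

lemma series_moments:
  assumes d: "\<And>i. \<bar>d i\<bar> \<le> D"
  shows "(\<integral>\<omega>. (\<Sum>i. d i * U i \<omega>) \<partial>N) = 0"
    "integrable N (\<lambda>\<omega>. (\<Sum>i. d i * U i \<omega>)\<^sup>2)"
    "(\<integral>\<omega>. (\<Sum>i. d i * U i \<omega>)\<^sup>2 \<partial>N) = (\<Sum>i. (d i)\<^sup>2 * p i)"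
proof -
  let ?X = "\<lambda>\<omega>. \<Sum>i. d i * U i \<omega>" and ?v = "\<Sum>i. (d i)\<^sup>2 * p i"
  have v: "?v \<ge> 0" by (rule suminf_nonneg[OF law_series(2)[OF d]]) (simp add: p_nonneg)
  have Xm: "?X \<in> borel_measurable N" by measurable
  have "(\<integral>x. x \<partial>distr N borel ?X) = 0" "integrable (distr N borel ?X) (\<lambda>x. x\<^sup>2)"
    "(\<integral>x. x\<^sup>2 \<partial>distr N borel ?X) = ?v"
    unfolding law_series(1)[OF d] using gauss_law_moments[OF v] by auto
  then show "(\<integral>\<omega>. ?X \<omega> \<partial>N) = 0" "integrable N (\<lambda>\<omega>. (?X \<omega>)\<^sup>2)" "(\<integral>\<omega>. (?X \<omega>)\<^sup>2 \<partial>N) = ?v"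
    by (simp_all only: distr_moments[OF Xm])
qed

text \<open>The mass at \<open>e i\<close> of the bridge: white noise minus its total mass spread according to \<open>p\<close>, so that the total mass becomes \<open>0\<close>.\<close>

definition bridge_weight :: "'w \<Rightarrow> nat \<Rightarrow> real" where
  "bridge_weight \<omega> i = U i \<omega> - p i * (\<Sum>j. U j \<omega>)"

lemma bridge_weight_measurable [measurable]: "(\<lambda>\<omega>. bridge_weight \<omega> i) \<in> borel_measurable N"
  unfolding bridge_weight_def by measurable

lemma bridge_weight_summable:
  assumes "summable (\<lambda>i. \<bar>U i \<omega>\<bar>)" shows "summable (\<lambda>i. \<bar>bridge_weight \<omega> i\<bar>)"
proof (rule summable_comparison_test'[of _ 0])
  show "summable (\<lambda>i. \<bar>U i \<omega>\<bar> + p i * \<bar>\<Sum>j. U j \<omega>\<bar>)"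
    by (intro summable_add assms summable_mult2 sums_summable[OF p_sums])
  show "norm \<bar>bridge_weight \<omega> i\<bar> \<le> \<bar>U i \<omega>\<bar> + p i * \<bar>\<Sum>j. U j \<omega>\<bar>" for i
    using abs_triangle_ineq4[of "U i \<omega>" "p i * (\<Sum>j. U j \<omega>)"] p_nonneg[of i]
    by (simp add: bridge_weight_def abs_mult)
qed

lemma atomic_bridge_weight:
  assumes s: "summable (\<lambda>i. \<bar>U i \<omega>\<bar>)" and f: "f \<in> indicators"
  shows "atomic e (bridge_weight \<omega>) f = (\<Sum>i. (f (e i) - (\<Sum>j. p j * f (e j))) * U i \<omega>)"
proof -
  let ?m = "\<Sum>j. p j * f (e j)" and ?W = "\<Sum>j. U j \<omega>"
  note fb = abs_indicators_le_1[OF f]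
  have pa: "summable (\<lambda>i. \<bar>p i\<bar>)" using p_nonneg sums_summable[OF p_sums] by simp
  have 1: "summable (\<lambda>i. U i \<omega> * f (e i))" by (rule summable_mult_bounded(2)[OF s fb])
  have 2: "summable (\<lambda>i. p i * f (e i))" by (rule summable_mult_bounded(2)[OF pa fb])
  have 3: "summable (\<lambda>i. U i \<omega>)" by (rule summable_rabs_cancel[OF s])
  have "atomic e (bridge_weight \<omega>) f = (\<Sum>i. bridge_weight \<omega> i * f (e i))"
    by (rule atomic_apply[OF bridge_weight_summable[OF s] f])
  also have "\<dots> = (\<Sum>i. U i \<omega> * f (e i) - ?W * (p i * f (e i)))"
    by (simp add: bridge_weight_def algebra_simps)
  also have "\<dots> = (\<Sum>i. U i \<omega> * f (e i)) - (\<Sum>i. ?W * (p i * f (e i)))"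
    by (rule suminf_diff[symmetric, OF 1 summable_mult[OF 2]])
  also have "(\<Sum>i. ?W * (p i * f (e i))) = ?W * ?m" by (rule suminf_mult[OF 2])
  also have "?W * ?m = (\<Sum>i. ?m * U i \<omega>)" using suminf_mult[OF 3, of ?m] by (simp add: mult.commute)
  also have "(\<Sum>i. U i \<omega> * f (e i)) - (\<Sum>i. ?m * U i \<omega>) = (\<Sum>i. U i \<omega> * f (e i) - ?m * U i \<omega>)"
    by (rule suminf_diff[OF 1 summable_mult[OF 3]])
  finally show ?thesis by (simp add: algebra_simps)
qed

text \<open>By \<open>atomic_bridge_weight\<close> the process at \<open>f\<close> is the series \<open>\<Sum>i. (f (e i) - P f) * U i\<close>; linear combinations are series of the same kind, hence
  normal, and polarisation of \<open>series_moments\<close> gives the covariance. For tightness, the weights \<open>w\<close> of \<open>diverging_weights\<close>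
  are chosen so that the weighted \<open>l\<^sup>1\<close> norm of the bridge still has a finite expectation; Markov's inequality then confines the
  process to a compact set from \<open>compactin_atomic_weighted\<close>.\<close>

lemma brownian_bridge_atomic:
  fixes P :: "'a measure"
  assumes P: "prob_space P" "sets P = UNIV" and e: "bij_betw e (UNIV :: nat set) UNIV"
    and p: "\<And>i. p i = measure P {e i}"
  shows "brownian_bridge P indicators N (\<lambda>\<omega>. atomic e (bridge_weight \<omega>))"
proof -
  let ?G = "\<lambda>\<omega>. atomic e (bridge_weight \<omega>) :: ('a \<Rightarrow> real) \<Rightarrow> real"
  have Gm [measurable]: "?G \<in> N \<rightarrow>\<^sub>M linf_borel indicators" by (rule measurable_atomic) measurable
  have ev [measurable]: "(\<lambda>\<omega>. ?G \<omega> f) \<in> borel_measurable N" if "f \<in> indicators" for f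
    by (rule measurable_compose[OF Gm continuous_map_linf_measurable[OF continuous_map_linf_eval[OF that]]])
  define m where "m f = (\<Sum>j. p j * f (e j))" for f :: "'a \<Rightarrow> real"
  have mP: "(\<integral>x. f x \<partial>P) = m f" if "\<And>x. \<bar>f x\<bar> \<le> B" for f :: "'a \<Rightarrow> real" and B
    unfolding m_def p by (rule integral_countable(1)[OF P e that])
  have psm: "summable (\<lambda>i. \<bar>p i\<bar>)" using p_nonneg sums_summable[OF p_sums] by simp
  have m1: "\<bar>m f\<bar> \<le> 1" if "f \<in> indicators" for f
    using summable_mult_bounded(3)[OF psm, of "\<lambda>i. f (e i)" 1] abs_indicators_le_1[OF that] p_nonneg sums_unique[OF p_sums]
    by (simp add: m_def)
  define d where "d f i = f (e i) - m f" for f i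
  have d2: "\<bar>d f i\<bar> \<le> 2" if "f \<in> indicators" for f i
    using m1[OF that] abs_indicators_le_1[OF that, of "e i"] unfolding d_def by linarith
  have Gd: "?G \<omega> f = (\<Sum>i. d f i * U i \<omega>)" if "summable (\<lambda>i. \<bar>U i \<omega>\<bar>)" "f \<in> indicators" for f \<omega>
    using atomic_bridge_weight[OF that] by (simp add: d_def m_def)
  have tight: "tight_linf indicators N ?G"
    unfolding tight_linf_def
  proof (intro allI impI)
    fix \<epsilon> :: real assume \<epsilon>: "\<epsilon> > 0"
    define A where "A = (\<Sum>i. \<integral>\<omega>. \<bar>U i \<omega>\<bar> \<partial>N)"
    define s where "s i = sqrt (p i) + p i * A" for i
    have A0: "A \<ge> 0" unfolding A_def by (rule suminf_nonneg[OF U_summable]) simp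
    have s0: "s i \<ge> 0" for i unfolding s_def using p_nonneg A0 by simp
    have ss: "summable s" unfolding s_def by (intro summable_add p_sqrt summable_mult2 sums_summable[OF p_sums])
    obtain w where w: "\<And>i. w i > 0" "filterlim w at_top sequentially" "summable (\<lambda>i. w i * s i)"
      using diverging_weights[OF ss s0] by blast
    have Wi: "integrable N (\<lambda>\<omega>. \<Sum>j. U j \<omega>)" "(\<integral>\<omega>. \<bar>\<Sum>j. U j \<omega>\<bar> \<partial>N) \<le> A"
    proof -
      have b: "AE \<omega> in N. \<bar>\<Sum>j. U j \<omega>\<bar> \<le> (\<Sum>j. \<bar>U j \<omega>\<bar>)"
        using U_series(1) by eventually_elim (rule summable_rabs)
      show i: "integrable N (\<lambda>\<omega>. \<Sum>j. U j \<omega>)"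
        by (rule Bochner_Integration.integrable_bound[OF U_series(2)]) (use b in auto)
      show "(\<integral>\<omega>. \<bar>\<Sum>j. U j \<omega>\<bar> \<partial>N) \<le> A"
        unfolding A_def U_series(3)[symmetric] by (rule integral_mono_AE) (use i U_series(2) b in auto)
    qed
    have bi: "integrable N (\<lambda>\<omega>. bridge_weight \<omega> i)" for i
      unfolding bridge_weight_def using Wi U_moments by simp
    have bs: "(\<integral>\<omega>. \<bar>bridge_weight \<omega> i\<bar> \<partial>N) \<le> s i" for i
    proof -
      have "(\<integral>\<omega>. \<bar>bridge_weight \<omega> i\<bar> \<partial>N) \<le> (\<integral>\<omega>. \<bar>U i \<omega>\<bar> + p i * \<bar>\<Sum>j. U j \<omega>\<bar> \<partial>N)"
      proof (rule integral_mono)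
        show "\<bar>bridge_weight \<omega> i\<bar> \<le> \<bar>U i \<omega>\<bar> + p i * \<bar>\<Sum>j. U j \<omega>\<bar>" for \<omega>
          using abs_triangle_ineq4[of "U i \<omega>" "p i * (\<Sum>j. U j \<omega>)"] p_nonneg[of i]
          by (simp add: bridge_weight_def abs_mult)
      qed (use bi U_moments Wi in auto)
      also have "\<dots> = (\<integral>\<omega>. \<bar>U i \<omega>\<bar> \<partial>N) + p i * (\<integral>\<omega>. \<bar>\<Sum>j. U j \<omega>\<bar> \<partial>N)"
        using U_moments Wi by simp
      also have "\<dots> \<le> s i" unfolding s_def
        by (intro add_mono U_moments mult_left_mono Wi p_nonneg)
      finally show ?thesis .
    qed
    define R where "R = (\<Sum>i. w i * s i) / \<epsilon>"
    \<comment> \<open>\<open>R\<close> alone may vanish, and Markov's inequality needs a positive level.\<close>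
    define R' where "R' = R + 1"
    have ws0: "(\<Sum>i. w i * s i) \<ge> 0" by (rule suminf_nonneg[OF w(3)]) (use w(1) s0 in \<open>simp add: less_imp_le\<close>)
    have R': "R' > 0" using ws0 \<epsilon> by (simp add: R'_def R_def add_nonneg_pos)
    let ?Y = "\<lambda>i \<omega>. w i * bridge_weight \<omega> i"
    have Yi: "integrable N (?Y i)" for i using bi by simp
    have Yn: "(\<integral>\<omega>. \<bar>?Y i \<omega>\<bar> \<partial>N) = w i * (\<integral>\<omega>. \<bar>bridge_weight \<omega> i\<bar> \<partial>N)" for i
      using w(1)[of i] by (simp add: abs_mult)
    have Yle: "(\<integral>\<omega>. \<bar>?Y i \<omega>\<bar> \<partial>N) \<le> w i * s i" for i
      unfolding Yn by (intro mult_left_mono bs less_imp_le[OF w(1)])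
    have Ys: "summable (\<lambda>i. \<integral>\<omega>. \<bar>?Y i \<omega>\<bar> \<partial>N)"
      by (rule summable_comparison_test'[OF w(3), of 0]) (use Yle in simp)
    note Y = L1_series[of N ?Y, OF Yi Ys]
    let ?T = "\<lambda>\<omega>. \<Sum>i. \<bar>?Y i \<omega>\<bar>"
    let ?K = "atomic e ` {u. \<forall>m. (\<Sum>i<m. w i * \<bar>u i\<bar>) \<le> R'}"
    have K: "compactin (mtopology_of (linf indicators)) ?K" by (rule compactin_atomic_weighted[OF w(1,2)])
    then have "closedin (mtopology_of (linf indicators)) ?K"
      by (intro compactin_imp_closedin) (simp_all add: mtopology_of_def Metric_space.Hausdorff_space_mtopology)
    then have Ks: "?K \<in> sets (linf_borel indicators)" by (rule closed_in_linf_borel)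
    have Km: "{\<omega>\<in>space N. ?G \<omega> \<in> ?K} \<in> sets N"
      using measurable_sets[OF Gm Ks] by (simp add: vimage_def Int_def conj_commute)
    have T0: "AE \<omega> in N. 0 \<le> ?T \<omega>"
      using Y(1) by eventually_elim (rule suminf_nonneg, auto)
    have "measure N {\<omega>\<in>space N. R' \<le> ?T \<omega>} \<le> (\<integral>\<omega>. ?T \<omega> \<partial>N) / R'"
      by (rule integral_Markov_inequality_measure[where A="{}" and u="?T", simplified])
         (use Y(2) R' T0 in auto)
    also have "(\<integral>\<omega>. ?T \<omega> \<partial>N) \<le> (\<Sum>i. w i * s i)" unfolding Y(3) by (rule suminf_le[OF Yle Ys w(3)])
    also have "(\<Sum>i. w i * s i) / R' \<le> \<epsilon>"
    proof -
      have "(\<Sum>i. w i * s i) = R * \<epsilon>" using \<epsilon> by (simp add: R_def)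
      also have "\<dots> \<le> R' * \<epsilon>" using \<epsilon> by (simp add: R'_def)
      finally show ?thesis using R' by (simp add: pos_divide_le_eq mult.commute)
    qed
    finally have small: "measure N {\<omega>\<in>space N. R' \<le> ?T \<omega>} \<le> \<epsilon>" using R' by (simp add: divide_right_mono)
    have "1 - measure N {\<omega>\<in>space N. R' \<le> ?T \<omega>} = measure N (space N - {\<omega>\<in>space N. R' \<le> ?T \<omega>})"
      by (rule prob_compl[symmetric]) measurable
    also have "\<dots> \<le> measure N {\<omega>\<in>space N. ?G \<omega> \<in> ?K}"
    proof (rule finite_measure_mono_AE)
      show "AE \<omega> in N. \<omega> \<in> space N - {\<omega>\<in>space N. R' \<le> ?T \<omega>} \<longrightarrow> \<omega> \<in> {\<omega>\<in>space N. ?G \<omega> \<in> ?K}"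
        using Y(1)
      proof eventually_elim
        case (elim \<omega>)
        show ?case
        proof
          assume \<omega>: "\<omega> \<in> space N - {\<omega>\<in>space N. R' \<le> ?T \<omega>}"
          have "(\<Sum>i<m. w i * \<bar>bridge_weight \<omega> i\<bar>) \<le> R'" for m
          proof -
            have "(\<Sum>i<m. w i * \<bar>bridge_weight \<omega> i\<bar>) = (\<Sum>i<m. \<bar>?Y i \<omega>\<bar>)"
              using less_imp_le[OF w(1)] by (simp add: abs_mult)
            also have "\<dots> \<le> ?T \<omega>" by (rule sum_le_suminf[OF elim]) auto
            finally show ?thesis using \<omega> by auto
          qed
          then have "?G \<omega> \<in> ?K" by blast
          with \<omega> show "\<omega> \<in> {\<omega>\<in>space N. ?G \<omega> \<in> ?K}" by blast
        qed
      qed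
    qed (rule Km)
    finally have "1 - \<epsilon> \<le> measure N {\<omega>\<in>space N. ?G \<omega> \<in> ?K}" using small by linarith
    with K show "\<exists>K. compactin (mtopology_of (linf indicators)) K \<and> 1 - \<epsilon> \<le> measure N {\<omega>\<in>space N. ?G \<omega> \<in> K}"
      by blast
  qed
  have gp: "gaussian_process indicators N ?G"
    unfolding gaussian_process_def
  proof (intro allI impI, elim conjE)
    fix S :: "('a \<Rightarrow> real) set" and c :: "('a \<Rightarrow> real) \<Rightarrow> real" assume S: "finite S" "S \<subseteq> indicators"
    define D where "D i = (\<Sum>f\<in>S. c f * d f i)" for i
    have Db: "\<bar>D i\<bar> \<le> (\<Sum>f\<in>S. \<bar>c f\<bar> * 2)" for i
    proof -
      have "\<bar>D i\<bar> \<le> (\<Sum>f\<in>S. \<bar>c f * d f i\<bar>)" unfolding D_def by (rule sum_abs)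
      also have "\<dots> \<le> (\<Sum>f\<in>S. \<bar>c f\<bar> * 2)"
        unfolding abs_mult using S d2 by (intro sum_mono mult_left_mono) auto
      finally show ?thesis .
    qed
    have Lm: "(\<lambda>\<omega>. \<Sum>f\<in>S. c f * ?G \<omega> f) \<in> borel_measurable N"
      by (intro borel_measurable_sum borel_measurable_times borel_measurable_const ev) (use S in blast)
    have "AE \<omega> in N. (\<Sum>f\<in>S. c f * ?G \<omega> f) = (\<Sum>i. D i * U i \<omega>)"
      using U_series(1)
    proof eventually_elim
      case (elim \<omega>)
      have sf: "summable (\<lambda>i. d f i * U i \<omega>)" if "f \<in> S" for f
      proof -
        have "f \<in> indicators" using S that by blast
        from summable_mult_bounded(2)[OF elim d2[OF this]] show ?thesis by (simp only: mult.commute)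
      qed
      have "(\<Sum>f\<in>S. c f * ?G \<omega> f) = (\<Sum>f\<in>S. \<Sum>i. c f * (d f i * U i \<omega>))"
        using S sf by (intro sum.cong refl) (simp add: Gd[OF elim] suminf_mult subset_eq)
      also have "\<dots> = (\<Sum>i. \<Sum>f\<in>S. c f * (d f i * U i \<omega>))"
        by (rule suminf_sum[symmetric]) (intro summable_mult sf)
      finally show ?case by (simp add: D_def sum_distrib_right mult.assoc)
    qed
    then have "distr N borel (\<lambda>\<omega>. \<Sum>f\<in>S. c f * ?G \<omega> f) = distr N borel (\<lambda>\<omega>. \<Sum>i. D i * U i \<omega>)"
      using Lm by (intro distr_cong_AE refl) auto
    also have "\<dots> = gauss_law (\<Sum>i. (D i)\<^sup>2 * p i)" by (rule law_series(1)[OF Db])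
    finally show "gaussian_law (distr N borel (\<lambda>\<omega>. \<Sum>f\<in>S. c f * ?G \<omega> f))"
      using suminf_nonneg[OF law_series(2)[OF Db]] p_nonneg by (simp add: gaussian_law_gauss_law)
  qed
  have mean: "(\<integral>\<omega>. ?G \<omega> f \<partial>N) = 0" if f: "f \<in> indicators" for f
  proof -
    have "AE \<omega> in N. ?G \<omega> f = (\<Sum>i. d f i * U i \<omega>)" using U_series(1) by eventually_elim (rule Gd[OF _ f])
    then have "(\<integral>\<omega>. ?G \<omega> f \<partial>N) = (\<integral>\<omega>. (\<Sum>i. d f i * U i \<omega>) \<partial>N)" using ev[OF f] by (intro integral_cong_AE) auto
    then show ?thesis using series_moments(1)[OF d2[OF f]] by simp
  qed
  have cov: "(\<integral>\<omega>. ?G \<omega> f * ?G \<omega> g \<partial>N) = (\<integral>y. f y * g y \<partial>P) - (\<integral>y. f y \<partial>P) * (\<integral>y. g y \<partial>P)"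
    if f: "f \<in> indicators" and g: "g \<in> indicators" for f g
  proof -
    let ?X = "\<lambda>d \<omega>. \<Sum>i. d i * U i \<omega>" and ?q = "\<lambda>i. d f i + d g i"
    have q4: "\<bar>?q i\<bar> \<le> 4" for i using d2[OF f, of i] d2[OF g, of i] by linarith
    have "AE \<omega> in N. ?G \<omega> f * ?G \<omega> g = ((?X ?q \<omega>)\<^sup>2 - (?X (d f) \<omega>)\<^sup>2 - (?X (d g) \<omega>)\<^sup>2) / 2"
      using U_series(1)
    proof eventually_elim
      case (elim \<omega>)
      have sf: "summable (\<lambda>i. d f i * U i \<omega>)" "summable (\<lambda>i. d g i * U i \<omega>)"
        using summable_mult_bounded(2)[OF elim d2[OF f]] summable_mult_bounded(2)[OF elim d2[OF g]]
        by (simp_all only: mult.commute)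
      have "?X ?q \<omega> = ?X (d f) \<omega> + ?X (d g) \<omega>"
        using suminf_add[OF sf] by (simp add: distrib_right)
      then show ?case by (simp add: Gd[OF elim] f g power2_eq_square algebra_simps)
    qed
    then have "(\<integral>\<omega>. ?G \<omega> f * ?G \<omega> g \<partial>N) = (\<integral>\<omega>. ((?X ?q \<omega>)\<^sup>2 - (?X (d f) \<omega>)\<^sup>2 - (?X (d g) \<omega>)\<^sup>2) / 2 \<partial>N)"
      using ev f g by (intro integral_cong_AE) auto
    also have "\<dots> = ((\<Sum>i. (?q i)\<^sup>2 * p i) - (\<Sum>i. (d f i)\<^sup>2 * p i) - (\<Sum>i. (d g i)\<^sup>2 * p i)) / 2"
      using series_moments[OF q4] series_moments[OF d2[OF f]] series_moments[OF d2[OF g]] by simp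
    also have "\<dots> = (\<Sum>i. ((?q i)\<^sup>2 * p i - (d f i)\<^sup>2 * p i - (d g i)\<^sup>2 * p i)) / 2"
      using suminf_diff[OF law_series(2)[OF q4] law_series(2)[OF d2[OF f]]]
        suminf_diff[OF summable_diff[OF law_series(2)[OF q4] law_series(2)[OF d2[OF f]]] law_series(2)[OF d2[OF g]]] by simp
    also have "(\<lambda>i. (?q i)\<^sup>2 * p i - (d f i)\<^sup>2 * p i - (d g i)\<^sup>2 * p i) =
        (\<lambda>i. 2 * (p i * (f (e i) * g (e i)) - m g * (p i * f (e i)) - m f * (p i * g (e i)) + m f * m g * p i))"
      by (rule ext) (simp add: d_def power2_eq_square algebra_simps)
    also have "(\<Sum>i. 2 * (p i * (f (e i) * g (e i)) - m g * (p i * f (e i)) - m f * (p i * g (e i)) + m f * m g * p i)) / 2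
        = m (\<lambda>x. f x * g x) - m f * m g"
    proof -
      have fg: "\<bar>f x * g x\<bar> \<le> 1" for x
        unfolding abs_mult using abs_indicators_le_1[OF f, of x] abs_indicators_le_1[OF g, of x] by (simp add: mult_le_one)
      have s1: "(\<lambda>i. p i * (f (e i) * g (e i))) sums m (\<lambda>x. f x * g x)"
        unfolding m_def by (rule summable_sums[OF summable_mult_bounded(2)[OF psm fg]])
      have s2: "(\<lambda>i. p i * f (e i)) sums m f"
        unfolding m_def by (rule summable_sums[OF summable_mult_bounded(2)[OF psm abs_indicators_le_1[OF f]]])
      have s3: "(\<lambda>i. p i * g (e i)) sums m g"
        unfolding m_def by (rule summable_sums[OF summable_mult_bounded(2)[OF psm abs_indicators_le_1[OF g]]])
      have "(\<lambda>i. 2 * (p i * (f (e i) * g (e i)) - m g * (p i * f (e i)) - m f * (p i * g (e i)) + m f * m g * p i))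
        sums (2 * (m (\<lambda>x. f x * g x) - m g * m f - m f * m g + m f * m g * 1))"
        by (intro sums_mult sums_add sums_diff s1 s2 s3 p_sums)
      from sums_unique[OF this, symmetric] show ?thesis by (simp add: algebra_simps)
    qed
    also have "\<dots> = (\<integral>y. f y * g y \<partial>P) - (\<integral>y. f y \<partial>P) * (\<integral>y. g y \<partial>P)"
    proof -
      have fg: "\<bar>f x * g x\<bar> \<le> 1" for x
        unfolding abs_mult using abs_indicators_le_1[OF f, of x] abs_indicators_le_1[OF g, of x] by (simp add: mult_le_one)
      show ?thesis using mP[OF fg] mP[OF abs_indicators_le_1[OF f]] mP[OF abs_indicators_le_1[OF g]] by simp
    qed
    finally show ?thesis .
  qed
  show ?thesis
    unfolding brownian_bridge_def using prob_space_axioms Gm tight gp mean cov by blast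
qed

end

section \<open>Empirical frequencies\<close>

lemma PiM_coordinates_indep:
  assumes M: "\<And>i. prob_space (M i)" and X: "\<And>i. X i \<in> M i \<rightarrow>\<^sub>M N i"
  shows "prob_space.indep_vars (PiM UNIV M) N (\<lambda>i \<omega>. X i (\<omega> i)) UNIV"
proof -
  interpret P: prob_space "PiM UNIV M" by (rule prob_space_PiM) (rule M)
  have "P.indep_vars M (\<lambda>i \<omega>. \<omega> i) UNIV"
  proof (subst P.indep_vars_iff_distr_eq_PiM)
    have "distr (PiM UNIV M) (PiM UNIV M) (\<lambda>x. \<lambda>i\<in>UNIV. x i) = PiM UNIV M"
    proof -
      have "(\<lambda>x. \<lambda>i\<in>UNIV. x i) = (\<lambda>x :: 'a \<Rightarrow> 'b. x)" by (simp add: restrict_def)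
      then show ?thesis by (simp only: distr_id)
    qed
    also have "\<dots> = (\<Pi>\<^sub>M i\<in>UNIV. distr (PiM UNIV M) (M i) (\<lambda>\<omega>. \<omega> i))"
      by (intro PiM_cong refl) (simp add: distr_PiM_component M)
    finally show "distr (PiM UNIV M) (PiM UNIV M) (\<lambda>x. \<lambda>i\<in>UNIV. x i) =
      (\<Pi>\<^sub>M i\<in>UNIV. distr (PiM UNIV M) (M i) (\<lambda>\<omega>. \<omega> i))" .
  qed auto
  from P.indep_vars_compose2[OF this, of X N] X show ?thesis by simp
qed

lemma PiM_coordinate_integral:
  fixes f :: "'b \<Rightarrow> real"
  assumes M: "\<And>i. prob_space (M i)" and f: "f \<in> borel_measurable (M i)"
  shows "(\<integral>\<omega>. f (\<omega> i) \<partial>PiM UNIV M) = (\<integral>x. f x \<partial>M i)"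
    and "integrable (PiM UNIV M) (\<lambda>\<omega>. f (\<omega> i)) \<longleftrightarrow> integrable (M i) f"
proof -
  have m: "(\<lambda>\<omega>. \<omega> i) \<in> PiM UNIV M \<rightarrow>\<^sub>M M i" by simp
  have d: "distr (PiM UNIV M) (M i) (\<lambda>\<omega>. \<omega> i) = M i" by (rule distr_PiM_component) (auto intro: M)
  show "(\<integral>\<omega>. f (\<omega> i) \<partial>PiM UNIV M) = (\<integral>x. f x \<partial>M i)"
    using integral_distr[OF m f] unfolding d by simp
  show "integrable (PiM UNIV M) (\<lambda>\<omega>. f (\<omega> i)) \<longleftrightarrow> integrable (M i) f"
    using integrable_distr_eq[OF m f] unfolding d by simp
qed

lemma PiM_coordinates_prod:
  fixes f :: "'i \<Rightarrow> 'b \<Rightarrow> real"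
  assumes M: "\<And>i. prob_space (M i)" and J: "finite J" and f: "\<And>i. i \<in> J \<Longrightarrow> integrable (M i) (f i)"
  shows "(\<integral>\<omega>. (\<Prod>i\<in>J. f i (\<omega> i)) \<partial>PiM UNIV M) = (\<Prod>i\<in>J. \<integral>x. f i x \<partial>M i)"
    and "integrable (PiM UNIV M) (\<lambda>\<omega>. \<Prod>i\<in>J. f i (\<omega> i))"
proof -
  interpret P: prob_space "PiM UNIV M" by (rule prob_space_PiM) (rule M)
  let ?f = "\<lambda>i. if i \<in> J then f i else (\<lambda>_. 0)"
  have fm: "?f i \<in> borel_measurable (M i)" for i using borel_measurable_integrable[OF f] by auto
  have "P.indep_vars (\<lambda>_. borel) (\<lambda>i \<omega>. ?f i (\<omega> i)) UNIV" by (rule PiM_coordinates_indep[OF M fm])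
  then have iv: "P.indep_vars (\<lambda>_. borel) (\<lambda>i \<omega>. ?f i (\<omega> i)) J" by (rule P.indep_vars_subset) simp
  have int: "integrable (PiM UNIV M) (\<lambda>\<omega>. ?f i (\<omega> i))" for i
    using PiM_coordinate_integral(2)[where f="?f i" and i=i and M=M, OF M fm] f by auto
  have eq: "(\<Prod>i\<in>J. ?f i (\<omega> i)) = (\<Prod>i\<in>J. f i (\<omega> i))" for \<omega> by (intro prod.cong) auto
  have "(\<integral>\<omega>. (\<Prod>i\<in>J. ?f i (\<omega> i)) \<partial>PiM UNIV M) = (\<Prod>i\<in>J. \<integral>\<omega>. ?f i (\<omega> i) \<partial>PiM UNIV M)"
    by (rule P.indep_vars_lebesgue_integral[OF J iv int])
  also have "\<dots> = (\<Prod>i\<in>J. \<integral>x. f i x \<partial>M i)"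
  proof (intro prod.cong refl)
    fix i assume "i \<in> J"
    then show "(\<integral>\<omega>. ?f i (\<omega> i) \<partial>PiM UNIV M) = (\<integral>x. f i x \<partial>M i)"
      using PiM_coordinate_integral(1)[where f="?f i" and i=i and M=M, OF M fm] by simp
  qed
  finally show "(\<integral>\<omega>. (\<Prod>i\<in>J. f i (\<omega> i)) \<partial>PiM UNIV M) = (\<Prod>i\<in>J. \<integral>x. f i x \<partial>M i)" unfolding eq .
  show "integrable (PiM UNIV M) (\<lambda>\<omega>. \<Prod>i\<in>J. f i (\<omega> i))"
    using P.indep_vars_integrable[OF J iv int] unfolding eq .
qed

text \<open>Off-diagonal terms vanish by independence.\<close>

lemma iid_sum_second_moment:
  fixes f :: "'b \<Rightarrow> real"
  assumes M: "prob_space M" and f: "f \<in> borel_measurable M" "integrable M (\<lambda>x. (f x)\<^sup>2)" "(\<integral>x. f x \<partial>M) = 0"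
  shows "(\<integral>\<omega>. (\<Sum>j<n. f (\<omega> j))\<^sup>2 \<partial>(\<Pi>\<^sub>M j\<in>(UNIV::nat set). M)) = real n * (\<integral>x. (f x)\<^sup>2 \<partial>M)"
    and "integrable (\<Pi>\<^sub>M j\<in>(UNIV::nat set). M) (\<lambda>\<omega>. (\<Sum>j<n. f (\<omega> j))\<^sup>2)"
proof -
  interpret M: prob_space M by (rule M)
  let ?P = "\<Pi>\<^sub>M j\<in>(UNIV::nat set). M"
  have f1: "integrable M f" by (rule M.square_integrable_imp_integrable[OF f(1,2)])
  have ij: "(\<integral>\<omega>. f (\<omega> i) * f (\<omega> j) \<partial>?P) = (if i = j then \<integral>x. (f x)\<^sup>2 \<partial>M else 0) \<and>
      integrable ?P (\<lambda>\<omega>. f (\<omega> i) * f (\<omega> j))" for i j :: nat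
  proof (cases "i = j")
    case True
    have m: "(\<lambda>x. (f x)\<^sup>2) \<in> borel_measurable M" using f(1) by measurable
    show ?thesis using PiM_coordinate_integral[of "\<lambda>_. M" "\<lambda>x. (f x)\<^sup>2" j, OF M m] f(2) True
      by (simp add: power2_eq_square)
  next
    case False
    have eq: "(\<Prod>k\<in>{i,j}. f (\<omega> k)) = f (\<omega> i) * f (\<omega> j)" for \<omega> using False by simp
    have "(\<integral>\<omega>. (\<Prod>k\<in>{i,j}. f (\<omega> k)) \<partial>?P) = (\<Prod>k\<in>{i,j}. \<integral>x. f x \<partial>M)"
      by (rule PiM_coordinates_prod(1)) (auto intro: M f1)
    moreover have "integrable ?P (\<lambda>\<omega>. \<Prod>k\<in>{i,j}. f (\<omega> k))"
      by (rule PiM_coordinates_prod(2)) (auto intro: M f1)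
    ultimately show ?thesis unfolding eq using False f(3) by simp
  qed
  have eq: "(\<Sum>j<n. f (\<omega> j))\<^sup>2 = (\<Sum>i<n. \<Sum>j<n. f (\<omega> i) * f (\<omega> j))" for \<omega>
    by (simp add: power2_eq_square sum_product)
  show "integrable ?P (\<lambda>\<omega>. (\<Sum>j<n. f (\<omega> j))\<^sup>2)"
    unfolding eq using ij by (intro Bochner_Integration.integrable_sum) auto
  have "(\<integral>\<omega>. (\<Sum>j<n. f (\<omega> j))\<^sup>2 \<partial>?P) = (\<Sum>i<n. \<integral>\<omega>. (\<Sum>j<n. f (\<omega> i) * f (\<omega> j)) \<partial>?P)"
    unfolding eq using ij by (intro Bochner_Integration.integral_sum Bochner_Integration.integrable_sum) auto
  also have "\<dots> = (\<Sum>i<n. \<Sum>j<n. \<integral>\<omega>. f (\<omega> i) * f (\<omega> j) \<partial>?P)"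
    using ij by (intro sum.cong refl Bochner_Integration.integral_sum) auto
  also have "\<dots> = (\<Sum>i<n. \<Sum>j<n. if i = j then \<integral>x. (f x)\<^sup>2 \<partial>M else 0)" using ij by simp
  also have "\<dots> = real n * (\<integral>x. (f x)\<^sup>2 \<partial>M)" by simp
  finally show "(\<integral>\<omega>. (\<Sum>j<n. f (\<omega> j))\<^sup>2 \<partial>?P) = real n * (\<integral>x. (f x)\<^sup>2 \<partial>M)" .
qed

text \<open>The value at \<open>n = 0\<close> is \<open>0\<close>, by division by zero.\<close>

definition freq :: "(nat \<Rightarrow> 'a) \<Rightarrow> nat \<Rightarrow> 'a \<Rightarrow> real" where
  "freq x n y = (\<Sum>j<n. indicator {y} (x j)) / real n"

lemma freq_bounds: "0 \<le> freq x n y" "freq x n y \<le> 1"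
proof -
  show "0 \<le> freq x n y" unfolding freq_def by (intro divide_nonneg_nonneg sum_nonneg) auto
  have "(\<Sum>j<n. indicator {y} (x j) :: real) \<le> (\<Sum>j<n. 1)" by (rule sum_mono) (simp add: indicator_def)
  then show "freq x n y \<le> 1" by (cases "n = 0") (simp_all add: freq_def divide_le_eq)
qed

locale countable_sample = prob_space P for P :: "'a measure" +
  assumes sets_P: "sets P = UNIV"
begin

abbreviation "S \<equiv> \<Pi>\<^sub>M j\<in>(UNIV::nat set). P"

sublocale S: prob_space S by (rule prob_space_PiM) (rule prob_space_axioms)

lemma measurable_P: "f \<in> borel_measurable P" for f :: "'a \<Rightarrow> real"
proof -
  have "space P = UNIV" using sets.sets_into_space[of UNIV P] by (auto simp: sets_P)
  then show ?thesis by (auto simp: measurable_def sets_P)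
qed

lemma space_P: "space P = UNIV"
  using sets.sets_into_space[of UNIV P] by (auto simp: sets_P)

lemma measurable_coordinate: "(\<lambda>x. f (x j)) \<in> borel_measurable S" for f :: "'a \<Rightarrow> real"
  by (rule measurable_compose[OF _ measurable_P]) (rule measurable_component_singleton, simp)

lemma measurable_freq [measurable]: "(\<lambda>x. freq x n y) \<in> borel_measurable S"
  unfolding freq_def by (intro borel_measurable_divide borel_measurable_sum measurable_coordinate borel_measurable_const)

lemma integral_atom: "(\<integral>x. indicator {y} x \<partial>P) = prob {y}" "integrable P (indicator {y} :: 'a \<Rightarrow> real)"
  by (auto simp: space_P sets_P intro!: integrable_real_indicator simp: emeasure_eq_measure)

lemma freq_L1_deviation:
  assumes "n > 0"
  shows "(\<integral>x. \<bar>freq x n y - prob {y}\<bar> \<partial>S) \<le> sqrt (prob {y} / real n)"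
    and "integrable S (\<lambda>x. freq x n y - prob {y})"
proof -
  let ?p = "prob {y}"
  let ?f = "\<lambda>z. indicator {y} z - ?p :: real"
  have f0: "(\<integral>z. ?f z \<partial>P) = 0" using integral_atom[of y] by (simp add: prob_space)
  have sqe: "(?f z)\<^sup>2 = indicator {y} z * (1 - 2 * ?p) + ?p\<^sup>2" for z
    by (auto simp: indicator_def power2_eq_square algebra_simps)
  have fi: "integrable P (\<lambda>z. (?f z)\<^sup>2)" unfolding sqe using integral_atom(2)[of y] by simp
  have fv: "(\<integral>z. (?f z)\<^sup>2 \<partial>P) \<le> ?p"
  proof -
    have "(\<integral>z. (?f z)\<^sup>2 \<partial>P) = ?p * (1 - 2 * ?p) + ?p\<^sup>2"
      unfolding sqe using integral_atom[of y] by (simp add: prob_space)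
    also have "\<dots> = ?p - ?p\<^sup>2" by (simp add: power2_eq_square algebra_simps)
    also have "\<dots> \<le> ?p" by simp
    finally show ?thesis .
  qed
  have dev: "freq x n y - ?p = (\<Sum>j<n. ?f (x j)) / real n" for x
    using assms by (simp add: freq_def sum_subtractf field_simps)
  note m = iid_sum_second_moment[OF prob_space_axioms measurable_P fi f0, of n]
  have i2: "integrable S (\<lambda>x. (freq x n y - ?p)\<^sup>2)"
    unfolding dev power_divide using m(2) by simp
  have v: "(\<integral>x. (freq x n y - ?p)\<^sup>2 \<partial>S) \<le> ?p / real n"
  proof -
    have "(\<integral>x. (freq x n y - ?p)\<^sup>2 \<partial>S) = real n * (\<integral>z. (?f z)\<^sup>2 \<partial>P) / (real n)\<^sup>2"
      unfolding dev power_divide using m(1) by simp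
    also have "\<dots> = (\<integral>z. (?f z)\<^sup>2 \<partial>P) / real n" using assms by (simp add: power2_eq_square)
    also have "\<dots> \<le> ?p / real n" using fv by (simp add: divide_right_mono)
    finally show ?thesis .
  qed
  have mm: "(\<lambda>x. freq x n y - ?p) \<in> borel_measurable S" by measurable
  note e = expectation_abs_le_sqrt_second_moment[OF S.prob_space_axioms i2 mm]
  show "integrable S (\<lambda>x. freq x n y - ?p)" by (rule e(1))
  show "(\<integral>x. \<bar>freq x n y - ?p\<bar> \<partial>S) \<le> sqrt (?p / real n)"
    by (rule order_trans[OF e(2)]) (rule real_sqrt_le_mono[OF v])
qed

lemma sum_inverse_sqrt_le: "(\<Sum>j<N. 1 / sqrt (real j + 1)) \<le> 2 * sqrt (real N)"
proof (induction N)
  case (Suc N)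
  have "1 / sqrt (real N + 1) \<le> 2 * (sqrt (real N + 1) - sqrt (real N))"
  proof -
    define a where "a = sqrt (real N + 1)"
    define b where "b = sqrt (real N)"
    have a: "a > 0" "b \<ge> 0" "b \<le> a" by (simp_all add: a_def b_def)
    have "1 = a\<^sup>2 - b\<^sup>2" by (simp add: a_def b_def)
    also have "\<dots> = (a - b) * (a + b)" by (simp add: power2_eq_square algebra_simps)
    also have "\<dots> \<le> (a - b) * (2 * a)" using a by (intro mult_left_mono) auto
    finally have "1 \<le> 2 * (a - b) * a" by (simp add: algebra_simps)
    then show ?thesis using a by (simp add: a_def[symmetric] b_def[symmetric] pos_divide_le_eq)
  qed
  then show ?case using Suc by (simp add: add.commute)
qed simp

text \<open>The expectation of the supremum over \<open>n\<close> of \<open>sqrt (freq x n y)\<close> is at most a constant times \<open>sqrt p\<close>, where \<open>p\<close> is the mass of \<open>y\<close>.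
  The two regimes meet at \<open>N\<close>, about \<open>1 / p\<close>. For \<open>n \<le> N\<close> the point is rarely hit, and as the number of hits is an integer,
  its square root is at most the number itself; the supremum is then at most the sum of \<open>1 / sqrt j\<close> over the hits \<open>j \<le> N\<close>, whose expectation
  is of order \<open>p * sqrt N\<close>. For \<open>n > N\<close> the number of hits is monotone, so the times \<open>m k = N * 2 ^ (k + 1)\<close> suffice, and there
  the deviations from \<open>p\<close> divided by \<open>sqrt p\<close> have expectations of order \<open>sqrt p\<close> that decrease geometrically.\<close>

lemma sqrt_freq_maximal:
  "\<exists>H. integrable S H \<and> (\<integral>x. \<bar>H x\<bar> \<partial>S) \<le> 8 * (1 + (\<Sum>k. (1 / sqrt 2) ^ k)) * sqrt (prob {y}) \<and>
     (AE x in S. \<forall>n. sqrt (freq x n y) \<le> H x)"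
proof (cases "prob {y} = 0")
  case True
  have "AE x in S. x j \<noteq> y" for j
  proof (rule AE_PiM_component)
    show "AE z in P. z \<noteq> y"
      by (rule AE_I[where N="{y}"]) (auto simp: sets_P emeasure_eq_measure True)
  qed (auto intro: prob_space_axioms)
  then have "AE x in S. \<forall>j. x j \<noteq> y" by (simp add: AE_all_countable)
  then have "AE x in S. \<forall>n. sqrt (freq x n y) \<le> 0"
    by eventually_elim (simp add: freq_def)
  then show ?thesis using True by (intro exI[of _ "\<lambda>_. 0"]) simp
next
  case False
  define p where "p = prob {y}"
  have p: "p > 0" "p \<le> 1" using False measure_nonneg[of P "{y}"] by (auto simp: p_def less_le)
  define r :: real where "r = 1 / sqrt 2"
  have r: "0 < r" "r < 1" by (simp_all add: r_def)
  have rs: "summable (\<lambda>k. r ^ k)" using r by (intro summable_geometric) simp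
  define N where "N = nat \<lceil>1 / p\<rceil>"
  have N: "1 / p \<le> real N" "real N \<le> 2 / p"
  proof -
    show "1 / p \<le> real N" unfolding N_def by (rule real_nat_ceiling_ge)
    have "real N \<le> 1 / p + 1" unfolding N_def using p by (simp add: of_nat_ceiling)
    also have "\<dots> \<le> 2 / p" using p by (simp add: field_simps)
    finally show "real N \<le> 2 / p" .
  qed
  have Npos: "N > 0" using N(1) p by (metis divide_pos_pos gr0I not_le of_nat_0 zero_less_one)
  define A where "A x = (\<Sum>j<N. indicator {y} (x j) * (1 / sqrt (real j + 1)))" for x :: "nat \<Rightarrow> 'a"
  define m where "m k = N * 2 ^ Suc k" for k
  define D where "D k x = (freq x (m k) y - p) / sqrt p" for k x
  have mpos: "m k > 0" for k using Npos by (simp add: m_def)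
  have Di: "integrable S (D k)" for k unfolding D_def p_def using freq_L1_deviation(2)[OF mpos] by simp
  have Db: "(\<integral>x. \<bar>D k x\<bar> \<partial>S) \<le> sqrt p * r ^ Suc k" for k
  proof -
    have "(\<integral>x. \<bar>D k x\<bar> \<partial>S) = (\<integral>x. \<bar>freq x (m k) y - p\<bar> \<partial>S) / sqrt p"
      unfolding D_def using p by (simp add: abs_divide)
    also have "\<dots> \<le> sqrt (p / real (m k)) / sqrt p"
      unfolding p_def using freq_L1_deviation(1)[OF mpos] by (intro divide_right_mono) auto
    also have "\<dots> = sqrt (1 / real (m k))" using p by (simp add: real_sqrt_divide)
    also have "\<dots> \<le> sqrt (p * (1 / 2 ^ Suc k))"
    proof (rule real_sqrt_le_mono)
      have "1 / real (m k) = (1 / real N) * (1 / 2 ^ Suc k)" by (simp add: m_def)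
      also have "\<dots> \<le> p * (1 / 2 ^ Suc k)"
        using N(1) p Npos by (intro mult_right_mono) (simp_all add: field_simps)
      finally show "1 / real (m k) \<le> p * (1 / 2 ^ Suc k)" .
    qed
    also have "\<dots> = sqrt p * r ^ Suc k"
    proof -
      have "r = sqrt (1 / 2)" by (simp add: r_def real_sqrt_divide)
      then have "r ^ Suc k = sqrt ((1 / 2) ^ Suc k)" by (simp only: real_sqrt_power)
      then show ?thesis by (simp only: real_sqrt_mult power_one_over)
    qed
    finally show ?thesis .
  qed
  have Ds: "summable (\<lambda>k. \<integral>x. \<bar>D k x\<bar> \<partial>S)"
    by (rule summable_comparison_test'[OF summable_mult[OF summable_Suc_iff[THEN iffD2, OF rs], of "sqrt p"], of 0])
       (use Db in simp)
  note DL = L1_series[of S D, OF Di Ds]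
  have DT: "(\<Sum>k. \<integral>x. \<bar>D k x\<bar> \<partial>S) \<le> sqrt p * (\<Sum>k. r ^ k)"
  proof -
    have "(\<Sum>k. \<integral>x. \<bar>D k x\<bar> \<partial>S) \<le> (\<Sum>k. sqrt p * r ^ Suc k)"
      by (rule suminf_le[OF Db Ds]) (intro summable_mult summable_Suc_iff[THEN iffD2] rs)
    also have "\<dots> = sqrt p * (\<Sum>k. r ^ Suc k)" by (rule suminf_mult) (intro summable_Suc_iff[THEN iffD2] rs)
    also have "(\<Sum>k. r ^ Suc k) \<le> (\<Sum>k. r ^ k)" using suminf_split_head[OF rs] by simp
    finally show ?thesis using p by simp
  qed
  have Ij: "integrable S (\<lambda>x. indicator {y} (x j) :: real)" for j
    by (rule PiM_coordinate_integral(2)[where f="indicator {y}" and i=j and M="\<lambda>_. P", OF prob_space_axioms measurable_P, THEN iffD2])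
       (rule integral_atom(2))
  have Ai: "integrable S A"
    unfolding A_def by (intro Bochner_Integration.integrable_sum integrable_mult_left Ij)
  have A0: "A x \<ge> 0" for x unfolding A_def by (intro sum_nonneg) auto
  have AI: "(\<integral>x. A x \<partial>S) \<le> 3 * sqrt p"
  proof -
    have "(\<integral>x. A x \<partial>S) = (\<Sum>j<N. \<integral>x. indicator {y} (x j) * (1 / sqrt (real j + 1)) \<partial>S)"
      unfolding A_def by (intro Bochner_Integration.integral_sum integrable_mult_left Ij)
    also have "\<dots> = (\<Sum>j<N. p * (1 / sqrt (real j + 1)))"
    proof (intro sum.cong refl)
      fix j
      have "(\<integral>x. indicator {y} (x j) \<partial>S) = p"
        unfolding p_def integral_atom(1)[symmetric] by (rule PiM_coordinate_integral(1)[OF prob_space_axioms measurable_P])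
      then show "(\<integral>x. indicator {y} (x j) * (1 / sqrt (real j + 1)) \<partial>S) = p * (1 / sqrt (real j + 1))"
        by (simp only: integral_mult_left_zero)
    qed
    also have "\<dots> \<le> p * (2 * sqrt (real N))"
      unfolding sum_distrib_left[symmetric] using p by (intro mult_left_mono sum_inverse_sqrt_le) auto
    also have "\<dots> \<le> p * (2 * sqrt (2 / p))" using N(2) p by (intro mult_left_mono real_sqrt_le_mono) auto
    also have "\<dots> = 2 * sqrt 2 * sqrt p"
    proof -
      have "p * (2 * sqrt (2 / p)) = 2 * sqrt 2 * (p / sqrt p)" using p by (simp add: real_sqrt_divide)
      also have "p / sqrt p = sqrt p" using p by (simp add: real_div_sqrt)
      finally show ?thesis .
    qed
    also have "\<dots> \<le> 3 * sqrt p"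
    proof (rule mult_right_mono)
      have "sqrt 2 \<le> sqrt ((3/2)\<^sup>2)" by (rule real_sqrt_le_mono) (simp add: power2_eq_square)
      then show "2 * sqrt 2 \<le> (3::real)" by simp
    qed (use p in simp)
    finally show ?thesis .
  qed
  \<comment> \<open>The term \<open>A\<close> serves \<open>n \<le> N\<close>, the other one \<open>n > N\<close>; the factor \<open>2\<close> pays for rounding \<open>n\<close> up to the next \<open>m k\<close>.\<close>
  define H where "H x = A x + 2 * (sqrt p + (\<Sum>k. \<bar>D k x\<bar>))" for x
  have Hi: "integrable S H" unfolding H_def using Ai DL(2) by simp
  have Hint: "(\<integral>x. H x \<partial>S) \<le> 8 * (1 + (\<Sum>k. r ^ k)) * sqrt p"
  proof -
    have "(\<integral>x. H x \<partial>S) = (\<integral>x. A x \<partial>S) + 2 * (sqrt p + (\<Sum>k. \<integral>x. \<bar>D k x\<bar> \<partial>S))"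
      unfolding H_def DL(3)[symmetric] using Ai DL(2) by (simp add: S.prob_space)
    also have "\<dots> \<le> 3 * sqrt p + 2 * (sqrt p + sqrt p * (\<Sum>k. r ^ k))"
      using AI DT by simp
    also have "\<dots> \<le> 8 * (1 + (\<Sum>k. r ^ k)) * sqrt p"
    proof -
      have "0 \<le> sqrt p * (\<Sum>k. r ^ k)" using p r suminf_nonneg[OF rs] by simp
      moreover have "0 \<le> sqrt p" using p by simp
      ultimately show ?thesis by (simp add: algebra_simps)
    qed
    finally show ?thesis .
  qed
  have bnd: "AE x in S. \<forall>n. sqrt (freq x n y) \<le> H x"
    using DL(1)
  proof eventually_elim
    case (elim x)
    have D0: "(\<Sum>k. \<bar>D k x\<bar>) \<ge> 0" by (rule suminf_nonneg[OF elim]) simp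
    have Hn: "H x \<ge> A x" "H x \<ge> 2 * (sqrt p + (\<Sum>k. \<bar>D k x\<bar>))" unfolding H_def using A0[of x] D0 p by auto
    show ?case
    proof
      fix n
      let ?K = "\<lambda>n. \<Sum>j<n. indicator {y} (x j) :: real"
      have K0: "?K n \<ge> 0" for n by (intro sum_nonneg) auto
      have Kmono: "?K a \<le> ?K b" if "a \<le> b" for a b using that by (intro sum_mono2) auto
      have Kint: "?K n \<in> {0} \<union> {1..}" for n
      proof -
        have "?K n = real (card ({..<n} \<inter> {j. y = x j}))" by (simp add: indicator_def eq_commute)
        moreover have "real c \<in> {0} \<union> {1..}" for c :: nat by (cases c) auto
        ultimately show ?thesis by (simp only:)
      qed
      show "sqrt (freq x n y) \<le> H x"
      proof (cases "n \<le> N")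
        case True
        show ?thesis
        proof (cases "n = 0")
          case True then show ?thesis using Hn A0[of x] by (simp add: freq_def)
        next
          case False
          have "sqrt (?K n) \<le> ?K n"
          proof -
            have "?K n \<le> (?K n)\<^sup>2" using Kint[of n] by (auto simp: power2_eq_square mult_le_cancel_left1)
            then show ?thesis using K0[of n] by (simp add: real_le_lsqrt)
          qed
          then have "sqrt (freq x n y) \<le> ?K n / sqrt (real n)"
            unfolding freq_def real_sqrt_divide by (intro divide_right_mono) auto
          also have "\<dots> = (\<Sum>j<n. indicator {y} (x j) * (1 / sqrt (real n)))" by (simp add: sum_divide_distrib)
          also have "\<dots> \<le> (\<Sum>j<n. indicator {y} (x j) * (1 / sqrt (real j + 1)))"
          proof (rule sum_mono, rule mult_left_mono)
            fix j assume "j \<in> {..<n}"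
            then have "sqrt (real j + 1) \<le> sqrt (real n)" by (intro real_sqrt_le_mono) auto
            then show "1 / sqrt (real n) \<le> 1 / sqrt (real j + 1)" by (intro divide_left_mono) (use False in auto)
          qed simp
          also have "\<dots> \<le> A x" unfolding A_def using True by (intro sum_mono2) auto
          finally show ?thesis using Hn by linarith
        qed
      next
        case False
        then have nN: "N < n" by simp
        have "\<exists>k. n < N * 2 ^ k"
        proof -
          have "n < 2 ^ n" by simp
          also have "\<dots> \<le> N * 2 ^ n" using Npos by simp
          finally show ?thesis by blast
        qed
        then have ex: "\<exists>k. n < N * 2 ^ k" .
        \<comment> \<open>The first dyadic time after \<open>n\<close> is at most twice as late.\<close>
        define k0 where "k0 = (LEAST k. n < N * 2 ^ k)"
        have k0: "n < N * 2 ^ k0" unfolding k0_def by (rule LeastI_ex[OF ex])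
        have "k0 \<noteq> 0" using k0 nN by (intro notI) simp
        then obtain k where k: "k0 = Suc k" by (cases k0) auto
        have "\<not> n < N * 2 ^ k"
          by (rule not_less_Least) (use k in \<open>simp add: k0_def\<close>)
        then have mk: "n < m k" "m k \<le> 2 * n" using k0 k by (auto simp: m_def)
        have "freq x n y \<le> ?K (m k) / real n"
          unfolding freq_def using mk by (intro divide_right_mono Kmono) auto
        also have "\<dots> \<le> ?K (m k) / (real (m k) / 2)"
          using mk nN K0[of "m k"] by (intro divide_left_mono) auto
        also have "\<dots> = 2 * freq x (m k) y" by (simp add: freq_def)
        finally have "freq x n y \<le> 2 * freq x (m k) y" .
        also have "freq x (m k) y \<le> (sqrt p + \<bar>D k x\<bar>)\<^sup>2"
        proof -
          have "freq x (m k) y - p = D k x * sqrt p" using p by (simp add: D_def)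
          also have "\<dots> \<le> \<bar>D k x\<bar> * sqrt p" using p by (intro mult_right_mono) auto
          finally have "freq x (m k) y \<le> p + \<bar>D k x\<bar> * sqrt p" by simp
          also have "\<dots> \<le> (sqrt p + \<bar>D k x\<bar>)\<^sup>2"
          proof -
            have "0 \<le> \<bar>D k x\<bar> * sqrt p" using p by simp
            then show ?thesis using p by (simp add: power2_sum algebra_simps)
          qed
          finally show ?thesis .
        qed
        finally have "freq x n y \<le> 2 * (sqrt p + \<bar>D k x\<bar>)\<^sup>2" by simp
        also have "\<dots> \<le> (2 * (sqrt p + \<bar>D k x\<bar>))\<^sup>2" unfolding power_mult_distrib by (intro mult_right_mono) auto
        finally have "sqrt (freq x n y) \<le> 2 * (sqrt p + \<bar>D k x\<bar>)"
          using p by (intro real_le_lsqrt) (auto intro: freq_bounds)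
        also have "\<bar>D k x\<bar> \<le> (\<Sum>k. \<bar>D k x\<bar>)"
          using sum_le_suminf[OF elim, of "{k}"] by simp
        finally show ?thesis using Hn(2) by simp
      qed
    qed
  qed
  have Hnn: "H x \<ge> 0" if "summable (\<lambda>k. \<bar>D k x\<bar>)" for x
    unfolding H_def using A0[of x] p suminf_nonneg[OF that] by simp
  have "(\<integral>x. \<bar>H x\<bar> \<partial>S) = (\<integral>x. H x \<partial>S)"
  proof (rule integral_cong_AE)
    show "AE x in S. \<bar>H x\<bar> = H x" using DL(1) by eventually_elim (simp add: Hnn)
  qed (use borel_measurable_integrable[OF Hi] in auto)
  then show ?thesis using Hi Hint bnd unfolding p_def r_def by (intro exI[of _ H]) simp
qed

text \<open>Hoeffding's inequality makes the deviation probabilities summable, so the Borel-Cantelli lemma applies.\<close>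

lemma freq_LLN: "AE x in S. (\<lambda>n. freq x n y) \<longlonglongrightarrow> prob {y}"
proof -
  let ?X = "\<lambda>j x. indicator {y} (x j) :: real"
  let ?p = "prob {y}"
  have iv: "S.indep_vars (\<lambda>_. borel) ?X UNIV"
    by (rule PiM_coordinates_indep[OF prob_space_axioms measurable_P])
  have X0: "(\<integral>x. ?X j x \<partial>S) = ?p" for j
    using PiM_coordinate_integral(1)[OF prob_space_axioms measurable_P, of "indicator {y}" j] integral_atom(1) by simp
  have dev: "S.prob {x \<in> space S. \<epsilon> \<le> \<bar>freq x n y - ?p\<bar>} \<le> 2 * exp (- 2 * \<epsilon>\<^sup>2) ^ n"
    if n: "n > 0" and \<epsilon>: "\<epsilon> > 0" for n \<epsilon>
  proof -
    interpret H: Hoeffding_ineq S "{..<n}" ?X "\<lambda>_. 0" "\<lambda>_. 1" "\<Sum>j<n. \<integral>x. ?X j x \<partial>S"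
      by unfold_locales (auto intro: S.indep_vars_subset[OF iv])
    have "S.prob {x \<in> space S. real n * \<epsilon> \<le> \<bar>(\<Sum>j<n. ?X j x) - (\<Sum>j<n. \<integral>x. ?X j x \<partial>S)\<bar>}
        \<le> 2 * exp (- 2 * (real n * \<epsilon>)\<^sup>2 / (\<Sum>j<n. (1 - 0)\<^sup>2))"
      by (rule H.Hoeffding_ineq_abs_ge) (use n \<epsilon> in auto)
    also have "- 2 * (real n * \<epsilon>)\<^sup>2 / (\<Sum>j<n. (1 - 0)\<^sup>2) = real n * (- 2 * \<epsilon>\<^sup>2)"
      using n by (simp add: power2_eq_square)
    also have "exp (real n * (- 2 * \<epsilon>\<^sup>2)) = exp (- 2 * \<epsilon>\<^sup>2) ^ n" by (rule exp_of_nat_mult)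
    also have "{x \<in> space S. real n * \<epsilon> \<le> \<bar>(\<Sum>j<n. ?X j x) - (\<Sum>j<n. \<integral>x. ?X j x \<partial>S)\<bar>} =
        {x \<in> space S. \<epsilon> \<le> \<bar>freq x n y - ?p\<bar>}"
    proof -
      have "real n * \<epsilon> \<le> \<bar>(\<Sum>j<n. ?X j x) - (\<Sum>j<n. \<integral>x. ?X j x \<partial>S)\<bar> \<longleftrightarrow> \<epsilon> \<le> \<bar>freq x n y - ?p\<bar>" for x
      proof -
        have "(\<Sum>j<n. ?X j x) - (\<Sum>j<n. \<integral>x. ?X j x \<partial>S) = real n * (freq x n y - ?p)"
          using n unfolding X0 by (simp add: freq_def right_diff_distrib)
        then show ?thesis using n by (simp add: abs_mult)
      qed
      then show ?thesis by simp
    qed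
    finally show ?thesis .
  qed
  have ae: "AE x in S. \<forall>\<^sub>F n in sequentially. \<bar>freq x n y - ?p\<bar> < \<epsilon>" if \<epsilon>: "\<epsilon> > 0" for \<epsilon>
  proof -
    have "AE x in S. \<forall>\<^sub>F n in sequentially. x \<in> space S - {x \<in> space S. \<epsilon> \<le> \<bar>freq x n y - ?p\<bar>}"
    proof (rule borel_cantelli_AE1)
      show "summable (\<lambda>n. S.prob {x \<in> space S. \<epsilon> \<le> \<bar>freq x n y - ?p\<bar>})"
      proof (rule summable_comparison_test'[of _ 1])
        show "summable (\<lambda>n. 2 * exp (- 2 * \<epsilon>\<^sup>2) ^ n)"
          by (intro summable_mult summable_geometric) (use \<epsilon> in simp)
        show "norm (S.prob {x \<in> space S. \<epsilon> \<le> \<bar>freq x n y - ?p\<bar>}) \<le> 2 * exp (- 2 * \<epsilon>\<^sup>2) ^ n" if "n \<ge> 1" for n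
          using dev[OF _ \<epsilon>, of n] that by simp
      qed
    qed (auto simp: S.emeasure_eq_measure)
    then show ?thesis
      by eventually_elim (auto elim!: eventually_mono)
  qed
  have "AE x in S. \<forall>k::nat. \<forall>\<^sub>F n in sequentially. \<bar>freq x n y - ?p\<bar> < 1 / real (Suc k)"
    unfolding AE_all_countable by (intro allI ae) simp
  then show ?thesis
  proof eventually_elim
    case (elim x)
    show ?case
    proof (rule tendstoI)
      fix \<epsilon> :: real assume "\<epsilon> > 0"
      then obtain k where k: "1 / real (Suc k) < \<epsilon>" using nat_approx_posE by blast
      show "\<forall>\<^sub>F n in sequentially. dist (freq x n y) ?p < \<epsilon>"
        using elim[rule_format, of k] by eventually_elim (use k in \<open>simp add: dist_real_def\<close>)
    qed
  qed
qed

text \<open>The two properties of the observed sequence on which the convergence of the posterior rests: pointwise convergence of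
  the frequencies, and a summable majorant \<open>b\<close> of their square roots that does not depend on \<open>n\<close>.\<close>

lemma freq_dominated_AE:
  assumes e: "bij_betw e (UNIV :: nat set) (UNIV :: 'a set)" and s: "summable (\<lambda>i. sqrt (prob {e i}))"
  shows "AE x in S. (\<forall>i. (\<lambda>n. freq x n (e i)) \<longlonglongrightarrow> prob {e i}) \<and>
    (\<exists>b. summable b \<and> (\<forall>n i. sqrt (freq x n (e i)) \<le> b i))"
proof -
  let ?C = "8 * (1 + (\<Sum>k. (1 / sqrt 2) ^ k)) :: real"
  have "\<forall>i. \<exists>H. integrable S H \<and> (\<integral>x. \<bar>H x\<bar> \<partial>S) \<le> ?C * sqrt (prob {e i}) \<and>
     (AE x in S. \<forall>n. sqrt (freq x n (e i)) \<le> H x)" by (intro allI sqrt_freq_maximal)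
  from choice[OF this] obtain H where HH: "\<forall>i. integrable S (H i) \<and> (\<integral>x. \<bar>H i x\<bar> \<partial>S) \<le> ?C * sqrt (prob {e i}) \<and>
     (AE x in S. \<forall>n. sqrt (freq x n (e i)) \<le> H i x)" ..
  have H: "integrable S (H i)" "(\<integral>x. \<bar>H i x\<bar> \<partial>S) \<le> ?C * sqrt (prob {e i})"
    "AE x in S. \<forall>n. sqrt (freq x n (e i)) \<le> H i x" for i
    using spec[OF HH, of i] by blast+
  have Hs: "summable (\<lambda>i. \<integral>x. \<bar>H i x\<bar> \<partial>S)"
    by (rule summable_comparison_test'[OF summable_mult[OF s, of ?C], of 0]) (use H(2) in simp)
  have 1: "AE x in S. \<forall>i. (\<lambda>n. freq x n (e i)) \<longlonglongrightarrow> prob {e i}"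
    unfolding AE_all_countable by (intro allI freq_LLN)
  have 2: "AE x in S. \<forall>i. \<forall>n. sqrt (freq x n (e i)) \<le> H i x"
    by (rule AE_all_countable[THEN iffD2]) (intro allI H(3))
  from 1 2 L1_series(1)[of S H, OF H(1) Hs] show ?thesis
  proof eventually_elim
    case (elim x)
    have "sqrt (freq x n (e i)) \<le> \<bar>H i x\<bar>" for n i using elim(2) abs_ge_self order_trans by blast
    then show ?case using elim by blast
  qed
qed

end

section \<open>Gamma laws and coupled sums of exponential variables\<close>

lemma nn_integral_gamma_scaled:
  fixes b c :: real
  assumes c: "c > 0" and b: "b > 0"
  shows "(\<integral>\<^sup>+x. ennreal (x powr (c - 1) * exp (- (b * x))) * indicator {0<..} x \<partial>lborel) = ennreal (Gamma c * b powr (- c))"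
proof -
  let ?g = "\<lambda>x::real. ennreal (x powr (c - 1) * exp (- x)) * indicator {0<..} x"
  let ?I = "\<integral>\<^sup>+x. ennreal (x powr (c - 1) * exp (- (b * x))) * indicator {0<..} x \<partial>lborel"
  have gm: "?g \<in> borel_measurable borel" by measurable
  have "(\<integral>\<^sup>+x. ennreal (x powr (c - 1) / exp x) * indicator {0..} x \<partial>lborel) = ennreal (Gamma c)"
    by (rule nn_integral_has_integral_lebesgue'[OF _ Gamma_integral_real[OF c]]) simp
  also have "(\<integral>\<^sup>+x. ennreal (x powr (c - 1) / exp x) * indicator {0..} x \<partial>lborel) = (\<integral>\<^sup>+x. ?g x \<partial>lborel)"
    by (intro nn_integral_cong) (auto simp: indicator_def exp_minus field_simps)
  finally have 1: "(\<integral>\<^sup>+x. ?g x \<partial>lborel) = ennreal (Gamma c)" .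
  have "(\<integral>\<^sup>+x. ?g x \<partial>lborel) = ennreal \<bar>b\<bar> * (\<integral>\<^sup>+x. ?g (0 + b * x) \<partial>lborel)"
    by (rule nn_integral_real_affine[OF gm]) (use b in simp)
  also have "(\<integral>\<^sup>+x. ?g (0 + b * x) \<partial>lborel) =
      (\<integral>\<^sup>+x. ennreal (b powr (c - 1)) * (ennreal (x powr (c - 1) * exp (- (b * x))) * indicator {0<..} x) \<partial>lborel)"
    using b by (intro nn_integral_cong)
      (auto simp: indicator_def zero_less_mult_iff powr_mult ennreal_mult'[symmetric] mult.assoc)
  also have "\<dots> = ennreal (b powr (c - 1)) * ?I" by (rule nn_integral_cmult) measurable
  finally have "ennreal (Gamma c) = ennreal \<bar>b\<bar> * (ennreal (b powr (c - 1)) * ?I)" unfolding 1 .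
  also have "\<dots> = ennreal (b * b powr (c - 1)) * ?I"
    using b by (simp add: ennreal_mult mult.assoc)
  also have "b * b powr (c - 1) = b powr c" using b by (simp add: powr_diff)
  finally have 2: "ennreal (Gamma c) = ennreal (b powr c) * ?I" .
  have "ennreal (Gamma c * b powr (- c)) = ennreal (b powr (- c)) * ennreal (Gamma c)"
    using Gamma_real_pos[OF c] by (simp add: ennreal_mult mult.commute)
  also have "\<dots> = ennreal (b powr (- c)) * ennreal (b powr c) * ?I" unfolding 2 by (simp add: mult.assoc)
  also have "ennreal (b powr (- c)) * ennreal (b powr c) = 1"
    using b by (simp add: ennreal_mult'[symmetric] powr_minus)
  finally show ?thesis by simp
qed

definition gamma_density :: "real \<Rightarrow> real \<Rightarrow> real" where
  "gamma_density c x = (if x > 0 then x powr (c - 1) * exp (- x) / Gamma c else 0)"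

text \<open>Parameter \<open>0\<close> gives the point mass at \<open>0\<close>; it occurs for points that carry no mass of \<open>\<alpha>\<close>.\<close>

definition gamma_law :: "real \<Rightarrow> real measure" where
  "gamma_law c = (if c = 0 then return borel 0 else density lborel (\<lambda>x. ennreal (gamma_density c x)))"

lemma gamma_density_measurable [measurable]: "gamma_density c \<in> borel_measurable borel"
  unfolding gamma_density_def by measurable

lemma sets_gamma_law [simp, measurable_cong]: "sets (gamma_law c) = sets borel"
  by (simp add: gamma_law_def)

lemma space_gamma_law [simp]: "space (gamma_law c) = UNIV"
  by (simp add: gamma_law_def)

lemma AE_gamma_law_pos:
  assumes "c > 0" shows "AE x in gamma_law c. x > 0"
proof -
  have "AE x in density lborel (\<lambda>x. ennreal (gamma_density c x)). x > 0"
    by (subst AE_density) (auto simp: gamma_density_def split: if_splits)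
  moreover have "gamma_law c = density lborel (\<lambda>x. ennreal (gamma_density c x))" using assms by (simp add: gamma_law_def)
  ultimately show ?thesis by (simp only:)
qed

lemma gamma_law_powr_exp:
  assumes c: "c > 0" and k: "k \<ge> 0" and s: "s \<ge> 0"
    and f: "f \<in> borel_measurable borel" "\<And>x. x > 0 \<Longrightarrow> f x = x powr k * exp (- (s * x))"
  shows "has_bochner_integral (gamma_law c) f (Gamma (c + k) / Gamma c * (1 + s) powr (- (c + k)))"
proof (rule has_bochner_integral_nn_integral)
  show "f \<in> borel_measurable (gamma_law c)" using f(1) by simp
  show "AE x in gamma_law c. 0 \<le> f x" using AE_gamma_law_pos[OF c] by eventually_elim (simp add: f)
  show "0 \<le> Gamma (c + k) / Gamma c * (1 + s) powr (- (c + k))"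
    using c k Gamma_real_pos[of c] Gamma_real_pos[of "c + k"] by simp
  have "(\<integral>\<^sup>+x. ennreal (f x) \<partial>gamma_law c) = (\<integral>\<^sup>+x. ennreal (gamma_density c x) * ennreal (f x) \<partial>lborel)"
    using c f(1) by (simp add: gamma_law_def nn_integral_density)
  also have "\<dots> = (\<integral>\<^sup>+x. ennreal (1 / Gamma c) * (ennreal (x powr ((c + k) - 1) * exp (- ((1 + s) * x))) * indicator {0<..} x) \<partial>lborel)"
  proof (rule nn_integral_cong)
    fix x :: real
    show "ennreal (gamma_density c x) * ennreal (f x) =
      ennreal (1 / Gamma c) * (ennreal (x powr ((c + k) - 1) * exp (- ((1 + s) * x))) * indicator {0<..} x)"
    proof (cases "x > 0")
      case True
      have "gamma_density c x * f x = 1 / Gamma c * (x powr ((c + k) - 1) * exp (- ((1 + s) * x)))"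
      proof -
        have "x powr ((c + k) - 1) = x powr (c - 1) * x powr k"
          by (simp add: powr_add[symmetric] algebra_simps)
        moreover have "exp (- ((1 + s) * x)) = exp (- x) * exp (- (s * x))"
          by (simp add: exp_add[symmetric] algebra_simps)
        ultimately show ?thesis using True by (simp add: gamma_density_def f)
      qed
      moreover have "gamma_density c x \<ge> 0" using True Gamma_real_pos[OF c] by (simp add: gamma_density_def)
      moreover have "1 / Gamma c \<ge> 0" using Gamma_real_pos[OF c] by simp
      ultimately show ?thesis using True by (simp add: ennreal_mult'[symmetric])
    qed (simp add: gamma_density_def)
  qed
  also have "\<dots> = ennreal (1 / Gamma c) * ennreal (Gamma (c + k) * (1 + s) powr (- (c + k)))"
    using nn_integral_gamma_scaled[of "c + k" "1 + s"] c k s by (subst nn_integral_cmult) auto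
  also have "\<dots> = ennreal (Gamma (c + k) / Gamma c * (1 + s) powr (- (c + k)))"
    using Gamma_real_pos[OF c] by (simp add: ennreal_mult'[symmetric])
  finally show "(\<integral>\<^sup>+x. ennreal (f x) \<partial>gamma_law c) = ennreal (Gamma (c + k) / Gamma c * (1 + s) powr (- (c + k)))" .
qed

lemma prob_space_gamma_law:
  assumes "c \<ge> 0" shows "prob_space (gamma_law c)"
proof (cases "c = 0")
  case True then show ?thesis by (simp add: gamma_law_def prob_space_return)
next
  case False
  then have c: "c > 0" using assms by simp
  have h: "has_bochner_integral (gamma_law c) (\<lambda>_. 1) (Gamma (c + 0) / Gamma c * (1 + 0) powr (- (c + 0)))"
    by (rule gamma_law_powr_exp[OF c]) auto
  then have i: "integrable (gamma_law c) (\<lambda>_. 1::real)" and e: "(\<integral>x. 1 \<partial>gamma_law c) = (1::real)"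
    using Gamma_real_pos[OF c] by (auto simp: has_bochner_integral_iff)
  have "emeasure (gamma_law c) UNIV = (\<integral>\<^sup>+x. ennreal 1 \<partial>gamma_law c)" by simp
  also have "\<dots> = ennreal (\<integral>x. 1 \<partial>gamma_law c)" by (rule nn_integral_eq_integral[OF i]) simp
  also have "\<dots> = 1" unfolding e by simp
  finally show ?thesis by (intro prob_spaceI) simp
qed

lemma AE_gamma_law_nonneg:
  assumes "c \<ge> 0" shows "AE x in gamma_law c. x \<ge> 0"
proof (cases "c = 0")
  case True
  have "AE x in return borel (0::real). x \<ge> 0" by (subst AE_return) auto
  moreover have "gamma_law c = return borel 0" using True by (simp add: gamma_law_def)
  ultimately show ?thesis by (simp only:)
next
  case False
  then have "c > 0" using assms by simp
  from AE_gamma_law_pos[OF this] show ?thesis by eventually_elim simp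
qed

lemma gamma_law_laplace:
  assumes c: "c \<ge> 0" and s: "s \<ge> 0"
  shows "integrable (gamma_law c) (\<lambda>x. exp (- (s * x)))" "(\<integral>x. exp (- (s * x)) \<partial>gamma_law c) = (1 + s) powr (- c)"
proof -
  have "has_bochner_integral (gamma_law c) (\<lambda>x. exp (- (s * x))) ((1 + s) powr (- c))"
  proof (cases "c = 0")
    case True
    interpret prob_space "return borel (0::real)" by (rule prob_space_return) simp
    have "integrable (return borel (0::real)) (\<lambda>x. exp (- (s * x)))"
      by (rule integrable_cong_AE_imp[where g="\<lambda>_. 1"]) (auto simp: AE_return)
    moreover have "(\<integral>x. exp (- (s * x)) \<partial>return borel (0::real)) = 1" by (subst integral_return) auto
    ultimately show ?thesis using True s by (simp add: gamma_law_def has_bochner_integral_iff)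
  next
    case False
    then have c: "c > 0" using assms by simp
    have "has_bochner_integral (gamma_law c) (\<lambda>x. exp (- (s * x))) (Gamma (c + 0) / Gamma c * (1 + s) powr (- (c + 0)))"
      by (rule gamma_law_powr_exp[OF c _ s]) auto
    then show ?thesis using Gamma_real_pos[OF c] by simp
  qed
  then show "integrable (gamma_law c) (\<lambda>x. exp (- (s * x)))" "(\<integral>x. exp (- (s * x)) \<partial>gamma_law c) = (1 + s) powr (- c)"
    by (auto simp: has_bochner_integral_iff)
qed

lemma gamma_law_mean:
  assumes c: "c \<ge> 0"
  shows "integrable (gamma_law c) (\<lambda>x. x)" "(\<integral>x. x \<partial>gamma_law c) = c"
proof -
  have "has_bochner_integral (gamma_law c) (\<lambda>x. x) c"
  proof (cases "c = 0")
    case True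
    interpret prob_space "return borel (0::real)" by (rule prob_space_return) simp
    have "integrable (return borel (0::real)) (\<lambda>x. x)"
      by (rule integrable_cong_AE_imp[where g="\<lambda>_. 0"]) (auto simp: AE_return)
    moreover have "(\<integral>x. x \<partial>return borel (0::real)) = 0" by (subst integral_return) auto
    ultimately show ?thesis using True by (simp add: gamma_law_def has_bochner_integral_iff)
  next
    case False
    then have c: "c > 0" using assms by simp
    have "has_bochner_integral (gamma_law c) (\<lambda>x. x) (Gamma (c + 1) / Gamma c * (1 + 0) powr (- (c + 1)))"
      by (rule gamma_law_powr_exp[OF c]) auto
    moreover have "Gamma (c + 1) = c * Gamma c" using c by (intro Gamma_plus1) (auto elim: nonpos_Ints_cases)
    ultimately show ?thesis using Gamma_real_pos[OF c] by simp
  qed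
  then show "integrable (gamma_law c) (\<lambda>x. x)" "(\<integral>x. x \<partial>gamma_law c) = c"
    by (auto simp: has_bochner_integral_iff)
qed

lemma gamma_law_1_variance:
  "integrable (gamma_law 1) (\<lambda>x. (x - 1)\<^sup>2)" "(\<integral>x. (x - 1)\<^sup>2 \<partial>gamma_law 1) = 1" "(\<integral>x. x - 1 \<partial>gamma_law 1) = 0"
proof -
  interpret prob_space "gamma_law 1" by (rule prob_space_gamma_law) simp
  have "has_bochner_integral (gamma_law 1) (\<lambda>x. x\<^sup>2) (Gamma (1 + 2) / Gamma 1 * (1 + 0) powr (- (1 + 2)))"
    by (rule gamma_law_powr_exp) (auto simp: powr_numeral)
  moreover have "Gamma (1 + 2 :: real) = 2"
    using Gamma_fact[of 2, where 'a=real] by (simp add: numeral_2_eq_2)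
  ultimately have h: "integrable (gamma_law 1) (\<lambda>x. x\<^sup>2)" "(\<integral>x. x\<^sup>2 \<partial>gamma_law 1) = 2"
    by (auto simp: has_bochner_integral_iff)
  note m = gamma_law_mean[of 1]
  have e: "(x - 1)\<^sup>2 = x\<^sup>2 - 2 * x + 1" for x :: real by (simp add: power2_eq_square algebra_simps)
  show "integrable (gamma_law 1) (\<lambda>x. (x - 1)\<^sup>2)" unfolding e using h m by simp
  show "(\<integral>x. (x - 1)\<^sup>2 \<partial>gamma_law 1) = 1" unfolding e using h m prob_space by simp
  show "(\<integral>x. x - 1 \<partial>gamma_law 1) = 0" using m prob_space by simp
qed

text \<open>Bounded second moments give uniform integrability: \<open>\<bar>d\<bar> \<le> min \<bar>d\<bar> K + d\<^sup>2 / K\<close>, where the first term is handled by dominated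
  convergence and the second is small for large \<open>K\<close>.\<close>

lemma L1_convergence_of_L2_bounded:
  fixes X :: "nat \<Rightarrow> 'w \<Rightarrow> real"
  assumes "prob_space N" and [measurable]: "\<And>n. X n \<in> borel_measurable N" "Y \<in> borel_measurable N"
    and lim: "AE \<omega> in N. (\<lambda>n. X n \<omega>) \<longlonglongrightarrow> Y \<omega>"
    and X2: "\<And>n. integrable N (\<lambda>\<omega>. (X n \<omega>)\<^sup>2)" "\<And>n. (\<integral>\<omega>. (X n \<omega>)\<^sup>2 \<partial>N) \<le> B"
    and Y2: "integrable N (\<lambda>\<omega>. (Y \<omega>)\<^sup>2)"
  shows "(\<lambda>n. \<integral>\<omega>. \<bar>X n \<omega> - Y \<omega>\<bar> \<partial>N) \<longlonglongrightarrow> 0"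
proof -
  interpret prob_space N by fact
  define C where "C = 2 * B + 2 * (\<integral>\<omega>. (Y \<omega>)\<^sup>2 \<partial>N)"
  let ?D = "\<lambda>n \<omega>. \<bar>X n \<omega> - Y \<omega>\<bar>"
  have sq: "(x - y)\<^sup>2 \<le> 2 * x\<^sup>2 + 2 * y\<^sup>2" for x y :: real
  proof -
    have "0 \<le> (x + y)\<^sup>2" by simp
    then show ?thesis by (simp add: power2_eq_square algebra_simps)
  qed
  have D2: "integrable N (\<lambda>\<omega>. (X n \<omega> - Y \<omega>)\<^sup>2)" for n
    by (rule Bochner_Integration.integrable_bound[where f="\<lambda>\<omega>. 2 * (X n \<omega>)\<^sup>2 + 2 * (Y \<omega>)\<^sup>2"])
       (use X2 Y2 sq in \<open>auto intro!: AE_I2\<close>)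
  have D2b: "(\<integral>\<omega>. (X n \<omega> - Y \<omega>)\<^sup>2 \<partial>N) \<le> C" for n
  proof -
    have "(\<integral>\<omega>. (X n \<omega> - Y \<omega>)\<^sup>2 \<partial>N) \<le> (\<integral>\<omega>. 2 * (X n \<omega>)\<^sup>2 + 2 * (Y \<omega>)\<^sup>2 \<partial>N)"
      by (rule integral_mono[OF D2]) (use X2 Y2 sq in auto)
    also have "\<dots> = 2 * (\<integral>\<omega>. (X n \<omega>)\<^sup>2 \<partial>N) + 2 * (\<integral>\<omega>. (Y \<omega>)\<^sup>2 \<partial>N)" using X2 Y2 by simp
    also have "\<dots> \<le> C" using X2(2)[of n] by (simp add: C_def)
    finally show ?thesis .
  qed
  have C0: "C \<ge> 0" by (rule order_trans[OF _ D2b[of 0]]) simp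
  have Di: "integrable N (?D n)" for n
    using square_integrable_imp_integrable[OF _ D2[of n]] by simp
  have min0: "(\<lambda>n. \<integral>\<omega>. min (?D n \<omega>) K \<partial>N) \<longlonglongrightarrow> 0" if "K > 0" for K
  proof -
    have "(\<lambda>n. \<integral>\<omega>. min (?D n \<omega>) K \<partial>N) \<longlonglongrightarrow> (\<integral>\<omega>. 0 \<partial>N)"
    proof (rule integral_dominated_convergence[where w="\<lambda>_. K"])
      show "AE \<omega> in N. (\<lambda>n. min (?D n \<omega>) K) \<longlonglongrightarrow> 0"
        using lim
      proof eventually_elim
        case (elim \<omega>)
        have "(\<lambda>n. ?D n \<omega>) \<longlonglongrightarrow> 0" using tendsto_rabs[OF tendsto_diff[OF elim tendsto_const[of "Y \<omega>"]]] by simp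
        from tendsto_min[OF this tendsto_const[of K]] show ?case using that by simp
      qed
    qed (use that in \<open>auto intro!: AE_I2\<close>)
    then show ?thesis by simp
  qed
  have split: "(\<integral>\<omega>. ?D n \<omega> \<partial>N) \<le> (\<integral>\<omega>. min (?D n \<omega>) K \<partial>N) + C / K" if K: "K > 0" for n K
  proof -
    have mi: "integrable N (\<lambda>\<omega>. min (?D n \<omega>) K)" using Di by simp
    have "(\<integral>\<omega>. ?D n \<omega> \<partial>N) \<le> (\<integral>\<omega>. min (?D n \<omega>) K + (X n \<omega> - Y \<omega>)\<^sup>2 / K \<partial>N)"
    proof (rule integral_mono[OF Di])
      show "integrable N (\<lambda>\<omega>. min (?D n \<omega>) K + (X n \<omega> - Y \<omega>)\<^sup>2 / K)" using mi D2 by simp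
      fix \<omega>
      show "?D n \<omega> \<le> min (?D n \<omega>) K + (X n \<omega> - Y \<omega>)\<^sup>2 / K"
      proof (cases "?D n \<omega> \<le> K")
        case True then show ?thesis using K by simp
      next
        case False
        then have "K * ?D n \<omega> \<le> ?D n \<omega> * ?D n \<omega>" by (intro mult_right_mono) auto
        also have "\<dots> = (X n \<omega> - Y \<omega>)\<^sup>2" by (simp add: power2_eq_square)
        finally have "?D n \<omega> \<le> (X n \<omega> - Y \<omega>)\<^sup>2 / K" using K by (simp add: field_simps)
        then show ?thesis using K False by simp
      qed
    qed
    also have "\<dots> = (\<integral>\<omega>. min (?D n \<omega>) K \<partial>N) + (\<integral>\<omega>. (X n \<omega> - Y \<omega>)\<^sup>2 \<partial>N) / K" using mi D2 by simp
    also have "\<dots> \<le> (\<integral>\<omega>. min (?D n \<omega>) K \<partial>N) + C / K" using D2b[of n] K by (simp add: divide_right_mono)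
    finally show ?thesis .
  qed
  show ?thesis
  proof (rule LIMSEQ_I)
    fix \<epsilon> :: real assume \<epsilon>: "0 < \<epsilon>"
    define K where "K = 2 * (C + 1) / \<epsilon>"
    have K: "K > 0" "C / K < \<epsilon> / 2"
    proof -
      show "K > 0" using \<epsilon> C0 by (simp add: K_def)
      then show "C / K < \<epsilon> / 2" using \<epsilon> C0 by (simp add: K_def field_simps)
    qed
    obtain n0 where n0: "\<And>n. n \<ge> n0 \<Longrightarrow> norm ((\<integral>\<omega>. min (?D n \<omega>) K \<partial>N) - 0) < \<epsilon> / 2"
      using LIMSEQ_D[OF min0[OF K(1)], of "\<epsilon> / 2"] \<epsilon> by auto
    have "norm ((\<integral>\<omega>. ?D n \<omega> \<partial>N) - 0) < \<epsilon>" if "n \<ge> n0" for n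
    proof -
      have "0 \<le> (\<integral>\<omega>. ?D n \<omega> \<partial>N)" by simp
      then have "norm ((\<integral>\<omega>. ?D n \<omega> \<partial>N) - 0) = (\<integral>\<omega>. ?D n \<omega> \<partial>N)" by simp
      moreover have "(\<integral>\<omega>. min (?D n \<omega>) K \<partial>N) < \<epsilon> / 2" using n0[OF that] by (simp only: real_norm_def diff_0_right)
      ultimately show ?thesis using split[OF K(1), of n] K(2) by linarith
    qed
    then show "\<exists>no. \<forall>n\<ge>no. norm ((\<integral>\<omega>. ?D n \<omega> \<partial>N) - 0) < \<epsilon>" by blast
  qed
qed

text \<open>\<open>k + sqrt k * V k\<close> has the law of a sum of \<open>k\<close> standard exponential variables. The central limit theorem gives convergence in
  law of \<open>V k\<close>, Skorohod's theorem turns it into pointwise convergence on a common space, and the unit variances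
  improve this to convergence in \<open>L\<^sup>1\<close>.\<close>

lemma coupled_exponential_sums:
  obtains \<Omega> :: "real measure" and V :: "nat \<Rightarrow> real \<Rightarrow> real" and Z :: "real \<Rightarrow> real"
  where "prob_space \<Omega>" "\<And>k. V k \<in> borel_measurable \<Omega>" "Z \<in> borel_measurable \<Omega>"
    "distr \<Omega> borel Z = std_normal_distribution"
    "\<And>k \<omega>. - sqrt (real k) \<le> V k \<omega>"
    "\<And>k s. s \<ge> 0 \<Longrightarrow> (\<integral>\<omega>. exp (- (s * (real k + sqrt (real k) * V k \<omega>))) \<partial>\<Omega>) = (1 + s) powr (- real k)"
    "\<And>k. integrable \<Omega> (V k)" "\<And>k. (\<integral>\<omega>. \<bar>V k \<omega>\<bar> \<partial>\<Omega>) \<le> 1"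
    "integrable \<Omega> Z"
    "(\<lambda>k. \<integral>\<omega>. \<bar>V k \<omega> - Z \<omega>\<bar> \<partial>\<Omega>) \<longlonglongrightarrow> 0"
proof -
  have g1: "prob_space (gamma_law 1)" by (rule prob_space_gamma_law) simp
  let ?E = "\<Pi>\<^sub>M j\<in>(UNIV::nat set). gamma_law 1"
  interpret E: prob_space ?E by (rule prob_space_PiM) (rule g1)
  define S where "S k \<omega> = (\<Sum>j<k. \<omega> j - 1)" for k :: nat and \<omega> :: "nat \<Rightarrow> real"
  have coord: "(\<lambda>\<omega>. \<omega> j) \<in> borel_measurable ?E" for j
  proof -
    have "(\<lambda>\<omega>. \<omega> j) \<in> ?E \<rightarrow>\<^sub>M gamma_law 1" by simp
    then show ?thesis by simp
  qed
  have Sm [measurable]: "S k \<in> borel_measurable ?E" for k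
    unfolding S_def by (intro borel_measurable_sum borel_measurable_diff coord borel_measurable_const)
  have fm: "(\<lambda>x. x - 1) \<in> borel_measurable (gamma_law 1)" by measurable
  have sqm: "(\<lambda>x. (x - 1)\<^sup>2) \<in> borel_measurable (gamma_law 1)" by measurable
  note var = gamma_law_1_variance
  define \<mu> where "\<mu> k = distr ?E borel (\<lambda>\<omega>. S k \<omega> / sqrt (real k))" for k
  have \<mu>_rd: "real_distribution (\<mu> k)" for k unfolding \<mu>_def by (rule E.real_distribution_distr) measurable
  have mean0: "(\<integral>\<omega>. \<omega> n - 1 \<partial>?E) = 0" for n :: nat
    using PiM_coordinate_integral(1)[where M="\<lambda>_. gamma_law 1" and f="\<lambda>x. x - 1" and i=n, OF g1 fm] var(3) by simp
  have wc: "weak_conv_m (\<lambda>n. distr ?E borel (\<lambda>\<omega>. (\<Sum>i<n. \<omega> i - 1) / sqrt (real n * 1\<^sup>2))) std_normal_distribution"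
  proof (rule E.central_limit_theorem_zero_mean[where X="\<lambda>i \<omega>. \<omega> i - 1" and \<mu>="distr (gamma_law 1) borel (\<lambda>x. x - 1)"])
    show "E.indep_vars (\<lambda>i. borel) (\<lambda>i \<omega>. \<omega> i - 1) UNIV"
      by (rule PiM_coordinates_indep[where X="\<lambda>_ x. x - 1", OF g1 fm])
    show "integrable ?E (\<lambda>\<omega>. (\<omega> n - 1)\<^sup>2)" for n
      using PiM_coordinate_integral(2)[where M="\<lambda>_. gamma_law 1" and f="\<lambda>x. (x - 1)\<^sup>2" and i=n, OF g1 sqm] var(1) by simp
    show "E.variance (\<lambda>\<omega>. \<omega> n - 1) = 1\<^sup>2" for n
      unfolding mean0
      using PiM_coordinate_integral(1)[where M="\<lambda>_. gamma_law 1" and f="\<lambda>x. (x - 1)\<^sup>2" and i=n, OF g1 sqm] var(2) by simp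
    show "distr ?E borel (\<lambda>\<omega>. \<omega> n - 1) = distr (gamma_law 1) borel (\<lambda>x. x - 1)" for n
    proof -
      have "distr ?E (gamma_law 1) (\<lambda>\<omega>. \<omega> n) = gamma_law 1" by (rule distr_PiM_component) (auto intro: g1)
      then have "distr (gamma_law 1) borel (\<lambda>x. x - 1) = distr (distr ?E (gamma_law 1) (\<lambda>\<omega>. \<omega> n)) borel (\<lambda>x. x - 1)" by simp
      also have "\<dots> = distr ?E borel (\<lambda>\<omega>. \<omega> n - 1)"
        by (subst distr_distr) (auto simp: comp_def)
      finally show ?thesis by simp
    qed
  qed (auto simp: mean0)
  then have wc: "weak_conv_m \<mu> std_normal_distribution" unfolding \<mu>_def[abs_def] S_def by simp
  obtain \<Omega> :: "real measure" and Y :: "nat \<Rightarrow> real \<Rightarrow> real" and Z :: "real \<Rightarrow> real" where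
    \<Omega>: "prob_space \<Omega>" and Ym': "\<forall>n. Y n \<in> borel_measurable \<Omega>" and Yd': "\<forall>n. distr \<Omega> borel (Y n) = \<mu> n"
    and Zm: "Z \<in> measurable \<Omega> lborel" and Zd: "distr \<Omega> borel Z = std_normal_distribution"
    and YZ: "\<forall>x\<in>space \<Omega>. (\<lambda>n. Y n x) \<longlonglongrightarrow> Z x"
    using Skorohod[OF \<mu>_rd real_dist_normal_dist wc] by (elim exE conjE) (rule that)
  interpret \<Omega>: prob_space \<Omega> by (rule \<Omega>)
  have Ym [measurable]: "Y n \<in> borel_measurable \<Omega>" for n using Ym' by simp
  have Yd: "distr \<Omega> borel (Y n) = \<mu> n" for n using Yd' by simp
  have Zm' [measurable]: "Z \<in> borel_measurable \<Omega>" using Zm by simp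
  \<comment> \<open>The sums are nonnegative only almost surely; the maximum enforces the lower bound at every point.\<close>
  define V where "V k \<omega> = max (Y k \<omega>) (- sqrt (real k))" for k \<omega>
  have Vm [measurable]: "V k \<in> borel_measurable \<Omega>" for k unfolding V_def by measurable
  have pos: "AE \<omega> in ?E. \<forall>j. \<omega> j \<ge> 0"
    unfolding AE_all_countable
    by (intro allI AE_PiM_component g1 AE_gamma_law_nonneg) auto
  have Slow: "AE \<omega> in ?E. max (S k \<omega> / sqrt (real k)) (- sqrt (real k)) = S k \<omega> / sqrt (real k)" for k
    using pos
  proof eventually_elim
    case (elim \<omega>)
    have "S k \<omega> \<ge> (\<Sum>j<k. - 1)" unfolding S_def by (intro sum_mono) (simp add: elim)
    then have "- real k / sqrt (real k) \<le> S k \<omega> / sqrt (real k)" by (intro divide_right_mono) auto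
    then show ?case by (simp add: real_div_sqrt max_absorb1)
  qed
  have VE: "(\<integral>\<omega>. g (V k \<omega>) \<partial>\<Omega>) = (\<integral>\<omega>. g (S k \<omega> / sqrt (real k)) \<partial>?E)"
    "integrable \<Omega> (\<lambda>\<omega>. g (V k \<omega>)) \<longleftrightarrow> integrable ?E (\<lambda>\<omega>. g (S k \<omega> / sqrt (real k)))"
    if [measurable]: "g \<in> borel_measurable borel" for g :: "real \<Rightarrow> real" and k
  proof -
    let ?h = "\<lambda>y. g (max y (- sqrt (real k)))"
    have hm [measurable]: "?h \<in> borel_measurable borel" by measurable
    have qm: "(\<lambda>\<omega>. S k \<omega> / sqrt (real k)) \<in> borel_measurable ?E" by measurable
    have ae: "AE \<omega> in ?E. ?h (S k \<omega> / sqrt (real k)) = g (S k \<omega> / sqrt (real k))"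
      using Slow[of k] by eventually_elim simp
    have "(\<integral>\<omega>. g (V k \<omega>) \<partial>\<Omega>) = (\<integral>y. ?h y \<partial>distr \<Omega> borel (Y k))"
      unfolding V_def by (rule integral_distr[OF Ym hm, symmetric])
    also have "\<dots> = (\<integral>\<omega>. ?h (S k \<omega> / sqrt (real k)) \<partial>?E)"
      unfolding Yd \<mu>_def by (rule integral_distr[OF qm hm])
    also have "\<dots> = (\<integral>\<omega>. g (S k \<omega> / sqrt (real k)) \<partial>?E)" by (rule integral_cong_AE[OF _ _ ae]) measurable
    finally show "(\<integral>\<omega>. g (V k \<omega>) \<partial>\<Omega>) = (\<integral>\<omega>. g (S k \<omega> / sqrt (real k)) \<partial>?E)" .
    have "integrable \<Omega> (\<lambda>\<omega>. g (V k \<omega>)) \<longleftrightarrow> integrable (distr \<Omega> borel (Y k)) ?h"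
      unfolding V_def by (rule integrable_distr_eq[OF Ym hm, symmetric])
    also have "\<dots> \<longleftrightarrow> integrable ?E (\<lambda>\<omega>. ?h (S k \<omega> / sqrt (real k)))"
      unfolding Yd \<mu>_def by (rule integrable_distr_eq[OF qm hm])
    also have "\<dots> \<longleftrightarrow> integrable ?E (\<lambda>\<omega>. g (S k \<omega> / sqrt (real k)))" by (rule integrable_cong_AE[OF _ _ ae]) measurable
    finally show "integrable \<Omega> (\<lambda>\<omega>. g (V k \<omega>)) \<longleftrightarrow> integrable ?E (\<lambda>\<omega>. g (S k \<omega> / sqrt (real k)))" .
  qed
  have m2: "(\<integral>\<omega>. (S k \<omega>)\<^sup>2 \<partial>?E) = real k" "integrable ?E (\<lambda>\<omega>. (S k \<omega>)\<^sup>2)" for k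
    using iid_sum_second_moment[OF g1 fm var(1,3), of k] var(2) unfolding S_def by auto
  have sqb: "(\<lambda>y::real. y\<^sup>2) \<in> borel_measurable borel" by measurable
  have V2i: "integrable \<Omega> (\<lambda>\<omega>. (V k \<omega>)\<^sup>2)" for k
    unfolding VE(2)[OF sqb] power_divide using m2 by simp
  have V2: "(\<integral>\<omega>. (V k \<omega>)\<^sup>2 \<partial>\<Omega>) \<le> 1" for k
    unfolding VE(1)[OF sqb] power_divide using m2 by simp
  have Z2: "integrable \<Omega> (\<lambda>\<omega>. (Z \<omega>)\<^sup>2)"
    using std_normal_moments(3) unfolding Zd[symmetric] distr_moments(2)[OF Zm'] .
  have VZ: "(\<lambda>k. V k \<omega>) \<longlonglongrightarrow> Z \<omega>" if "\<omega> \<in> space \<Omega>" for \<omega>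
  proof (rule Lim_transform_eventually)
    show Yl: "(\<lambda>n. Y n \<omega>) \<longlonglongrightarrow> Z \<omega>" using YZ that by simp
    have "\<forall>\<^sub>F n in sequentially. Y n \<omega> > Z \<omega> - 1" using order_tendstoD(1)[OF Yl, of "Z \<omega> - 1"] by simp
    moreover have "\<forall>\<^sub>F n in sequentially. sqrt (real n) \<ge> 1 - Z \<omega>"
      using filterlim_compose[OF sqrt_at_top filterlim_real_sequentially] unfolding filterlim_at_top by blast
    ultimately show "\<forall>\<^sub>F n in sequentially. Y n \<omega> = V n \<omega>"
      by eventually_elim (simp add: V_def max_def)
  qed
  have laplace: "(\<integral>\<omega>. exp (- (s * (real k + sqrt (real k) * V k \<omega>))) \<partial>\<Omega>) = (1 + s) powr (- real k)" if s: "s \<ge> 0" for k s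
  proof -
    let ?g = "\<lambda>y. exp (- (s * (real k + sqrt (real k) * y)))"
    have gm: "?g \<in> borel_measurable borel" by measurable
    have "(\<integral>\<omega>. ?g (V k \<omega>) \<partial>\<Omega>) = (\<integral>\<omega>. ?g (S k \<omega> / sqrt (real k)) \<partial>?E)" by (rule VE(1)[OF gm])
    also have "\<dots> = (\<integral>\<omega>. (\<Prod>j<k. exp (- (s * \<omega> j))) \<partial>?E)"
    proof (rule Bochner_Integration.integral_cong[OF refl])
      fix \<omega> :: "nat \<Rightarrow> real"
      have "real k + sqrt (real k) * (S k \<omega> / sqrt (real k)) = (\<Sum>j<k. \<omega> j)"
        by (cases "k = 0") (simp_all add: S_def sum_subtractf)
      then show "?g (S k \<omega> / sqrt (real k)) = (\<Prod>j<k. exp (- (s * \<omega> j)))"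
        by (simp add: exp_sum[symmetric] sum_distrib_left sum_negf)
    qed
    also have "\<dots> = (\<Prod>j<k. \<integral>x. exp (- (s * x)) \<partial>gamma_law 1)"
      by (rule PiM_coordinates_prod(1)) (auto intro: g1 gamma_law_laplace(1)[OF _ s])
    also have "\<dots> = ((1 + s) powr (- 1)) ^ k" using gamma_law_laplace(2)[OF _ s, of 1] by simp
    also have "\<dots> = (1 + s) powr (- real k)" using s by (simp add: powr_powr[symmetric] powr_realpow[symmetric] powr_minus power_inverse)
    finally show ?thesis .
  qed
  note V1 = expectation_abs_le_sqrt_second_moment[OF \<Omega> V2i Vm]
  show thesis
  proof (rule that[of \<Omega> V Z])
    show "- sqrt (real k) \<le> V k \<omega>" for k \<omega> by (simp add: V_def)
    show "(\<integral>\<omega>. \<bar>V k \<omega>\<bar> \<partial>\<Omega>) \<le> 1" for k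
      by (rule order_trans[OF V1(2)]) (use V2[of k] in simp)
    show "integrable \<Omega> Z" by (rule expectation_abs_le_sqrt_second_moment(1)[OF \<Omega> Z2 Zm'])
    show "(\<lambda>k. \<integral>\<omega>. \<bar>V k \<omega> - Z \<omega>\<bar> \<partial>\<Omega>) \<longlonglongrightarrow> 0"
      by (rule L1_convergence_of_L2_bounded[OF \<Omega> Vm Zm' _ V2i V2 Z2]) (use VZ in \<open>auto intro!: AE_I2\<close>)
  qed (use \<Omega> Vm Zm' Zd laplace V1(1) in auto)
qed

section \<open>Laplace transform of the Dirichlet process\<close>

lemma emeasure_stick_breaking:
  "emeasure (stick_breaking V Y) C = (\<Sum>i. ennreal (stick_weight V i) * indicator C (Y i))"
  "sets (stick_breaking V Y) = UNIV" "space (stick_breaking V Y) = UNIV"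
proof -
  let ?D = "distr (density (count_space (UNIV :: nat set)) (\<lambda>i. ennreal (stick_weight V i))) (count_space UNIV) Y"
  have D: "emeasure ?D C = (\<Sum>i. ennreal (stick_weight V i) * indicator C (Y i))" for C
  proof -
    have "emeasure ?D C = (\<integral>\<^sup>+i. ennreal (stick_weight V i) * indicator (Y -` C) i \<partial>count_space UNIV)"
      by (simp add: emeasure_distr emeasure_density)
    also have "\<dots> = (\<Sum>i. ennreal (stick_weight V i) * indicator (Y -` C) i)"
      by (rule nn_integral_count_space_nat)
    finally show ?thesis by (simp add: indicator_def)
  qed
  have "stick_breaking V Y = measure_of (space ?D) (sets ?D) (emeasure ?D)"
    unfolding stick_breaking_def by (rule arg_cong3[of _ _ _ _ _ _ measure_of]) (simp_all add: D fun_eq_iff)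
  then have eq: "stick_breaking V Y = ?D" by (simp only: measure_of_of_measure)
  show "emeasure (stick_breaking V Y) C = (\<Sum>i. ennreal (stick_weight V i) * indicator C (Y i))"
    unfolding eq by (rule D)
  show "sets (stick_breaking V Y) = UNIV" "space (stick_breaking V Y) = UNIV" unfolding eq by simp_all
qed

lemma sum_stick_weight: "(\<Sum>i<n. stick_weight V i) = 1 - (\<Prod>j<n. 1 - V j)"
  by (induction n) (simp_all add: stick_weight_def algebra_simps)

lemma stick_weight_bounds:
  assumes V: "\<And>i. V i \<in> {0<..<1}"
  shows "0 \<le> stick_weight V i" "(\<Sum>i<n. stick_weight V i) \<le> 1" "summable (stick_weight V)"
    "(\<Sum>i. stick_weight V i) \<le> 1"
proof -
  have pos: "(\<Prod>j<n. 1 - V j) \<ge> 0" for n using V by (intro prod_nonneg) (auto simp: less_imp_le)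
  show w: "0 \<le> stick_weight V i" for i unfolding stick_weight_def using V[of i] pos[of i] by (simp add: less_imp_le)
  show le: "(\<Sum>i<n. stick_weight V i) \<le> 1" for n unfolding sum_stick_weight using pos[of n] by simp
  show s: "summable (stick_weight V)" by (rule summableI_nonneg_bounded[OF w le])
  show "(\<Sum>i. stick_weight V i) \<le> 1" by (rule suminf_le_const[OF s le])
qed

text \<open>Removing the first stick scales all later weights by \<open>1 - v\<close>; this is the source of the recursion below.\<close>

lemma stick_weight_case_nat:
  "stick_weight (case_nat v V) 0 = v" "stick_weight (case_nat v V) (Suc i) = (1 - v) * stick_weight V i"
proof -
  show "stick_weight (case_nat v V) 0 = v" by (simp add: stick_weight_def)
  have "stick_weight (case_nat v V) (Suc i) = V i * ((1 - v) * (\<Prod>j<i. 1 - V j))"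
    unfolding stick_weight_def prod.lessThan_Suc_shift by simp
  then show "stick_weight (case_nat v V) (Suc i) = (1 - v) * stick_weight V i" by (simp add: stick_weight_def)
qed

definition stick_sum :: "('a \<Rightarrow> real) \<Rightarrow> (nat \<Rightarrow> real) \<Rightarrow> (nat \<Rightarrow> 'a) \<Rightarrow> real" where
  "stick_sum g V Y = (\<Sum>i. stick_weight V i * g (Y i))"

lemma stick_sum_props:
  assumes V: "\<And>i. V i \<in> {0<..<1}" and g: "\<And>y. 0 \<le> g y" "\<And>y. g y \<le> B"
  shows "summable (\<lambda>i. stick_weight V i * g (Y i))" "0 \<le> stick_sum g V Y" "stick_sum g V Y \<le> B"
    "stick_sum g (case_nat v V) (case_nat y Y) = v * g y + (1 - v) * stick_sum g V Y"
proof -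
  note w = stick_weight_bounds[where V=V, OF V]
  have B: "B \<ge> 0" using g order_trans by blast
  show s: "summable (\<lambda>i. stick_weight V i * g (Y i))"
    by (rule summable_comparison_test'[OF summable_mult2[where c=B, OF w(3)], of 0])
       (use w(1) g in \<open>auto intro!: mult_left_mono\<close>)
  show "0 \<le> stick_sum g V Y" unfolding stick_sum_def by (rule suminf_nonneg[OF s]) (simp add: w g)
  have "stick_sum g V Y \<le> (\<Sum>i. stick_weight V i * B)"
    unfolding stick_sum_def by (rule suminf_le[OF _ s summable_mult2[where c=B, OF w(3)]]) (intro mult_left_mono g w)
  also have "\<dots> = (\<Sum>i. stick_weight V i) * B" by (rule suminf_mult2[OF w(3), symmetric])
  also have "\<dots> \<le> 1 * B" by (intro mult_right_mono w B)
  finally show "stick_sum g V Y \<le> B" by simp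
  let ?t = "\<lambda>i. stick_weight (case_nat v V) i * g (case_nat y Y i)"
  have tS: "?t (Suc i) = (1 - v) * (stick_weight V i * g (Y i))" for i by (simp add: stick_weight_case_nat)
  have "summable (\<lambda>i. ?t (Suc i))" unfolding tS by (rule summable_mult[OF s])
  then have ts: "summable ?t" by (rule summable_Suc_iff[THEN iffD1])
  have "stick_sum g (case_nat v V) (case_nat y Y) = (\<Sum>i. ?t (Suc i)) + ?t 0"
    unfolding stick_sum_def using suminf_split_head[OF ts] by simp
  also have "(\<Sum>i. ?t (Suc i)) = (1 - v) * stick_sum g V Y"
    unfolding tS stick_sum_def by (rule suminf_mult[OF s])
  finally show "stick_sum g (case_nat v V) (case_nat y Y) = v * g y + (1 - v) * stick_sum g V Y"
    by (simp add: stick_weight_case_nat)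
qed

lemma Beta_1_left: assumes "M > 0" shows "Beta 1 M = 1 / (M::real)"
proof -
  have "M \<notin> \<int>\<^sub>\<le>\<^sub>0" using assms by (auto elim!: nonpos_Ints_cases)
  then have "Gamma (1 + M) = M * Gamma M" using Gamma_plus1[of M] by (simp add: add.commute)
  then show ?thesis using Gamma_real_pos[OF assms] by (simp add: Beta_def)
qed

lemma sets_beta_measure [simp]: "sets (beta_measure a b) = sets (restrict_space lborel {0<..<1})"
  and space_beta_measure [simp]: "space (beta_measure a b) = {0<..<1}"
  by (simp_all add: beta_measure_def space_restrict_space)

text \<open>The integrand has the antiderivative \<open>- (1 / A) * ((1 - v) / w) powr M\<close> with \<open>w = v * A + (1 - v) * B\<close>. The
  exponent \<open>M + 1\<close> is the one for which the integral splits into a function of \<open>A\<close> times a function of \<open>B\<close>.\<close>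

lemma beta_stick_has_integral:
  fixes A B M :: real
  assumes M: "M > 0" and A: "A > 0" and B: "B > 0"
  shows "((\<lambda>v. M * (1 - v) powr (M - 1) * (v * A + (1 - v) * B) powr (- (M + 1))) has_integral
    (1 / A * B powr (- M))) {0<..<1}"
proof -
  let ?w = "\<lambda>v. v * A + (1 - v) * B"
  let ?F = "\<lambda>v. - (1 / A) * ((1 - v) powr M * ?w v powr (- M))"
  have w: "?w v > 0" if "v \<in> {0..1}" for v
  proof (cases "v = 0")
    case False
    then have "v * A > 0" "(1 - v) * B \<ge> 0" using that A B by auto
    then show ?thesis by simp
  qed (use B in simp)
  have "((\<lambda>v. M * (1 - v) powr (M - 1) * ?w v powr (- (M + 1))) has_integral (?F 1 - ?F 0)) {0..1}"
  proof (rule fundamental_theorem_of_calculus_interior)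
    show "continuous_on {0..1} ?F"
    proof -
      have c1: "continuous_on {0..1} (\<lambda>v. (1 - v) powr M)"
        by (rule continuous_on_powr') (use M in \<open>auto intro!: continuous_intros\<close>)
      have c2: "continuous_on {0..1} (\<lambda>v. ?w v powr (- M))"
        by (rule continuous_on_powr) (use w in \<open>auto intro!: continuous_intros simp: less_imp_neq[symmetric]\<close>)
      show ?thesis by (intro continuous_on_mult continuous_on_const c1 c2)
    qed
    fix v :: real assume v: "v \<in> {0<..<1}"
    have wv: "?w v > 0" using w[of v] v by simp
    have D1: "((\<lambda>v. (1 - v) powr M) has_real_derivative (- (M * (1 - v) powr (M - 1)))) (at v)"
      using v by (auto intro!: derivative_eq_intros simp: powr_diff field_simps)
    have D2: "((\<lambda>v. ?w v powr (- M)) has_real_derivative (- M * ?w v powr (- M - 1) * (A - B))) (at v)"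
      using wv by (auto intro!: derivative_eq_intros simp: powr_diff field_simps)
    have "(?F has_real_derivative (- (1 / A) * (- (M * (1 - v) powr (M - 1)) * ?w v powr (- M) +
        (1 - v) powr M * (- M * ?w v powr (- M - 1) * (A - B))))) (at v)"
      by (rule DERIV_cmult) (use DERIV_mult[OF D1 D2] in \<open>simp add: mult.commute add.commute\<close>)
    also have "(- (1 / A) * (- (M * (1 - v) powr (M - 1)) * ?w v powr (- M) +
        (1 - v) powr M * (- M * ?w v powr (- M - 1) * (A - B)))) = M * (1 - v) powr (M - 1) * ?w v powr (- (M + 1))"
    proof -
      define P where "P = (1 - v) powr (M - 1)"
      define Q where "Q = ?w v powr (- M - 1)"
      have P: "(1 - v) powr M = P * (1 - v)" using v by (simp add: P_def powr_diff)
      have Q: "?w v powr (- M) = Q * ?w v" using wv by (simp add: Q_def powr_diff)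
      have Q': "?w v powr (- (M + 1)) = Q" by (simp add: Q_def)
      have id: "- (1 / A) * (- (M * P) * (Q * ?w v) + P * (1 - v) * (- M * Q * (A - B))) = (1 / A) * (M * P * Q) * (?w v + (1 - v) * (A - B))"
        by (simp add: algebra_simps)
      have "?w v + (1 - v) * (A - B) = A" by (simp add: algebra_simps)
      then show ?thesis unfolding Q' P Q P_def[symmetric] Q_def[symmetric] id using A by simp
    qed
    finally show "(?F has_vector_derivative (M * (1 - v) powr (M - 1) * ?w v powr (- (M + 1)))) (at v)"
      by (simp add: has_real_derivative_iff_has_vector_derivative)
  qed simp
  moreover have "?F 1 - ?F 0 = 1 / A * B powr (- M)" using M by simp
  ultimately have "((\<lambda>v. M * (1 - v) powr (M - 1) * ?w v powr (- (M + 1))) has_integral (1 / A * B powr (- M))) {0..1}" by simp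
  then show ?thesis by (simp only: has_integral_Icc_iff_Ioo)
qed

lemma beta_measure_stick_integral:
  fixes A B M :: real
  assumes M: "M > 0" and A: "A > 0" and B: "B > 0"
  shows "(\<integral>\<^sup>+v. ennreal ((v * A + (1 - v) * B) powr (- (M + 1))) \<partial>beta_measure 1 M) = ennreal (1 / A * B powr (- M))"
proof -
  let ?w = "\<lambda>v. v * A + (1 - v) * B"
  let ?f = "\<lambda>v. M * (1 - v) powr (M - 1) * ?w v powr (- (M + 1))"
  have bm: "beta_measure 1 M = density (restrict_space lborel {0<..<1}) (\<lambda>v. ennreal (v powr 0 * (1 - v) powr (M - 1) * M))"
    unfolding beta_measure_def Beta_1_left[OF M] by simp
  have m1: "(\<lambda>v. ennreal (v powr 0 * (1 - v) powr (M - 1) * M)) \<in> borel_measurable (restrict_space lborel {0<..<1})"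
    by (rule measurable_restrict_space1) measurable
  have m2: "(\<lambda>v. ennreal (?w v powr (- (M + 1)))) \<in> borel_measurable (restrict_space lborel {0<..<1})"
    by (rule measurable_restrict_space1) measurable
  have "(\<integral>\<^sup>+v. ennreal (?w v powr (- (M + 1))) \<partial>beta_measure 1 M) =
      (\<integral>\<^sup>+v. ennreal (v powr 0 * (1 - v) powr (M - 1) * M) * ennreal (?w v powr (- (M + 1))) \<partial>restrict_space lborel {0<..<1})"
    unfolding bm by (rule nn_integral_density[OF m1 m2])
  also have "\<dots> = (\<integral>\<^sup>+v. ennreal (v powr 0 * (1 - v) powr (M - 1) * M) * ennreal (?w v powr (- (M + 1))) * indicator {0<..<1} v \<partial>lborel)"
    by (rule nn_integral_restrict_space) simp
  also have "\<dots> = (\<integral>\<^sup>+v. ennreal (?f v) * indicator {0<..<1} v \<partial>lborel)"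
    using M by (intro nn_integral_cong) (auto simp: indicator_def ennreal_mult'[symmetric] mult_ac)
  also have "\<dots> = ennreal (1 / A * B powr (- M))"
    by (rule nn_integral_has_integral_lebesgue'[OF _ beta_stick_has_integral[OF assms]]) (use M in simp)
  finally show ?thesis .
qed

lemma prob_space_beta_measure:
  assumes "M > 0" shows "prob_space (beta_measure 1 M)"
proof
  have "(\<integral>\<^sup>+v. ennreal ((v * 1 + (1 - v) * 1) powr (- (M + 1))) \<partial>beta_measure 1 M) = ennreal (1 / 1 * 1 powr (- M))"
    by (rule beta_measure_stick_integral[OF assms]) auto
  then show "emeasure (beta_measure 1 M) (space (beta_measure 1 M)) = 1" by simp
qed

text \<open>The stick-breaking variables on their canonical space, which is the one in \<open>DP_law\<close>.\<close>

locale stick_process = fixes \<alpha> :: "'a measure" and M :: real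
  assumes prob_\<alpha>: "prob_space \<alpha>" and sets_\<alpha>: "sets \<alpha> = UNIV" and M_pos: "M > 0"
begin

abbreviation "\<beta> \<equiv> beta_measure 1 M"
abbreviation "SV \<equiv> \<Pi>\<^sub>M i\<in>(UNIV::nat set). \<beta>"
abbreviation "SY \<equiv> \<Pi>\<^sub>M i\<in>(UNIV::nat set). \<alpha>"
abbreviation "D \<equiv> SV \<Otimes>\<^sub>M SY"

sublocale \<alpha>: prob_space \<alpha> by (rule prob_\<alpha>)
sublocale \<beta>: prob_space \<beta> by (rule prob_space_beta_measure[OF M_pos])
sublocale V: sequence_space \<beta> by unfold_locales
sublocale Y: sequence_space \<alpha> by unfold_locales
sublocale SV: prob_space SV by (rule prob_space_PiM) (rule \<beta>.prob_space_axioms)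
sublocale SY: prob_space SY by (rule prob_space_PiM) (rule \<alpha>.prob_space_axioms)
sublocale D: pair_prob_space SV SY by unfold_locales

lemma sigma_finite_sequences: "sigma_finite_measure SV" "sigma_finite_measure SY"
  by (intro prob_space_imp_sigma_finite prob_space_PiM \<beta>.prob_space_axioms \<alpha>.prob_space_axioms)+

lemma space_\<alpha>: "space \<alpha> = UNIV"
  using sets.sets_into_space[of UNIV \<alpha>] by (auto simp: sets_\<alpha>)

lemma measurable_\<alpha>: "f \<in> borel_measurable \<alpha>" for f :: "'a \<Rightarrow> 'b::topological_space"
  by (auto simp: measurable_def sets_\<alpha> space_\<alpha>)

lemma V_coordinate [measurable]: "(\<lambda>V. V i) \<in> borel_measurable SV"
proof -
  have "(\<lambda>V. V i) \<in> SV \<rightarrow>\<^sub>M \<beta>" by simp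
  moreover have "(\<lambda>v. v) \<in> \<beta> \<rightarrow>\<^sub>M borel"
    by (subst measurable_cong_sets[OF sets_beta_measure refl]) (rule measurable_restrict_space1, simp)
  ultimately show ?thesis by (rule measurable_compose)
qed

lemma Y_coordinate: "(\<lambda>Y. f (Y i)) \<in> borel_measurable SY" for f :: "'a \<Rightarrow> 'b::topological_space"
  by (rule measurable_compose[OF _ measurable_\<alpha>]) (rule measurable_component_singleton, simp)

lemma space_SV: "V \<in> space SV \<Longrightarrow> V i \<in> {0<..<1}"
  by (auto simp: space_PiM PiE_def Pi_def)

lemma space_D: "z \<in> space D \<Longrightarrow> fst z i \<in> {0<..<1}"
  using space_SV by (auto simp: space_pair_measure)

lemma measurable_stick_weight [measurable]: "(\<lambda>V. stick_weight V i) \<in> borel_measurable SV"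
  unfolding stick_weight_def by measurable

lemma measurable_stick_sum [measurable]: "(\<lambda>z. stick_sum g (fst z) (snd z)) \<in> borel_measurable D"
  unfolding stick_sum_def
  by (intro borel_measurable_suminf borel_measurable_times
      measurable_compose[OF measurable_fst measurable_stick_weight] measurable_compose[OF measurable_snd Y_coordinate])

lemma measurable_stick_breaking: "(\<lambda>(V, Y). stick_breaking V Y) \<in> D \<rightarrow>\<^sub>M subprob_algebra (count_space UNIV)"
proof (rule measurable_subprob_algebra)
  fix z assume z: "z \<in> space D"
  obtain V Y where zz: "z = (V, Y)" by (cases z)
  have V: "\<And>i. V i \<in> {0<..<1}" using space_D[OF z] by (simp add: zz)
  note w = stick_weight_bounds[where V=V, OF V]
  have "emeasure (stick_breaking V Y) UNIV = (\<Sum>i. ennreal (stick_weight V i))"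
    by (simp add: emeasure_stick_breaking)
  also have "\<dots> = ennreal (\<Sum>i. stick_weight V i)" by (rule suminf_ennreal2[OF w(1,3)])
  also have "\<dots> \<le> 1" using w(4) by simp
  finally show "subprob_space (case z of (V, Y) \<Rightarrow> stick_breaking V Y)"
    by (intro subprob_spaceI) (auto simp: zz emeasure_stick_breaking)
  show "sets (case z of (V, Y) \<Rightarrow> stick_breaking V Y) = sets (count_space UNIV)"
    by (simp add: zz emeasure_stick_breaking)
next
  fix C :: "'a set"
  have "(\<lambda>z. \<Sum>i. ennreal (stick_weight (fst z) i) * indicator C (snd z i)) \<in> borel_measurable D"
    by (intro borel_measurable_suminf_order borel_measurable_times_ennreal measurable_compose[OF measurable_compose[OF measurable_fst measurable_stick_weight] measurable_ennreal]
        measurable_compose[OF measurable_snd Y_coordinate])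
  then show "(\<lambda>z. emeasure (case z of (V, Y) \<Rightarrow> stick_breaking V Y) C) \<in> borel_measurable D"
    by (simp add: emeasure_stick_breaking case_prod_beta)
qed

text \<open>With \<open>F\<close> the integral of \<open>g\<close> against the process, \<open>F = v * g y + (1 - v) * F'\<close> where \<open>F'\<close> has the law of \<open>F\<close> and is independent of the
  first stick \<open>v\<close> and its location \<open>y\<close>. Hence \<open>s + F\<close> is the mixture of \<open>s + g y\<close> and \<open>s + F'\<close>, and integrating over \<open>v\<close> by
  \<open>beta_measure_stick_integral\<close> separates the two.\<close>

lemma stick_recursion:
  assumes g: "\<And>y. 0 \<le> g y" "\<And>y. g y \<le> B" and s: "s > 0"
  shows "(\<integral>\<^sup>+z. ennreal ((s + stick_sum g (fst z) (snd z)) powr (- (M + 1))) \<partial>D) =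
    (\<integral>\<^sup>+y. ennreal (1 / (s + g y)) \<partial>\<alpha>) * (\<integral>\<^sup>+z. ennreal ((s + stick_sum g (fst z) (snd z)) powr (- M)) \<partial>D)"
proof -
  let ?h = "\<lambda>V Y. ennreal ((s + stick_sum g V Y) powr (- (M + 1)))"
  let ?k = "\<lambda>V Y. ennreal ((s + stick_sum g V Y) powr (- M))"
  have hm: "(\<lambda>z. ?h (fst z) (snd z)) \<in> borel_measurable D" by measurable
  have km: "(\<lambda>z. ?k (fst z) (snd z)) \<in> borel_measurable D" by measurable
  have gpos: "s + g y > 0" for y using g(1)[of y] s by simp
  have swap: "(\<integral>\<^sup>+z. f (fst z) (snd z) \<partial>D) = (\<integral>\<^sup>+Y. \<integral>\<^sup>+V. f V Y \<partial>SV \<partial>SY)"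
    if "(\<lambda>z. f (fst z) (snd z)) \<in> borel_measurable D" for f :: "(nat \<Rightarrow> real) \<Rightarrow> (nat \<Rightarrow> 'a) \<Rightarrow> ennreal"
    using D.nn_integral_snd[OF that] by simp
  have hY: "(\<lambda>V. ?h V Y) \<in> borel_measurable SV" if "Y \<in> space SY" for Y
    using measurable_compose[OF measurable_Pair2'[OF that] hm] by simp
  have inner: "(\<integral>\<^sup>+V. ?h V (case_nat y Y) \<partial>SV) = ennreal (1 / (s + g y)) * (\<integral>\<^sup>+V. ?k V Y \<partial>SV)"
    if Y: "Y \<in> space SY" for y Y
  proof -
    have cY: "case_nat y Y \<in> space SY" by (auto simp: space_PiM space_\<alpha>)
    have itm: "(\<lambda>(v, V). case_nat v V) \<in> \<beta> \<Otimes>\<^sub>M SV \<rightarrow>\<^sub>M SV" by measurable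
    have "(\<integral>\<^sup>+V. ?h V (case_nat y Y) \<partial>SV) = (\<integral>\<^sup>+V. ?h V (case_nat y Y) \<partial>distr (\<beta> \<Otimes>\<^sub>M SV) SV (\<lambda>(v, V). case_nat v V))"
      unfolding V.PiM_iter ..
    also have "\<dots> = (\<integral>\<^sup>+x. ?h (case_nat (fst x) (snd x)) (case_nat y Y) \<partial>(\<beta> \<Otimes>\<^sub>M SV))"
      using nn_integral_distr[OF itm, of "\<lambda>V. ?h V (case_nat y Y)"] hY[OF cY] by (simp add: case_prod_beta')
    also have "\<dots> = (\<integral>\<^sup>+V. \<integral>\<^sup>+v. ?h (case_nat v V) (case_nat y Y) \<partial>\<beta> \<partial>SV)"
    proof -
      interpret bv: pair_sigma_finite \<beta> SV by unfold_locales
      have "(\<lambda>x. ?h (case_nat (fst x) (snd x)) (case_nat y Y)) \<in> borel_measurable (\<beta> \<Otimes>\<^sub>M SV)"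
        using measurable_compose[OF itm hY[OF cY]] by (simp add: case_prod_beta')
      from bv.nn_integral_snd[OF this] show ?thesis by simp
    qed
    also have "\<dots> = (\<integral>\<^sup>+V. ennreal (1 / (s + g y)) * ?k V Y \<partial>SV)"
    proof (rule nn_integral_cong)
      fix V assume V: "V \<in> space SV"
      note q = stick_sum_props[where g=g and B=B and V=V, OF space_SV[OF V] g]
      have qpos: "s + stick_sum g V Y > 0" using q(2)[of Y] s by simp
      have "(\<integral>\<^sup>+v. ?h (case_nat v V) (case_nat y Y) \<partial>\<beta>) =
          (\<integral>\<^sup>+v. ennreal ((v * (s + g y) + (1 - v) * (s + stick_sum g V Y)) powr (- (M + 1))) \<partial>\<beta>)"
        unfolding q(4) by (intro nn_integral_cong) (simp add: algebra_simps)
      also have "\<dots> = ennreal (1 / (s + g y) * (s + stick_sum g V Y) powr (- M))"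
        by (rule beta_measure_stick_integral[OF M_pos gpos qpos])
      also have "\<dots> = ennreal (1 / (s + g y)) * ?k V Y"
        by (rule ennreal_mult') (use gpos[of y] in simp)
      finally show "(\<integral>\<^sup>+v. ?h (case_nat v V) (case_nat y Y) \<partial>\<beta>) = ennreal (1 / (s + g y)) * ?k V Y" .
    qed
    also have "\<dots> = ennreal (1 / (s + g y)) * (\<integral>\<^sup>+V. ?k V Y \<partial>SV)"
      by (rule nn_integral_cmult) (use measurable_compose[OF measurable_Pair2'[OF Y] km] in simp)
    finally show ?thesis .
  qed
  have Hm: "(\<lambda>Y. \<integral>\<^sup>+V. ?h V Y \<partial>SV) \<in> borel_measurable SY"
    by (rule sigma_finite_measure.borel_measurable_nn_integral[OF sigma_finite_sequences(1)]) (use measurable_pair_swap[OF hm] in \<open>simp add: case_prod_beta'\<close>)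
  have Km: "(\<lambda>Y. \<integral>\<^sup>+V. ?k V Y \<partial>SV) \<in> borel_measurable SY"
    by (rule sigma_finite_measure.borel_measurable_nn_integral[OF sigma_finite_sequences(1)]) (use measurable_pair_swap[OF km] in \<open>simp add: case_prod_beta'\<close>)
  have itY: "(\<lambda>(y, Y). case_nat y Y) \<in> \<alpha> \<Otimes>\<^sub>M SY \<rightarrow>\<^sub>M SY" by measurable
  have "(\<integral>\<^sup>+z. ?h (fst z) (snd z) \<partial>D) = (\<integral>\<^sup>+Y. \<integral>\<^sup>+V. ?h V Y \<partial>SV \<partial>SY)" by (rule swap[OF hm])
  also have "\<dots> = (\<integral>\<^sup>+Y. (\<integral>\<^sup>+V. ?h V Y \<partial>SV) \<partial>distr (\<alpha> \<Otimes>\<^sub>M SY) SY (\<lambda>(y, Y). case_nat y Y))"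
    unfolding Y.PiM_iter ..
  also have "\<dots> = (\<integral>\<^sup>+x. (\<integral>\<^sup>+V. ?h V (case_nat (fst x) (snd x)) \<partial>SV) \<partial>(\<alpha> \<Otimes>\<^sub>M SY))"
    using nn_integral_distr[OF itY, of "\<lambda>Y. \<integral>\<^sup>+V. ?h V Y \<partial>SV"] Hm by (simp add: case_prod_beta')
  also have "\<dots> = (\<integral>\<^sup>+x. ennreal (1 / (s + g (fst x))) * (\<integral>\<^sup>+V. ?k V (snd x) \<partial>SV) \<partial>(\<alpha> \<Otimes>\<^sub>M SY))"
    by (rule nn_integral_cong, rule inner) (simp only: space_pair_measure mem_Times_iff)
  also have "\<dots> = (\<integral>\<^sup>+y. \<integral>\<^sup>+Y. ennreal (1 / (s + g y)) * (\<integral>\<^sup>+V. ?k V Y \<partial>SV) \<partial>SY \<partial>\<alpha>)"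
  proof -
    have "(\<lambda>x. ennreal (1 / (s + g (fst x))) * (\<integral>\<^sup>+V. ?k V (snd x) \<partial>SV)) \<in> borel_measurable (\<alpha> \<Otimes>\<^sub>M SY)"
      by (intro borel_measurable_times_ennreal measurable_compose[OF measurable_fst measurable_\<alpha>] measurable_compose[OF measurable_snd Km])
    from sigma_finite_measure.nn_integral_fst[OF sigma_finite_sequences(2) this] show ?thesis by simp
  qed
  also have "\<dots> = (\<integral>\<^sup>+y. ennreal (1 / (s + g y)) * (\<integral>\<^sup>+Y. \<integral>\<^sup>+V. ?k V Y \<partial>SV \<partial>SY) \<partial>\<alpha>)"
    by (intro nn_integral_cong nn_integral_cmult Km)
  also have "\<dots> = (\<integral>\<^sup>+y. ennreal (1 / (s + g y)) \<partial>\<alpha>) * (\<integral>\<^sup>+Y. \<integral>\<^sup>+V. ?k V Y \<partial>SV \<partial>SY)"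
    by (rule nn_integral_multc) (rule measurable_\<alpha>)
  also have "(\<integral>\<^sup>+Y. \<integral>\<^sup>+V. ?k V Y \<partial>SV \<partial>SY) = (\<integral>\<^sup>+z. ?k (fst z) (snd z) \<partial>D)" by (rule swap[OF km, symmetric])
  finally show ?thesis .
qed

lemma stick_recursion_real:
  assumes g: "\<And>y. 0 \<le> g y" "\<And>y. g y \<le> B" and s: "s > 0"
  shows "integrable D (\<lambda>z. (s + stick_sum g (fst z) (snd z)) powr (- k))"
    "(\<integral>z. (s + stick_sum g (fst z) (snd z)) powr (- (M + 1)) \<partial>D) =
    (\<integral>y. 1 / (s + g y) \<partial>\<alpha>) * (\<integral>z. (s + stick_sum g (fst z) (snd z)) powr (- M) \<partial>D)"
proof -
  have qb: "0 \<le> stick_sum g (fst z) (snd z)" "stick_sum g (fst z) (snd z) \<le> B" if "z \<in> space D" for z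
    using stick_sum_props[where g=g and B=B and V="fst z" and Y="snd z", OF space_D[OF that] g] by auto
  show int: "integrable D (\<lambda>z. (s + stick_sum g (fst z) (snd z)) powr (- k))" for k
  proof (rule D.integrable_const_bound[where B="s powr (- k) + (s + B) powr (- k)"])
    show "AE z in D. norm ((s + stick_sum g (fst z) (snd z)) powr (- k)) \<le> s powr (- k) + (s + B) powr (- k)"
    proof (rule AE_I2)
      fix z assume z: "z \<in> space D"
      have "(s + stick_sum g (fst z) (snd z)) powr (- k) \<le> s powr (- k) + (s + B) powr (- k)"
      proof (cases "- k \<ge> 0")
        case True
        then have "(s + stick_sum g (fst z) (snd z)) powr (- k) \<le> (s + B) powr (- k)"
          using qb[OF z] s by (intro powr_mono2) auto
        then show ?thesis by (simp add: add_increasing)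
      next
        case False
        then have "(s + stick_sum g (fst z) (snd z)) powr (- k) \<le> s powr (- k)"
          using qb[OF z] s by (intro powr_mono2') auto
        then show ?thesis by (simp add: add_increasing2)
      qed
      then show "norm ((s + stick_sum g (fst z) (snd z)) powr (- k)) \<le> s powr (- k) + (s + B) powr (- k)" by simp
    qed
  qed measurable
  have inti: "integrable \<alpha> (\<lambda>y. 1 / (s + g y))"
  proof (rule \<alpha>.integrable_const_bound[where B="1 / s"])
    show "AE y in \<alpha>. norm (1 / (s + g y)) \<le> 1 / s"
    proof (rule AE_I2)
      fix y
      have "s + g y \<ge> s" using g(1)[of y] by simp
      then show "norm (1 / (s + g y)) \<le> 1 / s" using s by (simp add: frac_le)
    qed
  qed (rule measurable_\<alpha>)
  have nn: "(\<integral>\<^sup>+z. ennreal ((s + stick_sum g (fst z) (snd z)) powr (- k)) \<partial>D) = ennreal (\<integral>z. (s + stick_sum g (fst z) (snd z)) powr (- k) \<partial>D)" for k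
    by (rule nn_integral_eq_integral[OF int]) simp
  have ni: "(\<integral>\<^sup>+y. ennreal (1 / (s + g y)) \<partial>\<alpha>) = ennreal (\<integral>y. 1 / (s + g y) \<partial>\<alpha>)"
    by (rule nn_integral_eq_integral[OF inti]) (use g s in \<open>auto intro!: AE_I2 simp: add_nonneg_nonneg less_imp_le\<close>)
  have pos: "(\<integral>y. 1 / (s + g y) \<partial>\<alpha>) \<ge> 0" 
    by (rule Bochner_Integration.integral_nonneg) (use g s in \<open>auto simp: add_nonneg_nonneg less_imp_le\<close>)
  have "ennreal (\<integral>z. (s + stick_sum g (fst z) (snd z)) powr (- (M + 1)) \<partial>D) =
      ennreal ((\<integral>y. 1 / (s + g y) \<partial>\<alpha>) * (\<integral>z. (s + stick_sum g (fst z) (snd z)) powr (- M) \<partial>D))"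
    using stick_recursion[where g=g and B=B and s=s, OF assms] unfolding nn ni by (simp only: ennreal_mult'[OF pos])
  then show "(\<integral>z. (s + stick_sum g (fst z) (snd z)) powr (- (M + 1)) \<partial>D) =
    (\<integral>y. 1 / (s + g y) \<partial>\<alpha>) * (\<integral>z. (s + stick_sum g (fst z) (snd z)) powr (- M) \<partial>D)"
    using pos by (subst (asm) ennreal_inj) auto
qed

text \<open>Differentiation under the integral turns the power \<open>- M\<close> into \<open>- (M + 1)\<close>, and \<open>stick_recursion\<close> brings it back: \<open>s \<mapsto> E (s + F) powr (- M)\<close>
  solves a linear differential equation of first order.\<close>

lemma stick_derivative:
  assumes g: "\<And>y. 0 \<le> g y" "\<And>y. g y \<le> B" and s: "s > 0"
  defines "u \<equiv> \<lambda>s. \<integral>z. (s + stick_sum g (fst z) (snd z)) powr (- M) \<partial>D"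
  shows "(u has_real_derivative (- M * ((\<integral>y. 1 / (s + g y) \<partial>\<alpha>) * u s))) (at s)"
proof -
  let ?q = "\<lambda>z. stick_sum g (fst z) (snd z)"
  have qb: "0 \<le> ?q z" if "z \<in> space D" for z using stick_sum_props[where g=g and B=B and V="fst z" and Y="snd z", OF space_D[OF that] g] by auto
  have int: "integrable D (\<lambda>z. (t + ?q z) powr (- k))" if "t > 0" for t k
    by (rule stick_recursion_real(1)[where g=g and B=B, OF g that])
  have lim: "((\<lambda>h. (u (s + h) - u s) / h) \<longlongrightarrow> (\<integral>z. - M * (s + ?q z) powr (- M - 1) \<partial>D)) (at 0)"
    unfolding tendsto_at_iff_sequentially
  proof (intro allI impI)
    fix X :: "nat \<Rightarrow> real" assume X0: "\<forall>i. X i \<in> UNIV - {0}" and X: "X \<longlonglongrightarrow> 0"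
    have "\<forall>\<^sub>F n in sequentially. \<bar>X n\<bar> < s / 2"
      using order_tendstoD(2)[OF tendsto_rabs[OF X], of "s / 2"] s by simp
    then obtain n0 where n0: "\<And>n. n \<ge> n0 \<Longrightarrow> \<bar>X n\<bar> < s / 2" unfolding eventually_sequentially by blast
    define H where "H n = X (n + n0)" for n
    have H: "H n \<noteq> 0" "\<bar>H n\<bar> < s / 2" for n using X0 n0 by (auto simp: H_def)
    have Hlim: "H \<longlonglongrightarrow> 0" unfolding H_def by (rule LIMSEQ_ignore_initial_segment[OF X])
    let ?d = "\<lambda>n z. ((s + H n + ?q z) powr (- M) - (s + ?q z) powr (- M)) / H n"
    have "(\<lambda>n. \<integral>z. ?d n z \<partial>D) \<longlonglongrightarrow> (\<integral>z. - M * (s + ?q z) powr (- M - 1) \<partial>D)"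
    proof (rule integral_dominated_convergence[where w="\<lambda>_. M * (s / 2) powr (- M - 1)"])
      show "AE z in D. (\<lambda>n. ?d n z) \<longlonglongrightarrow> - M * (s + ?q z) powr (- M - 1)"
      proof (rule AE_I2)
        fix z assume z: "z \<in> space D"
        have p: "s + ?q z > 0" using s qb[OF z] by simp
        have "((\<lambda>t. t powr (- M)) has_real_derivative (- M * (s + ?q z) powr (- M - 1))) (at (s + ?q z))"
          by (rule has_real_derivative_powr[OF p])
        then have "((\<lambda>h. ((s + ?q z + h) powr (- M) - (s + ?q z) powr (- M)) / h) \<longlongrightarrow> - M * (s + ?q z) powr (- M - 1)) (at 0)"
          by (simp add: DERIV_def)
        moreover have "filterlim H (at 0) sequentially"
          by (rule filterlim_atI[OF Hlim]) (simp add: H)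
        ultimately have "(\<lambda>n. ((s + ?q z + H n) powr (- M) - (s + ?q z) powr (- M)) / H n) \<longlonglongrightarrow> - M * (s + ?q z) powr (- M - 1)"
          by (rule filterlim_compose)
        then show "(\<lambda>n. ?d n z) \<longlonglongrightarrow> - M * (s + ?q z) powr (- M - 1)" by (simp add: add_ac)
      qed
      show "AE z in D. norm (?d n z) \<le> M * (s / 2) powr (- M - 1)" for n
      proof (rule AE_I2)
        fix z assume z: "z \<in> space D"
        define a where "a = s + ?q z"
        have a: "a \<ge> s" using qb[OF z] by (simp add: a_def)
        have der: "((\<lambda>t. t powr (- M)) has_real_derivative (- M * t powr (- M - 1))) (at t within {s/2..})" if "t \<ge> s / 2" for t
          using has_real_derivative_powr[of t "- M"] that s by (auto intro: has_field_derivative_at_within)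
        have bd: "norm (- M * t powr (- M - 1)) \<le> M * (s / 2) powr (- M - 1)" if "t \<ge> s / 2" for t
        proof -
          have "t powr (- M - 1) \<le> (s / 2) powr (- M - 1)" using that s M_pos by (intro powr_mono2') auto
          then show ?thesis using M_pos by (simp add: abs_mult)
        qed
        have "norm ((a + H n) powr (- M) - a powr (- M)) \<le> M * (s / 2) powr (- M - 1) * norm ((a + H n) - a)"
          by (rule field_differentiable_bound[where S="{s/2..}" and f'="\<lambda>t. - M * t powr (- M - 1)"])
             (use der bd a H(2)[of n] in \<open>auto simp del: norm_mult real_norm_def\<close>)
        then have "\<bar>(a + H n) powr (- M) - a powr (- M)\<bar> / \<bar>H n\<bar> \<le> M * (s / 2) powr (- M - 1)"
          using H(1)[of n] by (simp add: pos_divide_le_eq)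
        then show "norm (?d n z) \<le> M * (s / 2) powr (- M - 1)" by (simp add: a_def abs_divide add_ac)
      qed
    qed auto
    also have "(\<lambda>n. \<integral>z. ?d n z \<partial>D) = (\<lambda>n. (u (s + H n) - u s) / H n)"
    proof
      fix n
      have "s + H n > 0" using H(2)[of n] s by (simp add: abs_less_iff)
      then show "(\<integral>z. ?d n z \<partial>D) = (u (s + H n) - u s) / H n"
        unfolding u_def using int[of "s + H n" M] int[OF s, of M] by simp
    qed
    finally have "(\<lambda>n. (u (s + H n) - u s) / H n) \<longlonglongrightarrow> (\<integral>z. - M * (s + ?q z) powr (- M - 1) \<partial>D)" .
    then have "(\<lambda>n. ((\<lambda>h. (u (s + h) - u s) / h) \<circ> X) (n + n0)) \<longlonglongrightarrow> (\<integral>z. - M * (s + ?q z) powr (- M - 1) \<partial>D)"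
      by (simp add: H_def o_def)
    then show "((\<lambda>h. (u (s + h) - u s) / h) \<circ> X) \<longlonglongrightarrow> (\<integral>z. - M * (s + ?q z) powr (- M - 1) \<partial>D)"
      by (rule LIMSEQ_offset)
  qed
  have "(\<integral>z. - M * (s + ?q z) powr (- M - 1) \<partial>D) = - M * (\<integral>z. (s + ?q z) powr (- (M + 1)) \<partial>D)"
  proof -
    have "- M - 1 = - (M + 1)" by simp
    then show ?thesis by (simp only: integral_mult_right_zero)
  qed
  also have "\<dots> = - M * ((\<integral>y. 1 / (s + g y) \<partial>\<alpha>) * u s)"
    unfolding u_def stick_recursion_real(2)[where g=g and B=B, OF g s] ..
  finally have "(\<integral>z. - M * (s + ?q z) powr (- M - 1) \<partial>D) = - M * ((\<integral>y. 1 / (s + g y) \<partial>\<alpha>) * u s)" .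
  then show ?thesis using lim unfolding DERIV_def by (simp only:)
qed

text \<open>The differential equation of \<open>stick_derivative\<close> is solved by the integrating factor \<open>exp (L s)\<close>, where \<open>L' = M * \<kappa>\<close> is explicit for a
  simple function \<open>g\<close>; the constant is found by letting \<open>s\<close> tend to infinity.\<close>

lemma stick_laplace:
  fixes e :: "nat \<Rightarrow> 'a" and m :: nat
  assumes e: "inj e" and f: "\<And>i. f i \<ge> 0"
  defines "g \<equiv> \<lambda>y. \<Sum>i<m. f i * indicator {e i} y"
  shows "(\<integral>z. (1 + stick_sum g (fst z) (snd z)) powr (- M) \<partial>D) = (\<Prod>i<m. (1 + f i) powr (- (M * \<alpha>.prob {e i})))"
proof -
  let ?q = "\<lambda>z. stick_sum g (fst z) (snd z)"
  define a where "a i = \<alpha>.prob {e i}" for i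
  define B where "B = (\<Sum>i<m. f i)"
  have g0: "0 \<le> g y" for y unfolding g_def using f by (intro sum_nonneg) simp
  have gB: "g y \<le> B" for y unfolding g_def B_def using f by (intro sum_mono) (simp add: indicator_def)
  have qb: "0 \<le> ?q z" "?q z \<le> B" if "z \<in> space D" for z using stick_sum_props[where g=g and B=B and V="fst z" and Y="snd z", OF space_D[OF that] g0 gB] by auto
  define u where "u s = (\<integral>z. (s + ?q z) powr (- M) \<partial>D)" for s
  define \<kappa> where "\<kappa> s = (\<integral>y. 1 / (s + g y) \<partial>\<alpha>)" for s
  have du: "(u has_real_derivative (- M * (\<kappa> s * u s))) (at s)" if "s > 0" for s
    using stick_derivative[where g=g and B=B, OF g0 gB that] unfolding u_def \<kappa>_def .
  have \<kappa>: "\<kappa> s = 1 / s + (\<Sum>i<m. a i * (1 / (s + f i) - 1 / s))" if s: "s > 0" for s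
  proof -
    have pt: "1 / (s + g y) = 1 / s + (\<Sum>i<m. indicator {e i} y * (1 / (s + f i) - 1 / s))" for y
    proof (cases "\<exists>j<m. y = e j")
      case True
      then obtain j where j: "j < m" "y = e j" by blast
      have ind: "indicator {e i} y = (if i = j then 1 else 0 :: real)" for i using j inj_eq[OF e] by (auto simp: indicator_def)
      have "g y = (\<Sum>i<m. if i = j then f i else 0)" unfolding g_def ind by (intro sum.cong) auto
      then have "g y = f j" using j by simp
      moreover have "(\<Sum>i<m. indicator {e i} y * (1 / (s + f i) - 1 / s)) = 1 / (s + f j) - 1 / s"
      proof -
        have "(\<Sum>i<m. indicator {e i} y * (1 / (s + f i) - 1 / s)) = (\<Sum>i<m. if i = j then 1 / (s + f i) - 1 / s else 0)"
          unfolding ind by (intro sum.cong) auto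
        then show ?thesis using j by simp
      qed
      ultimately show ?thesis by simp
    next
      case False
      then have z: "indicator {e i} y = (0::real)" if "i < m" for i using that by (auto simp: indicator_def)
      have "g y = 0" unfolding g_def by (rule sum.neutral) (use z in auto)
      moreover have "(\<Sum>i<m. indicator {e i} y * (1 / (s + f i) - 1 / s)) = 0" by (rule sum.neutral) (use z in auto)
      ultimately show ?thesis by (simp only: add_0_right)
    qed
    have ii: "integrable \<alpha> (\<lambda>y. indicator {e i} y * (1 / (s + f i) - 1 / s))" for i
      by (intro integrable_mult_left integrable_real_indicator) (auto simp: sets_\<alpha> \<alpha>.emeasure_eq_measure)
    have "\<kappa> s = (\<integral>y. 1 / s \<partial>\<alpha>) + (\<integral>y. (\<Sum>i<m. indicator {e i} y * (1 / (s + f i) - 1 / s)) \<partial>\<alpha>)"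
      unfolding \<kappa>_def pt using ii by (intro Bochner_Integration.integral_add Bochner_Integration.integrable_sum) auto
    also have "(\<integral>y. (\<Sum>i<m. indicator {e i} y * (1 / (s + f i) - 1 / s)) \<partial>\<alpha>) = (\<Sum>i<m. \<integral>y. indicator {e i} y * (1 / (s + f i) - 1 / s) \<partial>\<alpha>)"
      using ii by (intro Bochner_Integration.integral_sum) auto
    also have "(\<integral>y. 1 / s \<partial>\<alpha>) = 1 / s" by (simp add: \<alpha>.prob_space)
    also have "(\<Sum>i<m. \<integral>y. indicator {e i} y * (1 / (s + f i) - 1 / s) \<partial>\<alpha>) = (\<Sum>i<m. a i * (1 / (s + f i) - 1 / s))"
      by (simp add: a_def space_\<alpha>)
    finally show ?thesis .
  qed
  define L where "L s = M * (ln s + (\<Sum>i<m. a i * (ln (s + f i) - ln s)))" for s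
  have dL: "(L has_real_derivative (M * \<kappa> s)) (at s)" if s: "s > 0" for s
  proof -
    have fs: "s + f i > 0" for i using f[of i] s by simp
    have t: "((\<lambda>s. a i * (ln (s + f i) - ln s)) has_real_derivative a i * (1 / (s + f i) - 1 / s)) (at s)" for i
    proof (rule DERIV_cmult, rule DERIV_diff)
      show "((\<lambda>s. ln (s + f i)) has_real_derivative 1 / (s + f i)) (at s)"
        using fs[of i] by (auto intro!: derivative_eq_intros)
      show "(ln has_real_derivative 1 / s) (at s)" by (rule DERIV_ln_divide[OF s])
    qed
    have "((\<lambda>s. M * (ln s + (\<Sum>i<m. a i * (ln (s + f i) - ln s)))) has_real_derivative
        M * (1 / s + (\<Sum>i<m. a i * (1 / (s + f i) - 1 / s)))) (at s)"
      by (intro DERIV_cmult DERIV_add DERIV_ln_divide[OF s] DERIV_sum t)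
    then show ?thesis unfolding L_def \<kappa>[OF s] .
  qed
  have "((\<lambda>s. u s * exp (L s)) has_real_derivative 0) (at s within {0<..})" if "s \<in> {0<..}" for s
  proof -
    have s: "s > 0" using that by simp
    have "((\<lambda>s. u s * exp (L s)) has_real_derivative (- M * (\<kappa> s * u s)) * exp (L s) + (exp (L s) * (M * \<kappa> s)) * u s) (at s)"
      by (intro DERIV_mult du[OF s] DERIV_chain2[OF DERIV_exp dL[OF s]])
    also have "(- M * (\<kappa> s * u s)) * exp (L s) + (exp (L s) * (M * \<kappa> s)) * u s = 0" by simp
    finally show ?thesis by (rule has_field_derivative_at_within)
  qed
  then obtain c where c: "\<And>s. s > 0 \<Longrightarrow> u s * exp (L s) = c"
    using has_field_derivative_zero_constant[of "{0<..}" "\<lambda>s. u s * exp (L s)"] by auto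
  have "(\<lambda>n. u (real (Suc n)) * exp (L (real (Suc n)))) \<longlonglongrightarrow> 1 * exp (M * (\<Sum>i<m. a i * 0))"
  proof -
    have sc: "u (real (Suc n)) * exp (L (real (Suc n))) =
        (\<integral>z. (1 + ?q z / real (Suc n)) powr (- M) \<partial>D) * exp (M * (\<Sum>i<m. a i * ln (1 + f i / real (Suc n))))" for n
    proof -
      let ?N = "real (Suc n)"
      have N: "?N > 0" by simp
      have "u ?N = (\<integral>z. ?N powr (- M) * (1 + ?q z / ?N) powr (- M) \<partial>D)"
        unfolding u_def
      proof (rule Bochner_Integration.integral_cong[OF refl])
        fix z assume "z \<in> space D"
        have "?N + ?q z = ?N * (1 + ?q z / ?N)" using N by (simp add: distrib_left)
        moreover have "1 + ?q z / ?N \<ge> 0" using qb[OF \<open>z \<in> space D\<close>] by simp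
        ultimately show "(?N + ?q z) powr (- M) = ?N powr (- M) * (1 + ?q z / ?N) powr (- M)"
          using N by (simp only: powr_mult)
      qed
      also have "\<dots> = ?N powr (- M) * (\<integral>z. (1 + ?q z / ?N) powr (- M) \<partial>D)" by simp
      finally have U: "u ?N = ?N powr (- M) * (\<integral>z. (1 + ?q z / ?N) powr (- M) \<partial>D)" .
      have "ln (?N + f i) - ln ?N = ln (1 + f i / ?N)" for i
      proof -
        have "ln (?N + f i) - ln ?N = ln ((?N + f i) / ?N)" using f[of i] N by (subst ln_div) auto
        also have "(?N + f i) / ?N = 1 + f i / ?N" using N by (simp add: add_divide_distrib)
        finally show ?thesis .
      qed
      then have "L ?N = M * ln ?N + M * (\<Sum>i<m. a i * ln (1 + f i / ?N))"
        unfolding L_def by (simp only: distrib_left)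
      then have "exp (L ?N) = ?N powr M * exp (M * (\<Sum>i<m. a i * ln (1 + f i / ?N)))"
        using N by (simp add: exp_add powr_def)
      moreover have "?N powr (- M) * ?N powr M = 1" using N by (simp add: powr_minus)
      ultimately show ?thesis unfolding U by (simp add: mult_ac)
    qed
    have inv: "(\<lambda>n. x / real (Suc n)) \<longlonglongrightarrow> 0" for x :: real
      using tendsto_mult_right_zero[OF LIMSEQ_Suc[OF lim_1_over_n[where 'a=real]], of x] by simp
    have 1: "(\<lambda>n. \<integral>z. (1 + ?q z / real (Suc n)) powr (- M) \<partial>D) \<longlonglongrightarrow> (\<integral>z. 1 \<partial>D)"
    proof (rule integral_dominated_convergence[where w="\<lambda>_. 1"])
      show "AE z in D. (\<lambda>n. (1 + ?q z / real (Suc n)) powr (- M)) \<longlonglongrightarrow> 1"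
      proof (rule AE_I2)
        fix z
        have "(\<lambda>n. (1 + ?q z / real (Suc n)) powr (- M)) \<longlonglongrightarrow> (1 + 0) powr (- M)"
          by (intro tendsto_powr tendsto_add tendsto_const inv) simp
        then show "(\<lambda>n. (1 + ?q z / real (Suc n)) powr (- M)) \<longlonglongrightarrow> 1" by simp
      qed
      show "AE z in D. norm ((1 + ?q z / real (Suc n)) powr (- M)) \<le> 1" for n
      proof (rule AE_I2)
        fix z assume z: "z \<in> space D"
        have "(1 + ?q z / real (Suc n)) powr (- M) \<le> 1 powr (- M)"
          using qb[OF z] M_pos by (intro powr_mono2') auto
        then show "norm ((1 + ?q z / real (Suc n)) powr (- M)) \<le> 1" by simp
      qed
    qed auto
    have 2: "(\<lambda>n. exp (M * (\<Sum>i<m. a i * ln (1 + f i / real (Suc n))))) \<longlonglongrightarrow> exp (M * (\<Sum>i<m. a i * 0))"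
    proof (intro tendsto_exp tendsto_mult tendsto_const tendsto_sum)
      fix i
      have "(\<lambda>n. ln (1 + f i / real (Suc n))) \<longlonglongrightarrow> ln (1 + 0)" by (intro tendsto_ln tendsto_add tendsto_const inv) simp
      then show "(\<lambda>n. ln (1 + f i / real (Suc n))) \<longlonglongrightarrow> 0" by simp
    qed
    have "(\<integral>z. 1 \<partial>D) = (1::real)" by (simp add: D.prob_space)
    then show ?thesis unfolding sc using tendsto_mult[OF 1 2] by simp
  qed
  moreover have "(\<lambda>n. u (real (Suc n)) * exp (L (real (Suc n)))) = (\<lambda>_. c)" by (rule ext, rule c) simp
  ultimately have "c = 1" by (simp add: LIMSEQ_const_iff)
  then have "u 1 * exp (L 1) = 1" using c[of 1] by simp
  then have "u 1 = exp (- L 1)" by (simp add: exp_minus field_simps)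
  also have "- L 1 = (\<Sum>i<m. - (M * a i) * ln (1 + f i))" by (simp add: L_def sum_distrib_left sum_negf mult.assoc)
  also have "exp \<dots> = (\<Prod>i<m. (1 + f i) powr (- (M * a i)))"
  proof (subst exp_sum)
    show "(\<Prod>i<m. exp (- (M * a i) * ln (1 + f i))) = (\<Prod>i<m. (1 + f i) powr (- (M * a i)))"
    proof (rule prod.cong[OF refl])
      fix i show "exp (- (M * a i) * ln (1 + f i)) = (1 + f i) powr (- (M * a i))"
        using f[of i] by (simp add: powr_def)
    qed
  qed simp
  finally show ?thesis by (simp add: u_def a_def)
qed

text \<open>After multiplication by an independent gamma variable with parameter \<open>M\<close> this is a Laplace transform, since \<open>E exp (- t * S) = (1 + t) powr (- M)\<close>
  for such a variable \<open>S\<close>; the product on the right-hand side says that the masses become independent gamma variables.\<close>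

lemma dirichlet_laplace:
  fixes e :: "nat \<Rightarrow> 'a"
  assumes R: "dirichlet_process \<alpha> M \<Omega> R" and e: "inj e" and f: "\<And>i. f i \<ge> 0"
  shows "(\<integral>\<omega>. (1 + (\<Sum>i<m. f i * measure (R \<omega>) {e i})) powr (- M) \<partial>\<Omega>) = (\<Prod>i<m. (1 + f i) powr (- (M * \<alpha>.prob {e i})))"
proof -
  let ?A = "subprob_algebra (count_space (UNIV :: 'a set))"
  let ?F = "\<lambda>P. (1 + (\<Sum>i<m. f i * measure P {e i})) powr (- M)"
  have Rm: "R \<in> \<Omega> \<rightarrow>\<^sub>M ?A" using R unfolding dirichlet_process_def by (auto intro: measurable_prob_algebraD)
  have law: "distr \<Omega> ?A R = distr D ?A (\<lambda>(V, Y). stick_breaking V Y)"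
    using R unfolding dirichlet_process_def DP_law_def by simp
  have mm: "(\<lambda>P. measure P {y}) \<in> borel_measurable ?A" for y :: 'a by (rule measurable_measure_subprob_algebra) simp
  have Fm: "?F \<in> borel_measurable ?A" using mm by measurable
  have "(\<integral>\<omega>. ?F (R \<omega>) \<partial>\<Omega>) = (\<integral>P. ?F P \<partial>distr \<Omega> ?A R)" by (rule integral_distr[OF Rm Fm, symmetric])
  also have "\<dots> = (\<integral>z. ?F (case z of (V, Y) \<Rightarrow> stick_breaking V Y) \<partial>D)"
    unfolding law by (rule integral_distr[OF measurable_stick_breaking Fm])
  also have "\<dots> = (\<integral>z. (1 + stick_sum (\<lambda>y. \<Sum>i<m. f i * indicator {e i} y) (fst z) (snd z)) powr (- M) \<partial>D)"
  proof (rule Bochner_Integration.integral_cong[OF refl])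
    fix z assume z: "z \<in> space D"
    obtain V Y where zz: "z = (V, Y)" by (cases z)
    have V: "\<And>i. V i \<in> {0<..<1}" using space_D[OF z] by (simp add: zz)
    note w = stick_weight_bounds[where V=V, OF V]
    have sm: "summable (\<lambda>j. stick_weight V j * indicator {y} (Y j))" for y
      by (rule summable_comparison_test'[OF w(3), of 0]) (use w(1) in \<open>simp add: indicator_def\<close>)
    have "measure (stick_breaking V Y) {y} = (\<Sum>j. stick_weight V j * indicator {y} (Y j))" for y
    proof -
      have "emeasure (stick_breaking V Y) {y} = (\<Sum>j. ennreal (stick_weight V j * indicator {y} (Y j)))"
        unfolding emeasure_stick_breaking(1) by (intro suminf_cong) (simp add: indicator_def)
      also have "\<dots> = ennreal (\<Sum>j. stick_weight V j * indicator {y} (Y j))"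
        by (rule suminf_ennreal2[OF _ sm]) (simp add: w)
      finally show ?thesis unfolding measure_def
        by (simp add: suminf_nonneg[OF sm] w)
    qed
    then have "(\<Sum>i<m. f i * measure (stick_breaking V Y) {e i}) = (\<Sum>i<m. \<Sum>j. f i * (stick_weight V j * indicator {e i} (Y j)))"
      using suminf_mult[OF sm] by simp
    also have "\<dots> = (\<Sum>j. \<Sum>i<m. f i * (stick_weight V j * indicator {e i} (Y j)))"
      by (rule suminf_sum[symmetric]) (rule summable_mult[OF sm])
    also have "\<dots> = stick_sum (\<lambda>y. \<Sum>i<m. f i * indicator {e i} y) V Y"
      unfolding stick_sum_def by (intro suminf_cong) (simp only: sum_distrib_left mult.left_commute)
    finally show "?F (case z of (V, Y) \<Rightarrow> stick_breaking V Y) =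
        (1 + stick_sum (\<lambda>y. \<Sum>i<m. f i * indicator {e i} y) (fst z) (snd z)) powr (- M)" by (simp add: zz)
  qed
  also have "\<dots> = (\<Prod>i<m. (1 + f i) powr (- (M * \<alpha>.prob {e i})))" by (rule stick_laplace[OF e f])
  finally show ?thesis .
qed

end

section \<open>Random nonnegative sequences and discrete measures\<close>

text \<open>The restriction to nonnegative numbers keeps the exponentials in \<open>laplace_unique\<close> bounded at every point.\<close>

abbreviation nonneg_sequences :: "(nat \<Rightarrow> real) measure" where
  "nonneg_sequences \<equiv> \<Pi>\<^sub>M i\<in>(UNIV::nat set). restrict_space borel {0..}"

lemma space_nonneg_sequences: "space nonneg_sequences = {x. \<forall>i. 0 \<le> x i}"
  by (auto simp: space_PiM space_restrict_space PiE_def Pi_def)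

lemma nonneg_coordinate: "(\<lambda>x. x i) \<in> borel_measurable nonneg_sequences"
proof -
  have "(\<lambda>x. x i) \<in> nonneg_sequences \<rightarrow>\<^sub>M restrict_space borel {0..}" by simp
  from measurable_compose[OF this measurable_restrict_space1[of "\<lambda>x::real. x" borel borel]] show ?thesis by simp
qed

lemma measurable_nonneg_sequences:
  assumes "\<And>i. (\<lambda>\<omega>. X \<omega> i) \<in> borel_measurable N" "\<And>\<omega> i. 0 \<le> X \<omega> i"
  shows "X \<in> N \<rightarrow>\<^sub>M nonneg_sequences"
proof (rule measurable_PiM_single')
  show "(\<lambda>\<omega>. X \<omega> i) \<in> N \<rightarrow>\<^sub>M restrict_space borel {0..}" for i
    by (rule measurable_restrict_space2) (use assms in auto)
qed (use assms in \<open>auto simp: space_restrict_space\<close>)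

text \<open>Exponentials of nonnegative linear forms are closed under products. They generate the \<open>\<sigma>\<close>-algebra because each
  coordinate is minus the logarithm of one of them.\<close>

lemma laplace_unique:
  assumes \<mu>: "prob_space \<mu>" and \<nu>: "prob_space \<nu>"
    and sets: "sets \<mu> = sets nonneg_sequences" "sets \<nu> = sets nonneg_sequences"
    and eq: "\<And>m f. (\<And>i. 0 \<le> f i) \<Longrightarrow>
      (\<integral>x. exp (- (\<Sum>i<m. f i * x i)) \<partial>\<mu>) = (\<integral>x. exp (- (\<Sum>i<m. f i * x i)) \<partial>\<nu>)"
  shows "\<mu> = \<nu>"
proof -
  let ?B = nonneg_sequences
  define T where "T = {\<lambda>x::nat \<Rightarrow> real. exp (- (\<Sum>i<m. f i * x i)) | m f. \<forall>i. 0 \<le> f i}"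
  have lin: "(\<lambda>x. \<Sum>i<m. f i * x i) \<in> borel_measurable ?B" for m and f :: "nat \<Rightarrow> real"
    by (intro borel_measurable_sum borel_measurable_times borel_measurable_const nonneg_coordinate)
  have meas: "t \<in> borel_measurable ?B" if t: "t \<in> T" for t
  proof -
    obtain m f where t: "t = (\<lambda>x. exp (- (\<Sum>i<m. f i * x i)))" using t by (auto simp: T_def)
    note [measurable] = lin[of f m]
    show ?thesis unfolding t by measurable
  qed
  show ?thesis
  proof (rule prob_measure_eqI_mult_class[of \<mu> \<nu> ?B T, OF \<mu> \<nu> sets meas])
    show "\<exists>b. \<forall>x\<in>space ?B. \<bar>t x\<bar> \<le> b" if t: "t \<in> T" for t
    proof -
      obtain m f where t: "t = (\<lambda>x. exp (- (\<Sum>i<m. f i * x i)))" and f: "\<forall>i. 0 \<le> f i" using t by (auto simp: T_def)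
      have "\<bar>t x\<bar> \<le> 1" if "x \<in> space ?B" for x
      proof -
        have "0 \<le> (\<Sum>i<m. f i * x i)" using that f by (intro sum_nonneg) (auto simp: space_nonneg_sequences)
        then show ?thesis by (simp add: t)
      qed
      then show ?thesis by blast
    qed
    show "(\<lambda>_. 1) \<in> T" unfolding T_def by (intro CollectI exI[of _ 0] exI[of _ "\<lambda>_. 0"]) simp
    show "integral\<^sup>L \<mu> t = integral\<^sup>L \<nu> t" if t: "t \<in> T" for t
    proof -
      obtain m f where t: "t = (\<lambda>x. exp (- (\<Sum>i<m. f i * x i)))" and f: "\<And>i. 0 \<le> f i" using t by (auto simp: T_def)
      show ?thesis unfolding t by (rule eq[OF f])
    qed
    show "\<exists>c1 t1 c2 t2. t1 \<in> T \<and> t2 \<in> T \<and> (\<forall>x\<in>space ?B. s x * t x = c1 * t1 x + c2 * t2 x)"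
      if s: "s \<in> T" and t: "t \<in> T" for s t
    proof -
      obtain m f where s: "s = (\<lambda>x. exp (- (\<Sum>i<m. f i * x i)))" and f: "\<forall>i. 0 \<le> f i" using s by (auto simp: T_def)
      obtain n g where t: "t = (\<lambda>x. exp (- (\<Sum>i<n. g i * x i)))" and g: "\<forall>i. 0 \<le> g i" using t by (auto simp: T_def)
      let ?f = "\<lambda>i. if i < m then f i else 0" and ?g = "\<lambda>i. if i < n then g i else 0"
      have 1: "(\<Sum>i<m. f i * x i) = (\<Sum>i<m + n. ?f i * x i)" for x
        by (intro sum.mono_neutral_cong_left) auto
      have 2: "(\<Sum>i<n. g i * x i) = (\<Sum>i<m + n. ?g i * x i)" for x
        by (intro sum.mono_neutral_cong_left) auto
      have "s x * t x = exp (- (\<Sum>i<m + n. (?f i + ?g i) * x i))" for x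
        unfolding s t 1 2 by (simp only: distrib_right sum.distrib minus_add_distrib exp_add)
      moreover have "(\<lambda>x. exp (- (\<Sum>i<m + n. (?f i + ?g i) * x i))) \<in> T"
        unfolding T_def by (intro CollectI exI[of _ "m + n"] exI[of _ "\<lambda>i. ?f i + ?g i"]) (use f g in auto)
      ultimately show ?thesis
        by (intro exI[of _ 1] exI[of _ "\<lambda>x. exp (- (\<Sum>i<m + n. (?f i + ?g i) * x i))"] exI[of _ 0]) auto
    qed
    define \<Sigma> where "\<Sigma> = sigma (space ?B) {t -` {..c} \<inter> space ?B | t c. t \<in> T}"
    have sp: "space \<Sigma> = space ?B" unfolding \<Sigma>_def by (rule space_measure_of) auto
    have se: "sets \<Sigma> = sigma_sets (space ?B) {t -` {..c} \<inter> space ?B | t c. t \<in> T}"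
      unfolding \<Sigma>_def by (rule sets_measure_of) auto
    have tm: "t \<in> borel_measurable \<Sigma>" if t: "t \<in> T" for t
    proof -
      have "t -` {..c} \<inter> space ?B \<in> sets \<Sigma>" for c unfolding se using t by auto
      moreover have "{x \<in> space \<Sigma>. t x \<le> c} = t -` {..c} \<inter> space ?B" for c by (auto simp: sp)
      ultimately show ?thesis unfolding borel_measurable_iff_le by simp
    qed
    have coord: "(\<lambda>x. x i) \<in> \<Sigma> \<rightarrow>\<^sub>M restrict_space borel {0..}" for i
    proof (rule measurable_restrict_space2)
      show "(\<lambda>x. x i) \<in> space \<Sigma> \<rightarrow> {0..}" by (auto simp: sp space_nonneg_sequences)
      let ?f = "\<lambda>j. if j = i then 1 else 0 :: real"
      have "(\<lambda>x. exp (- (\<Sum>j<Suc i. ?f j * x j))) \<in> T"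
        unfolding T_def by (intro CollectI exI[of _ "Suc i"] exI[of _ ?f]) auto
      from tm[OF this] have m: "(\<lambda>x. exp (- (\<Sum>j<Suc i. ?f j * x j))) \<in> borel_measurable \<Sigma>" .
      have "(\<Sum>j<Suc i. ?f j * x j) = x i" for x :: "nat \<Rightarrow> real"
      proof -
        have "(\<Sum>j<Suc i. ?f j * x j) = (\<Sum>j<Suc i. if j = i then x j else 0)" by (intro sum.cong) auto
        then show ?thesis by simp
      qed
      with m have m': "(\<lambda>x. exp (- x i)) \<in> borel_measurable \<Sigma>" by simp
      have "(\<lambda>x. - ln (exp (- x i))) \<in> borel_measurable \<Sigma>" using m' by measurable
      then show "(\<lambda>x. x i) \<in> borel_measurable \<Sigma>" by simp
    qed
    have id: "(\<lambda>x. x) \<in> \<Sigma> \<rightarrow>\<^sub>M ?B"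
      by (rule measurable_PiM_single') (use coord in \<open>auto simp: sp space_PiM\<close>)
    show "sets ?B \<subseteq> sigma_sets (space ?B) {t -` {..c} \<inter> space ?B | t c. t \<in> T}"
    proof
      fix A assume A: "A \<in> sets ?B"
      have "(\<lambda>x. x) -` A \<inter> space \<Sigma> \<in> sets \<Sigma>" by (rule measurable_sets[OF id A])
      moreover have "(\<lambda>x. x) -` A \<inter> space \<Sigma> = A" using sets.sets_into_space[OF A] by (auto simp: sp)
      ultimately show "A \<in> sigma_sets (space ?B) {t -` {..c} \<inter> space ?B | t c. t \<in> T}" using se by simp
    qed
  qed
qed

lemma LIMSEQ_subsubseqI:
  fixes a :: "nat \<Rightarrow> real"
  assumes "\<And>r :: nat \<Rightarrow> nat. strict_mono r \<Longrightarrow> \<exists>s :: nat \<Rightarrow> nat. strict_mono s \<and> (\<lambda>k. a (r (s k))) \<longlonglongrightarrow> L"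
  shows "a \<longlonglongrightarrow> L"
proof (rule ccontr)
  assume "\<not> a \<longlonglongrightarrow> L"
  then obtain \<epsilon> where \<epsilon>: "\<epsilon> > 0" and "\<And>N. \<exists>n\<ge>N. \<not> dist (a n) L < \<epsilon>"
    unfolding lim_sequentially by blast
  then have "infinite {n. \<not> dist (a n) L < \<epsilon>}" unfolding infinite_nat_iff_unbounded_le by blast
  from infinite_enumerate[OF this] obtain r :: "nat \<Rightarrow> nat" where r: "strict_mono r" "\<And>n. \<not> dist (a (r n)) L < \<epsilon>" by auto
  from assms[OF r(1)] obtain s where "(\<lambda>k. a (r (s k))) \<longlonglongrightarrow> L" by blast
  from tendstoD[OF this \<epsilon>] have "\<forall>\<^sub>F k in sequentially. False" by (rule eventually_mono) (use r(2) in blast)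
  then show False by simp
qed

text \<open>A bounded measurable function is its own least integrable majorant.\<close>

lemma outer_expectation_measurable:
  assumes "prob_space \<Omega>" and m: "g \<in> borel_measurable \<Omega>" and b: "\<And>\<omega>. \<omega> \<in> space \<Omega> \<Longrightarrow> \<bar>g \<omega>\<bar> \<le> b"
  shows "outer_expectation \<Omega> g = (\<integral>\<omega>. g \<omega> \<partial>\<Omega>)"
proof -
  interpret prob_space \<Omega> by fact
  have i: "integrable \<Omega> g" by (rule integrable_const_bound[of _ b]) (use m b in auto)
  show ?thesis unfolding outer_expectation_def
  proof (rule cInf_eq_minimum)
    show "integral\<^sup>L \<Omega> g \<in> {integral\<^sup>L \<Omega> U | U. integrable \<Omega> U \<and> (\<forall>\<omega>\<in>space \<Omega>. g \<omega> \<le> U \<omega>)}" using i by blast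
    fix y assume "y \<in> {integral\<^sup>L \<Omega> U | U. integrable \<Omega> U \<and> (\<forall>\<omega>\<in>space \<Omega>. g \<omega> \<le> U \<omega>)}"
    then obtain U where U: "y = integral\<^sup>L \<Omega> U" "integrable \<Omega> U" "\<forall>\<omega>\<in>space \<Omega>. g \<omega> \<le> U \<omega>" by blast
    show "integral\<^sup>L \<Omega> g \<le> y" unfolding U(1) by (rule integral_mono[OF i U(2)]) (use U(3) in blast)
  qed
qed

lemma empirical_measure_props:
  fixes x :: "nat \<Rightarrow> 'a"
  assumes n: "n > 0"
  shows "prob_space (empirical_measure x n)" "sets (empirical_measure x n) = UNIV"
    "measure (empirical_measure x n) {y} = freq x n y"
proof -
  let ?D = "distr (density (count_space (UNIV :: nat set)) (\<lambda>i. if i < n then ennreal (1 / real n) else 0)) (count_space UNIV) x"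
  have D: "emeasure ?D C = ennreal (1 / real n) * (\<Sum>i<n. emeasure (return (count_space UNIV) (x i)) C)" for C
  proof -
    have "emeasure ?D C = (\<integral>\<^sup>+i. (if i < n then ennreal (1 / real n) else 0) * indicator (x -` C) i \<partial>count_space UNIV)"
      by (simp add: emeasure_distr emeasure_density)
    also have "\<dots> = (\<Sum>i. (if i < n then ennreal (1 / real n) else 0) * indicator (x -` C) i)"
      by (rule nn_integral_count_space_nat)
    also have "\<dots> = (\<Sum>i<n. (if i < n then ennreal (1 / real n) else 0) * indicator (x -` C) i)"
      by (rule suminf_finite) auto
    also have "\<dots> = (\<Sum>i<n. ennreal (1 / real n) * emeasure (return (count_space UNIV) (x i)) C)"
      by (intro sum.cong) (auto simp: indicator_def)
    finally show ?thesis by (simp only: sum_distrib_left)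
  qed
  have "empirical_measure x n = measure_of (space ?D) (sets ?D) (emeasure ?D)"
    unfolding empirical_measure_def by (rule arg_cong3[of _ _ _ _ _ _ measure_of]) (simp_all add: D fun_eq_iff)
  then have eq: "empirical_measure x n = ?D" by (simp only: measure_of_of_measure)
  have em: "emeasure (empirical_measure x n) C = ennreal ((\<Sum>i<n. indicator C (x i)) / real n)" for C
  proof -
    have "emeasure (empirical_measure x n) C = ennreal (1 / real n) * (\<Sum>i<n. ennreal (indicator C (x i)))"
      unfolding eq D by (simp add: ennreal_indicator)
    also have "\<dots> = ennreal (1 / real n) * ennreal (\<Sum>i<n. indicator C (x i))" by (subst sum_ennreal) auto
    also have "\<dots> = ennreal (1 / real n * (\<Sum>i<n. indicator C (x i)))" by (rule ennreal_mult'[symmetric]) simp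
    finally show ?thesis by simp
  qed
  show "sets (empirical_measure x n) = UNIV" unfolding eq by simp
  show "prob_space (empirical_measure x n)"
  proof
    have "space (empirical_measure x n) = UNIV" unfolding eq by simp
    then show "emeasure (empirical_measure x n) (space (empirical_measure x n)) = 1" using n by (simp add: em)
  qed
  have "0 \<le> (\<Sum>i<n. indicator {y} (x i)) / real n" using freq_bounds(1)[of x n y] unfolding freq_def .
  then show "measure (empirical_measure x n) {y} = freq x n y" unfolding measure_def em freq_def by simp
qed

lemma mixture_measure_props:
  fixes P Q :: "'a measure"
  assumes P: "prob_space P" "sets P = UNIV" and Q: "prob_space Q" "sets Q = UNIV" and \<theta>: "0 \<le> \<theta>" "\<theta> \<le> 1"
  shows "prob_space (mixture_measure \<theta> P Q)" "sets (mixture_measure \<theta> P Q) = UNIV"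
    "measure (mixture_measure \<theta> P Q) C = \<theta> * measure P C + (1 - \<theta>) * measure Q C"
proof -
  interpret P: prob_space P by (rule P)
  interpret Q: prob_space Q by (rule Q)
  let ?\<mu> = "\<lambda>C. ennreal \<theta> * emeasure P C + ennreal (1 - \<theta>) * emeasure Q C"
  have sU: "sigma_sets UNIV (UNIV :: 'a set set) = UNIV"
    by (rule sigma_algebra.sigma_sets_eq) (use sigma_algebra_Pow[of UNIV] in simp)
  have em: "emeasure (mixture_measure \<theta> P Q) C = ?\<mu> C" for C
    unfolding mixture_measure_def
  proof (rule emeasure_measure_of_sigma)
    show "sigma_algebra UNIV (UNIV :: 'a set set)" using sigma_algebra_Pow[of UNIV] by simp
    show "positive UNIV ?\<mu>" by (simp add: positive_def)
    show "countably_additive UNIV ?\<mu>"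
    proof (rule countably_additiveI)
      fix A :: "nat \<Rightarrow> 'a set" assume d: "disjoint_family A"
      have "(\<Sum>i. ?\<mu> (A i)) = (\<Sum>i. ennreal \<theta> * emeasure P (A i)) + (\<Sum>i. ennreal (1 - \<theta>) * emeasure Q (A i))"
        by (rule suminf_add[symmetric]) auto
      also have "\<dots> = ennreal \<theta> * (\<Sum>i. emeasure P (A i)) + ennreal (1 - \<theta>) * (\<Sum>i. emeasure Q (A i))"
        by (simp only: ennreal_suminf_cmult)
      also have "\<dots> = ?\<mu> (\<Union>i. A i)"
        using suminf_emeasure[of A P] suminf_emeasure[of A Q] d P(2) Q(2) by simp
      finally show "(\<Sum>i. ?\<mu> (A i)) = ?\<mu> (\<Union>i. A i)" .
    qed
  qed simp
  have em': "emeasure (mixture_measure \<theta> P Q) C = ennreal (\<theta> * measure P C + (1 - \<theta>) * measure Q C)" for C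
    unfolding em P.emeasure_eq_measure Q.emeasure_eq_measure using \<theta>
    by (simp add: ennreal_mult'[symmetric] ennreal_plus[symmetric] del: ennreal_plus)
  show "sets (mixture_measure \<theta> P Q) = UNIV" unfolding mixture_measure_def by (simp add: sU)
  have sp: "space P = UNIV" "space Q = UNIV"
    using sets.sets_into_space[of UNIV P] sets.sets_into_space[of UNIV Q] P(2) Q(2) by auto
  show "prob_space (mixture_measure \<theta> P Q)"
  proof
    have "space (mixture_measure \<theta> P Q) = UNIV" unfolding mixture_measure_def by (rule space_measure_of) simp
    then show "emeasure (mixture_measure \<theta> P Q) (space (mixture_measure \<theta> P Q)) = 1"
      using P.prob_space Q.prob_space by (simp add: em' sp)
  qed
  have "0 \<le> \<theta> * measure P C + (1 - \<theta>) * measure Q C" using \<theta> by simp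
  then show "measure (mixture_measure \<theta> P Q) C = \<theta> * measure P C + (1 - \<theta>) * measure Q C"
    unfolding measure_def[of "mixture_measure \<theta> P Q"] em' by simp
qed

lemma posterior_mean_props:
  fixes \<alpha> :: "'a measure"
  assumes \<alpha>: "prob_space \<alpha>" "sets \<alpha> = UNIV" and M: "M > 0" and n: "n > 0"
  shows "prob_space (posterior_mean \<alpha> M x n)" "sets (posterior_mean \<alpha> M x n) = UNIV"
    "(M + real n) * measure (posterior_mean \<alpha> M x n) {y} = M * measure \<alpha> {y} + real n * freq x n y"
proof -
  have \<theta>: "0 \<le> M / (M + real n)" "M / (M + real n) \<le> 1" using M by auto
  note p = mixture_measure_props[OF \<alpha> empirical_measure_props(1,2)[OF n, of x] \<theta>]
  show "prob_space (posterior_mean \<alpha> M x n)" "sets (posterior_mean \<alpha> M x n) = UNIV"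
    unfolding posterior_mean_def by (rule p)+
  have pos: "M + real n \<noteq> 0" using M by linarith
  have "1 - M / (M + real n) = real n / (M + real n)" using pos by (simp add: field_simps)
  then have "measure (posterior_mean \<alpha> M x n) {y} = M / (M + real n) * measure \<alpha> {y} + real n / (M + real n) * freq x n y"
    unfolding posterior_mean_def p(3) empirical_measure_props(3)[OF n] by simp
  then show "(M + real n) * measure (posterior_mean \<alpha> M x n) {y} = M * measure \<alpha> {y} + real n * freq x n y"
    using pos by (simp add: distrib_left)
qed

lemma brownian_bridge_exists:
  fixes P :: "'a measure"
  assumes P: "prob_space P" "sets P = UNIV" and e: "bij_betw e (UNIV :: nat set) UNIV"
    and s: "summable (\<lambda>i. sqrt (measure P {e i}))"
  shows "\<exists>(N :: (nat \<Rightarrow> real) measure) G. brownian_bridge P indicators N G"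
proof -
  let ?N = "\<Pi>\<^sub>M i\<in>(UNIV::nat set). std_normal_distribution"
  let ?p = "\<lambda>i. measure P {e i}"
  have ps: "prob_space std_normal_distribution" by (rule std_normal.prob_space_axioms)
  interpret N: prob_space ?N by (rule prob_space_PiM) (rule ps)
  have m: "(\<lambda>x. sqrt (?p i) * x) \<in> std_normal_distribution \<rightarrow>\<^sub>M borel" for i by measurable
  have d: "distr ?N borel (\<lambda>\<omega>. sqrt (?p i) * \<omega> i) = gauss_law (?p i)" for i
  proof -
    have "distr ?N borel (\<lambda>\<omega>. sqrt (?p i) * \<omega> i) =
        distr (distr ?N std_normal_distribution (\<lambda>\<omega>. \<omega> i)) borel (\<lambda>x. sqrt (?p i) * x)"
      by (subst distr_distr[OF m]) (auto simp: comp_def)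
    also have "distr ?N std_normal_distribution (\<lambda>\<omega>. \<omega> i) = std_normal_distribution"
      by (rule distr_PiM_component) (auto intro: ps)
    finally show ?thesis by (simp add: gauss_law_def)
  qed
  interpret gaussian_sequence ?N "\<lambda>i \<omega>. sqrt (?p i) * \<omega> i" ?p
  proof unfold_locales
    show "N.indep_vars (\<lambda>_. borel) (\<lambda>i \<omega>. sqrt (?p i) * \<omega> i) UNIV" by (rule PiM_coordinates_indep[OF ps m])
    show "?p sums 1" by (rule integral_countable(2)[where f="\<lambda>_. 0" and B=0, OF P e]) simp
  qed (use d s in auto)
  show ?thesis using brownian_bridge_atomic[OF P e refl] by blast
qed

text \<open>The supremum over sets in the total variation distance is the supremum over their indicators.\<close>

lemma tv_dist_scaled:
  fixes P Q :: "'a measure"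
  assumes P: "prob_space P" "sets P = UNIV" and Q: "prob_space Q" "sets Q = UNIV" and c: "c > 0"
  shows "linf_norm indicators (scaled_diff indicators c P Q) = c * tv_dist P Q"
proof -
  interpret P: prob_space P by (rule P)
  interpret Q: prob_space Q by (rule Q)
  have sp: "space P = UNIV" "space Q = UNIV"
    using sets.sets_into_space[of UNIV P] sets.sets_into_space[of UNIV Q] P(2) Q(2) by auto
  have v: "\<bar>scaled_diff indicators c P Q (indicator C)\<bar> = c * \<bar>measure P C - measure Q C\<bar>" for C
    using c by (simp add: scaled_diff_def sp abs_mult)
  have L: "linf_norm indicators (scaled_diff indicators c P Q) = (SUP C. c * \<bar>measure P C - measure Q C\<bar>)"
    unfolding linf_norm_def image_image v ..
  have b1: "\<bar>measure P C - measure Q C\<bar> \<le> 1" for C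
    using P.prob_le_1[of C] Q.prob_le_1[of C] measure_nonneg[of P C] measure_nonneg[of Q C] unfolding abs_le_iff by linarith
  have bd: "bdd_above (range (\<lambda>C. \<bar>measure P C - measure Q C\<bar>))" by (rule bdd_aboveI[of _ 1]) (use b1 in auto)
  have bd': "bdd_above (range (\<lambda>C. c * \<bar>measure P C - measure Q C\<bar>))"
    by (rule bdd_aboveI[of _ "c * 1"]) (use mult_left_mono[OF b1 less_imp_le[OF c]] in auto)
  show ?thesis
  proof (rule antisym)
    show "linf_norm indicators (scaled_diff indicators c P Q) \<le> c * tv_dist P Q"
      unfolding L tv_dist_def
      by (rule cSUP_least) (auto intro!: mult_left_mono cSUP_upper bd less_imp_le[OF c])
    have "tv_dist P Q \<le> linf_norm indicators (scaled_diff indicators c P Q) / c"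
      unfolding L tv_dist_def
    proof (rule cSUP_least)
      fix C
      have "c * \<bar>measure P C - measure Q C\<bar> \<le> (SUP C. c * \<bar>measure P C - measure Q C\<bar>)" by (rule cSUP_upper[OF UNIV_I bd'])
      then show "\<bar>measure P C - measure Q C\<bar> \<le> (SUP C. c * \<bar>measure P C - measure Q C\<bar>) / c"
        using c by (simp add: pos_le_divide_eq mult.commute)
    qed simp
    then show "c * tv_dist P Q \<le> linf_norm indicators (scaled_diff indicators c P Q)"
      using c by (simp add: pos_le_divide_eq mult.commute)
  qed
qed

lemma scaled_diff_atomic:
  fixes P Q :: "'a measure"
  assumes P: "prob_space P" "sets P = UNIV" and Q: "prob_space Q" "sets Q = UNIV"
    and e: "bij_betw e (UNIV :: nat set) UNIV"
  shows "scaled_diff indicators c P Q = atomic e (\<lambda>i. c * (measure P {e i} - measure Q {e i}))"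
proof -
  have z: "\<bar>0::real\<bar> \<le> 0" by simp
  have sP: "summable (\<lambda>i. \<bar>measure P {e i}\<bar>)" using integral_countable(2)[where f="\<lambda>_. 0" and B=0, OF P e z] by (simp add: sums_summable)
  have sQ: "summable (\<lambda>i. \<bar>measure Q {e i}\<bar>)" using integral_countable(2)[where f="\<lambda>_. 0" and B=0, OF Q e z] by (simp add: sums_summable)
  have s: "summable (\<lambda>i. \<bar>c * (measure P {e i} - measure Q {e i})\<bar>)"
    unfolding abs_mult
  proof (rule summable_mult, rule summable_comparison_test'[OF summable_add[OF sP sQ], of 0])
    show "norm \<bar>measure P {e i} - measure Q {e i}\<bar> \<le> \<bar>measure P {e i}\<bar> + \<bar>measure Q {e i}\<bar>" for i
      using abs_triangle_ineq4[of "measure P {e i}" "measure Q {e i}"] by simp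
  qed
  have "scaled_diff indicators c P Q f = atomic e (\<lambda>i. c * (measure P {e i} - measure Q {e i})) f" if f: "f \<in> indicators" for f
  proof -
    note fb = abs_indicators_le_1[OF f]
    note 1 = summable_mult_bounded(2)[OF sP fb] and 2 = summable_mult_bounded(2)[OF sQ fb]
    have "atomic e (\<lambda>i. c * (measure P {e i} - measure Q {e i})) f = (\<Sum>i. c * (measure P {e i} * f (e i) - measure Q {e i} * f (e i)))"
      unfolding atomic_apply[OF s f] by (simp add: algebra_simps)
    also have "\<dots> = c * (\<Sum>i. measure P {e i} * f (e i) - measure Q {e i} * f (e i))"
      by (rule suminf_mult[OF summable_diff[OF 1 2]])
    also have "(\<Sum>i. measure P {e i} * f (e i) - measure Q {e i} * f (e i)) = (\<Sum>i. measure P {e i} * f (e i)) - (\<Sum>i. measure Q {e i} * f (e i))"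
      by (rule suminf_diff[OF 1 2, symmetric])
    also have "\<dots> = (\<integral>y. f y \<partial>P) - (\<integral>y. f y \<partial>Q)"
      using integral_countable(1)[where f=f and B=1, OF P e fb] integral_countable(1)[where f=f and B=1, OF Q e fb] by simp
    finally show ?thesis using f by (simp add: scaled_diff_def)
  qed
  moreover have "scaled_diff indicators c P Q f = atomic e (\<lambda>i. c * (measure P {e i} - measure Q {e i})) f" if "f \<notin> indicators" for f
    using that by (simp only: scaled_diff_def atomic_def restrict_apply if_False)
  ultimately show ?thesis by blast
qed

section \<open>The coupled posterior\<close>

lemma distr_pair_snd:
  assumes "prob_space A" "prob_space B"
  shows "distr (A \<Otimes>\<^sub>M B) B snd = B"
proof (rule measure_eqI)
  interpret A: prob_space A by fact
  interpret B: prob_space B by fact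
  fix C assume "C \<in> sets (distr (A \<Otimes>\<^sub>M B) B snd)"
  then have C: "C \<in> sets B" by simp
  have "snd -` C \<inter> space (A \<Otimes>\<^sub>M B) = space A \<times> C"
    using sets.sets_into_space[OF C] by (auto simp: space_pair_measure)
  then show "emeasure (distr (A \<Otimes>\<^sub>M B) B snd) C = emeasure B C"
    using B.emeasure_pair_measure_Times[of "space A" A C] C by (simp add: emeasure_distr A.emeasure_space_1)
qed simp

text \<open>Used twice: with \<open>w = 1\<close> and random \<open>s\<close> for a gamma multiple of a random measure, and with constant \<open>s\<close> for a sum of
  independent variables. The absolute value is the identity almost surely and makes the integrand bounded everywhere.\<close>

lemma pair_gamma_laplace:
  assumes A: "prob_space A" and c: "c \<ge> 0" and s [measurable]: "s \<in> borel_measurable A" and s0: "\<And>v. s v \<ge> 0"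
    and w [measurable]: "w \<in> borel_measurable A" and w0: "\<And>v. \<bar>w v\<bar> \<le> 1"
  shows "integrable (A \<Otimes>\<^sub>M gamma_law c) (\<lambda>z. w (fst z) * exp (- (s (fst z) * \<bar>snd z\<bar>)))"
    "(\<integral>z. w (fst z) * exp (- (s (fst z) * \<bar>snd z\<bar>)) \<partial>(A \<Otimes>\<^sub>M gamma_law c)) = (\<integral>v. w v * (1 + s v) powr (- c) \<partial>A)"
proof -
  interpret A: prob_space A by (rule A)
  interpret g: prob_space "gamma_law c" by (rule prob_space_gamma_law[OF c])
  interpret D: pair_prob_space A "gamma_law c" by unfold_locales
  show int: "integrable (A \<Otimes>\<^sub>M gamma_law c) (\<lambda>z. w (fst z) * exp (- (s (fst z) * \<bar>snd z\<bar>)))"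
  proof (rule D.integrable_const_bound[where B=1])
    show "AE z in A \<Otimes>\<^sub>M gamma_law c. norm (w (fst z) * exp (- (s (fst z) * \<bar>snd z\<bar>))) \<le> 1"
    proof (rule AE_I2)
      fix z
      have "exp (- (s (fst z) * \<bar>snd z\<bar>)) \<le> 1" using s0 by simp
      then show "norm (w (fst z) * exp (- (s (fst z) * \<bar>snd z\<bar>))) \<le> 1" using w0[of "fst z"] by (simp add: abs_mult mult_le_one)
    qed
  qed measurable
  have "(\<integral>z. w (fst z) * exp (- (s (fst z) * \<bar>snd z\<bar>)) \<partial>(A \<Otimes>\<^sub>M gamma_law c)) =
      (\<integral>v. (\<integral>t. w v * exp (- (s v * \<bar>t\<bar>)) \<partial>gamma_law c) \<partial>A)"
    using D.integral_fst'[OF int] by simp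
  also have "\<dots> = (\<integral>v. w v * (1 + s v) powr (- c) \<partial>A)"
  proof (rule Bochner_Integration.integral_cong[OF refl])
    fix v
    have "(\<integral>t. exp (- (s v * \<bar>t\<bar>)) \<partial>gamma_law c) = (\<integral>t. exp (- (s v * t)) \<partial>gamma_law c)"
    proof (rule integral_cong_AE)
      show "AE t in gamma_law c. exp (- (s v * \<bar>t\<bar>)) = exp (- (s v * t))"
        using AE_gamma_law_nonneg[OF c] by eventually_elim simp
    qed measurable
    then show "(\<integral>t. w v * exp (- (s v * \<bar>t\<bar>)) \<partial>gamma_law c) = w v * (1 + s v) powr (- c)"
      using gamma_law_laplace(2)[OF c s0] by simp
  qed
  finally show "(\<integral>z. w (fst z) * exp (- (s (fst z) * \<bar>snd z\<bar>)) \<partial>(A \<Otimes>\<^sub>M gamma_law c)) = (\<integral>v. w v * (1 + s v) powr (- c) \<partial>A)" .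
qed

text \<open>The deterministic core of the theorem, along a subsequence \<open>n k\<close>. With \<open>T\<close> the sum of the weights \<open>X\<close> and \<open>W\<close> the sum of the \<open>Uc\<close>, the identity
  \<open>X i - q i * T = M * (a i - q i) + sqrt n * (Uc i - q i * W)\<close> shows that the scaled difference is \<open>n / T\<close> times a sequence which
  tends to \<open>u\<close> in \<open>l\<^sup>1\<close>, and \<open>n / T\<close> tends to \<open>1\<close>.\<close>

lemma l1_limit_of_normalised_weights:
  fixes a p U :: "nat \<Rightarrow> real" and q Uc X :: "nat \<Rightarrow> nat \<Rightarrow> real" and n :: "nat \<Rightarrow> nat"
  assumes n: "filterlim n at_top sequentially" "\<And>k. n k > 0"
    and a: "a sums 1" "\<And>i. 0 \<le> a i" and p: "p sums 1" "\<And>i. 0 \<le> p i"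
    and q: "\<And>k. q k sums 1" "\<And>k i. 0 \<le> q k i"
    and qp: "\<And>k. summable (\<lambda>i. \<bar>q k i - p i\<bar>)" "(\<lambda>k. \<Sum>i. \<bar>q k i - p i\<bar>) \<longlonglongrightarrow> 0"
    and U: "summable (\<lambda>i. \<bar>U i\<bar>)"
    and Uc: "\<And>k. summable (\<lambda>i. \<bar>Uc k i - U i\<bar>)" "(\<lambda>k. \<Sum>i. \<bar>Uc k i - U i\<bar>) \<longlonglongrightarrow> 0"
    and X: "\<And>k i. X k i = M * a i + real (n k) * q k i + sqrt (real (n k)) * Uc k i" and M: "M > 0"
  defines "\<zeta> \<equiv> \<lambda>k i. sqrt (real (n k)) * (X k i / (\<Sum>j. X k j) - q k i)"
    and "u \<equiv> \<lambda>i. U i - p i * (\<Sum>j. U j)"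
  shows "\<And>k. summable (\<lambda>i. \<bar>\<zeta> k i\<bar>)" "summable (\<lambda>i. \<bar>u i\<bar>)" "(\<lambda>k. \<Sum>i. \<bar>\<zeta> k i - u i\<bar>) \<longlonglongrightarrow> 0"
proof -
  define W where "W = (\<Sum>j. U j)"
  define Wn where "Wn k = (\<Sum>j. Uc k j)" for k
  define T where "T k = (\<Sum>j. X k j)" for k
  define D where "D k = (\<Sum>i. \<bar>Uc k i - U i\<bar>)" for k
  define C where "C k = (\<Sum>i. \<bar>q k i - p i\<bar>)" for k
  define sn where "sn k = sqrt (real (n k))" for k
  have sn: "sn k > 0" "sn k * sn k = real (n k)" for k using n(2)[of k] by (auto simp: sn_def)
  have Us: "summable U" by (rule summable_rabs_cancel[OF U])
  have dUs: "summable (\<lambda>i. Uc k i - U i)" for k by (rule summable_rabs_cancel[OF Uc(1)])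
  have Uns: "summable (Uc k)" for k using summable_add[OF dUs[of k] Us] by simp
  have Una: "summable (\<lambda>i. \<bar>Uc k i\<bar>)" for k
    by (rule summable_comparison_test'[OF summable_add[OF Uc(1)[of k] U], of 0]) (simp add: abs_triangle_ineq2_sym) 
  have WW: "\<bar>Wn k - W\<bar> \<le> D k" for k
  proof -
    have "Wn k - W = (\<Sum>i. Uc k i - U i)" unfolding Wn_def W_def by (rule suminf_diff[OF Uns Us])
    then show ?thesis using summable_rabs[OF Uc(1)[of k]] by (simp add: D_def)
  qed
  have Xs: "X k sums (M * 1 + real (n k) * 1 + sn k * Wn k)" for k
    unfolding X sn_def Wn_def by (intro sums_add sums_mult a(1) q(1) summable_sums Uns)
  have T: "T k = M + real (n k) + sn k * Wn k" for k unfolding T_def using sums_unique[OF Xs[of k]] by simp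
  have aa: "summable (\<lambda>i. \<bar>a i\<bar>)" and qa: "\<And>k. summable (\<lambda>i. \<bar>q k i\<bar>)" and pa: "summable (\<lambda>i. \<bar>p i\<bar>)"
    using sums_summable[OF a(1)] sums_summable[OF p(1)] sums_summable[OF q(1)] a(2) q(2) p(2) by simp_all
  have Xa: "summable (\<lambda>i. \<bar>X k i\<bar>)" for k
  proof (rule summable_comparison_test'[of _ 0])
    show "summable (\<lambda>i. M * \<bar>a i\<bar> + real (n k) * \<bar>q k i\<bar> + sn k * \<bar>Uc k i\<bar>)"
      by (intro summable_add summable_mult aa qa Una)
    fix i
    have "\<bar>X k i\<bar> \<le> \<bar>M * a i\<bar> + \<bar>real (n k) * q k i\<bar> + \<bar>sn k * Uc k i\<bar>"
      unfolding X sn_def[symmetric] by linarith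
    then show "norm \<bar>X k i\<bar> \<le> M * \<bar>a i\<bar> + real (n k) * \<bar>q k i\<bar> + sn k * \<bar>Uc k i\<bar>"
      using M sn(1)[of k] by (simp add: abs_mult)
  qed
  show \<zeta>s: "summable (\<lambda>i. \<bar>\<zeta> k i\<bar>)" for k
  proof (rule summable_comparison_test'[of _ 0])
    show "summable (\<lambda>i. sn k * (\<bar>X k i\<bar> / \<bar>T k\<bar> + \<bar>q k i\<bar>))"
      by (intro summable_mult summable_add summable_divide Xa qa)
    fix i
    have "\<bar>X k i / T k - q k i\<bar> \<le> \<bar>X k i\<bar> / \<bar>T k\<bar> + \<bar>q k i\<bar>"
      using abs_triangle_ineq4[of "X k i / T k" "q k i"] by (simp add: abs_divide)
    then show "norm \<bar>\<zeta> k i\<bar> \<le> sn k * (\<bar>X k i\<bar> / \<bar>T k\<bar> + \<bar>q k i\<bar>)"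
      using sn(1)[of k] by (simp add: \<zeta>_def T_def[symmetric] sn_def[symmetric] abs_mult)
  qed
  show us: "summable (\<lambda>i. \<bar>u i\<bar>)"
  proof (rule summable_comparison_test'[of _ 0])
    show "summable (\<lambda>i. \<bar>U i\<bar> + \<bar>p i\<bar> * \<bar>W\<bar>)" by (intro summable_add U summable_mult2 pa)
    show "norm \<bar>u i\<bar> \<le> \<bar>U i\<bar> + \<bar>p i\<bar> * \<bar>W\<bar>" for i
      using abs_triangle_ineq4[of "U i" "p i * W"] by (simp add: u_def W_def[symmetric] abs_mult)
  qed
  define E where "E k = 2 * M / sn k + D k + D k + \<bar>W\<bar> * C k" for k
  have nr: "filterlim (\<lambda>k. real (n k)) at_top sequentially"
    by (rule filterlim_compose[OF filterlim_real_sequentially n(1)])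
  have snlim: "filterlim sn at_top sequentially" unfolding sn_def by (rule filterlim_compose[OF sqrt_at_top nr])
  have inv: "(\<lambda>k. c / sn k) \<longlonglongrightarrow> 0" for c
    by (rule real_tendsto_divide_at_top[OF tendsto_const snlim])
  have E0: "E \<longlonglongrightarrow> 0"
    unfolding E_def D_def C_def using tendsto_add[OF tendsto_add[OF tendsto_add[OF inv[of "2 * M"] Uc(2)] Uc(2)] tendsto_mult[OF tendsto_const[of "\<bar>W\<bar>"] qp(2)]]
    by simp
  have D0: "D \<longlonglongrightarrow> 0" unfolding D_def by (rule Uc(2))
  have WnW: "Wn \<longlonglongrightarrow> W"
    by (rule LIM_zero_cancel, rule Lim_null_comparison[OF _ D0]) (use WW in \<open>auto intro: always_eventually\<close>)
  define \<rho> where "\<rho> k = real (n k) / T k" for k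
  have Tn: "(\<lambda>k. T k / real (n k)) \<longlonglongrightarrow> 0 + 1 + W * 0"
  proof -
    have "T k / real (n k) = M / real (n k) + 1 + Wn k * (1 / sn k)" for k
    proof -
      have "sn k * Wn k / real (n k) = Wn k * (1 / sn k)"
        unfolding sn(2)[symmetric] using sn(1)[of k] by simp
      then show ?thesis using n(2)[of k] by (simp add: T add_divide_distrib)
    qed
    moreover have "(\<lambda>k. M / real (n k) + 1 + Wn k * (1 / sn k)) \<longlonglongrightarrow> 0 + 1 + W * 0"
      by (intro tendsto_add tendsto_mult tendsto_const WnW inv real_tendsto_divide_at_top[OF tendsto_const nr])
    ultimately show ?thesis by simp
  qed
  then have Tn1: "(\<lambda>k. T k / real (n k)) \<longlonglongrightarrow> 1" by simp
  have \<rho>1: "\<rho> \<longlonglongrightarrow> 1"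
  proof -
    have "(\<lambda>k. inverse (T k / real (n k))) \<longlonglongrightarrow> inverse 1" by (rule tendsto_inverse[OF Tn1]) simp
    then show ?thesis by (simp add: \<rho>_def[abs_def])
  qed
  have Tpos: "\<forall>\<^sub>F k in sequentially. T k \<noteq> 0"
    using order_tendstoD(1)[OF Tn1 zero_less_one] by (rule eventually_mono) auto
  have bnd: "(\<Sum>i. \<bar>\<zeta> k i - u i\<bar>) \<le> \<bar>\<rho> k\<bar> * E k + \<bar>\<rho> k - 1\<bar> * (\<Sum>i. \<bar>u i\<bar>)" if T0: "T k \<noteq> 0" for k
  proof -
    define v where "v i = M * (a i - q k i) / sn k + Uc k i - q k i * Wn k" for i
    have \<zeta>v: "\<zeta> k i = \<rho> k * v i" for i
    proof -
      have "X k i - q k i * T k = M * (a i - q k i) + sn k * (Uc k i - q k i * Wn k)"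
        unfolding X T sn_def[symmetric] by (simp add: algebra_simps)
      also have "\<dots> = sn k * v i" using sn(1)[of k] by (simp add: v_def field_simps)
      finally have "(X k i - q k i * T k) / T k = sn k * v i / T k" by (simp only:)
      then have "X k i / T k - q k i = sn k * v i / T k" using T0 by (simp add: diff_divide_distrib)
      then have "\<zeta> k i = sn k * (sn k * v i / T k)" by (simp add: \<zeta>_def T_def[symmetric] sn_def[symmetric])
      also have "\<dots> = (sn k * sn k) / T k * v i" by simp
      finally show ?thesis by (simp only: sn(2) \<rho>_def)
    qed
    let ?B = "\<lambda>i. (M / sn k) * (a i + q k i) + \<bar>Uc k i - U i\<bar> + q k i * D k + \<bar>W\<bar> * \<bar>q k i - p i\<bar>"
    have vu: "\<bar>v i - u i\<bar> \<le> ?B i" for i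
    proof -
      have "v i - u i = (M / sn k) * (a i - q k i) + (Uc k i - U i) - q k i * (Wn k - W) - W * (q k i - p i)"
        by (simp add: v_def u_def W_def[symmetric] algebra_simps diff_divide_distrib)
      then have "\<bar>v i - u i\<bar> \<le> \<bar>(M / sn k) * (a i - q k i)\<bar> + \<bar>Uc k i - U i\<bar> + \<bar>q k i * (Wn k - W)\<bar> + \<bar>W * (q k i - p i)\<bar>"
        by linarith
      moreover have "\<bar>(M / sn k) * (a i - q k i)\<bar> \<le> (M / sn k) * (a i + q k i)"
        unfolding abs_mult using M sn(1)[of k] a(2)[of i] q(2)[of k i] by (simp add: abs_le_iff divide_right_mono mult_left_mono)
      moreover have "\<bar>q k i * (Wn k - W)\<bar> \<le> q k i * D k"
        unfolding abs_mult using q(2)[of k i] WW[of k] by (simp add: mult_left_mono)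
      ultimately show ?thesis by (simp add: abs_mult)
    qed
    have Bs: "?B sums ((M / sn k) * (1 + 1) + D k + 1 * D k + \<bar>W\<bar> * C k)"
      unfolding D_def C_def
      by (intro sums_add sums_mult sums_mult2 a(1) q(1) summable_sums Uc(1) qp(1))
    have vus: "summable (\<lambda>i. \<bar>v i - u i\<bar>)"
      by (rule summable_comparison_test'[OF sums_summable[OF Bs], of 0]) (use vu in simp)
    have vuE: "(\<Sum>i. \<bar>v i - u i\<bar>) \<le> E k"
    proof -
      have "(\<Sum>i. \<bar>v i - u i\<bar>) \<le> (\<Sum>i. ?B i)" by (rule suminf_le[OF vu vus sums_summable[OF Bs]])
      also have "\<dots> = E k" using sums_unique[OF Bs, symmetric] by (simp add: E_def mult.commute)
      finally show ?thesis .
    qed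
    have le: "\<bar>\<zeta> k i - u i\<bar> \<le> \<bar>\<rho> k\<bar> * \<bar>v i - u i\<bar> + \<bar>\<rho> k - 1\<bar> * \<bar>u i\<bar>" for i
    proof -
      have "\<zeta> k i - u i = \<rho> k * (v i - u i) + (\<rho> k - 1) * u i" by (simp add: \<zeta>v algebra_simps)
      then show ?thesis using abs_triangle_ineq[of "\<rho> k * (v i - u i)" "(\<rho> k - 1) * u i"] by (simp add: abs_mult)
    qed
    have rs: "(\<lambda>i. \<bar>\<rho> k\<bar> * \<bar>v i - u i\<bar> + \<bar>\<rho> k - 1\<bar> * \<bar>u i\<bar>) sums (\<bar>\<rho> k\<bar> * (\<Sum>i. \<bar>v i - u i\<bar>) + \<bar>\<rho> k - 1\<bar> * (\<Sum>i. \<bar>u i\<bar>))"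
      by (intro sums_add sums_mult summable_sums vus us)
    have "(\<Sum>i. \<bar>\<zeta> k i - u i\<bar>) \<le> (\<Sum>i. \<bar>\<rho> k\<bar> * \<bar>v i - u i\<bar> + \<bar>\<rho> k - 1\<bar> * \<bar>u i\<bar>)"
      by (rule suminf_le[OF le _ sums_summable[OF rs]])
         (rule summable_comparison_test'[OF sums_summable[OF rs], of 0], use le in simp)
    also have "\<dots> = \<bar>\<rho> k\<bar> * (\<Sum>i. \<bar>v i - u i\<bar>) + \<bar>\<rho> k - 1\<bar> * (\<Sum>i. \<bar>u i\<bar>)" by (rule sums_unique[OF rs, symmetric])
    also have "\<dots> \<le> \<bar>\<rho> k\<bar> * E k + \<bar>\<rho> k - 1\<bar> * (\<Sum>i. \<bar>u i\<bar>)" by (intro add_right_mono mult_left_mono vuE) simp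
    finally show ?thesis .
  qed
  have lim: "(\<lambda>k. \<bar>\<rho> k\<bar> * E k + \<bar>\<rho> k - 1\<bar> * (\<Sum>i. \<bar>u i\<bar>)) \<longlonglongrightarrow> 0"
  proof -
    have "(\<lambda>k. \<bar>\<rho> k\<bar> * E k + \<bar>\<rho> k - 1\<bar> * (\<Sum>i. \<bar>u i\<bar>)) \<longlonglongrightarrow> \<bar>1\<bar> * 0 + \<bar>1 - 1\<bar> * (\<Sum>i. \<bar>u i\<bar>)"
      by (intro tendsto_add tendsto_mult tendsto_rabs tendsto_diff \<rho>1 E0 tendsto_const)
    then show ?thesis by simp
  qed
  show "(\<lambda>k. \<Sum>i. \<bar>\<zeta> k i - u i\<bar>) \<longlonglongrightarrow> 0"
  proof (rule Lim_null_comparison[OF _ lim])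
    show "\<forall>\<^sub>F k in sequentially. norm (\<Sum>i. \<bar>\<zeta> k i - u i\<bar>) \<le> \<bar>\<rho> k\<bar> * E k + \<bar>\<rho> k - 1\<bar> * (\<Sum>i. \<bar>u i\<bar>)"
      using Tpos
    proof eventually_elim
      case (elim k)
      have "summable (\<lambda>i. \<bar>\<zeta> k i - u i\<bar>)"
        by (rule summable_comparison_test'[OF summable_add[OF \<zeta>s[of k] us], of 0]) (simp add: abs_triangle_ineq4)
      then have "0 \<le> (\<Sum>i. \<bar>\<zeta> k i - u i\<bar>)" by (rule suminf_nonneg) simp
      then show ?case using bnd[OF elim] by simp
    qed
  qed
qed

text \<open>A fixed sample \<open>x\<close> with the properties from \<open>freq_dominated_AE\<close>, together with the variables from
  \<open>coupled_exponential_sums\<close>, of which the locale takes independent copies.\<close>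

locale posterior_coupling =
  fixes \<alpha> P0 :: "'a measure" and M :: real and e :: "nat \<Rightarrow> 'a" and x :: "nat \<Rightarrow> 'a" and b :: "nat \<Rightarrow> real"
    and \<Omega>0 :: "real measure" and V :: "nat \<Rightarrow> real \<Rightarrow> real" and Z :: "real \<Rightarrow> real"
  assumes \<alpha>: "prob_space \<alpha>" "sets \<alpha> = UNIV" and P0: "prob_space P0" "sets P0 = UNIV" and M: "M > 0"
    and e: "bij_betw e (UNIV :: nat set) UNIV" and psum: "summable (\<lambda>i. sqrt (measure P0 {e i}))"
    and freq_lim: "\<And>i. (\<lambda>n. freq x n (e i)) \<longlonglongrightarrow> measure P0 {e i}"
    and b: "summable b" "\<And>n i. sqrt (freq x n (e i)) \<le> b i"
    and \<Omega>0: "prob_space \<Omega>0" and V: "\<And>k. V k \<in> borel_measurable \<Omega>0" and Z: "Z \<in> borel_measurable \<Omega>0"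
    and Z_law: "distr \<Omega>0 borel Z = std_normal_distribution"
    and V_low: "\<And>k \<omega>. - sqrt (real k) \<le> V k \<omega>"
    and V_laplace: "\<And>k s. s \<ge> 0 \<Longrightarrow> (\<integral>\<omega>. exp (- (s * (real k + sqrt (real k) * V k \<omega>))) \<partial>\<Omega>0) = (1 + s) powr (- real k)"
    and V_int: "\<And>k. integrable \<Omega>0 (V k)" and V_abs: "\<And>k. (\<integral>\<omega>. \<bar>V k \<omega>\<bar> \<partial>\<Omega>0) \<le> 1"
    and Z_int: "integrable \<Omega>0 Z"
    and VZ: "(\<lambda>k. \<integral>\<omega>. \<bar>V k \<omega> - Z \<omega>\<bar> \<partial>\<Omega>0) \<longlonglongrightarrow> 0"
begin

sublocale \<Omega>0: prob_space \<Omega>0 by (rule \<Omega>0)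

abbreviation "a i \<equiv> measure \<alpha> {e i}"
abbreviation "p i \<equiv> measure P0 {e i}"
abbreviation "q n i \<equiv> freq x n (e i)"

text \<open>The number of observations equal to \<open>e i\<close>, which has to be a natural number to select the variable \<open>V (hits n i)\<close>.\<close>

definition hits :: "nat \<Rightarrow> nat \<Rightarrow> nat" where "hits n i = card ({..<n} \<inter> {j. e i = x j})"

lemma hits_eq: "n > 0 \<Longrightarrow> real (hits n i) = real n * q n i"
  unfolding hits_def freq_def by (simp add: indicator_def sum.If_cases of_bool_def Int_def eq_commute[of "e i"])

abbreviation "\<Theta>i i \<equiv> \<Omega>0 \<Otimes>\<^sub>M gamma_law (M * a i)"
definition \<Theta> :: "(nat \<Rightarrow> real \<times> real) measure" where "\<Theta> = PiM UNIV \<Theta>i"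

lemma Ma_nonneg: "0 \<le> M * a i" using M by simp

lemma prob_\<Theta>i: "prob_space (\<Theta>i i)"
proof -
  interpret g: prob_space "gamma_law (M * a i)" by (rule prob_space_gamma_law[OF Ma_nonneg])
  interpret D: pair_prob_space \<Omega>0 "gamma_law (M * a i)" by unfold_locales
  show ?thesis by (rule D.prob_space_axioms)
qed

sublocale \<Theta>: prob_space \<Theta> unfolding \<Theta>_def by (rule prob_space_PiM) (rule prob_\<Theta>i)

definition hit_mass :: "nat \<Rightarrow> real \<Rightarrow> real" where "hit_mass k v = real k + sqrt (real k) * V k v"

lemma hit_mass_nonneg: "0 \<le> hit_mass k v"
proof -
  have "sqrt (real k) * (- sqrt (real k)) \<le> sqrt (real k) * V k v" by (rule mult_left_mono[OF V_low]) simp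
  then show ?thesis by (simp add: hit_mass_def)
qed

lemma hit_mass_measurable [measurable]: "hit_mass k \<in> borel_measurable \<Omega>0"
  unfolding hit_mass_def using V by measurable

text \<open>The gamma variable with parameter \<open>M * a i + hits n i\<close>, as the sum of one that does not depend on \<open>n\<close> and a coupled
  sum of exponential variables; see \<open>X_laplace\<close>.\<close>

definition X :: "nat \<Rightarrow> (nat \<Rightarrow> real \<times> real) \<Rightarrow> nat \<Rightarrow> real" where
  "X n \<theta> i = \<bar>snd (\<theta> i)\<bar> + hit_mass (hits n i) (fst (\<theta> i))"

lemma X_nonneg: "0 \<le> X n \<theta> i" unfolding X_def by (simp add: hit_mass_nonneg)

lemma coordinate_measurable: "f \<in> borel_measurable (\<Theta>i i) \<Longrightarrow> (\<lambda>\<theta>. f (\<theta> i)) \<in> borel_measurable \<Theta>"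
  unfolding \<Theta>_def by (rule measurable_compose[of "\<lambda>\<theta>. \<theta> i"]) (rule measurable_component_singleton, simp)

lemma X_coordinate_measurable: "(\<lambda>z. \<bar>snd z\<bar> + hit_mass k (fst z)) \<in> borel_measurable (\<Theta>i i)" by measurable

lemma X_measurable: "(\<lambda>\<theta>. X n \<theta> i) \<in> borel_measurable \<Theta>"
  unfolding X_def by (rule coordinate_measurable[OF X_coordinate_measurable])

lemma X_laplace:
  assumes f: "\<And>i. f i \<ge> 0"
  shows "(\<integral>\<theta>. exp (- (\<Sum>i<m. f i * X n \<theta> i)) \<partial>\<Theta>) = (\<Prod>i<m. (1 + f i) powr (- (M * a i + real (hits n i))))"
proof -
  let ?g = "\<lambda>i z. exp (- (f i * hit_mass (hits n i) (fst z))) * exp (- (f i * \<bar>snd z\<bar>))"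
  have w: "\<bar>exp (- (f i * hit_mass k v))\<bar> \<le> 1" for i k v using f[of i] hit_mass_nonneg[of k v] by simp
  have wm: "(\<lambda>v. exp (- (f i * hit_mass k v))) \<in> borel_measurable \<Omega>0" for i k by measurable
  note pg = pair_gamma_laplace[where s="\<lambda>_. f i" and w="\<lambda>v. exp (- (f i * hit_mass (hits n i) v))" for i, OF \<Omega>0 Ma_nonneg _ f wm w]
  have eq: "exp (- (\<Sum>i<m. f i * X n \<theta> i)) = (\<Prod>i<m. ?g i (\<theta> i))" for \<theta>
    unfolding X_def by (simp add: exp_sum[symmetric] exp_add[symmetric] sum_negf[symmetric] distrib_left add.commute)
  have "(\<integral>\<theta>. exp (- (\<Sum>i<m. f i * X n \<theta> i)) \<partial>\<Theta>) = (\<Prod>i<m. \<integral>z. ?g i z \<partial>\<Theta>i i)"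
    unfolding eq \<Theta>_def by (rule PiM_coordinates_prod(1)[OF prob_\<Theta>i]) (auto intro: pg(1))
  also have "\<dots> = (\<Prod>i<m. (1 + f i) powr (- (M * a i + real (hits n i))))"
  proof (rule prod.cong[OF refl])
    fix i
    have "(\<integral>z. ?g i z \<partial>\<Theta>i i) = (\<integral>v. exp (- (f i * hit_mass (hits n i) v)) * (1 + f i) powr (- (M * a i)) \<partial>\<Omega>0)"
      by (rule pg(2)) simp
    also have "\<dots> = (1 + f i) powr (- real (hits n i)) * (1 + f i) powr (- (M * a i))"
      using V_laplace[OF f, of i "hits n i"] by (simp add: hit_mass_def)
    also have "\<dots> = (1 + f i) powr (- (M * a i + real (hits n i)))" by (simp add: powr_add[symmetric] add.commute)
    finally show "(\<integral>z. ?g i z \<partial>\<Theta>i i) = (1 + f i) powr (- (M * a i + real (hits n i)))" .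
  qed
  finally show ?thesis .
qed

definition posterior_weight :: "nat \<Rightarrow> (nat \<Rightarrow> real \<times> real) \<Rightarrow> nat \<Rightarrow> real" where
  "posterior_weight n \<theta> i = sqrt (real n) * (X n \<theta> i / (\<Sum>j. X n \<theta> j) - q n i)"

text \<open>The gamma representation of the posterior \<open>R\<close>. The Laplace transforms of \<open>S * R\<close> and of \<open>X\<close> agree by \<open>dirichlet_laplace\<close> and
  \<open>X_laplace\<close>, so the laws agree, and normalisation of the first recovers \<open>R\<close>.\<close>

lemma posterior_expectation:
  assumes n: "n > 0" and R: "DP_posterior \<alpha> M x n \<Omega> R"
    and h: "continuous_map (mtopology_of (linf indicators)) euclideanreal h"
  shows "(\<lambda>\<omega>. scaled_diff indicators (sqrt n) (R \<omega>) (empirical_measure x n)) \<in> \<Omega> \<rightarrow>\<^sub>M linf_borel indicators"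
    and "(\<integral>\<omega>. h (scaled_diff indicators (sqrt n) (R \<omega>) (empirical_measure x n)) \<partial>\<Omega>) = (\<integral>\<theta>. h (atomic e (posterior_weight n \<theta>)) \<partial>\<Theta>)"
proof -
  let ?\<alpha>' = "posterior_mean \<alpha> M x n" and ?c = "M + real n"
  note pm = posterior_mean_props[OF \<alpha> M n, of x]
  note em = empirical_measure_props[OF n, of x]
  have c: "?c > 0" "?c \<ge> 0" using M by auto
  interpret sp: stick_process ?\<alpha>' ?c by (rule stick_process.intro) (use pm c in auto)
  have dp: "dirichlet_process ?\<alpha>' ?c \<Omega> R" using R by (simp add: DP_posterior_def)
  interpret \<Omega>: prob_space \<Omega> using dp by (simp add: dirichlet_process_def)
  have Rp: "R \<in> \<Omega> \<rightarrow>\<^sub>M prob_algebra (count_space UNIV)" using dp by (simp add: dirichlet_process_def)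
  have Rm [measurable]: "(\<lambda>\<omega>. measure (R \<omega>) {y}) \<in> borel_measurable \<Omega>" for y
    by (rule measurable_compose[OF measurable_prob_algebraD[OF Rp] measurable_measure_subprob_algebra]) simp
  have Rprob: "prob_space (R \<omega>)" "sets (R \<omega>) = UNIV" if "\<omega> \<in> space \<Omega>" for \<omega>
    using measurable_space[OF Rp that] by (auto simp: space_prob_algebra)
  have sd: "scaled_diff indicators (sqrt n) (R \<omega>) (empirical_measure x n) = atomic e (\<lambda>i. sqrt n * (measure (R \<omega>) {e i} - q n i))"
    if "\<omega> \<in> space \<Omega>" for \<omega>
    unfolding scaled_diff_atomic[OF Rprob[OF that] em(1,2) e] em(3) ..
  have "(\<lambda>\<omega>. atomic e (\<lambda>i. sqrt n * (measure (R \<omega>) {e i} - q n i))) \<in> \<Omega> \<rightarrow>\<^sub>M linf_borel indicators"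
    by (rule measurable_atomic) measurable
  then show "(\<lambda>\<omega>. scaled_diff indicators (sqrt n) (R \<omega>) (empirical_measure x n)) \<in> \<Omega> \<rightarrow>\<^sub>M linf_borel indicators"
    by (rule measurable_cong[THEN iffD1, rotated]) (simp add: sd)
  note hm = continuous_map_linf_measurable[OF h]
  let ?G = "gamma_law ?c"
  interpret G: prob_space ?G by (rule prob_space_gamma_law[OF c(2)])
  interpret DG: pair_prob_space \<Omega> ?G by unfold_locales
  define \<xi> where "\<xi> z i = \<bar>snd z\<bar> * measure (R (fst z)) {e i}" for z :: "'b \<times> real" and i
  have \<xi>m: "\<xi> \<in> \<Omega> \<Otimes>\<^sub>M ?G \<rightarrow>\<^sub>M nonneg_sequences"
  proof (rule measurable_nonneg_sequences)
    show "(\<lambda>z. \<xi> z i) \<in> borel_measurable (\<Omega> \<Otimes>\<^sub>M ?G)" for i unfolding \<xi>_def by measurable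
  qed (simp add: \<xi>_def)
  have Xm: "X n \<in> \<Theta> \<rightarrow>\<^sub>M nonneg_sequences" by (rule measurable_nonneg_sequences[OF X_measurable X_nonneg])
  have laws: "distr (\<Omega> \<Otimes>\<^sub>M ?G) nonneg_sequences \<xi> = distr \<Theta> nonneg_sequences (X n)"
  proof (rule laplace_unique)
    show "prob_space (distr (\<Omega> \<Otimes>\<^sub>M ?G) nonneg_sequences \<xi>)" by (rule DG.prob_space_distr[OF \<xi>m])
    show "prob_space (distr \<Theta> nonneg_sequences (X n))" by (rule \<Theta>.prob_space_distr[OF Xm])
    fix m and f :: "nat \<Rightarrow> real" assume f: "\<And>i. 0 \<le> f i"
    have "(\<lambda>x. \<Sum>i<m. f i * x i) \<in> borel_measurable nonneg_sequences"
      by (intro borel_measurable_sum borel_measurable_times borel_measurable_const nonneg_coordinate)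
    then have lm: "(\<lambda>x. exp (- (\<Sum>i<m. f i * x i))) \<in> borel_measurable nonneg_sequences" by measurable
    let ?s = "\<lambda>\<omega>. \<Sum>i<m. f i * measure (R \<omega>) {e i}"
    have s0: "0 \<le> ?s \<omega>" for \<omega> using f by (intro sum_nonneg) auto
    have sm: "?s \<in> borel_measurable \<Omega>" by measurable
    have "(\<integral>x. exp (- (\<Sum>i<m. f i * x i)) \<partial>distr (\<Omega> \<Otimes>\<^sub>M ?G) nonneg_sequences \<xi>) =
        (\<integral>z. exp (- (\<Sum>i<m. f i * \<xi> z i)) \<partial>(\<Omega> \<Otimes>\<^sub>M ?G))" by (rule integral_distr[OF \<xi>m lm])
    also have "\<dots> = (\<integral>z. 1 * exp (- (?s (fst z) * \<bar>snd z\<bar>)) \<partial>(\<Omega> \<Otimes>\<^sub>M ?G))"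
      by (rule Bochner_Integration.integral_cong[OF refl]) (simp add: \<xi>_def sum_distrib_left mult_ac)
    also have "\<dots> = (\<integral>\<omega>. 1 * (1 + ?s \<omega>) powr (- ?c) \<partial>\<Omega>)"
      by (rule pair_gamma_laplace(2)[where w="\<lambda>_. 1" and s="?s", OF \<Omega>.prob_space_axioms c(2) sm s0]) auto
    also have "\<dots> = (\<Prod>i<m. (1 + f i) powr (- (?c * measure ?\<alpha>' {e i})))"
      using sp.dirichlet_laplace[OF dp bij_betw_imp_inj_on[OF e] f, where m=m] by simp
    also have "\<dots> = (\<Prod>i<m. (1 + f i) powr (- (M * a i + real (hits n i))))"
      unfolding pm(3) hits_eq[OF n] ..
    also have "\<dots> = (\<integral>\<theta>. exp (- (\<Sum>i<m. f i * X n \<theta> i)) \<partial>\<Theta>)" by (rule X_laplace[OF f, symmetric])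
    also have "\<dots> = (\<integral>x. exp (- (\<Sum>i<m. f i * x i)) \<partial>distr \<Theta> nonneg_sequences (X n))"
      by (rule integral_distr[OF Xm lm, symmetric])
    finally show "(\<integral>x. exp (- (\<Sum>i<m. f i * x i)) \<partial>distr (\<Omega> \<Otimes>\<^sub>M ?G) nonneg_sequences \<xi>) =
        (\<integral>x. exp (- (\<Sum>i<m. f i * x i)) \<partial>distr \<Theta> nonneg_sequences (X n))" .
  qed simp_all
  define H where "H y = h (atomic e (\<lambda>i. sqrt n * (y i / (\<Sum>j. y j) - q n i)))" for y :: "nat \<Rightarrow> real"
  have Hm: "H \<in> borel_measurable nonneg_sequences"
    unfolding H_def
    by (rule measurable_compose[OF measurable_atomic hm])
       (intro borel_measurable_times borel_measurable_diff borel_measurable_divide borel_measurable_suminf borel_measurable_const nonneg_coordinate)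
  let ?J = "\<lambda>\<omega>. h (atomic e (\<lambda>i. sqrt n * (measure (R \<omega>) {e i} - q n i)))"
  have Jm: "?J \<in> borel_measurable \<Omega>"
    by (rule measurable_compose[OF measurable_atomic hm]) measurable
  have "(\<integral>\<omega>. h (scaled_diff indicators (sqrt n) (R \<omega>) (empirical_measure x n)) \<partial>\<Omega>) = (\<integral>\<omega>. ?J \<omega> \<partial>\<Omega>)"
    by (rule Bochner_Integration.integral_cong[OF refl]) (simp add: sd)
  also have "\<dots> = (\<integral>\<omega>. ?J \<omega> \<partial>distr (\<Omega> \<Otimes>\<^sub>M ?G) \<Omega> fst)" by (simp add: G.distr_pair_fst)
  also have "\<dots> = (\<integral>z. ?J (fst z) \<partial>(\<Omega> \<Otimes>\<^sub>M ?G))" by (rule integral_distr[OF measurable_fst Jm])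
  also have "\<dots> = (\<integral>z. H (\<xi> z) \<partial>(\<Omega> \<Otimes>\<^sub>M ?G))"
  proof (rule integral_cong_AE)
    show "(\<lambda>z. ?J (fst z)) \<in> borel_measurable (\<Omega> \<Otimes>\<^sub>M ?G)" by (rule measurable_compose[OF measurable_fst Jm])
    show "(\<lambda>z. H (\<xi> z)) \<in> borel_measurable (\<Omega> \<Otimes>\<^sub>M ?G)" by (rule measurable_compose[OF \<xi>m Hm])
    have "AE t in distr (\<Omega> \<Otimes>\<^sub>M ?G) ?G snd. t > 0"
    proof -
      have "distr (\<Omega> \<Otimes>\<^sub>M ?G) ?G snd = ?G" by (rule distr_pair_snd[OF \<Omega>.prob_space_axioms G.prob_space_axioms])
      then show ?thesis using AE_gamma_law_pos[OF c(1)] by (simp only:)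
    qed
    then have "AE z in \<Omega> \<Otimes>\<^sub>M ?G. snd z > 0" by (rule AE_distrD[OF measurable_snd])
    then show "AE z in \<Omega> \<Otimes>\<^sub>M ?G. ?J (fst z) = H (\<xi> z)"
    proof (rule AE_mp, intro AE_I2 impI)
      fix z assume z: "z \<in> space (\<Omega> \<Otimes>\<^sub>M ?G)" and pos: "snd z > 0"
      have fz: "fst z \<in> space \<Omega>" using z by (simp only: space_pair_measure mem_Times_iff)
      have "(\<lambda>i. measure (R (fst z)) {e i}) sums 1"
        by (rule integral_countable(2)[where f="\<lambda>_. 0" and B=0, OF Rprob[OF fz] e]) simp
      from sums_mult[OF this, of "\<bar>snd z\<bar>"] have "(\<Sum>i. \<xi> z i) = \<bar>snd z\<bar>"
        unfolding \<xi>_def using sums_unique by fastforce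
      then have "\<xi> z i / (\<Sum>j. \<xi> z j) = measure (R (fst z)) {e i}" for i using pos by (simp add: \<xi>_def)
      then show "?J (fst z) = H (\<xi> z)" by (simp add: H_def)
    qed
  qed
  also have "\<dots> = (\<integral>y. H y \<partial>distr (\<Omega> \<Otimes>\<^sub>M ?G) nonneg_sequences \<xi>)" by (rule integral_distr[OF \<xi>m Hm, symmetric])
  also have "\<dots> = (\<integral>\<theta>. H (X n \<theta>) \<partial>\<Theta>)" unfolding laws by (rule integral_distr[OF Xm Hm])
  finally show "(\<integral>\<omega>. h (scaled_diff indicators (sqrt n) (R \<omega>) (empirical_measure x n)) \<partial>\<Omega>) = (\<integral>\<theta>. h (atomic e (posterior_weight n \<theta>)) \<partial>\<Theta>)"
    unfolding H_def posterior_weight_def .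
qed

definition gauss_limit :: "nat \<Rightarrow> (nat \<Rightarrow> real \<times> real) \<Rightarrow> real" where "gauss_limit i \<theta> = sqrt (p i) * Z (fst (\<theta> i))"

lemma p_sums: "p sums 1"
  by (rule integral_countable(2)[where f="\<lambda>_. 0" and B=0, OF P0 e]) simp

lemma a_sums: "a sums 1"
  by (rule integral_countable(2)[where f="\<lambda>_. 0" and B=0, OF \<alpha> e]) simp

lemma q_sums: "n > 0 \<Longrightarrow> q n sums 1"
  using integral_countable(2)[where f="\<lambda>_. 0" and B=0 and P="empirical_measure x n", OF empirical_measure_props(1,2) e]
  by (simp add: empirical_measure_props(3))

lemma gaussian_sequence_gauss_limit: "gaussian_sequence \<Theta> gauss_limit p"
proof
  have m: "(\<lambda>z. sqrt (p i) * Z (fst z)) \<in> borel_measurable (\<Theta>i i)" for i using Z by measurable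
  show "\<Theta>.indep_vars (\<lambda>_. borel) gauss_limit UNIV"
    unfolding \<Theta>_def gauss_limit_def[abs_def] by (rule PiM_coordinates_indep[OF prob_\<Theta>i m])
  show "distr \<Theta> borel (gauss_limit i) = gauss_law (p i)" for i
  proof -
    interpret g: prob_space "gamma_law (M * a i)" by (rule prob_space_gamma_law[OF Ma_nonneg])
    have c: "(\<lambda>\<theta>. \<theta> i) \<in> PiM UNIV \<Theta>i \<rightarrow>\<^sub>M \<Theta>i i" by (rule measurable_component_singleton) simp
    have Zm: "(\<lambda>v. sqrt (p i) * Z v) \<in> borel_measurable \<Omega>0" using Z by measurable
    have "distr \<Theta> borel (gauss_limit i) = distr (distr (PiM UNIV \<Theta>i) (\<Theta>i i) (\<lambda>\<theta>. \<theta> i)) borel (\<lambda>z. sqrt (p i) * Z (fst z))"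
      unfolding \<Theta>_def gauss_limit_def[abs_def] by (subst distr_distr[OF m c]) (simp add: comp_def)
    also have "distr (PiM UNIV \<Theta>i) (\<Theta>i i) (\<lambda>\<theta>. \<theta> i) = \<Theta>i i" by (rule distr_PiM_component) (auto intro: prob_\<Theta>i)
    also have "distr (\<Theta>i i) borel (\<lambda>z. sqrt (p i) * Z (fst z)) = distr (distr (\<Theta>i i) \<Omega>0 fst) borel (\<lambda>v. sqrt (p i) * Z v)"
      by (subst distr_distr[OF Zm measurable_fst]) (simp add: comp_def)
    also have "distr (\<Theta>i i) \<Omega>0 fst = \<Omega>0" by (rule g.distr_pair_fst)
    also have "distr \<Omega>0 borel (\<lambda>v. sqrt (p i) * Z v) = distr (distr \<Omega>0 borel Z) borel (\<lambda>y. sqrt (p i) * y)"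
      by (subst distr_distr[OF _ Z]) (simp_all add: comp_def)
    finally show ?thesis by (simp add: Z_law gauss_law_def)
  qed
qed (use p_sums psum in auto)

sublocale U: gaussian_sequence \<Theta> gauss_limit p by (rule gaussian_sequence_gauss_limit)

definition fluctuation :: "nat \<Rightarrow> nat \<Rightarrow> (nat \<Rightarrow> real \<times> real) \<Rightarrow> real" where
  "fluctuation n i \<theta> = (X n \<theta> i - (M * a i + real (hits n i))) / sqrt (real n)"

definition clt_error :: "nat \<Rightarrow> real" where "clt_error k = (\<integral>\<omega>. \<bar>V k \<omega> - Z \<omega>\<bar> \<partial>\<Omega>0)"

definition dist_bound :: "nat \<Rightarrow> nat \<Rightarrow> real" where
  "dist_bound n i = 2 * M * a i / sqrt (real n) + \<bar>sqrt (q n i) - sqrt (p i)\<bar> + sqrt (p i) * clt_error (hits n i)"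

lemma marginal_integral:
  fixes f g :: "real \<Rightarrow> real"
  assumes "f \<in> borel_measurable \<Omega>0" "g \<in> borel_measurable borel"
    and f: "integrable \<Omega>0 f" and g: "integrable (gamma_law (M * a i)) g"
  shows "integrable \<Theta> (\<lambda>\<theta>. f (fst (\<theta> i)))" "(\<integral>\<theta>. f (fst (\<theta> i)) \<partial>\<Theta>) = (\<integral>v. f v \<partial>\<Omega>0)"
    "integrable \<Theta> (\<lambda>\<theta>. g (snd (\<theta> i)))" "(\<integral>\<theta>. g (snd (\<theta> i)) \<partial>\<Theta>) = (\<integral>t. g t \<partial>gamma_law (M * a i))"
proof -
  interpret g: prob_space "gamma_law (M * a i)" by (rule prob_space_gamma_law[OF Ma_nonneg])
  have gm: "g \<in> borel_measurable (gamma_law (M * a i))" using assms(2) by simp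
  have m1: "(\<lambda>z. f (fst z)) \<in> borel_measurable (\<Theta>i i)" by (rule measurable_compose[OF measurable_fst assms(1)])
  have m2: "(\<lambda>z. g (snd z)) \<in> borel_measurable (\<Theta>i i)" by (rule measurable_compose[OF measurable_snd gm])
  have d1: "distr (\<Theta>i i) \<Omega>0 fst = \<Omega>0" by (rule g.distr_pair_fst)
  have d2: "distr (\<Theta>i i) (gamma_law (M * a i)) snd = gamma_law (M * a i)" by (rule distr_pair_snd[OF \<Omega>0 g.prob_space_axioms])
  note c1 = PiM_coordinate_integral[where M=\<Theta>i and i=i and f="\<lambda>z. f (fst z)", OF prob_\<Theta>i m1, folded \<Theta>_def]
  note c2 = PiM_coordinate_integral[where M=\<Theta>i and i=i and f="\<lambda>z. g (snd z)", OF prob_\<Theta>i m2, folded \<Theta>_def]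
  show "integrable \<Theta> (\<lambda>\<theta>. f (fst (\<theta> i)))"
    unfolding c1(2) using integrable_distr_eq[OF measurable_fst assms(1), of "gamma_law (M * a i)"] f unfolding d1 by simp
  show "(\<integral>\<theta>. f (fst (\<theta> i)) \<partial>\<Theta>) = (\<integral>v. f v \<partial>\<Omega>0)"
    unfolding c1(1) using integral_distr[OF measurable_fst assms(1), of "gamma_law (M * a i)"] unfolding d1 by simp
  show "integrable \<Theta> (\<lambda>\<theta>. g (snd (\<theta> i)))"
    unfolding c2(2) using integrable_distr_eq[OF measurable_snd gm, of \<Omega>0] g unfolding d2 by simp
  show "(\<integral>\<theta>. g (snd (\<theta> i)) \<partial>\<Theta>) = (\<integral>t. g t \<partial>gamma_law (M * a i))"
    unfolding c2(1) using integral_distr[OF measurable_snd gm, of \<Omega>0] unfolding d2 by simp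
qed

text \<open>Up to the gamma variable with parameter \<open>M * a i\<close>, which contributes the first term of the bound, the difference is
  \<open>(sqrt (q n i) - sqrt (p i)) * V k + sqrt (p i) * (V k - Z)\<close> with \<open>k = hits n i\<close>.\<close>

lemma fluctuation_L1:
  assumes n: "n > 0"
  shows "integrable \<Theta> (\<lambda>\<theta>. fluctuation n i \<theta> - gauss_limit i \<theta>)" "(\<integral>\<theta>. \<bar>fluctuation n i \<theta> - gauss_limit i \<theta>\<bar> \<partial>\<Theta>) \<le> dist_bound n i"
proof -
  let ?k = "hits n i" and ?s = "sqrt (real n)"
  have s: "?s > 0" using n by simp
  define f where "f v = sqrt (q n i) * V ?k v - sqrt (p i) * Z v" for v
  define g where "g t = (\<bar>t\<bar> - M * a i) / ?s" for t :: real
  have split: "fluctuation n i \<theta> - gauss_limit i \<theta> = f (fst (\<theta> i)) + g (snd (\<theta> i))" for \<theta>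
  proof -
    have "sqrt (real ?k) / ?s = sqrt (q n i)" unfolding hits_eq[OF n] using n by (simp add: real_sqrt_mult)
    then have "sqrt (real ?k) * V ?k (fst (\<theta> i)) / ?s = sqrt (q n i) * V ?k (fst (\<theta> i))"
      by (metis times_divide_eq_left)
    then show ?thesis
      by (simp add: fluctuation_def gauss_limit_def X_def hit_mass_def f_def g_def add_divide_distrib diff_divide_distrib)
  qed
  have fm: "f \<in> borel_measurable \<Omega>0" unfolding f_def using V Z by measurable
  have gm: "g \<in> borel_measurable borel" unfolding g_def by measurable
  have fi: "integrable \<Omega>0 f" unfolding f_def using V_int Z_int by simp
  note gml = gamma_law_mean[OF Ma_nonneg, of i]
  interpret g: prob_space "gamma_law (M * a i)" by (rule prob_space_gamma_law[OF Ma_nonneg])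
  have gi: "integrable (gamma_law (M * a i)) g" unfolding g_def using gml(1) by simp
  note mi = marginal_integral[OF fm gm fi gi]
  show "integrable \<Theta> (\<lambda>\<theta>. fluctuation n i \<theta> - gauss_limit i \<theta>)" unfolding split using mi by simp
  have fm': "(\<lambda>v. \<bar>f v\<bar>) \<in> borel_measurable \<Omega>0" using fm by measurable
  have gm': "(\<lambda>t. \<bar>g t\<bar>) \<in> borel_measurable borel" using gm by measurable
  have fi': "integrable \<Omega>0 (\<lambda>v. \<bar>f v\<bar>)" and gi': "integrable (gamma_law (M * a i)) (\<lambda>t. \<bar>g t\<bar>)" using fi gi by simp_all
  note mi' = marginal_integral[OF fm' gm' fi' gi']
  have F: "(\<integral>v. \<bar>f v\<bar> \<partial>\<Omega>0) \<le> \<bar>sqrt (q n i) - sqrt (p i)\<bar> + sqrt (p i) * clt_error ?k"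
  proof -
    have "(\<integral>v. \<bar>f v\<bar> \<partial>\<Omega>0) \<le> (\<integral>v. \<bar>sqrt (q n i) - sqrt (p i)\<bar> * \<bar>V ?k v\<bar> + sqrt (p i) * \<bar>V ?k v - Z v\<bar> \<partial>\<Omega>0)"
    proof (rule integral_mono[OF fi'])
      show "integrable \<Omega>0 (\<lambda>v. \<bar>sqrt (q n i) - sqrt (p i)\<bar> * \<bar>V ?k v\<bar> + sqrt (p i) * \<bar>V ?k v - Z v\<bar>)" using V_int Z_int by simp
      fix v
      have "f v = (sqrt (q n i) - sqrt (p i)) * V ?k v + sqrt (p i) * (V ?k v - Z v)" by (simp add: f_def algebra_simps)
      then show "\<bar>f v\<bar> \<le> \<bar>sqrt (q n i) - sqrt (p i)\<bar> * \<bar>V ?k v\<bar> + sqrt (p i) * \<bar>V ?k v - Z v\<bar>"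
        using abs_triangle_ineq[of "(sqrt (q n i) - sqrt (p i)) * V ?k v" "sqrt (p i) * (V ?k v - Z v)"] by (simp add: abs_mult)
    qed
    also have "\<dots> = \<bar>sqrt (q n i) - sqrt (p i)\<bar> * (\<integral>v. \<bar>V ?k v\<bar> \<partial>\<Omega>0) + sqrt (p i) * clt_error ?k"
      using V_int Z_int by (simp add: clt_error_def)
    also have "\<dots> \<le> \<bar>sqrt (q n i) - sqrt (p i)\<bar> * 1 + sqrt (p i) * clt_error ?k" by (intro add_right_mono mult_left_mono V_abs) simp
    finally show ?thesis by simp
  qed
  have Gb: "(\<integral>t. \<bar>g t\<bar> \<partial>gamma_law (M * a i)) \<le> 2 * M * a i / ?s"
  proof -
    have "(\<integral>t. \<bar>g t\<bar> \<partial>gamma_law (M * a i)) \<le> (\<integral>t. (t + M * a i) / ?s \<partial>gamma_law (M * a i))"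
    proof (rule integral_mono_AE[OF gi'])
      show "integrable (gamma_law (M * a i)) (\<lambda>t. (t + M * a i) / ?s)" using gml(1) by simp
      show "AE t in gamma_law (M * a i). \<bar>g t\<bar> \<le> (t + M * a i) / ?s"
        using AE_gamma_law_nonneg[OF Ma_nonneg]
      proof eventually_elim
        case (elim t)
        have "\<bar>t - M * a i\<bar> \<le> t + M * a i" using elim Ma_nonneg[of i] by (simp add: abs_le_iff)
        then show ?case using elim s by (simp add: g_def abs_divide divide_right_mono)
      qed
    qed
    also have "\<dots> = 2 * M * a i / ?s" using gml g.prob_space by simp
    finally show ?thesis .
  qed
  have "(\<integral>\<theta>. \<bar>fluctuation n i \<theta> - gauss_limit i \<theta>\<bar> \<partial>\<Theta>) \<le> (\<integral>\<theta>. \<bar>f (fst (\<theta> i))\<bar> + \<bar>g (snd (\<theta> i))\<bar> \<partial>\<Theta>)"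
    unfolding split using mi(1,3) mi'(1,3) by (intro integral_mono) auto
  also have "\<dots> = (\<integral>v. \<bar>f v\<bar> \<partial>\<Omega>0) + (\<integral>t. \<bar>g t\<bar> \<partial>gamma_law (M * a i))" using mi' by simp
  also have "\<dots> \<le> dist_bound n i" using F Gb by (simp add: dist_bound_def)
  finally show "(\<integral>\<theta>. \<bar>fluctuation n i \<theta> - gauss_limit i \<theta>\<bar> \<partial>\<Theta>) \<le> dist_bound n i" .
qed

lemma clt_error_props: "clt_error \<longlonglongrightarrow> 0" "clt_error k \<ge> 0" "clt_error k \<le> 1 + (\<integral>\<omega>. \<bar>Z \<omega>\<bar> \<partial>\<Omega>0)"
proof -
  show "clt_error \<longlonglongrightarrow> 0" unfolding clt_error_def by (rule VZ)
  show "clt_error k \<ge> 0" unfolding clt_error_def by simp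
  have "clt_error k \<le> (\<integral>\<omega>. \<bar>V k \<omega>\<bar> + \<bar>Z \<omega>\<bar> \<partial>\<Omega>0)" unfolding clt_error_def using V_int Z_int by (intro integral_mono) (auto simp: abs_triangle_ineq4)
  also have "\<dots> \<le> 1 + (\<integral>\<omega>. \<bar>Z \<omega>\<bar> \<partial>\<Omega>0)" using V_int Z_int V_abs[of k] by simp
  finally show "clt_error k \<le> 1 + (\<integral>\<omega>. \<bar>Z \<omega>\<bar> \<partial>\<Omega>0)" .
qed

lemma freq_le_b: "q n i \<le> b i"
proof -
  have "q n i \<le> sqrt (q n i)" by (rule real_le_rsqrt) (simp add: power2_eq_square mult_left_le freq_bounds)
  then show ?thesis using b(2)[of n i] by linarith
qed

lemma hits_at_top:
  assumes "p i > 0" shows "filterlim (\<lambda>n. hits n i) at_top sequentially"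
proof -
  have 1: "filterlim (\<lambda>n. q n i * real n) at_top sequentially"
    by (rule filterlim_tendsto_pos_mult_at_top[OF freq_lim assms filterlim_real_sequentially])
  show ?thesis unfolding filterlim_at_top
  proof
    fix m :: nat
    have "\<forall>\<^sub>F n in sequentially. real m \<le> q n i * real n" using 1 unfolding filterlim_at_top by (rule spec)
    then show "\<forall>\<^sub>F n in sequentially. m \<le> hits n i" using eventually_gt_at_top[of 0]
    proof eventually_elim
      case (elim n)
      then have "real m \<le> real (hits n i)" by (simp only: hits_eq mult.commute)
      then show ?case by simp
    qed
  qed
qed

text \<open>A bound of \<open>dist_bound n i\<close> for all \<open>n > 0\<close>, with \<open>b i\<close> taking the place of \<open>sqrt (q n i)\<close> and \<open>1 + E \<bar>Z\<bar>\<close> that of \<open>clt_error k\<close>.\<close>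

definition dist_majorant :: "nat \<Rightarrow> real" where
  "dist_majorant i = 2 * M * a i + (b i + sqrt (p i)) + sqrt (p i) * (1 + (\<integral>\<omega>. \<bar>Z \<omega>\<bar> \<partial>\<Omega>0))"

lemma dist_majorant_summable: "summable dist_majorant"
  unfolding dist_majorant_def by (intro summable_add summable_mult summable_mult2 psum b(1) sums_summable[OF a_sums])

lemma dist_bound_props:
  shows "(\<lambda>n. dist_bound n i) \<longlonglongrightarrow> 0" "n > 0 \<Longrightarrow> dist_bound n i \<le> dist_majorant i" "0 \<le> dist_bound n i"
proof -
  have 1: "(\<lambda>n. 2 * M * a i / sqrt (real n)) \<longlonglongrightarrow> 0"
    by (rule real_tendsto_divide_at_top[OF tendsto_const filterlim_compose[OF sqrt_at_top filterlim_real_sequentially]])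
  have 2: "(\<lambda>n. \<bar>sqrt (q n i) - sqrt (p i)\<bar>) \<longlonglongrightarrow> 0"
    using tendsto_rabs[OF tendsto_diff[OF tendsto_real_sqrt[OF freq_lim[of i]] tendsto_const[of "sqrt (p i)"]]] by simp
  have 3: "(\<lambda>n. sqrt (p i) * clt_error (hits n i)) \<longlonglongrightarrow> 0"
  \<comment> \<open>The number of hits tends to infinity only at points of positive mass; elsewhere the factor \<open>sqrt (p i)\<close> vanishes.\<close>
  proof (cases "p i = 0")
    case False
    then have "p i > 0" using measure_nonneg[of P0 "{e i}"] by (simp add: less_le)
    from filterlim_compose[OF clt_error_props(1) hits_at_top[OF this]] have "(\<lambda>n. clt_error (hits n i)) \<longlonglongrightarrow> 0" .
    from tendsto_mult[OF tendsto_const[of "sqrt (p i)"] this] show ?thesis by simp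
  qed simp
  show "(\<lambda>n. dist_bound n i) \<longlonglongrightarrow> 0" unfolding dist_bound_def using tendsto_add[OF tendsto_add[OF 1 2] 3] by simp
  show "0 \<le> dist_bound n i" unfolding dist_bound_def using M clt_error_props(2) by simp
  assume n: "n > 0"
  have "2 * M * a i / sqrt (real n) \<le> 2 * M * a i"
  proof -
    have "1 \<le> sqrt (real n)" using n by simp
    moreover have "0 \<le> 2 * M * a i" using M by simp
    ultimately show ?thesis using mult_left_mono[of 1 "sqrt (real n)" "2 * M * a i"] n by (simp add: pos_divide_le_eq)
  qed
  moreover have "\<bar>sqrt (q n i) - sqrt (p i)\<bar> \<le> b i + sqrt (p i)"
  proof -
    have "0 \<le> sqrt (q n i)" "0 \<le> sqrt (p i)" by (simp_all add: freq_bounds)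
    then show ?thesis using b(2)[of n i] by (simp only: abs_le_iff) linarith
  qed
  moreover have "sqrt (p i) * clt_error (hits n i) \<le> sqrt (p i) * (1 + (\<integral>\<omega>. \<bar>Z \<omega>\<bar> \<partial>\<Omega>0))" by (intro mult_left_mono clt_error_props) simp
  ultimately show "dist_bound n i \<le> dist_majorant i" unfolding dist_bound_def dist_majorant_def by linarith
qed

text \<open>The index is shifted because at \<open>n = 0\<close> no observation is available and the bounds fail.\<close>

definition l1_error :: "nat \<Rightarrow> (nat \<Rightarrow> real \<times> real) \<Rightarrow> real" where "l1_error n \<theta> = (\<Sum>i. \<bar>fluctuation (Suc n) i \<theta> - gauss_limit i \<theta>\<bar>)"

text \<open>Tannery's theorem, that is, dominated convergence for the series over \<open>i\<close>.\<close>

lemma l1_error_L1: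
  "AE \<theta> in \<Theta>. summable (\<lambda>i. \<bar>fluctuation (Suc n) i \<theta> - gauss_limit i \<theta>\<bar>)" "integrable \<Theta> (l1_error n)"
  "(\<lambda>n. \<integral>\<theta>. norm (l1_error n \<theta>) \<partial>\<Theta>) \<longlonglongrightarrow> 0"
proof -
  have s: "summable (\<lambda>i. \<integral>\<theta>. \<bar>fluctuation (Suc n) i \<theta> - gauss_limit i \<theta>\<bar> \<partial>\<Theta>)" for n
    by (rule summable_comparison_test'[OF dist_majorant_summable, of 0])
       (use order_trans[OF fluctuation_L1(2) dist_bound_props(2)] in simp)
  note L = L1_series[of \<Theta> "\<lambda>i \<theta>. fluctuation (Suc n) i \<theta> - gauss_limit i \<theta>" for n, OF fluctuation_L1(1) s]
  show ae: "AE \<theta> in \<Theta>. summable (\<lambda>i. \<bar>fluctuation (Suc n) i \<theta> - gauss_limit i \<theta>\<bar>)" for n by (rule L(1)) simp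
  show l1_error_int: "integrable \<Theta> (l1_error n)" for n unfolding l1_error_def[abs_def] by (rule L(2)) simp
  have ds: "summable (dist_bound (Suc n))" for n
    by (rule summable_comparison_test'[OF dist_majorant_summable, of 0]) (use dist_bound_props in simp)
  have "(\<lambda>n. \<Sum>i. dist_bound (Suc n) i) \<longlonglongrightarrow> (\<Sum>i. 0)"
  proof (rule tannerys_theorem[THEN conjunct2, THEN conjunct2])
    show "(\<lambda>n. dist_bound (Suc n) i) \<longlonglongrightarrow> 0" for i by (rule LIMSEQ_Suc[OF dist_bound_props(1)])
    show "\<forall>\<^sub>F (i, n) in sequentially \<times>\<^sub>F sequentially. norm (dist_bound (Suc n) i) \<le> dist_majorant i"
      by (rule always_eventually) (use dist_bound_props in auto)
  qed (use dist_majorant_summable in auto)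
  then have lim: "(\<lambda>n. \<Sum>i. dist_bound (Suc n) i) \<longlonglongrightarrow> 0" by simp
  show "(\<lambda>n. \<integral>\<theta>. norm (l1_error n \<theta>) \<partial>\<Theta>) \<longlonglongrightarrow> 0"
  proof (rule Lim_null_comparison[OF _ lim], rule always_eventually, rule allI)
    fix n
    have "(\<integral>\<theta>. norm (l1_error n \<theta>) \<partial>\<Theta>) = (\<integral>\<theta>. l1_error n \<theta> \<partial>\<Theta>)"
    proof (rule integral_cong_AE)
      show "AE \<theta> in \<Theta>. norm (l1_error n \<theta>) = l1_error n \<theta>"
        using ae[of n] by eventually_elim (simp add: l1_error_def suminf_nonneg)
    qed (use borel_measurable_integrable[OF l1_error_int[of n]] in auto)
    also have "\<dots> = (\<Sum>i. \<integral>\<theta>. \<bar>fluctuation (Suc n) i \<theta> - gauss_limit i \<theta>\<bar> \<partial>\<Theta>)" unfolding l1_error_def by (rule L(3)) simp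
    also have "\<dots> \<le> (\<Sum>i. dist_bound (Suc n) i)" by (rule suminf_le[OF fluctuation_L1(2) s ds]) simp
    finally show "norm (\<integral>\<theta>. norm (l1_error n \<theta>) \<partial>\<Theta>) \<le> (\<Sum>i. dist_bound (Suc n) i)" by simp
  qed
qed

lemma freq_l1:
  "summable (\<lambda>i. \<bar>q n i - p i\<bar>)" "(\<lambda>n. \<Sum>i. \<bar>q n i - p i\<bar>) \<longlonglongrightarrow> 0"
proof -
  have le: "\<bar>q n i - p i\<bar> \<le> b i + p i" for n i
    using freq_le_b[of n i] freq_bounds(1)[of x n "e i"] measure_nonneg[of P0 "{e i}"] unfolding abs_le_iff by linarith
  have bs: "summable (\<lambda>i. b i + p i)" by (intro summable_add b(1) sums_summable[OF p_sums])
  show "summable (\<lambda>i. \<bar>q n i - p i\<bar>)" by (rule summable_comparison_test'[OF bs, of 0]) (use le in simp)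
  have "(\<lambda>n. \<Sum>i. \<bar>q n i - p i\<bar>) \<longlonglongrightarrow> (\<Sum>i. 0)"
  proof (rule tannerys_theorem[THEN conjunct2, THEN conjunct2])
    show "(\<lambda>n. \<bar>q n i - p i\<bar>) \<longlonglongrightarrow> 0" for i
      using tendsto_rabs[OF tendsto_diff[OF freq_lim[of i] tendsto_const[of "p i"]]] by simp
    show "\<forall>\<^sub>F (i, n) in sequentially \<times>\<^sub>F sequentially. norm \<bar>q n i - p i\<bar> \<le> b i + p i"
      by (rule always_eventually) (use le in auto)
  qed (use bs in auto)
  then show "(\<lambda>n. \<Sum>i. \<bar>q n i - p i\<bar>) \<longlonglongrightarrow> 0" by simp
qed

lemma X_decomposition:
  assumes "n > 0"
  shows "X n \<theta> i = M * a i + real n * q n i + sqrt (real n) * fluctuation n i \<theta>"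
  using assms by (simp add: fluctuation_def hits_eq[OF assms])

text \<open>Convergence of \<open>l1_error\<close> in mean gives almost sure convergence along subsequences only, which suffices for the
  convergence of the numerical sequence of expectations.\<close>

lemma coupled_convergence:
  assumes h: "continuous_map (mtopology_of (linf indicators)) euclideanreal h" and hb: "\<And>\<psi>. \<psi> \<in> mspace (linf indicators) \<Longrightarrow> \<bar>h \<psi>\<bar> \<le> B"
  shows "(\<lambda>n. \<integral>\<theta>. h (atomic e (posterior_weight n \<theta>)) \<partial>\<Theta>) \<longlonglongrightarrow> (\<integral>\<theta>. h (atomic e (U.bridge_weight \<theta>)) \<partial>\<Theta>)"
proof -
  note hm = continuous_map_linf_measurable[OF h]
  have zm: "(\<lambda>\<theta>. posterior_weight n \<theta> i) \<in> borel_measurable \<Theta>" for n i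
    unfolding posterior_weight_def using X_measurable by measurable
  have "(\<lambda>n. \<integral>\<theta>. h (atomic e (posterior_weight (Suc n) \<theta>)) \<partial>\<Theta>) \<longlonglongrightarrow> (\<integral>\<theta>. h (atomic e (U.bridge_weight \<theta>)) \<partial>\<Theta>)"
  proof (rule LIMSEQ_subsubseqI)
    fix r :: "nat \<Rightarrow> nat" assume r: "strict_mono r"
    have "(\<lambda>k. \<integral>\<theta>. norm (l1_error (r k) \<theta>) \<partial>\<Theta>) \<longlonglongrightarrow> 0"
      using LIMSEQ_subseq_LIMSEQ[OF l1_error_L1(3) r] by (simp add: o_def)
    from tendsto_L1_AE_subseq[OF l1_error_L1(2) this] obtain s :: "nat \<Rightarrow> nat" where s: "strict_mono s"
      and ae: "AE \<theta> in \<Theta>. (\<lambda>k. l1_error (r (s k)) \<theta>) \<longlonglongrightarrow> 0" by blast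
    let ?n = "\<lambda>k. Suc (r (s k))"
    have sm: "strict_mono (\<lambda>k. r (s k))" using strict_mono_o[OF r s] by (simp add: o_def)
    have nlim: "filterlim ?n at_top sequentially"
      by (rule filterlim_compose[OF filterlim_Suc filterlim_subseq[OF sm]])
    have "AE \<theta> in \<Theta>. \<forall>n. summable (\<lambda>i. \<bar>fluctuation (Suc n) i \<theta> - gauss_limit i \<theta>\<bar>)"
      unfolding AE_all_countable by (intro allI l1_error_L1(1))
    with ae U.U_series(1) have conv: "AE \<theta> in \<Theta>. (\<lambda>k. h (atomic e (posterior_weight (?n k) \<theta>))) \<longlonglongrightarrow> h (atomic e (U.bridge_weight \<theta>))"
    proof eventually_elim
      case (elim \<theta>)
      have q1: "q (?n k) sums 1" for k by (rule q_sums) simp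
      have qlim: "(\<lambda>k. \<Sum>i. \<bar>q (?n k) i - p i\<bar>) \<longlonglongrightarrow> 0"
        by (rule filterlim_compose[OF freq_l1(2) nlim])
      have Ulim: "(\<lambda>k. \<Sum>i. \<bar>fluctuation (?n k) i \<theta> - gauss_limit i \<theta>\<bar>) \<longlonglongrightarrow> 0" using elim(1) by (simp add: l1_error_def)
      note res = l1_limit_of_normalised_weights[where n="?n" and a=a and p=p and q="\<lambda>k. q (?n k)" and U="\<lambda>i. gauss_limit i \<theta>"
          and Uc="\<lambda>k i. fluctuation (?n k) i \<theta>" and X="\<lambda>k. X (?n k) \<theta>" and M=M,
          OF nlim _ a_sums measure_nonneg p_sums measure_nonneg q1 freq_bounds(1) freq_l1(1) qlim elim(2) spec[OF elim(3)] Ulim X_decomposition M]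
      have w: "U.bridge_weight \<theta> = (\<lambda>i. gauss_limit i \<theta> - p i * (\<Sum>j. gauss_limit j \<theta>))" by (simp add: U.bridge_weight_def[abs_def])
      have z: "posterior_weight (?n k) \<theta> = (\<lambda>i. sqrt (real (?n k)) * (X (?n k) \<theta> i / (\<Sum>j. X (?n k) \<theta> j) - q (?n k) i))" for k
        by (simp only: posterior_weight_def[abs_def])
      show ?case unfolding w z
        by (rule continuous_atomic_tendsto[OF h res(1) res(2) res(3)]) simp_all
    qed
    have "(\<lambda>k. \<integral>\<theta>. h (atomic e (posterior_weight (?n k) \<theta>)) \<partial>\<Theta>) \<longlonglongrightarrow> (\<integral>\<theta>. h (atomic e (U.bridge_weight \<theta>)) \<partial>\<Theta>)"
    proof (rule integral_dominated_convergence[where w="\<lambda>_. B"])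
      show "(\<lambda>\<theta>. h (atomic e (U.bridge_weight \<theta>))) \<in> borel_measurable \<Theta>"
        by (rule measurable_compose[OF measurable_atomic[OF U.bridge_weight_measurable] hm])
      show "(\<lambda>\<theta>. h (atomic e (posterior_weight (?n k) \<theta>))) \<in> borel_measurable \<Theta>" for k
        by (rule measurable_compose[OF measurable_atomic[OF zm] hm])
      show "AE \<theta> in \<Theta>. norm (h (atomic e (posterior_weight (?n k) \<theta>))) \<le> B" for k using hb[OF atomic_in_linf] by simp
    qed (use conv in auto)
    then show "\<exists>s. strict_mono s \<and> (\<lambda>k. \<integral>\<theta>. h (atomic e (posterior_weight (Suc (r (s k))) \<theta>)) \<partial>\<Theta>) \<longlonglongrightarrow> (\<integral>\<theta>. h (atomic e (U.bridge_weight \<theta>)) \<partial>\<Theta>)"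
      using s by blast
  qed
  then show ?thesis by (rule LIMSEQ_imp_Suc)
qed

lemma posterior_expectation_converges:
  fixes N :: "'g measure" and \<Omega> :: "nat \<Rightarrow> 'w measure"
  assumes G: "brownian_bridge P0 indicators N G"
    and R: "\<And>n. n \<ge> 1 \<Longrightarrow> DP_posterior \<alpha> M x n (\<Omega> n) (Post n)"
    and h: "continuous_map (mtopology_of (linf indicators)) euclideanreal h" "bounded (h ` mspace (linf indicators))"
  shows "(\<lambda>n. \<integral>\<omega>. h (scaled_diff indicators (sqrt n) (Post n \<omega>) (empirical_measure x n)) \<partial>\<Omega> n) \<longlonglongrightarrow> (\<integral>\<omega>. h (G \<omega>) \<partial>N)"
proof -
  obtain B where B: "\<forall>\<psi>\<in>mspace (linf indicators). \<bar>h \<psi>\<bar> \<le> B" using h(2) unfolding bounded_iff by (metis image_eqI real_norm_def)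
  have "(\<integral>\<omega>. h (G \<omega>) \<partial>N) = (\<integral>\<theta>. h (atomic e (U.bridge_weight \<theta>)) \<partial>\<Theta>)"
    by (rule bridge_expectation_unique[OF G U.brownian_bridge_atomic[OF P0 e refl] h])
  moreover have "(\<lambda>n. \<integral>\<theta>. h (atomic e (posterior_weight n \<theta>)) \<partial>\<Theta>) \<longlonglongrightarrow> (\<integral>\<theta>. h (atomic e (U.bridge_weight \<theta>)) \<partial>\<Theta>)"
    by (rule coupled_convergence[OF h(1)]) (use B in blast)
  moreover have "\<forall>\<^sub>F n in sequentially. (\<integral>\<theta>. h (atomic e (posterior_weight n \<theta>)) \<partial>\<Theta>) =
      (\<integral>\<omega>. h (scaled_diff indicators (sqrt n) (Post n \<omega>) (empirical_measure x n)) \<partial>\<Omega> n)"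
    using posterior_expectation(2)[OF _ R h(1)] by (intro eventually_sequentiallyI[of 1]) simp
  ultimately show ?thesis using Lim_transform_eventually by fastforce
qed

end

section \<open>Convergence of the posterior\<close>

context posterior_coupling
begin

lemma posterior_weakly_converges:
  fixes N :: "'g measure" and \<Omega> :: "nat \<Rightarrow> 'w measure"
  assumes G: "brownian_bridge P0 indicators N G"
    and R: "\<And>n. n \<ge> 1 \<Longrightarrow> DP_posterior \<alpha> M x n (\<Omega> n) (Post n)"
  shows "weakly_converges_linf indicators \<Omega>
    (\<lambda>n \<omega>. scaled_diff indicators (sqrt n) (Post n \<omega>) (empirical_measure x n)) N G"
  unfolding weakly_converges_linf_def
proof (intro allI impI, elim conjE)
  fix h assume h: "continuous_map (mtopology_of (linf indicators)) euclideanreal h" "bounded (h ` mspace (linf (indicators :: ('a \<Rightarrow> real) set)))"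
  let ?D = "\<lambda>n \<omega>. scaled_diff indicators (sqrt (real n)) (Post n \<omega>) (empirical_measure x n)"
  obtain B where B: "\<forall>\<psi>\<in>mspace (linf indicators). \<bar>h \<psi>\<bar> \<le> B" using h(2) unfolding bounded_iff by (metis image_eqI real_norm_def)
  have "\<forall>\<^sub>F n in sequentially. (\<integral>\<omega>. h (?D n \<omega>) \<partial>\<Omega> n) = outer_expectation (\<Omega> n) (\<lambda>\<omega>. h (?D n \<omega>))"
    using eventually_ge_at_top[of 1]
  proof eventually_elim
    case (elim n)
    have "prob_space (\<Omega> n)" using R[OF elim] by (simp add: DP_posterior_def dirichlet_process_def)
    moreover have m: "?D n \<in> \<Omega> n \<rightarrow>\<^sub>M linf_borel indicators" by (rule posterior_expectation(1)[OF _ R[OF elim] h(1)]) (use elim in simp)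
    moreover have "\<bar>h (?D n \<omega>)\<bar> \<le> B" if "\<omega> \<in> space (\<Omega> n)" for \<omega>
    proof -
      have "?D n \<omega> \<in> mspace (linf indicators)" using measurable_space[OF m that] by simp
      with B show ?thesis by blast
    qed
    ultimately show ?case
      by (intro outer_expectation_measurable[symmetric, of _ _ B] measurable_compose[OF m continuous_map_linf_measurable[OF h(1)]])
  qed
  then show "(\<lambda>n. outer_expectation (\<Omega> n) (\<lambda>\<omega>. h (?D n \<omega>))) \<longlonglongrightarrow> (\<integral>\<omega>. h (G \<omega>) \<partial>N)"
    by (rule Lim_transform_eventually[OF posterior_expectation_converges[OF G R h], rotated])
qed

text \<open>By \<open>tv_dist_scaled\<close> the scaled total variation distance is the norm of the scaled difference, and bounded continuous functions
  of the norm are among the test functions of weak convergence. The sequence starts at index \<open>1\<close> in the proof, since nothing is known about \<open>\<Omega> 0\<close>.\<close>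

lemma posterior_tv_dist_converges:
  fixes N :: "'g measure" and \<Omega> :: "nat \<Rightarrow> 'w measure"
  assumes G: "brownian_bridge P0 indicators N G"
    and R: "\<And>n. n \<ge> 1 \<Longrightarrow> DP_posterior \<alpha> M x n (\<Omega> n) (Post n)"
  shows "weak_conv_m
    (\<lambda>n. distr (\<Omega> n) borel (\<lambda>\<omega>. sqrt n * tv_dist (Post n \<omega>) (empirical_measure x n)))
    (distr N borel (\<lambda>\<omega>. linf_norm indicators (G \<omega>)))"
proof -
  let ?D = "\<lambda>n \<omega>. scaled_diff indicators (sqrt (real n)) (Post n \<omega>) (empirical_measure x n)"
  let ?L = "\<lambda>n \<omega>. linf_norm indicators (?D n \<omega>)"
  let ?\<nu> = "\<lambda>n. distr (\<Omega> n) borel (\<lambda>\<omega>. sqrt n * tv_dist (Post n \<omega>) (empirical_measure x n))"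
  let ?\<nu>\<^sub>0 = "distr N borel (\<lambda>\<omega>. linf_norm indicators (G \<omega>))"
  note cont = continuous_map_linf_norm[OF indicators_nonempty]
  note norm_meas = continuous_map_linf_measurable[OF cont]
  have Lm: "?L n \<in> borel_measurable (\<Omega> n)" if "n \<ge> 1" for n
    by (rule measurable_compose[OF posterior_expectation(1)[OF _ R[OF that] cont] norm_meas]) (use that in simp)
  have \<nu>: "?\<nu> n = distr (\<Omega> n) borel (?L n)" if n: "n \<ge> 1" for n
  proof (rule distr_cong[OF refl refl])
    fix \<omega> assume "\<omega> \<in> space (\<Omega> n)"
    moreover have "Post n \<in> \<Omega> n \<rightarrow>\<^sub>M prob_algebra (count_space UNIV)"
      using R[OF n] by (simp add: DP_posterior_def dirichlet_process_def)
    ultimately have "Post n \<omega> \<in> space (prob_algebra (count_space UNIV))" by (blast dest: measurable_space)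
    then have "prob_space (Post n \<omega>)" "sets (Post n \<omega>) = UNIV" by (auto simp: space_prob_algebra)
    then show "sqrt n * tv_dist (Post n \<omega>) (empirical_measure x n) = ?L n \<omega>"
      using tv_dist_scaled[OF _ _ empirical_measure_props(1,2)[of n x], of "Post n \<omega>" "sqrt (real n)"] n by simp
  qed
  have one_le_Suc: "1 \<le> Suc n" for n by simp
  have Gm: "G \<in> N \<rightarrow>\<^sub>M linf_borel indicators" and N: "prob_space N" using G by (simp_all add: brownian_bridge_def)
  have Gnm: "(\<lambda>\<omega>. linf_norm indicators (G \<omega>)) \<in> borel_measurable N" by (rule measurable_compose[OF Gm norm_meas])
  have "weak_conv_m (\<lambda>n. ?\<nu> (Suc n)) ?\<nu>\<^sub>0"
  proof (rule integral_bdd_continuous_conv_imp_weak_conv)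
    show "real_distribution (?\<nu> (Suc n))" for n
    proof -
      interpret prob_space "\<Omega> (Suc n)" using R[of "Suc n"] by (simp add: DP_posterior_def dirichlet_process_def)
      show ?thesis unfolding \<nu>[OF one_le_Suc] by (rule real_distribution_distr) (rule Lm, simp)
    qed
    show "real_distribution ?\<nu>\<^sub>0" by (rule prob_space.real_distribution_distr[OF N Gnm])
    fix f :: "real \<Rightarrow> real" assume f: "\<And>t. isCont f t" "\<And>t. \<bar>f t\<bar> \<le> 1"
    have fm: "f \<in> borel_measurable borel" by (intro borel_measurable_continuous_onI continuous_at_imp_continuous_on ballI f(1))
    let ?h = "\<lambda>\<psi>. f (linf_norm indicators \<psi>)"
    have "continuous_map euclideanreal euclideanreal f"
      using f(1) by (simp add: continuous_at_imp_continuous_on)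
    from continuous_map_compose[OF cont this]
    have hc: "continuous_map (mtopology_of (linf (indicators :: ('a \<Rightarrow> real) set))) euclideanreal ?h" by (simp add: o_def)
    have hb: "bounded (?h ` mspace (linf (indicators :: ('a \<Rightarrow> real) set)))"
      by (rule boundedI[of _ 1]) (use f(2) in auto)
    have eq: "(\<integral>\<omega>. ?h (?D (Suc n) \<omega>) \<partial>\<Omega> (Suc n)) = integral\<^sup>L (?\<nu> (Suc n)) f" for n
      unfolding \<nu>[OF one_le_Suc] by (rule integral_distr[symmetric, OF Lm fm]) simp
    have eq0: "(\<integral>\<omega>. ?h (G \<omega>) \<partial>N) = integral\<^sup>L ?\<nu>\<^sub>0 f" by (rule integral_distr[symmetric, OF Gnm fm])
    show "(\<lambda>n. integral\<^sup>L (?\<nu> (Suc n)) f) \<longlonglongrightarrow> integral\<^sup>L ?\<nu>\<^sub>0 f"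
      using LIMSEQ_Suc[OF posterior_expectation_converges[OF G R hc hb]] unfolding eq eq0 .
  qed
  then show ?thesis unfolding weak_conv_m_def weak_conv_def by (blast intro: LIMSEQ_imp_Suc)
qed

end

text \<open>The exceptional samples are described by their frequencies only, so one null set serves all spaces that may carry the posteriors.\<close>

lemma posterior_coupling_exists_AE:
  fixes \<alpha> P0 :: "'a measure"
  assumes \<alpha>: "prob_space \<alpha>" "sets \<alpha> = UNIV" and M: "M > 0"
    and P0: "prob_space P0" "sets P0 = UNIV" and e: "bij_betw e (UNIV :: nat set) UNIV"
    and psum: "summable (\<lambda>i. sqrt (measure P0 {e i}))"
  shows "AE x in (\<Pi>\<^sub>M i\<in>(UNIV :: nat set). P0). \<exists>b \<Omega>0 V Z. posterior_coupling \<alpha> P0 M e x b \<Omega>0 V Z"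
proof -
  interpret countable_sample P0 by (intro countable_sample.intro countable_sample_axioms.intro P0)
  show ?thesis using freq_dominated_AE[OF e psum]
  proof eventually_elim
    case (elim x)
    then obtain b where lim: "\<forall>i. (\<lambda>n. freq x n (e i)) \<longlonglongrightarrow> measure P0 {e i}"
      and b: "summable b" "\<forall>n i. sqrt (freq x n (e i)) \<le> b i" by blast
    show ?case
    proof (rule coupled_exponential_sums)
      fix \<Omega>0 :: "real measure" and V :: "nat \<Rightarrow> real \<Rightarrow> real" and Z :: "real \<Rightarrow> real"
      assume VZ: "prob_space \<Omega>0" "\<And>k. V k \<in> borel_measurable \<Omega>0" "Z \<in> borel_measurable \<Omega>0"
        "distr \<Omega>0 borel Z = std_normal_distribution" "\<And>k \<omega>. - sqrt (real k) \<le> V k \<omega>"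
        "\<And>k s. s \<ge> 0 \<Longrightarrow> (\<integral>\<omega>. exp (- (s * (real k + sqrt (real k) * V k \<omega>))) \<partial>\<Omega>0) = (1 + s) powr (- real k)"
        "\<And>k. integrable \<Omega>0 (V k)" "\<And>k. (\<integral>\<omega>. \<bar>V k \<omega>\<bar> \<partial>\<Omega>0) \<le> 1" "integrable \<Omega>0 Z"
        "(\<lambda>k. \<integral>\<omega>. \<bar>V k \<omega> - Z \<omega>\<bar> \<partial>\<Omega>0) \<longlonglongrightarrow> 0"
      have "posterior_coupling \<alpha> P0 M e x b \<Omega>0 V Z"
        by (rule posterior_coupling.intro[OF \<alpha> P0 M e psum spec[OF lim] b(1) spec[OF spec[OF b(2)]] VZ])
      then show ?thesis by blast
    qed
  qed
qed

theorem corollary2: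
  fixes \<alpha> P0 :: "'a measure" and M :: real
  assumes "countable (UNIV :: 'a set)" and "infinite (UNIV :: 'a set)"
    and "prob_space \<alpha>" and "sets \<alpha> = UNIV" and "M > 0"
    and "prob_space P0" and "sets P0 = UNIV"
    and "(\<lambda>y. sqrt (measure P0 {y})) summable_on UNIV"
    and "(\<lambda>y. sqrt (measure \<alpha> {y})) summable_on UNIV"
  shows "(\<exists>(N :: (nat \<Rightarrow> real) measure) G. brownian_bridge P0 indicators N G) \<and>
    (\<forall>(N :: 'g measure) G. brownian_bridge P0 indicators N G \<longrightarrow>
      (AE x in (\<Pi>\<^sub>M i\<in>(UNIV :: nat set). P0).
        \<forall>(\<Omega> :: nat \<Rightarrow> 'w measure) Post. (\<forall>n\<ge>1. DP_posterior \<alpha> M x n (\<Omega> n) (Post n)) \<longrightarrow>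
          weakly_converges_linf indicators \<Omega>
            (\<lambda>n \<omega>. scaled_diff indicators (sqrt n) (Post n \<omega>) (empirical_measure x n)) N G) \<and>
      (AE x in (\<Pi>\<^sub>M i\<in>(UNIV :: nat set). P0).
        \<forall>(\<Omega> :: nat \<Rightarrow> 'w measure) Post. (\<forall>n\<ge>1. DP_posterior \<alpha> M x n (\<Omega> n) (Post n)) \<longrightarrow>
          weak_conv_m
            (\<lambda>n. distr (\<Omega> n) borel (\<lambda>\<omega>. sqrt n * tv_dist (Post n \<omega>) (empirical_measure x n)))
            (distr N borel (\<lambda>\<omega>. linf_norm indicators (G \<omega>)))))"
proof -
  let ?e = "from_nat_into (UNIV :: 'a set)"
  have e: "bij_betw ?e (UNIV :: nat set) UNIV" by (rule bij_betw_from_nat_into[OF assms(1,2)])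
  have "(\<lambda>i. sqrt (measure P0 {?e i})) summable_on UNIV"
    using summable_on_reindex_bij_betw[OF e, of "\<lambda>y. sqrt (measure P0 {y})"] assms(8) by simp
  then have psum: "summable (\<lambda>i. sqrt (measure P0 {?e i}))" by (rule summable_on_imp_summable)
  note coupling = posterior_coupling_exists_AE[OF assms(3-7) e psum]
  show ?thesis
  proof (intro conjI allI impI)
    show "\<exists>(N :: (nat \<Rightarrow> real) measure) G. brownian_bridge P0 indicators N G"
      by (rule brownian_bridge_exists[OF assms(6,7) e psum])
    fix N :: "'g measure" and G assume G: "brownian_bridge P0 indicators N G"
    show "AE x in (\<Pi>\<^sub>M i\<in>(UNIV :: nat set). P0).
        \<forall>(\<Omega> :: nat \<Rightarrow> 'w measure) Post. (\<forall>n\<ge>1. DP_posterior \<alpha> M x n (\<Omega> n) (Post n)) \<longrightarrow>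
          weakly_converges_linf indicators \<Omega>
            (\<lambda>n \<omega>. scaled_diff indicators (sqrt n) (Post n \<omega>) (empirical_measure x n)) N G"
      using coupling
      by eventually_elim (auto intro: posterior_coupling.posterior_weakly_converges[OF _ G])
    show "AE x in (\<Pi>\<^sub>M i\<in>(UNIV :: nat set). P0).
        \<forall>(\<Omega> :: nat \<Rightarrow> 'w measure) Post. (\<forall>n\<ge>1. DP_posterior \<alpha> M x n (\<Omega> n) (Post n)) \<longrightarrow>
          weak_conv_m
            (\<lambda>n. distr (\<Omega> n) borel (\<lambda>\<omega>. sqrt n * tv_dist (Post n \<omega>) (empirical_measure x n)))
            (distr N borel (\<lambda>\<omega>. linf_norm indicators (G \<omega>)))"
      using coupling
      by eventually_elim (auto intro: posterior_coupling.posterior_tv_dist_converges[OF _ G])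
  qed
qed

end
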